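(* Let $\mathcal{A}$ be a finite-dimensional weak Hopf algebra over $\mathbb{C}$ such that $\mathcal{A}^*$ is semisimple and pivotal, let $k\in\mathcal{A}^*$ be a pivotal element of $\mathcal{A}^*$ and $\xi_a\in\mathbb{C}$ scalars with $\psi_a(k)=\xi_a\psi_a(g)$ for all $a$. Define $\Omega\in\mathcal{A}$ by $$f(\Omega)=\sum_{a\in\mathrm{Irr}(\mathcal{A}^* )}\frac{1}{\sum_{x:\,l_x=l_a}d_x^2}\cdot\frac{d_a}{\xi_a}\,\mathrm{Tr}\,\psi_a(f)\qquad(f\in\mathcal{A}^* ).$$ Then $\Omega$ is non-degenerate and cocommutative ($\Delta_{\mathrm{op}}(\Omega)=\Delta(\Omega)$), $\Omega^2=\Omega$, and there exists a linear map $T:\mathcal{A}\to\mathcal{A}$ such that for all $x\in\mathcal{A}$, $(1\otimes x)\Delta(\Omega)=(T(x)\otimes1)\Delta(\Omega)$ and $$\Delta(T(x))=\sum k^{-1}(x_{(2)})\,T(x_{(3)})\otimes T(x_{(1)}),$$ i.e. $\Delta\circ T=(T\otimes k^{-1}\otimes T)\circ\Delta^2_{\mathrm{op}}$.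
   Context: Weak Hopf algebra: a finite-dimensional unital algebra $\mathcal{A}$ with coassociative counital coproduct $\Delta$ (Sweedler notation), counit $\epsilon$, $\Delta(xy)=\Delta(x)\Delta(y)$, $\Delta^2(1)=(1\otimes\Delta(1))(\Delta(1)\otimes1)=(\Delta(1)\otimes1)(1\otimes\Delta(1))$, $\epsilon(xyz)=\sum\epsilon(xy_{(1)})\epsilon(y_{(2)}z)=\sum\epsilon(xy_{(2)})\epsilon(y_{(1)}z)$, and antipode $S$ with $\sum S(x_{(1)})x_{(2)}=\sum 1_{(1)}\epsilon(x1_{(2)})$, $\sum x_{(1)}S(x_{(2)})=\sum\epsilon(1_{(1)}x)1_{(2)}$, $\sum S(x_{(1)})x_{(2)}S(x_{(3)})=S(x)$. $\Delta_{\mathrm{op}}(x)=\sum x_{(2)}\otimes x_{(1)}$, $\Delta^2_{\mathrm{op}}(x)=\sum x_{(3)}\otimes x_{(2)}\otimes x_{(1)}$. The dual $\mathcal{A}^*$ is a weak Hopf algebra with product $(fg)(x)=\sum f(x_{(1)})g(x_{(2)})$, unit $\epsilon$, coproduct $\Delta(f)(x\otimes y)=f(xy)$, antipode $S(f)=f\circ S$. An element $k\in\mathcal{A}^*$ is group-like if it is invertible and $\Delta(k)=(k\otimes k)\Delta(\epsilon)=\Delta(\epsilon)(k\otimes k)$; it is a pivotal element of $\mathcal{A}^*$ if it is group-like and $S^2(f)=kfk^{-1}$ for all $f\in\mathcal{A}^*$; $\mathcal{A}^*$ is pivotal if such $k$ exists. An element $x\in\mathcal{A}$ is non-degenerate if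 $\{(f\otimes\mathrm{Id})\Delta(x)\}=\{(\mathrm{Id}\otimes f)\Delta(x)\}=\mathcal{A}$ ($f$ ranging over $\mathcal{A}^*$). For $a\in\mathrm{Irr}(\mathcal{A}^* )$ fix irreps $\psi_a:\mathcal{A}^*\to\mathrm{End}(W_a)$. $N_{ab}^c$ = multiplicity of $\psi_c$ in $f\mapsto(\psi_a\otimes\psi_b)(\Delta f)$ restricted to the range of $(\psi_a\otimes\psi_b)(\Delta\epsilon)$; fusion tensors $V^{c\mu}_{ab}:W_c\to W_a\otimes W_b$, $W^{c\mu}_{ab}:W_a\otimes W_b\to W_c$ with $(\psi_a\otimes\psi_b)(\Delta f)=\sum_{c,\mu}V^{c\mu}_{ab}\psi_c(f)W^{c\mu}_{ab}$, $W^{c\mu}_{ab}V^{d\nu}_{ab}=\delta_{cd}\delta_{\mu\nu}\mathrm{id}$. Vacuum: $b_a\in\mathrm{End}(W_a)$ with $f(1)=\sum_a\mathrm{Tr}(b_a\psi_a(f))$, $E=\{a:b_a\ne0\}$; $b_e=v_eu_e$ rank one; for each $a$ unique $l_a,r_a\in E$ with $N_{ea}^b=\delta_{e,l_a}\delta_{ab}$, $N_{ae}^b=\delta_{e,r_a}\delta_{ab}$ ($e\in E$). Conjugation: $\bar a$ is the class of $f\mapsto\psi_a(Sf)^T$ on $W_a^*$; invertible $Z_a:W_{\bar a}\to W_a^*$ with $\psi_a(Sf)^T=Z_a\psi_{\bar a}(f)Z_a^{-1}$. With $\zeta_c(\xi\otimes\eta)=(Z_c\xi)(\eta)$ on $W_{\bar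 c}\otimes W_c$ and $\theta_c\in W_{\bar c}\otimes W_c$ given by $(\varphi\otimes\mathrm{id})\theta_c=Z_{\bar c}^{-1}(\varphi)$, $w_c\ne0$ is defined by $\zeta_c\otimes\theta_c=w_c(u_{r_c}\circ W^{r_c}_{\bar cc})\otimes(V^{r_c}_{\bar cc}v_{r_c})$. $d_a\in\mathbb{C}$ satisfy $d_a^2=w_aw_{\bar a}$, $d_a=d_{\bar a}$; $g\in\mathcal{A}^*$ is defined by $\psi_a(g)=\frac{d_a}{w_{\bar a}}(Z_a^{-1})^TZ_{\bar a}$ (it implements $S^2$: $\psi_a(S^2f)=\psi_a(g)\psi_a(f)\psi_a(g)^{-1}$). *)

theory Defs
  imports Complex_Main "Jordan_Normal_Form.Matrix"
begin

text \<open>The finite-dimensional algebra A is modelled on coordinates: an element of A is a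
  function 'i => complex (coefficients w.r.t. a fixed basis indexed by the finite type 'i).
  An element f of the dual A* is also a function 'i => complex, namely its values on the basis
  (coordinates in the dual basis).  Tensor powers are functions on product index types.\<close>

type_synonym 'i cv = "'i \<Rightarrow> complex"

definition bas :: "'i \<Rightarrow> 'i cv" where
  "bas i = (\<lambda>j. if j = i then 1 else 0)"

definition tens :: "'a cv \<Rightarrow> 'b cv \<Rightarrow> ('a \<times> 'b) cv" where
  "tens x y = (\<lambda>(i, j). x i * y j)"

definition tmap :: "('a::finite cv \<Rightarrow> 'c cv) \<Rightarrow> ('b::finite cv \<Rightarrow> 'd cv) \<Rightarrow> ('a \<times> 'b) cv \<Rightarrow> ('c \<times> 'd) cv" where
  "tmap L M X = (\<lambda>(k, l). \<Sum>p\<in>UNIV. X p * L (bas (fst p)) k * M (bas (snd p)) l)"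

definition ev :: "'i::finite cv \<Rightarrow> 'i cv \<Rightarrow> complex" where
  "ev f x = (\<Sum>i\<in>UNIV. f i * x i)"

definition clinear :: "('a cv \<Rightarrow> 'b cv) \<Rightarrow> bool" where
  "clinear T \<longleftrightarrow> (\<forall>a x y. T (\<lambda>i. a * x i + y i) = (\<lambda>j. a * T x j + T y j))"

definition csubspace :: "'a cv set \<Rightarrow> bool" where
  "csubspace L \<longleftrightarrow> (\<lambda>_. 0) \<in> L \<and> (\<forall>a\<in>L. \<forall>b\<in>L. \<forall>c. (\<lambda>i. c * a i + b i) \<in> L)"

record 'i wstr =
  smul :: "'i \<Rightarrow> 'i \<Rightarrow> 'i \<Rightarrow> complex"   \<comment> \<open>e_i e_j = sum_k smul i j k e_k\<close>
  sunit :: "'i \<Rightarrow> complex"                  \<comment> \<open>1 = sum_k sunit k e_k\<close>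
  scomul :: "'i \<Rightarrow> 'i \<Rightarrow> 'i \<Rightarrow> complex" \<comment> \<open>Delta e_i = sum_{j,k} scomul i j k e_j (x) e_k\<close>
  scounit :: "'i \<Rightarrow> complex"                \<comment> \<open>epsilon(e_i)\<close>
  santi :: "'i \<Rightarrow> 'i \<Rightarrow> complex"          \<comment> \<open>S e_i = sum_j santi i j e_j\<close>

definition mulA :: "'i::finite wstr \<Rightarrow> 'i cv \<Rightarrow> 'i cv \<Rightarrow> 'i cv" where
  "mulA H x y = (\<lambda>k. \<Sum>i\<in>UNIV. \<Sum>j\<in>UNIV. x i * y j * smul H i j k)"

definition oneA :: "'i wstr \<Rightarrow> 'i cv" where
  "oneA H = sunit H"

definition DeltaA :: "'i::finite wstr \<Rightarrow> 'i cv \<Rightarrow> ('i \<times> 'i) cv" where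
  "DeltaA H x = (\<lambda>(j, k). \<Sum>i\<in>UNIV. x i * scomul H i j k)"

definition DeltaopA :: "'i::finite wstr \<Rightarrow> 'i cv \<Rightarrow> ('i \<times> 'i) cv" where
  "DeltaopA H x = (\<lambda>(j, k). DeltaA H x (k, j))"

text \<open>Delta^2 = (Delta (x) id) Delta; component ((a,b),c) is the coefficient of x_(1) (x) x_(2) (x) x_(3).\<close>
definition Delta2A :: "'i::finite wstr \<Rightarrow> 'i cv \<Rightarrow> (('i \<times> 'i) \<times> 'i) cv" where
  "Delta2A H x = tmap (DeltaA H) id (DeltaA H x)"

definition epsA :: "'i::finite wstr \<Rightarrow> 'i cv \<Rightarrow> complex" where
  "epsA H x = (\<Sum>i\<in>UNIV. x i * scounit H i)"

definition SA :: "'i::finite wstr \<Rightarrow> 'i cv \<Rightarrow> 'i cv" where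
  "SA H x = (\<lambda>j. \<Sum>i\<in>UNIV. x i * santi H i j)"

definition mul2A :: "'i::finite wstr \<Rightarrow> ('i \<times> 'i) cv \<Rightarrow> ('i \<times> 'i) cv \<Rightarrow> ('i \<times> 'i) cv" where
  "mul2A H X Y = (\<lambda>(k, l). \<Sum>p\<in>UNIV. \<Sum>q\<in>UNIV.
      X p * Y q * smul H (fst p) (fst q) k * smul H (snd p) (snd q) l)"

definition mul3A :: "'i::finite wstr \<Rightarrow> (('i \<times> 'i) \<times> 'i) cv \<Rightarrow> (('i \<times> 'i) \<times> 'i) cv \<Rightarrow> (('i \<times> 'i) \<times> 'i) cv" where
  "mul3A H X Y = (\<lambda>((k, l), m). \<Sum>p\<in>UNIV. \<Sum>q\<in>UNIV.
      X p * Y q * smul H (fst (fst p)) (fst (fst q)) k * smul H (snd (fst p)) (snd (fst q)) l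
        * smul H (snd p) (snd q) m)"

definition weak_hopf :: "'i::finite wstr \<Rightarrow> bool" where
  "weak_hopf H \<longleftrightarrow>
     \<comment> \<open>unital associative algebra\<close>
     (\<forall>x y z. mulA H (mulA H x y) z = mulA H x (mulA H y z)) \<and>
     (\<forall>x. mulA H (oneA H) x = x \<and> mulA H x (oneA H) = x) \<and>
     \<comment> \<open>coassociative, counital coproduct\<close>
     (\<forall>x. Delta2A H x = (\<lambda>((a, b), c). tmap id (DeltaA H) (DeltaA H x) (a, (b, c)))) \<and>
     (\<forall>x. (\<lambda>j. \<Sum>i\<in>UNIV. epsA H (bas i) * DeltaA H x (i, j)) = x) \<and>
     (\<forall>x. (\<lambda>i. \<Sum>j\<in>UNIV. DeltaA H x (i, j) * epsA H (bas j)) = x) \<and>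
     \<comment> \<open>multiplicativity of Delta\<close>
     (\<forall>x y. DeltaA H (mulA H x y) = mul2A H (DeltaA H x) (DeltaA H y)) \<and>
     \<comment> \<open>Delta^2(1) = (1 (x) Delta 1)(Delta 1 (x) 1) = (Delta 1 (x) 1)(1 (x) Delta 1)\<close>
     (let one_D1 = (\<lambda>((a, b), c). oneA H a * DeltaA H (oneA H) (b, c));
          D1_one = (\<lambda>((a, b), c). DeltaA H (oneA H) (a, b) * oneA H c) in
        Delta2A H (oneA H) = mul3A H one_D1 D1_one \<and>
        Delta2A H (oneA H) = mul3A H D1_one one_D1) \<and>
     \<comment> \<open>weak multiplicativity of the counit\<close>
     (\<forall>x y z. epsA H (mulA H (mulA H x y) z) =
        (\<Sum>p\<in>UNIV. DeltaA H y p * epsA H (mulA H x (bas (fst p))) * epsA H (mulA H (bas (snd p)) z)) \<and>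
        epsA H (mulA H (mulA H x y) z) =
        (\<Sum>p\<in>UNIV. DeltaA H y p * epsA H (mulA H x (bas (snd p))) * epsA H (mulA H (bas (fst p)) z))) \<and>
     \<comment> \<open>antipode axioms\<close>
     (\<forall>x. (\<lambda>k. \<Sum>p\<in>UNIV. DeltaA H x p * mulA H (SA H (bas (fst p))) (bas (snd p)) k) =
          (\<lambda>k. \<Sum>p\<in>UNIV. DeltaA H (oneA H) p * epsA H (mulA H x (bas (snd p))) * bas (fst p) k)) \<and>
     (\<forall>x. (\<lambda>k. \<Sum>p\<in>UNIV. DeltaA H x p * mulA H (bas (fst p)) (SA H (bas (snd p))) k) =
          (\<lambda>k. \<Sum>p\<in>UNIV. DeltaA H (oneA H) p * epsA H (mulA H (bas (fst p)) x) * bas (snd p) k)) \<and>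
     (\<forall>x. (\<lambda>k. \<Sum>p\<in>UNIV. Delta2A H x p *
            mulA H (mulA H (SA H (bas (fst (fst p)))) (bas (snd (fst p)))) (SA H (bas (snd p))) k) =
          SA H x)"

definition dmul :: "'i::finite wstr \<Rightarrow> 'i cv \<Rightarrow> 'i cv \<Rightarrow> 'i cv" where
  "dmul H f g = (\<lambda>i. \<Sum>p\<in>UNIV. f (fst p) * g (snd p) * scomul H i (fst p) (snd p))"

definition dunit :: "'i wstr \<Rightarrow> 'i cv" where
  "dunit H = scounit H"

definition dDelta :: "'i::finite wstr \<Rightarrow> 'i cv \<Rightarrow> ('i \<times> 'i) cv" where
  "dDelta H f = (\<lambda>(i, j). \<Sum>k\<in>UNIV. f k * smul H i j k)"

definition dS :: "'i::finite wstr \<Rightarrow> 'i cv \<Rightarrow> 'i cv" where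
  "dS H f = (\<lambda>i. \<Sum>j\<in>UNIV. santi H i j * f j)"

definition dmul2 :: "'i::finite wstr \<Rightarrow> ('i \<times> 'i) cv \<Rightarrow> ('i \<times> 'i) cv \<Rightarrow> ('i \<times> 'i) cv" where
  "dmul2 H X Y = (\<lambda>(i, j). \<Sum>p\<in>UNIV. \<Sum>q\<in>UNIV.
      X p * Y q * scomul H i (fst p) (fst q) * scomul H j (snd p) (snd q))"

definition dinvertible :: "'i::finite wstr \<Rightarrow> 'i cv \<Rightarrow> bool" where
  "dinvertible H k \<longleftrightarrow> (\<exists>h. dmul H k h = dunit H \<and> dmul H h k = dunit H)"

definition dinv :: "'i::finite wstr \<Rightarrow> 'i cv \<Rightarrow> 'i cv" where
  "dinv H k = (THE h. dmul H k h = dunit H \<and> dmul H h k = dunit H)"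

definition dgrouplike :: "'i::finite wstr \<Rightarrow> 'i cv \<Rightarrow> bool" where
  "dgrouplike H k \<longleftrightarrow> dinvertible H k \<and>
     dDelta H k = dmul2 H (tens k k) (dDelta H (dunit H)) \<and>
     dDelta H k = dmul2 H (dDelta H (dunit H)) (tens k k)"

definition dpivotal_elem :: "'i::finite wstr \<Rightarrow> 'i cv \<Rightarrow> bool" where
  "dpivotal_elem H k \<longleftrightarrow> dgrouplike H k \<and>
     (\<forall>f. dS H (dS H f) = dmul H (dmul H k f) (dinv H k))"

definition dpivotal :: "'i::finite wstr \<Rightarrow> bool" where
  "dpivotal H \<longleftrightarrow> (\<exists>k. dpivotal_elem H k)"

definition dleft_ideal :: "'i::finite wstr \<Rightarrow> 'i cv set \<Rightarrow> bool" where
  "dleft_ideal H L \<longleftrightarrow> csubspace L \<and> (\<forall>f x. x \<in> L \<longrightarrow> dmul H f x \<in> L)"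

definition dsemisimple :: "'i::finite wstr \<Rightarrow> bool" where
  "dsemisimple H \<longleftrightarrow> (\<forall>L. dleft_ideal H L \<longrightarrow>
     (\<exists>L'. dleft_ideal H L' \<and> L \<inter> L' = {\<lambda>_. 0} \<and>
        (\<forall>x. \<exists>y\<in>L. \<exists>z\<in>L'. x = (\<lambda>i. y i + z i))))"

definition nondegenerate :: "'i::finite wstr \<Rightarrow> 'i cv \<Rightarrow> bool" where
  "nondegenerate H x \<longleftrightarrow>
     range (\<lambda>f. (\<lambda>j. \<Sum>i\<in>UNIV. f i * DeltaA H x (i, j))) = UNIV \<and>
     range (\<lambda>f. (\<lambda>i. \<Sum>j\<in>UNIV. DeltaA H x (i, j) * f j)) = UNIV"

definition mtrace :: "complex mat \<Rightarrow> complex" where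
  "mtrace A = (\<Sum>i<dim_row A. A $$ (i, i))"

definition minv :: "complex mat \<Rightarrow> complex mat" where
  "minv A = (THE B. B \<in> carrier_mat (dim_col A) (dim_row A) \<and>
                    A * B = 1\<^sub>m (dim_row A) \<and> B * A = 1\<^sub>m (dim_col A))"

text \<open>Kronecker product; basis vector e_i (x) e_j of C^m (x) C^n has index i*n + j.\<close>
definition kron :: "complex mat \<Rightarrow> complex mat \<Rightarrow> complex mat" where
  "kron A B = mat (dim_row A * dim_row B) (dim_col A * dim_col B)
     (\<lambda>(i, j). A $$ (i div dim_row B, j div dim_col B) * B $$ (i mod dim_row B, j mod dim_col B))"

definition drep :: "'i::finite wstr \<Rightarrow> nat \<Rightarrow> ('i cv \<Rightarrow> complex mat) \<Rightarrow> bool" where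
  "drep H n \<rho> \<longleftrightarrow> (\<forall>f. \<rho> f \<in> carrier_mat n n) \<and>
     (\<forall>a f g. \<rho> (\<lambda>i. a * f i + g i) = a \<cdot>\<^sub>m \<rho> f + \<rho> g) \<and>
     (\<forall>f g. \<rho> (dmul H f g) = \<rho> f * \<rho> g) \<and>
     \<rho> (dunit H) = 1\<^sub>m n"

definition inv_subspace :: "nat \<Rightarrow> ('i cv \<Rightarrow> complex mat) \<Rightarrow> complex vec set \<Rightarrow> bool" where
  "inv_subspace n \<rho> V \<longleftrightarrow> V \<subseteq> carrier_vec n \<and> 0\<^sub>v n \<in> V \<and>
     (\<forall>x\<in>V. \<forall>y\<in>V. \<forall>c. c \<cdot>\<^sub>v x + y \<in> V) \<and> (\<forall>f. \<forall>x\<in>V. \<rho> f *\<^sub>v x \<in> V)"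

definition dirrep :: "'i::finite wstr \<Rightarrow> nat \<Rightarrow> ('i cv \<Rightarrow> complex mat) \<Rightarrow> bool" where
  "dirrep H n \<rho> \<longleftrightarrow> drep H n \<rho> \<and> n > 0 \<and>
     (\<forall>V. inv_subspace n \<rho> V \<longrightarrow> V = {0\<^sub>v n} \<or> V = carrier_vec n)"

definition rep_equiv :: "nat \<Rightarrow> ('i cv \<Rightarrow> complex mat) \<Rightarrow> nat \<Rightarrow> ('i cv \<Rightarrow> complex mat) \<Rightarrow> bool" where
  "rep_equiv n \<rho> m \<sigma> \<longleftrightarrow> n = m \<and>
     (\<exists>P. P \<in> carrier_mat n n \<and> invertible_mat P \<and> (\<forall>f. \<rho> f * P = P * \<sigma> f))"

text \<open>A complete family of pairwise inequivalent irreducible representations psi_a of A*,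
  indexed by the finite type 'a (playing the role of Irr(A*)), on W_a = C^(dimW a).\<close>
definition irr_family :: "'i::finite wstr \<Rightarrow> ('a \<Rightarrow> nat) \<Rightarrow> ('a \<Rightarrow> 'i cv \<Rightarrow> complex mat) \<Rightarrow> bool" where
  "irr_family H dimW \<psi> \<longleftrightarrow>
     (\<forall>a. dirrep H (dimW a) (\<psi> a)) \<and>
     (\<forall>a b. a \<noteq> b \<longrightarrow> \<not> rep_equiv (dimW a) (\<psi> a) (dimW b) (\<psi> b)) \<and>
     (\<forall>n \<rho>. dirrep H n \<rho> \<longrightarrow> (\<exists>a. rep_equiv n \<rho> (dimW a) (\<psi> a)))"

definition psi2 :: "('a \<Rightarrow> nat) \<Rightarrow> ('a \<Rightarrow> 'i::finite cv \<Rightarrow> complex mat) \<Rightarrow> 'a \<Rightarrow> 'a \<Rightarrow> ('i \<times> 'i) cv \<Rightarrow> complex mat" where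
  "psi2 dimW \<psi> a b X = mat (dimW a * dimW b) (dimW a * dimW b)
     (\<lambda>rs. \<Sum>p\<in>UNIV. X p * kron (\<psi> a (bas (fst p))) (\<psi> b (bas (snd p))) $$ rs)"

text \<open>Fusion multiplicities N a b c and fusion tensors V a b c mu : W_c -> W_a (x) W_b,
  W a b c mu : W_a (x) W_b -> W_c (mu < N a b c).\<close>
definition fusion_data :: "'i::finite wstr \<Rightarrow> ('a::finite \<Rightarrow> nat) \<Rightarrow> ('a \<Rightarrow> 'i cv \<Rightarrow> complex mat) \<Rightarrow>
    ('a \<Rightarrow> 'a \<Rightarrow> 'a \<Rightarrow> nat) \<Rightarrow> ('a \<Rightarrow> 'a \<Rightarrow> 'a \<Rightarrow> nat \<Rightarrow> complex mat) \<Rightarrow>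
    ('a \<Rightarrow> 'a \<Rightarrow> 'a \<Rightarrow> nat \<Rightarrow> complex mat) \<Rightarrow> bool" where
  "fusion_data H dimW \<psi> N V W \<longleftrightarrow>
     (\<forall>a b c \<mu>. \<mu> < N a b c \<longrightarrow>
        V a b c \<mu> \<in> carrier_mat (dimW a * dimW b) (dimW c) \<and>
        W a b c \<mu> \<in> carrier_mat (dimW c) (dimW a * dimW b)) \<and>
     (\<forall>a b f. psi2 dimW \<psi> a b (dDelta H f) =
        mat (dimW a * dimW b) (dimW a * dimW b)
          (\<lambda>rs. \<Sum>c\<in>UNIV. \<Sum>\<mu><N a b c. (V a b c \<mu> * \<psi> c f * W a b c \<mu>) $$ rs)) \<and>
     (\<forall>a b c d \<mu> \<nu>. \<mu> < N a b c \<longrightarrow> \<nu> < N a b d \<longrightarrow>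
        W a b c \<mu> * V a b d \<nu> =
          (if c = d \<and> \<mu> = \<nu> then 1\<^sub>m (dimW c) else 0\<^sub>m (dimW c) (dimW d)))"

definition vacuum_data :: "'i::finite wstr \<Rightarrow> ('a::finite \<Rightarrow> nat) \<Rightarrow> ('a \<Rightarrow> 'i cv \<Rightarrow> complex mat) \<Rightarrow>
    ('a \<Rightarrow> complex mat) \<Rightarrow> ('a \<Rightarrow> complex mat) \<Rightarrow> ('a \<Rightarrow> complex mat) \<Rightarrow> bool" where
  "vacuum_data H dimW \<psi> b u v \<longleftrightarrow>
     (\<forall>a. b a \<in> carrier_mat (dimW a) (dimW a)) \<and>
     (\<forall>f. ev f (oneA H) = (\<Sum>a\<in>UNIV. mtrace (b a * \<psi> a f))) \<and>
     (\<forall>e. b e \<noteq> 0\<^sub>m (dimW e) (dimW e) \<longrightarrow>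
        v e \<in> carrier_mat (dimW e) 1 \<and> u e \<in> carrier_mat 1 (dimW e) \<and> b e = v e * u e)"

definition vacE :: "('a \<Rightarrow> nat) \<Rightarrow> ('a \<Rightarrow> complex mat) \<Rightarrow> 'a set" where
  "vacE dimW b = {a. b a \<noteq> 0\<^sub>m (dimW a) (dimW a)}"

definition lidx :: "('a \<Rightarrow> nat) \<Rightarrow> ('a \<Rightarrow> complex mat) \<Rightarrow> ('a \<Rightarrow> 'a \<Rightarrow> 'a \<Rightarrow> nat) \<Rightarrow> 'a \<Rightarrow> 'a" where
  "lidx dimW b N a = (THE e. e \<in> vacE dimW b \<and> N e a a \<noteq> 0)"

definition ridx :: "('a \<Rightarrow> nat) \<Rightarrow> ('a \<Rightarrow> complex mat) \<Rightarrow> ('a \<Rightarrow> 'a \<Rightarrow> 'a \<Rightarrow> nat) \<Rightarrow> 'a \<Rightarrow> 'a" where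
  "ridx dimW b N a = (THE e. e \<in> vacE dimW b \<and> N a e a \<noteq> 0)"

definition conj_data :: "'i::finite wstr \<Rightarrow> ('a \<Rightarrow> nat) \<Rightarrow> ('a \<Rightarrow> 'i cv \<Rightarrow> complex mat) \<Rightarrow>
    ('a \<Rightarrow> 'a) \<Rightarrow> ('a \<Rightarrow> complex mat) \<Rightarrow> bool" where
  "conj_data H dimW \<psi> bar Z \<longleftrightarrow>
     (\<forall>a. Z a \<in> carrier_mat (dimW a) (dimW (bar a)) \<and> invertible_mat (Z a) \<and>
        (\<forall>f. transpose_mat (\<psi> a (dS H f)) = Z a * \<psi> (bar a) f * minv (Z a)))"

text \<open>zeta_c as a row vector on W_{bar c} (x) W_c and theta_c as a column vector in it.\<close>
definition zeta_row :: "('a \<Rightarrow> nat) \<Rightarrow> ('a \<Rightarrow> 'a) \<Rightarrow> ('a \<Rightarrow> complex mat) \<Rightarrow> 'a \<Rightarrow> complex mat" where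
  "zeta_row dimW bar Z c = mat 1 (dimW (bar c) * dimW c)
     (\<lambda>(_, r). Z c $$ (r mod dimW c, r div dimW c))"

definition theta_col :: "('a \<Rightarrow> nat) \<Rightarrow> ('a \<Rightarrow> 'a) \<Rightarrow> ('a \<Rightarrow> complex mat) \<Rightarrow> 'a \<Rightarrow> complex mat" where
  "theta_col dimW bar Z c = mat (dimW (bar c) * dimW c) 1
     (\<lambda>(r, _). minv (Z (bar c)) $$ (r mod dimW c, r div dimW c))"

text \<open>w_c: zeta_c (x) theta_c = w_c (u_{r_c} o W^{r_c}_{bar c c}) (x) (V^{r_c}_{bar c c} v_{r_c}),
  written as equality of the corresponding rank-one operators (vector times functional).\<close>
definition w_data :: "('a \<Rightarrow> nat) \<Rightarrow> ('a \<Rightarrow> 'a \<Rightarrow> 'a \<Rightarrow> nat) \<Rightarrow>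
    ('a \<Rightarrow> 'a \<Rightarrow> 'a \<Rightarrow> nat \<Rightarrow> complex mat) \<Rightarrow> ('a \<Rightarrow> 'a \<Rightarrow> 'a \<Rightarrow> nat \<Rightarrow> complex mat) \<Rightarrow>
    ('a \<Rightarrow> complex mat) \<Rightarrow> ('a \<Rightarrow> complex mat) \<Rightarrow> ('a \<Rightarrow> complex mat) \<Rightarrow>
    ('a \<Rightarrow> 'a) \<Rightarrow> ('a \<Rightarrow> complex mat) \<Rightarrow> ('a \<Rightarrow> complex) \<Rightarrow> bool" where
  "w_data dimW N V W b u v bar Z w \<longleftrightarrow>
     (\<forall>c. let r = ridx dimW b N c in
        w c \<noteq> 0 \<and>
        theta_col dimW bar Z c * zeta_row dimW bar Z c =
          w c \<cdot>\<^sub>m ((V (bar c) c r 0 * v r) * (u r * W (bar c) c r 0)))"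

end

theory Submission
  imports Defs "Jordan_Normal_Form.Spectral_Radius" "HOL-Library.Function_Algebras"
begin

text \<open>
  Write \<open>B\<close> for the dual of \<open>\<A>\<close>, \<open>\<Pi>\<^sub>R f = S(f\<^sub>1) f\<^sub>2\<close> and \<open>\<Pi>\<^sub>L f = f\<^sub>1 S(f\<^sub>2)\<close>.
  For every \<open>h\<close> the functional \<open>\<lambda>\<^sub>h(f) = Tr\<^sub>B(y \<mapsto> f y k\<^sup>-\<^sup>1 \<Pi>\<^sub>R(h))\<close> is tracial, and cyclicity of the
  trace together with \<open>S\<^sup>2 = k _ k\<^sup>-\<^sup>1\<close> gives the pulling-through identity
  \<open>g\<^sub>1 \<lambda>\<^sub>h(f g\<^sub>2) = S(f\<^sub>1) k \<lambda>\<^sub>h(f\<^sub>2 g)\<close>; hence \<open>T\<close> is the transpose of \<open>f \<mapsto> S(f) k\<close>, and the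
  formula for \<open>\<Delta> \<circ> T\<close> only expresses that \<open>S\<close> is antimultiplicative.

  The definition of \<open>w\<^sub>a\<close> says that \<open>\<chi>\<^sub>a(k\<^sup>-\<^sup>1 \<Pi>\<^sub>R f) = \<delta>\<^sub>a \<beta>(f)\<close> with \<open>\<delta>\<^sub>a = d\<^sub>a / \<xi>\<^sub>a\<close> and \<open>\<beta>\<close> the part of the
  counit of \<open>B\<close> in the vacuum block \<open>r\<^sub>a\<close>, so that \<open>\<lambda>\<^sub>h\<close> is a combination of the \<open>\<delta>\<^sub>a \<chi>\<^sub>a\<close> whose
  coefficients can be prescribed vacuum block by vacuum block.  Pulling through also yields
  \<open>\<Sum>\<^sub>a N\<^sub>c\<^sub>a\<^sup>b \<delta>\<^sub>a = \<delta>\<^sub>c\<^sub>' \<delta>\<^sub>b\<close> (\<open>l\<^sub>b = l\<^sub>c\<close>, \<open>c'\<close> the conjugate of \<open>c\<close>).  Combined with Frobenius reciprocity for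
  \<open>N\<close>, this shows that \<open>\<delta>\<^sub>a \<delta>\<^sub>a\<^sub>' = d\<^sub>a\<^sup>2\<close> is positive and that \<open>\<Sum>(d\<^sub>x\<^sup>2 : l\<^sub>x = e)\<close> takes the same value at
  \<open>e = l\<^sub>a\<close> and \<open>e = r\<^sub>a\<close>.  So \<open>\<Omega>\<close> is some \<open>\<lambda>\<^sub>h\<close>, and it is idempotent by pulling through once more.
\<close>

section \<open>Weak Hopf algebras in coordinates\<close>

text \<open>The scalars \<open>d\<close> and \<open>\<xi>\<close> are only complex numbers, so a
  priori the normalising sums of Omega could vanish. The fusion rules are therefore summed against
  complex conjugates of \<open>del\<close>, in both orders, which compares \<open>d_a^2\<close> with
  sums of absolute squares. This needs reciprocity, which is not part of the fusion data: it is
  obtained by evaluating characters on an element \<open>t\<close> with \<open>f t = PiL f t\<close>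
  and \<open>PiL t = 1\<close>, assembled from the rank-one vacuum blocks. The factor under the
  trace in \<open>lam\<close> is explained by its coproduct: up to Delta(1), the first leg of
  \<open>k^-1 PiR h\<close> is only \<open>k^-1\<close>, and the inverse antipode turns it into the
  \<open>k\<close> of the pulling-through formula. The parameter \<open>h\<close> supplies one
  weight per right vacuum, whereas Omega is normalised per left vacuum; this mismatch is why the
  equality of the two sums matters. Sweedler sums are scalars \<open>sw x F\<close>, and identities
  between elements are tested on functionals. Semisimplicity, given through complements of left
  ideals, has to be converted into matrix units.\<close>

definition lin :: "('i cv \<Rightarrow> complex) \<Rightarrow> bool" where
  "lin \<phi> \<longleftrightarrow> (\<forall>c x y. \<phi> (\<lambda>i. c * x i + y i) = c * \<phi> x + \<phi> y)"

definition linv :: "('i cv \<Rightarrow> 'j cv) \<Rightarrow> bool" where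
  "linv g \<longleftrightarrow> (\<forall>j. lin (\<lambda>x. g x j))"

text \<open>Linearity side conditions are discharged by rewriting: most operations contribute a rule
  saying that composition with a linear map is linear, so \<open>simp\<close> descends through
  nested products, antipodes and Sweedler sums.\<close>

named_theorems lin_rules

lemma linD: "lin \<phi> \<Longrightarrow> \<phi> (\<lambda>i. c * x i + y i) = c * \<phi> x + \<phi> y"
  by (simp add: lin_def)

lemma lin_zero_vec: "lin \<phi> \<Longrightarrow> \<phi> (\<lambda>i. 0) = 0"
  using linD[of \<phi> "-1" "\<lambda>i. 0" "\<lambda>i. 0"] by simp

lemma lin_scale_vec: "lin \<phi> \<Longrightarrow> \<phi> (\<lambda>i. c * x i) = c * \<phi> x"
  using linD[of \<phi> c x "\<lambda>i. 0"] lin_zero_vec[of \<phi>] by simp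

lemma lin_add_vec: "lin \<phi> \<Longrightarrow> \<phi> (\<lambda>i. x i + y i) = \<phi> x + \<phi> y"
  using linD[of \<phi> 1 x y] by simp

lemma lin_diff_vec: "lin \<phi> \<Longrightarrow> \<phi> (\<lambda>i. x i - y i) = \<phi> x - \<phi> y"
  using linD[of \<phi> "-1" y x] by (simp add: algebra_simps)

lemma lin_sum_vec:
  assumes "lin \<phi>"
  shows "\<phi> (\<lambda>i. \<Sum>s\<in>A. f s i) = (\<Sum>s\<in>A. \<phi> (f s))"
proof (induction A rule: infinite_finite_induct)
  case (insert a A)
  then show ?case using lin_add_vec[OF assms, of "f a" "\<lambda>i. \<Sum>s\<in>A. f s i"] by simp
qed (auto simp: lin_zero_vec[OF assms])

lemma lin_sum_scale_vec:
  assumes "lin \<phi>"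
  shows "\<phi> (\<lambda>i. \<Sum>s\<in>A. g s * f s i) = (\<Sum>s\<in>A. g s * \<phi> (f s))"
  by (simp add: lin_sum_vec[OF assms] lin_scale_vec[OF assms])

lemma sum_delta_mult:
  fixes f :: "'i::finite \<Rightarrow> complex"
  shows "(\<Sum>i\<in>UNIV. f i * (if i = j then 1 else 0)) = f j"
    "(\<Sum>i\<in>UNIV. f i * (if j = i then 1 else 0)) = f j"
    "(\<Sum>i\<in>UNIV. (if i = j then 1 else 0) * f i) = f j"
    "(\<Sum>i\<in>UNIV. (if j = i then 1 else 0) * f i) = f j"
proof -
  have *: "f i * (if i = j then 1 else 0) = (if i = j then f i else 0)"
    "f i * (if j = i then 1 else 0) = (if j = i then f i else 0)" 
    "(if i = j then 1 else 0) * f i = (if i = j then f i else 0)"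
    "(if j = i then 1 else 0) * f i = (if j = i then f i else 0)" for i by auto
  show "(\<Sum>i\<in>UNIV. f i * (if i = j then 1 else 0)) = f j"
    "(\<Sum>i\<in>UNIV. f i * (if j = i then 1 else 0)) = f j"
    "(\<Sum>i\<in>UNIV. (if i = j then 1 else 0) * f i) = f j"
    "(\<Sum>i\<in>UNIV. (if j = i then 1 else 0) * f i) = f j"
    unfolding * by simp_all
qed

lemma cv_expand: "(x :: 'i::finite cv) = (\<lambda>j. \<Sum>i\<in>UNIV. x i * bas i j)"
  by (rule ext) (simp add: bas_def sum_delta_mult)

lemma lin_expand:
  fixes \<phi> :: "'i::finite cv \<Rightarrow> complex"
  assumes "lin \<phi>"
  shows "\<phi> x = (\<Sum>i\<in>UNIV. x i * \<phi> (bas i))"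
  using lin_sum_scale_vec[OF assms, where A = UNIV and g = x and f = bas] by (simp only: cv_expand[symmetric])

lemma lin_ext:
  fixes \<phi> :: "'i::finite cv \<Rightarrow> complex"
  assumes "lin \<phi>" "lin \<phi>'" "\<And>i. \<phi> (bas i) = \<phi>' (bas i)"
  shows "\<phi> x = \<phi>' x"
  by (subst lin_expand[OF assms(1)], subst lin_expand[OF assms(2)]) (simp only: assms(3))

lemma linvD: "linv g \<Longrightarrow> g (\<lambda>i. c * x i + y i) = (\<lambda>j. c * g x j + g y j)"
  by (auto simp: linv_def lin_def)

lemma lin_comp: "lin \<phi> \<Longrightarrow> linv g \<Longrightarrow> lin (\<lambda>x. \<phi> (g x))"
  by (simp add: lin_def linvD[of g])

lemma linvI: "(\<And>j. lin (\<lambda>x. g x j)) \<Longrightarrow> linv g"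
  by (simp add: linv_def)

lemma lin_coord: "linv g \<Longrightarrow> lin (\<lambda>x. g x j)"
  by (simp add: linv_def)

lemma linv_ident [lin_rules]: "linv (\<lambda>x. x)"
  by (simp add: linv_def lin_def)

lemma lin_coord_ident [lin_rules]: "lin (\<lambda>x. x j)"
  by (simp add: lin_def)

lemma lin_mult_left [lin_rules]: "lin \<phi> \<Longrightarrow> lin (\<lambda>x. c * \<phi> x)"
  by (simp add: lin_def algebra_simps)

lemma lin_mult_right [lin_rules]: "lin \<phi> \<Longrightarrow> lin (\<lambda>x. \<phi> x * c)"
  by (simp add: lin_def algebra_simps)

lemma lin_sum [lin_rules]: "(\<And>i. lin (\<phi> i)) \<Longrightarrow> lin (\<lambda>x. \<Sum>i\<in>A. \<phi> i x)"
  by (simp add: lin_def sum.distrib sum_distrib_left)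

text \<open>Sweedler sums exist here only after pairing with a form, so equalities of elements are
  reduced to equalities of scalars.\<close>

lemma cv_eqI:
  assumes "\<And>\<phi>. lin \<phi> \<Longrightarrow> \<phi> x = \<phi> y"
  shows "x = y"
  by (rule ext) (rule assms, rule lin_coord_ident)

lemma sum_rotate4:
  "(\<Sum>i\<in>A. \<Sum>j\<in>B. \<Sum>k\<in>C. \<Sum>l\<in>D. f i j k l) = (\<Sum>j\<in>B. \<Sum>k\<in>C. \<Sum>l\<in>D. \<Sum>i\<in>A. f i j k l)"
  by (subst sum.swap, rule sum.cong[OF refl], subst sum.swap, rule sum.cong[OF refl], rule sum.swap)

lemma sum_rotate5:
  "(\<Sum>i\<in>A. \<Sum>j\<in>B. \<Sum>k\<in>C. \<Sum>l\<in>D. \<Sum>n\<in>E. f i j k l n) = (\<Sum>j\<in>B. \<Sum>k\<in>C. \<Sum>l\<in>D. \<Sum>n\<in>E. \<Sum>i\<in>A. f i j k l n)"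
  by (subst sum.swap, rule sum.cong[OF refl], rule sum_rotate4)

lemma sum_rotate6:
  "(\<Sum>i\<in>A. \<Sum>j\<in>B. \<Sum>k\<in>C. \<Sum>l\<in>D. \<Sum>n\<in>E. \<Sum>p\<in>G. f i j k l n p) = (\<Sum>j\<in>B. \<Sum>k\<in>C. \<Sum>l\<in>D. \<Sum>n\<in>E. \<Sum>p\<in>G. \<Sum>i\<in>A. f i j k l n p)"
  by (subst sum.swap, rule sum.cong[OF refl], rule sum_rotate5)

text \<open>The list of axioms is invariant under transposing all structure tensors, so the same
  locale serves for the algebra and its dual.\<close>

locale wha =
  fixes m :: "'i::finite \<Rightarrow> 'i \<Rightarrow> 'i \<Rightarrow> complex" and u :: "'i \<Rightarrow> complex"
    and c :: "'i \<Rightarrow> 'i \<Rightarrow> 'i \<Rightarrow> complex" and e :: "'i \<Rightarrow> complex"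
    and s :: "'i \<Rightarrow> 'i \<Rightarrow> complex" and D1 e2 :: "'i \<Rightarrow> 'i \<Rightarrow> complex"
  assumes D1_def: "D1 = (\<lambda>j k. \<Sum>r\<in>UNIV. u r * c r j k)"
    and e2_def: "e2 = (\<lambda>i j. \<Sum>r\<in>UNIV. e r * m i j r)"
    and m_assoc: "(\<Sum>r\<in>UNIV. m i j r * m r k l) = (\<Sum>r\<in>UNIV. m j k r * m i r l)"
    and m_unit: "(\<Sum>r\<in>UNIV. u r * m r j k) = (if j = k then 1 else 0)"
      "(\<Sum>r\<in>UNIV. u r * m j r k) = (if j = k then 1 else 0)"
    and c_assoc: "(\<Sum>r\<in>UNIV. c l r k * c r i j) = (\<Sum>r\<in>UNIV. c l i r * c r j k)"
    and c_counit: "(\<Sum>r\<in>UNIV. e r * c k r j) = (if j = k then 1 else 0)"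
      "(\<Sum>r\<in>UNIV. e r * c k j r) = (if j = k then 1 else 0)"
    and m_c: "(\<Sum>r\<in>UNIV. m i j r * c r k l) =
      (\<Sum>a\<in>UNIV. \<Sum>b\<in>UNIV. \<Sum>p\<in>UNIV. \<Sum>q\<in>UNIV. c i a b * c j p q * m a p k * m b q l)"
    and D1_D1: "(\<Sum>r\<in>UNIV. D1 r l * c r j k) = (\<Sum>p\<in>UNIV. \<Sum>q\<in>UNIV. D1 j p * D1 q l * m q p k)"
      "(\<Sum>r\<in>UNIV. D1 r l * c r j k) = (\<Sum>p\<in>UNIV. \<Sum>q\<in>UNIV. D1 j p * D1 q l * m p q k)"
    and e2_e2: "(\<Sum>r\<in>UNIV. e2 r l * m j k r) = (\<Sum>p\<in>UNIV. \<Sum>q\<in>UNIV. e2 j p * e2 q l * c k q p)"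
      "(\<Sum>r\<in>UNIV. e2 r l * m j k r) = (\<Sum>p\<in>UNIV. \<Sum>q\<in>UNIV. e2 j p * e2 q l * c k p q)"
    and s_left: "(\<Sum>a\<in>UNIV. \<Sum>b\<in>UNIV. \<Sum>r\<in>UNIV. c i a b * s a r * m r b k) =
      (\<Sum>p\<in>UNIV. D1 k p * e2 i p)"
    and s_right: "(\<Sum>a\<in>UNIV. \<Sum>b\<in>UNIV. \<Sum>r\<in>UNIV. c i a b * s b r * m a r k) =
      (\<Sum>p\<in>UNIV. D1 p k * e2 p i)"
    and s_s: "(\<Sum>a\<in>UNIV. \<Sum>b\<in>UNIV. \<Sum>d\<in>UNIV. \<Sum>a'\<in>UNIV. \<Sum>d'\<in>UNIV.
        (\<Sum>r\<in>UNIV. c i a r * c r b d) * s a a' * s d d' * (\<Sum>r\<in>UNIV. m a' b r * m r d' k)) = s i k"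
begin

section \<open>Sweedler calculus over structure constants\<close>

definition mul :: "'i cv \<Rightarrow> 'i cv \<Rightarrow> 'i cv" (infixl "\<diamondop>" 70) where
  "x \<diamondop> y = (\<lambda>k. \<Sum>i\<in>UNIV. \<Sum>j\<in>UNIV. x i * y j * m i j k)"

definition one :: "'i cv" where "one = u"

definition eps :: "'i cv \<Rightarrow> complex" where "eps x = (\<Sum>i\<in>UNIV. x i * e i)"

definition S :: "'i cv \<Rightarrow> 'i cv" where "S x = (\<lambda>j. \<Sum>i\<in>UNIV. x i * s i j)"

text \<open>The Sweedler sum of \<open>F x_1 x_2\<close>. Iterated coproducts are nested occurrences
  of \<open>sw\<close>, and the scalar value avoids tensor powers of the carrier.\<close>

definition sw :: "'i cv \<Rightarrow> ('i cv \<Rightarrow> 'i cv \<Rightarrow> complex) \<Rightarrow> complex" where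
  "sw x F = (\<Sum>j\<in>UNIV. \<Sum>k\<in>UNIV. (\<Sum>i\<in>UNIV. x i * c i j k) * F (bas j) (bas k))"

lemma bas_mul: "bas i \<diamondop> y = (\<lambda>k. \<Sum>j\<in>UNIV. y j * m i j k)"
  by (rule ext) (simp add: mul_def bas_def sum_delta_mult mult.assoc sum_distrib_left[symmetric])

lemma mul_bas': "x \<diamondop> bas j = (\<lambda>k. \<Sum>i\<in>UNIV. x i * m i j k)"
  by (rule ext) (simp add: mul_def bas_def mult.assoc sum_distrib_left[symmetric] sum_delta_mult)

lemma mul_bas: "bas i \<diamondop> bas j = m i j"
  by (simp add: bas_mul) (simp add: bas_def sum_delta_mult)

lemma S_bas: "S (bas i) = s i"
  by (rule ext) (simp add: S_def bas_def sum_delta_mult)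

lemma eps_bas: "eps (bas i) = e i"
  by (simp add: eps_def bas_def sum_delta_mult)

lemma sw_bas: "sw (bas i) F = (\<Sum>j\<in>UNIV. \<Sum>k\<in>UNIV. c i j k * F (bas j) (bas k))"
  by (simp add: sw_def bas_def sum_delta_mult)

lemma sw_one: "sw one F = (\<Sum>j\<in>UNIV. \<Sum>k\<in>UNIV. D1 j k * F (bas j) (bas k))"
  by (simp add: sw_def one_def D1_def)

lemma lin_eps0: "lin eps"
  by (simp add: lin_def eps_def algebra_simps sum.distrib sum_distrib_left)

lemma linv_S0: "linv S"
  by (rule linvI) (simp add: lin_def S_def algebra_simps sum.distrib sum_distrib_left)

lemma linv_mul0: "linv (\<lambda>x. x \<diamondop> y)" "linv (\<lambda>y. x \<diamondop> y)"
  by (rule linvI, simp add: lin_def mul_def algebra_simps sum.distrib sum_distrib_left)+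

lemma linv_comp: "linv h \<Longrightarrow> linv g \<Longrightarrow> linv (\<lambda>x. h (g x))"
  by (subst linv_def) (simp add: lin_def linvD[of g] linvD[of h])

lemmas lin_eps [lin_rules] = lin_comp[OF lin_eps0]
lemmas linv_S [lin_rules] = linv_comp[OF linv_S0]
lemmas linv_mul [lin_rules] = linv_comp[OF linv_mul0(1)] linv_comp[OF linv_mul0(2)]
lemmas lin_mul_S_coord [lin_rules] = linv_mul[THEN lin_coord] linv_S[THEN lin_coord]

lemma lin_sw0: "lin (\<lambda>x. sw x F)"
  by (simp add: lin_def sw_def algebra_simps sum.distrib sum_distrib_left sum_distrib_right)

lemmas lin_sw1 [lin_rules] = lin_comp[OF lin_sw0]

lemma lin_sw2 [lin_rules]:
  assumes "\<And>a b. lin (\<lambda>x. F x a b)"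
  shows "lin (\<lambda>x. sw y (F x))"
  unfolding sw_def by (intro lin_sum lin_mult_left assms)

lemma sw_mult_left: "sw x (\<lambda>a b. t * F a b) = t * sw x F"
  unfolding sw_def sum_distrib_left[of t] by (simp add: mult.left_commute)

lemma sw_mult_right: "sw x (\<lambda>a b. F a b * t) = sw x F * t"
  using sw_mult_left[of x t F] by (simp add: mult.commute)

lemma sw_sum: "sw x (\<lambda>a b. \<Sum>r\<in>A. F r a b) = (\<Sum>r\<in>A. sw x (F r))"
  unfolding sw_def sum_distrib_left
  by (rule sym, subst sum.swap, rule sum.cong[OF refl], rule sum.swap)

lemma sw_swap: "sw x (\<lambda>a b. sw y (\<lambda>a' b'. F a b a' b')) = sw y (\<lambda>a' b'. sw x (\<lambda>a b. F a b a' b'))"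
proof -
  have "sw x (\<lambda>a b. sw y (\<lambda>a' b'. F a b a' b')) =
    sw x (\<lambda>a b. \<Sum>j\<in>UNIV. \<Sum>k\<in>UNIV. (\<Sum>i\<in>UNIV. y i * c i j k) * F a b (bas j) (bas k))"
    by (simp add: sw_def[of y])
  also have "\<dots> = sw y (\<lambda>a' b'. sw x (\<lambda>a b. F a b a' b'))"
    by (simp add: sw_sum sw_mult_left sw_def[of y])
  finally show ?thesis .
qed

lemma mul_assoc: "x \<diamondop> y \<diamondop> z = x \<diamondop> (y \<diamondop> z)"
proof (rule cv_eqI)
  fix \<phi> :: "'i cv \<Rightarrow> complex" assume \<phi>: "lin \<phi>"
  note [simp] = lin_rules lin_comp[OF \<phi>]
  have *: "\<phi> (bas i \<diamondop> bas j \<diamondop> bas k) = \<phi> (bas i \<diamondop> (bas j \<diamondop> bas k))" for i j k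
  proof -
    have "bas i \<diamondop> bas j \<diamondop> bas k = bas i \<diamondop> (bas j \<diamondop> bas k)"
      by (simp add: mul_bas) (simp add: bas_mul mul_bas' m_assoc)
    then show ?thesis by simp
  qed
  have 1: "\<phi> (bas i \<diamondop> bas j \<diamondop> z) = \<phi> (bas i \<diamondop> (bas j \<diamondop> z))" for i j
    by (rule lin_ext[of "\<lambda>z. \<phi> (bas i \<diamondop> bas j \<diamondop> z)" "\<lambda>z. \<phi> (bas i \<diamondop> (bas j \<diamondop> z))"]) (simp_all add: *)
  have 2: "\<phi> (bas i \<diamondop> y \<diamondop> z) = \<phi> (bas i \<diamondop> (y \<diamondop> z))" for i
    by (rule lin_ext[of "\<lambda>y. \<phi> (bas i \<diamondop> y \<diamondop> z)" "\<lambda>y. \<phi> (bas i \<diamondop> (y \<diamondop> z))"]) (simp_all add: 1)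
  show "\<phi> (x \<diamondop> y \<diamondop> z) = \<phi> (x \<diamondop> (y \<diamondop> z))"
    by (rule lin_ext[of "\<lambda>x. \<phi> (x \<diamondop> y \<diamondop> z)" "\<lambda>x. \<phi> (x \<diamondop> (y \<diamondop> z))"]) (simp_all add: 2)
qed

lemma one_mul [simp]: "one \<diamondop> x = x"
proof (rule cv_eqI)
  fix \<phi> :: "'i cv \<Rightarrow> complex" assume \<phi>: "lin \<phi>"
  note [simp] = lin_rules lin_comp[OF \<phi>]
  have "one \<diamondop> bas i = bas i" for i
    by (simp add: mul_bas' one_def m_unit) (simp add: bas_def fun_eq_iff)
  then show "\<phi> (one \<diamondop> x) = \<phi> x"
    by - (rule lin_ext[of "\<lambda>x. \<phi> (one \<diamondop> x)" \<phi>], simp_all add: \<phi>)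
qed

lemma mul_one [simp]: "x \<diamondop> one = x"
proof (rule cv_eqI)
  fix \<phi> :: "'i cv \<Rightarrow> complex" assume \<phi>: "lin \<phi>"
  note [simp] = lin_rules lin_comp[OF \<phi>]
  have "bas i \<diamondop> one = bas i" for i
    by (simp add: bas_mul one_def m_unit) (simp add: bas_def fun_eq_iff)
  then show "\<phi> (x \<diamondop> one) = \<phi> x"
    by - (rule lin_ext[of "\<lambda>x. \<phi> (x \<diamondop> one)" \<phi>], simp_all add: \<phi>)
qed

lemma sw_assoc: "sw x (\<lambda>a b. sw a (\<lambda>a' b'. F a' b' b)) = sw x (\<lambda>a b. sw b (F a))"
proof (rule lin_ext[of "\<lambda>x. sw x _" "\<lambda>x. sw x _"])
  fix i
  have "sw (bas i) (\<lambda>a b. sw a (\<lambda>a' b'. F a' b' b)) =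
    (\<Sum>r\<in>UNIV. \<Sum>l\<in>UNIV. \<Sum>j\<in>UNIV. \<Sum>k\<in>UNIV. c i r l * c r j k * F (bas j) (bas k) (bas l))"
    by (simp add: sw_bas sum_distrib_left mult.assoc)
  also have "\<dots> = (\<Sum>l\<in>UNIV. \<Sum>j\<in>UNIV. \<Sum>k\<in>UNIV. \<Sum>r\<in>UNIV. c i r l * c r j k * F (bas j) (bas k) (bas l))"
    by (rule sum_rotate4)
  also have "\<dots> = (\<Sum>l\<in>UNIV. \<Sum>j\<in>UNIV. \<Sum>k\<in>UNIV. \<Sum>r\<in>UNIV. c i j r * c r k l * F (bas j) (bas k) (bas l))"
    by (simp only: sum_distrib_right[symmetric] c_assoc)
  also have "\<dots> = (\<Sum>j\<in>UNIV. \<Sum>k\<in>UNIV. \<Sum>r\<in>UNIV. \<Sum>l\<in>UNIV. c i j r * c r k l * F (bas j) (bas k) (bas l))"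
    by (rule sum_rotate4)
  also have "\<dots> = (\<Sum>j\<in>UNIV. \<Sum>r\<in>UNIV. \<Sum>k\<in>UNIV. \<Sum>l\<in>UNIV. c i j r * c r k l * F (bas j) (bas k) (bas l))"
    by (intro sum.cong refl sum.swap)
  also have "\<dots> = sw (bas i) (\<lambda>a b. sw b (F a))"
    by (simp add: sw_bas sum_distrib_left mult.assoc)
  finally show "sw (bas i) (\<lambda>a b. sw a (\<lambda>a' b'. F a' b' b)) = sw (bas i) (\<lambda>a b. sw b (F a))" .
qed (rule lin_sw0)+

lemma sw_counit1:
  assumes "lin \<phi>"
  shows "sw x (\<lambda>a b. eps a * \<phi> b) = \<phi> x"
proof (rule lin_ext[OF lin_sw0 assms])
  fix i
  have "sw (bas i) (\<lambda>a b. eps a * \<phi> b) = (\<Sum>k\<in>UNIV. (\<Sum>j\<in>UNIV. e j * c i j k) * \<phi> (bas k))"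
    by (simp add: sw_bas eps_bas sum_distrib_right) (subst sum.swap, simp add: mult.commute mult.left_commute)
  then show "sw (bas i) (\<lambda>a b. eps a * \<phi> b) = \<phi> (bas i)"
    by (simp add: c_counit sum_delta_mult)
qed

lemma sw_counit2:
  assumes "lin \<phi>"
  shows "sw x (\<lambda>a b. \<phi> a * eps b) = \<phi> x"
proof (rule lin_ext[OF lin_sw0 assms])
  fix i
  have "sw (bas i) (\<lambda>a b. \<phi> a * eps b) = (\<Sum>k\<in>UNIV. (\<Sum>j\<in>UNIV. e j * c i k j) * \<phi> (bas k))"
    by (simp add: sw_bas eps_bas sum_distrib_right) (simp add: mult.commute mult.left_commute)
  then show "sw (bas i) (\<lambda>a b. \<phi> a * eps b) = \<phi> (bas i)"
    by (simp add: c_counit sum_delta_mult)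
qed

lemma sw_cong: "(\<And>a b. F a b = G a b) \<Longrightarrow> sw x F = sw x G"
  by (simp add: sw_def)

text \<open>Multiplicativity of Delta evaluates \<open>F\<close> at products of basis vectors, which
  need not be basis vectors; this is where bilinearity of \<open>F\<close> enters.\<close>

lemma sw_mul:
  assumes F: "\<And>b. lin (\<lambda>a. F a b)" "\<And>a. lin (F a)"
  shows "sw (x \<diamondop> y) F = sw x (\<lambda>a b. sw y (\<lambda>a' b'. F (a \<diamondop> a') (b \<diamondop> b')))"
proof -
  have *: "sw (bas i \<diamondop> bas j) F = sw (bas i) (\<lambda>a b. sw (bas j) (\<lambda>a' b'. F (a \<diamondop> a') (b \<diamondop> b')))" for i j
  proof -
    have Fm: "F (m a p) (m b q) = (\<Sum>k\<in>UNIV. \<Sum>l\<in>UNIV. m a p k * m b q l * F (bas k) (bas l))" for a b p q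
      by (subst lin_expand[OF F(1)], subst lin_expand[OF F(2)]) (simp add: sum_distrib_left mult.assoc)
    have "sw (bas i \<diamondop> bas j) F = (\<Sum>k\<in>UNIV. \<Sum>l\<in>UNIV. (\<Sum>r\<in>UNIV. m i j r * c r k l) * F (bas k) (bas l))"
      by (simp add: mul_bas sw_def)
    also have "\<dots> = (\<Sum>k\<in>UNIV. \<Sum>l\<in>UNIV. \<Sum>a\<in>UNIV. \<Sum>b\<in>UNIV. \<Sum>p\<in>UNIV. \<Sum>q\<in>UNIV.
        c i a b * c j p q * (m a p k * m b q l * F (bas k) (bas l)))"
      by (simp add: m_c sum_distrib_right mult.assoc)
    also have "\<dots> = (\<Sum>l\<in>UNIV. \<Sum>a\<in>UNIV. \<Sum>b\<in>UNIV. \<Sum>p\<in>UNIV. \<Sum>q\<in>UNIV. \<Sum>k\<in>UNIV.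
        c i a b * c j p q * (m a p k * m b q l * F (bas k) (bas l)))"
      by (rule sum_rotate6)
    also have "\<dots> = (\<Sum>a\<in>UNIV. \<Sum>b\<in>UNIV. \<Sum>p\<in>UNIV. \<Sum>q\<in>UNIV. \<Sum>k\<in>UNIV. \<Sum>l\<in>UNIV.
        c i a b * c j p q * (m a p k * m b q l * F (bas k) (bas l)))"
      by (rule sum_rotate6)
    also have "\<dots> = sw (bas i) (\<lambda>a b. sw (bas j) (\<lambda>a' b'. F (a \<diamondop> a') (b \<diamondop> b')))"
      by (simp add: sw_bas mul_bas Fm sum_distrib_left mult.assoc)
    finally show ?thesis .
  qed
  note [simp] = lin_rules lin_comp[OF F(1)] lin_comp[OF F(2)]
  have 1: "sw (bas i \<diamondop> y) F = sw (bas i) (\<lambda>a b. sw y (\<lambda>a' b'. F (a \<diamondop> a') (b \<diamondop> b')))" for i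
    by (rule lin_ext[of "\<lambda>y. sw (bas i \<diamondop> y) F" "\<lambda>y. sw (bas i) (\<lambda>a b. sw y (\<lambda>a' b'. F (a \<diamondop> a') (b \<diamondop> b')))"])
      (simp_all add: *)
  show ?thesis
    by (rule lin_ext[of "\<lambda>x. sw (x \<diamondop> y) F" "\<lambda>x. sw x (\<lambda>a b. sw y (\<lambda>a' b'. F (a \<diamondop> a') (b \<diamondop> b')))"])
      (simp_all add: 1)
qed

text \<open>In place of Delta(1) = 1 (x) 1 only the two weak unit axioms are available: Delta^2(1)
  is \<open>1_1 (x) 1'_1 1_2 (x) 1'_2\<close>, and also the same with the middle factors exchanged.
  Having both orders is what makes values of \<open>PiR\<close> and \<open>PiL\<close>
  commute.\<close>

lemma sw_one3a:
  assumes F: "\<And>a b. lin (\<lambda>x. F a x b)"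
  shows "sw one (\<lambda>a b. sw b (F a)) = sw one (\<lambda>a b. sw one (\<lambda>a' b'. F a (a' \<diamondop> b) b'))"
    "sw one (\<lambda>a b. sw b (F a)) = sw one (\<lambda>a b. sw one (\<lambda>a' b'. F a (b \<diamondop> a') b'))"
proof -
  have Fm: "F a (m p q) b = (\<Sum>k\<in>UNIV. m p q k * F a (bas k) b)" for a p q b
    by (rule lin_expand[OF F])
  have "sw one (\<lambda>a b. sw b (F a)) = sw one (\<lambda>a b. sw a (\<lambda>a' b'. F a' b' b))"
    by (rule sw_assoc[symmetric])
  also have "\<dots> = (\<Sum>r\<in>UNIV. \<Sum>l\<in>UNIV. \<Sum>j\<in>UNIV. \<Sum>k\<in>UNIV. D1 r l * c r j k * F (bas j) (bas k) (bas l))"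
    by (simp add: sw_one sw_bas sum_distrib_left mult.assoc)
  also have "\<dots> = (\<Sum>l\<in>UNIV. \<Sum>j\<in>UNIV. \<Sum>k\<in>UNIV. (\<Sum>r\<in>UNIV. D1 r l * c r j k) * F (bas j) (bas k) (bas l))"
    by (subst sum_rotate4) (simp only: sum_distrib_right)
  finally have eq: "sw one (\<lambda>a b. sw b (F a)) = \<dots>" .
  \<comment> \<open>\<open>M\<close> is kept general so that one reindexing serves both orders of
    the middle product.\<close>
  have "(\<Sum>l\<in>UNIV. \<Sum>j\<in>UNIV. \<Sum>k\<in>UNIV. (\<Sum>p\<in>UNIV. \<Sum>q\<in>UNIV. D1 j p * D1 q l * M q p k) * F (bas j) (bas k) (bas l))
    = (\<Sum>j\<in>UNIV. \<Sum>p\<in>UNIV. \<Sum>q\<in>UNIV. \<Sum>l\<in>UNIV. D1 j p * (D1 q l * (\<Sum>k\<in>UNIV. M q p k * F (bas j) (bas k) (bas l))))" (is "?l = ?r") for M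
  proof -
    have "?l = (\<Sum>j\<in>UNIV. \<Sum>k\<in>UNIV. \<Sum>p\<in>UNIV. \<Sum>q\<in>UNIV. \<Sum>l\<in>UNIV. D1 j p * D1 q l * M q p k * F (bas j) (bas k) (bas l))"
      by (simp only: sum_distrib_right) (rule sum_rotate5)
    also have "\<dots> = (\<Sum>j\<in>UNIV. \<Sum>p\<in>UNIV. \<Sum>q\<in>UNIV. \<Sum>l\<in>UNIV. \<Sum>k\<in>UNIV. D1 j p * D1 q l * M q p k * F (bas j) (bas k) (bas l))"
      by (rule sum.cong[OF refl], rule sum_rotate4)
    also have "\<dots> = ?r"
      by (simp add: sum_distrib_left mult.assoc)
    finally show ?thesis .
  qed
  note * = this
  show "sw one (\<lambda>a b. sw b (F a)) = sw one (\<lambda>a b. sw one (\<lambda>a' b'. F a (a' \<diamondop> b) b'))"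
    unfolding eq D1_D1(1) *[of m] by (simp add: sw_one mul_bas Fm sum_distrib_left)
  show "sw one (\<lambda>a b. sw b (F a)) = sw one (\<lambda>a b. sw one (\<lambda>a' b'. F a (b \<diamondop> a') b'))"
    unfolding eq D1_D1(2) *[of "\<lambda>q p. m p q"] by (simp add: sw_one mul_bas Fm sum_distrib_left)
qed

lemma lin_sw_out:
  assumes "lin \<phi>"
  shows "\<phi> (\<lambda>k. sw x (\<lambda>a b. G a b k)) = sw x (\<lambda>a b. \<phi> (G a b))"
  unfolding sw_def by (simp only: lin_sum_vec[OF assms] lin_scale_vec[OF assms])

lemma eps_mul_bas: "eps (bas i \<diamondop> bas j) = e2 i j"
  by (simp add: eps_def mul_bas e2_def mult.commute)

lemma eps_mul3:
  "eps (x \<diamondop> y \<diamondop> z) = sw y (\<lambda>a b. eps (x \<diamondop> b) * eps (a \<diamondop> z))"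
  "eps (x \<diamondop> y \<diamondop> z) = sw y (\<lambda>a b. eps (x \<diamondop> a) * eps (b \<diamondop> z))"
proof -
  note [simp] = lin_rules
  have lhs: "eps (bas j \<diamondop> bas k \<diamondop> bas l) = (\<Sum>r\<in>UNIV. e2 r l * m j k r)" for j k l
    using lin_expand[of "\<lambda>x. eps (x \<diamondop> bas l)" "m j k"] by (simp add: mul_bas[of j k] eps_mul_bas mult.commute)
  have "eps (bas j \<diamondop> bas k \<diamondop> bas l) = sw (bas k) (\<lambda>a b. eps (bas j \<diamondop> b) * eps (a \<diamondop> bas l))" for j k l
    unfolding lhs e2_e2(1) sw_bas by (subst sum.swap) (simp add: eps_mul_bas mult_ac)
  then have "eps (bas j \<diamondop> bas k \<diamondop> z) = sw (bas k) (\<lambda>a b. eps (bas j \<diamondop> b) * eps (a \<diamondop> z))" for j k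
    by - (rule lin_ext[of "\<lambda>z. eps (bas j \<diamondop> bas k \<diamondop> z)" "\<lambda>z. sw (bas k) (\<lambda>a b. eps (bas j \<diamondop> b) * eps (a \<diamondop> z))"], simp_all)
  then have "eps (bas j \<diamondop> y \<diamondop> z) = sw y (\<lambda>a b. eps (bas j \<diamondop> b) * eps (a \<diamondop> z))" for j
    by - (rule lin_ext[of "\<lambda>y. eps (bas j \<diamondop> y \<diamondop> z)" "\<lambda>y. sw y (\<lambda>a b. eps (bas j \<diamondop> b) * eps (a \<diamondop> z))"], simp_all)
  then show "eps (x \<diamondop> y \<diamondop> z) = sw y (\<lambda>a b. eps (x \<diamondop> b) * eps (a \<diamondop> z))"
    by - (rule lin_ext[of "\<lambda>x. eps (x \<diamondop> y \<diamondop> z)" "\<lambda>x. sw y (\<lambda>a b. eps (x \<diamondop> b) * eps (a \<diamondop> z))"], simp_all)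
  have "eps (bas j \<diamondop> bas k \<diamondop> bas l) = sw (bas k) (\<lambda>a b. eps (bas j \<diamondop> a) * eps (b \<diamondop> bas l))" for j k l
    unfolding lhs e2_e2(2) sw_bas by (simp add: eps_mul_bas mult_ac)
  then have "eps (bas j \<diamondop> bas k \<diamondop> z) = sw (bas k) (\<lambda>a b. eps (bas j \<diamondop> a) * eps (b \<diamondop> z))" for j k
    by - (rule lin_ext[of "\<lambda>z. eps (bas j \<diamondop> bas k \<diamondop> z)" "\<lambda>z. sw (bas k) (\<lambda>a b. eps (bas j \<diamondop> a) * eps (b \<diamondop> z))"], simp_all)
  then have "eps (bas j \<diamondop> y \<diamondop> z) = sw y (\<lambda>a b. eps (bas j \<diamondop> a) * eps (b \<diamondop> z))" for j
    by - (rule lin_ext[of "\<lambda>y. eps (bas j \<diamondop> y \<diamondop> z)" "\<lambda>y. sw y (\<lambda>a b. eps (bas j \<diamondop> a) * eps (b \<diamondop> z))"], simp_all)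
  then show "eps (x \<diamondop> y \<diamondop> z) = sw y (\<lambda>a b. eps (x \<diamondop> a) * eps (b \<diamondop> z))"
    by - (rule lin_ext[of "\<lambda>x. eps (x \<diamondop> y \<diamondop> z)" "\<lambda>x. sw y (\<lambda>a b. eps (x \<diamondop> a) * eps (b \<diamondop> z))"], simp_all)
qed

lemma sum_bas: "(\<Sum>j::'i\<in>UNIV. f j * bas j k) = (f k :: complex)"
  by (simp add: bas_def sum_delta_mult)

lemma sum_bas': "(\<Sum>j::'i\<in>UNIV. f j * (bas j k * t j)) = (f k * t k :: complex)"
  using sum_bas[of "\<lambda>j. f j * t j" k] by (simp add: mult_ac)

lemma S_left:
  assumes \<phi>: "lin \<phi>"
  shows "sw x (\<lambda>a b. \<phi> (S a \<diamondop> b)) = sw one (\<lambda>a b. \<phi> a * eps (x \<diamondop> b))"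
proof -
  note [simp] = lin_rules
  have c: "(\<lambda>k. sw (bas i) (\<lambda>a b. (S a \<diamondop> b) k)) = (\<lambda>k. sw one (\<lambda>a b. eps (bas i \<diamondop> b) * a k))" for i
  proof (rule ext)
    fix k
    have "sw one (\<lambda>a b. eps (bas i \<diamondop> b) * a k) = (\<Sum>p\<in>UNIV. \<Sum>j\<in>UNIV. D1 j p * (bas j k * e2 i p))"
      unfolding sw_one by (subst sum.swap) (simp add: eps_mul_bas mult_ac)
    also have "\<dots> = (\<Sum>p\<in>UNIV. D1 k p * e2 i p)"
      by (simp only: sum_bas')
    also have "\<dots> = sw (bas i) (\<lambda>a b. (S a \<diamondop> b) k)"
      unfolding s_left[symmetric]
      by (simp add: sw_bas S_bas mul_bas' sum_distrib_left mult.assoc)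
    finally show "sw (bas i) (\<lambda>a b. (S a \<diamondop> b) k) = sw one (\<lambda>a b. eps (bas i \<diamondop> b) * a k)" by simp
  qed
  have *: "sw (bas i) (\<lambda>a b. \<phi> (S a \<diamondop> b)) = sw one (\<lambda>a b. \<phi> a * eps (bas i \<diamondop> b))" for i
    using lin_sw_out[OF \<phi>, of "bas i" "\<lambda>a b. S a \<diamondop> b"]
      lin_sw_out[OF \<phi>, of one "\<lambda>a b k. eps (bas i \<diamondop> b) * a k"]
    by (simp add: c lin_scale_vec[OF \<phi>]) (simp add: mult.commute)
  show ?thesis
    by (rule lin_ext[of "\<lambda>x. sw x (\<lambda>a b. \<phi> (S a \<diamondop> b))" "\<lambda>x. sw one (\<lambda>a b. \<phi> a * eps (x \<diamondop> b))"])
      (simp_all add: *)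
qed

lemma S_right:
  assumes \<phi>: "lin \<phi>"
  shows "sw x (\<lambda>a b. \<phi> (a \<diamondop> S b)) = sw one (\<lambda>a b. eps (a \<diamondop> x) * \<phi> b)"
proof -
  note [simp] = lin_rules
  have c: "(\<lambda>k. sw (bas i) (\<lambda>a b. (a \<diamondop> S b) k)) = (\<lambda>k. sw one (\<lambda>a b. eps (a \<diamondop> bas i) * b k))" for i
  proof (rule ext)
    fix k
    have "sw one (\<lambda>a b. eps (a \<diamondop> bas i) * b k) = (\<Sum>p\<in>UNIV. \<Sum>j\<in>UNIV. D1 p j * (bas j k * e2 p i))"
      unfolding sw_one by (simp add: eps_mul_bas mult_ac)
    also have "\<dots> = (\<Sum>p\<in>UNIV. D1 p k * e2 p i)"
      by (simp only: sum_bas')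
    also have "\<dots> = sw (bas i) (\<lambda>a b. (a \<diamondop> S b) k)"
      unfolding s_right[symmetric]
      by (simp add: sw_bas S_bas bas_mul sum_distrib_left mult.assoc)
    finally show "sw (bas i) (\<lambda>a b. (a \<diamondop> S b) k) = sw one (\<lambda>a b. eps (a \<diamondop> bas i) * b k)" by simp
  qed
  have *: "sw (bas i) (\<lambda>a b. \<phi> (a \<diamondop> S b)) = sw one (\<lambda>a b. eps (a \<diamondop> bas i) * \<phi> b)" for i
    using lin_sw_out[OF \<phi>, of "bas i" "\<lambda>a b. a \<diamondop> S b"]
      lin_sw_out[OF \<phi>, of one "\<lambda>a b k. eps (a \<diamondop> bas i) * b k"]
    by (simp add: c lin_scale_vec[OF \<phi>])
  show ?thesis
    by (rule lin_ext[of "\<lambda>x. sw x (\<lambda>a b. \<phi> (a \<diamondop> S b))" "\<lambda>x. sw one (\<lambda>a b. eps (a \<diamondop> x) * \<phi> b)"])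
      (simp_all add: *)
qed

lemma S_S:
  assumes \<phi>: "lin \<phi>"
  shows "sw x (\<lambda>a b. sw b (\<lambda>a' b'. \<phi> (S a \<diamondop> a' \<diamondop> S b'))) = \<phi> (S x)"
proof -
  note [simp] = lin_rules lin_comp[OF \<phi>]
  have mm: "(s a \<diamondop> bas b \<diamondop> s d) k = (\<Sum>a'\<in>UNIV. \<Sum>d'\<in>UNIV. s a a' * s d d' * (\<Sum>r\<in>UNIV. m a' b r * m r d' k))" for a b d k
  proof -
    have "(s a \<diamondop> bas b \<diamondop> s d) k = (\<Sum>a'\<in>UNIV. s a a' * (bas a' \<diamondop> bas b \<diamondop> s d) k)"
      by (rule lin_expand[of "\<lambda>x. (x \<diamondop> bas b \<diamondop> s d) k"]) simp
    also have "\<dots> = (\<Sum>a'\<in>UNIV. s a a' * (\<Sum>d'\<in>UNIV. s d d' * (bas a' \<diamondop> bas b \<diamondop> bas d') k))"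
      by (rule sum.cong[OF refl], rule arg_cong[where f = "times _"], rule lin_expand) simp
    also have "\<dots> = (\<Sum>a'\<in>UNIV. s a a' * (\<Sum>d'\<in>UNIV. s d d' * (\<Sum>r\<in>UNIV. m a' b r * m r d' k)))"
      by (simp add: mul_bas) (simp add: mul_bas')
    finally show ?thesis by (simp add: sum_distrib_left mult.assoc)
  qed
  have c: "sw (bas i) (\<lambda>a b. sw b (\<lambda>a' b'. (S a \<diamondop> a' \<diamondop> S b') k)) = S (bas i) k" for i k
  proof -
    have "sw (bas i) (\<lambda>a b. sw b (\<lambda>a' b'. (S a \<diamondop> a' \<diamondop> S b') k)) =
      (\<Sum>a\<in>UNIV. \<Sum>r\<in>UNIV. \<Sum>b\<in>UNIV. \<Sum>d\<in>UNIV. c i a r * c r b d * (s a \<diamondop> bas b \<diamondop> s d) k)"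
      by (simp add: sw_bas S_bas sum_distrib_left mult.assoc)
    also have "\<dots> = (\<Sum>a\<in>UNIV. \<Sum>b\<in>UNIV. \<Sum>d\<in>UNIV. (\<Sum>r\<in>UNIV. c i a r * c r b d) * (s a \<diamondop> bas b \<diamondop> s d) k)"
      by (rule sum.cong[OF refl], subst sum.swap, rule sum.cong[OF refl], subst sum.swap) (simp add: sum_distrib_right)
    also have "\<dots> = s i k"
      by (subst s_s[symmetric]) (simp add: mm sum_distrib_left mult.assoc)
    finally show ?thesis by (simp add: S_bas)
  qed
  have "sw x (\<lambda>a b. sw b (\<lambda>a' b'. (S a \<diamondop> a' \<diamondop> S b') k)) = S x k" for x k
    by (rule lin_ext[of "\<lambda>x. sw x (\<lambda>a b. sw b (\<lambda>a' b'. (S a \<diamondop> a' \<diamondop> S b') k))" "\<lambda>x. S x k"]) (simp_all add: c)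
  then have "S x = (\<lambda>k. sw x (\<lambda>a b. sw b (\<lambda>a' b'. (S a \<diamondop> a' \<diamondop> S b') k)))" by simp
  then show ?thesis
    using lin_sw_out[OF \<phi>, of x "\<lambda>a b k. sw b (\<lambda>a' b'. (S a \<diamondop> a' \<diamondop> S b') k)"]
    by (simp add: lin_sw_out[OF \<phi>])
qed

text \<open>Write \<open>f\<close> as \<open>f 1\<close>. Weak multiplicativity splits
  \<open>eps (f_2 1_2 y)\<close> into \<open>eps (f_2 1_2) eps (1_3 y)\<close>, and by
  coassociativity the first factor acts as the counit on the coproduct of \<open>f 1_1\<close>. The
  three variants below differ in the side from which the unit multiplies and in the leg that carries
  the counit.\<close>

lemma counit_absorb1:
  assumes \<phi>: "lin \<phi>"
  shows "sw f (\<lambda>a b. \<phi> a * eps (b \<diamondop> y)) = sw one (\<lambda>a b. \<phi> (f \<diamondop> a) * eps (b \<diamondop> y))"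
proof -
  note [simp] = lin_rules lin_comp[OF \<phi>] \<phi>
  have "sw f (\<lambda>a b. \<phi> a * eps (b \<diamondop> y)) = sw (f \<diamondop> one) (\<lambda>a b. \<phi> a * eps (b \<diamondop> y))" by simp
  also have "\<dots> = sw f (\<lambda>a b. sw one (\<lambda>a' b'. \<phi> (a \<diamondop> a') * eps (b \<diamondop> b' \<diamondop> y)))"
    by (subst sw_mul) simp_all
  also have "\<dots> = sw one (\<lambda>a' b'. sw f (\<lambda>a b. \<phi> (a \<diamondop> a') * eps (b \<diamondop> b' \<diamondop> y)))"
    by (rule sw_swap)
  also have "\<dots> = sw one (\<lambda>a' b'. sw b' (\<lambda>p q. sw f (\<lambda>a b. \<phi> (a \<diamondop> a') * (eps (b \<diamondop> p) * eps (q \<diamondop> y)))))"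
    by (subst sw_swap) (simp only: eps_mul3(2) sw_mult_left)
  also have "\<dots> = sw one (\<lambda>c d. sw c (\<lambda>p q. sw f (\<lambda>a b. \<phi> (a \<diamondop> p) * (eps (b \<diamondop> q) * eps (d \<diamondop> y)))))"
    by (rule sw_assoc[symmetric])
  also have "\<dots> = sw one (\<lambda>c d. sw (f \<diamondop> c) (\<lambda>a b. \<phi> a * eps b) * eps (d \<diamondop> y))"
    by (subst sw_swap, subst sw_mul) (simp_all add: sw_mult_right[symmetric] mult.assoc)
  also have "\<dots> = sw one (\<lambda>a b. \<phi> (f \<diamondop> a) * eps (b \<diamondop> y))"
    by (simp add: sw_counit2)
  finally show ?thesis .
qed

lemma counit_absorb2:
  assumes \<phi>: "lin \<phi>"
  shows "sw f (\<lambda>a b. \<phi> a * eps (y \<diamondop> b)) = sw one (\<lambda>a b. \<phi> (a \<diamondop> f) * eps (y \<diamondop> b))"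
proof -
  note [simp] = lin_rules lin_comp[OF \<phi>] \<phi>
  have "sw f (\<lambda>a b. \<phi> a * eps (y \<diamondop> b)) = sw (one \<diamondop> f) (\<lambda>a b. \<phi> a * eps (y \<diamondop> b))" by simp
  also have "\<dots> = sw one (\<lambda>a' b'. sw f (\<lambda>a b. \<phi> (a' \<diamondop> a) * eps (y \<diamondop> b' \<diamondop> b)))"
    by (subst sw_mul) (simp_all add: mul_assoc)
  also have "\<dots> = sw one (\<lambda>a' b'. sw b' (\<lambda>p q. sw f (\<lambda>a b. \<phi> (a' \<diamondop> a) * (eps (y \<diamondop> q) * eps (p \<diamondop> b)))))"
    by (subst sw_swap) (simp only: eps_mul3(1) sw_mult_left)
  also have "\<dots> = sw one (\<lambda>c d. sw c (\<lambda>p q. sw f (\<lambda>a b. \<phi> (p \<diamondop> a) * (eps (y \<diamondop> d) * eps (q \<diamondop> b)))))"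
    by (rule sw_assoc[symmetric])
  also have "\<dots> = sw one (\<lambda>c d. sw (c \<diamondop> f) (\<lambda>a b. \<phi> a * eps b) * eps (y \<diamondop> d))"
    by (subst sw_mul) (simp_all add: sw_mult_left[symmetric] mult_ac)
  also have "\<dots> = sw one (\<lambda>a b. \<phi> (a \<diamondop> f) * eps (y \<diamondop> b))"
    by (simp add: sw_counit2)
  finally show ?thesis .
qed

lemma counit_absorb3:
  assumes \<phi>: "lin \<phi>"
  shows "sw f (\<lambda>a b. eps (a \<diamondop> y) * \<phi> b) = sw one (\<lambda>a b. eps (a \<diamondop> y) * \<phi> (f \<diamondop> b))"
proof -
  note [simp] = lin_rules lin_comp[OF \<phi>] \<phi>
  have "sw f (\<lambda>a b. eps (a \<diamondop> y) * \<phi> b) = sw (f \<diamondop> one) (\<lambda>a b. eps (a \<diamondop> y) * \<phi> b)" by simp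
  also have "\<dots> = sw f (\<lambda>a b. sw one (\<lambda>a' b'. eps (a \<diamondop> a' \<diamondop> y) * \<phi> (b \<diamondop> b')))"
    by (subst sw_mul) simp_all
  also have "\<dots> = sw one (\<lambda>a' b'. sw f (\<lambda>a b. eps (a \<diamondop> a' \<diamondop> y) * \<phi> (b \<diamondop> b')))"
    by (rule sw_swap)
  also have "\<dots> = sw one (\<lambda>a' b'. sw a' (\<lambda>p q. sw f (\<lambda>a b. eps (a \<diamondop> q) * eps (p \<diamondop> y) * \<phi> (b \<diamondop> b'))))"
    by (subst sw_swap) (simp only: eps_mul3(1) sw_mult_right)
  also have "\<dots> = sw one (\<lambda>c d. sw d (\<lambda>p q. sw f (\<lambda>a b. eps (a \<diamondop> p) * eps (c \<diamondop> y) * \<phi> (b \<diamondop> q))))"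
    by (rule sw_assoc)
  also have "\<dots> = sw one (\<lambda>c d. eps (c \<diamondop> y) * sw (f \<diamondop> d) (\<lambda>a b. eps a * \<phi> b))"
    by (subst sw_swap, subst sw_mul) (simp_all add: sw_mult_left[symmetric] mult_ac)
  also have "\<dots> = sw one (\<lambda>a b. eps (a \<diamondop> y) * \<phi> (f \<diamondop> b))"
    by (simp add: sw_counit1)
  finally show ?thesis .
qed

lemma counit_absorb4:
  assumes \<phi>: "lin \<phi>"
  shows "sw f (\<lambda>a b. eps (y \<diamondop> a) * \<phi> b) = sw one (\<lambda>a b. eps (y \<diamondop> a) * \<phi> (b \<diamondop> f))"
proof -
  note [simp] = lin_rules lin_comp[OF \<phi>] \<phi>
  have "sw f (\<lambda>a b. eps (y \<diamondop> a) * \<phi> b) = sw (one \<diamondop> f) (\<lambda>a b. eps (y \<diamondop> a) * \<phi> b)" by simp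
  also have "\<dots> = sw one (\<lambda>a' b'. sw f (\<lambda>a b. eps (y \<diamondop> a' \<diamondop> a) * \<phi> (b' \<diamondop> b)))"
    by (subst sw_mul) (simp_all add: mul_assoc)
  also have "\<dots> = sw one (\<lambda>a' b'. sw a' (\<lambda>p q. sw f (\<lambda>a b. eps (y \<diamondop> p) * eps (q \<diamondop> a) * \<phi> (b' \<diamondop> b))))"
    by (subst sw_swap) (simp only: eps_mul3(2) sw_mult_right)
  also have "\<dots> = sw one (\<lambda>c d. sw d (\<lambda>p q. sw f (\<lambda>a b. eps (y \<diamondop> c) * eps (p \<diamondop> a) * \<phi> (q \<diamondop> b))))"
    by (rule sw_assoc)
  also have "\<dots> = sw one (\<lambda>c d. eps (y \<diamondop> c) * sw (d \<diamondop> f) (\<lambda>a b. eps a * \<phi> b))"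
    by (subst sw_mul) (simp_all add: sw_mult_left[symmetric] mult_ac)
  also have "\<dots> = sw one (\<lambda>a b. eps (y \<diamondop> a) * \<phi> (b \<diamondop> f))"
    by (simp add: sw_counit1)
  finally show ?thesis .
qed

text \<open>This is \<open>1_1 (x) f 1_2 = PiR f_1 (x) f_2\<close>, with \<open>PiR\<close> still
  written through the counit. Expanding \<open>f 1_2\<close> by the counit produces Delta^2(1); the
  weak unit axiom separates it into two copies of Delta(1), one of which is absorbed by
  \<open>f\<close>.\<close>

lemma one_right_mul:
  assumes F: "\<And>b. lin (\<lambda>a. F a b)" "\<And>a. lin (F a)"
  shows "sw one (\<lambda>a b. F a (f \<diamondop> b)) = sw f (\<lambda>a b. sw one (\<lambda>p q. F p b * eps (a \<diamondop> q)))"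
proof -
  note [simp] = lin_rules lin_comp[OF F(1)] lin_comp[OF F(2)] F
  have "sw one (\<lambda>p q. F p (f \<diamondop> q)) = sw one (\<lambda>p q. sw (f \<diamondop> q) (\<lambda>a b. eps a * F p b))"
    by (simp add: sw_counit1)
  also have "\<dots> = sw one (\<lambda>p q. sw q (\<lambda>q1 q2. sw f (\<lambda>a b. eps (a \<diamondop> q1) * F p (b \<diamondop> q2))))"
    by (subst sw_mul, simp, simp, subst sw_swap) (rule refl)
  also have "\<dots> = sw one (\<lambda>p q. sw one (\<lambda>a' b'. sw f (\<lambda>a b. eps (a \<diamondop> (a' \<diamondop> q)) * F p (b \<diamondop> b'))))"
    by (rule sw_one3a(1)) simp
  also have "\<dots> = sw one (\<lambda>p q. sw (f \<diamondop> one) (\<lambda>a b. eps (a \<diamondop> q) * F p b))"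
    by (subst sw_mul, simp, simp, subst sw_swap) (simp add: mul_assoc)
  also have "\<dots> = sw f (\<lambda>a b. sw one (\<lambda>p q. F p b * eps (a \<diamondop> q)))"
    by (subst sw_swap) (simp add: mult.commute)
  finally show ?thesis .
qed

lemma one_left_mul:
  assumes F: "\<And>b. lin (\<lambda>a. F a b)" "\<And>a. lin (F a)"
  shows "sw one (\<lambda>a b. F a (b \<diamondop> f)) = sw f (\<lambda>a b. sw one (\<lambda>p q. F p b * eps (q \<diamondop> a)))"
proof -
  note [simp] = lin_rules lin_comp[OF F(1)] lin_comp[OF F(2)] F
  have "sw one (\<lambda>p q. F p (q \<diamondop> f)) = sw one (\<lambda>p q. sw (q \<diamondop> f) (\<lambda>a b. eps a * F p b))"
    by (simp add: sw_counit1)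
  also have "\<dots> = sw one (\<lambda>p q. sw q (\<lambda>q1 q2. sw f (\<lambda>a b. eps (q1 \<diamondop> a) * F p (q2 \<diamondop> b))))"
    by (subst sw_mul) simp_all
  also have "\<dots> = sw one (\<lambda>p q. sw one (\<lambda>a' b'. sw f (\<lambda>a b. eps (q \<diamondop> a' \<diamondop> a) * F p (b' \<diamondop> b))))"
    by (rule sw_one3a(2)) simp
  also have "\<dots> = sw one (\<lambda>p q. sw (one \<diamondop> f) (\<lambda>a b. eps (q \<diamondop> a) * F p b))"
    by (subst sw_mul) (simp_all add: mul_assoc)
  also have "\<dots> = sw f (\<lambda>a b. sw one (\<lambda>p q. F p b * eps (q \<diamondop> a)))"
    by (simp, subst sw_swap) (simp add: mult.commute)
  finally show ?thesis .
qed

text \<open>The weak substitute for the Hopf identity \<open>S(f_1) f_2 (x) f_3 = 1 (x) f\<close>: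
  the left side collapses only to \<open>1_1 (x) f 1_2\<close>.\<close>

lemma S_left_three:
  assumes F: "\<And>b. lin (\<lambda>a. F a b)" "\<And>a. lin (F a)"
  shows "sw f (\<lambda>a b. sw a (\<lambda>p q. F (S p \<diamondop> q) b)) = sw one (\<lambda>a b. F a (f \<diamondop> b))"
  unfolding one_right_mul[of F, OF F] by (simp add: S_left[OF F(1)])

section \<open>Counital maps and antimultiplicativity of the antipode\<close>

definition PiL :: "'i cv \<Rightarrow> 'i cv" where "PiL x = (\<lambda>k. sw x (\<lambda>a b. (a \<diamondop> S b) k))"

definition PiR :: "'i cv \<Rightarrow> 'i cv" where "PiR x = (\<lambda>k. sw x (\<lambda>a b. (S a \<diamondop> b) k))"

text \<open>Two readings of one element: the antipode form, and the counit form
  \<open>eps (1_1 x) 1_2\<close>, which is the one the absorption rules can handle.\<close>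

lemma lin_PiL:
  assumes "lin \<phi>"
  shows "\<phi> (PiL x) = sw x (\<lambda>a b. \<phi> (a \<diamondop> S b))" "\<phi> (PiL x) = sw one (\<lambda>a b. eps (a \<diamondop> x) * \<phi> b)"
  unfolding PiL_def S_right[OF assms, symmetric] by (rule lin_sw_out[OF assms])+

lemma lin_PiR:
  assumes "lin \<phi>"
  shows "\<phi> (PiR x) = sw x (\<lambda>a b. \<phi> (S a \<diamondop> b))" "\<phi> (PiR x) = sw one (\<lambda>a b. \<phi> a * eps (x \<diamondop> b))"
  unfolding PiR_def S_left[OF assms, symmetric] by (rule lin_sw_out[OF assms])+

lemma linv_PiL0: "linv PiL"
  by (rule linvI) (simp add: PiL_def lin_rules)

lemma linv_PiR0: "linv PiR"
  by (rule linvI) (simp add: PiR_def lin_rules)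

lemmas linv_PiLR [lin_rules] = linv_comp[OF linv_PiL0] linv_comp[OF linv_PiR0]

text \<open>In counit form the product sits on the middle leg of two copies of Delta(1); the two
  weak unit axioms identify both orders of that leg with Delta^2(1).\<close>

lemma PiR_PiL_commute: "PiR x \<diamondop> PiL y = PiL y \<diamondop> PiR x"
proof (rule cv_eqI)
  fix \<phi> :: "'i cv \<Rightarrow> complex" assume \<phi>: "lin \<phi>"
  note [simp] = lin_rules lin_comp[OF \<phi>] \<phi>
  have "\<phi> (PiR x \<diamondop> PiL y) = sw one (\<lambda>a b. eps (a \<diamondop> y) * sw one (\<lambda>a' b'. \<phi> (a' \<diamondop> b) * eps (x \<diamondop> b')))"
    by (subst lin_PiL(2)[of "\<lambda>z. \<phi> (PiR x \<diamondop> z)"], simp, subst lin_PiR(2)[of "\<lambda>z. \<phi> (z \<diamondop> _)"], simp_all)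
  also have "\<dots> = sw one (\<lambda>a b. sw one (\<lambda>a' b'. eps (a \<diamondop> y) * \<phi> (a' \<diamondop> b) * eps (x \<diamondop> b')))"
    by (simp only: sw_mult_left[symmetric] mult.assoc)
  also have "\<dots> = sw one (\<lambda>a b. sw b (\<lambda>p q. eps (a \<diamondop> y) * \<phi> p * eps (x \<diamondop> q)))"
    by (rule sw_one3a(1)[symmetric]) simp
  also have "\<dots> = sw one (\<lambda>a b. sw one (\<lambda>a' b'. eps (a \<diamondop> y) * \<phi> (b \<diamondop> a') * eps (x \<diamondop> b')))"
    by (rule sw_one3a(2)) simp
  also have "\<dots> = sw one (\<lambda>a b. eps (a \<diamondop> y) * sw one (\<lambda>a' b'. \<phi> (b \<diamondop> a') * eps (x \<diamondop> b')))"
    by (simp only: sw_mult_left[symmetric] mult.assoc)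
  also have "\<dots> = \<phi> (PiL y \<diamondop> PiR x)"
    by (subst lin_PiL(2)[of "\<lambda>z. \<phi> (z \<diamondop> PiR x)"], simp, subst lin_PiR(2)[of "\<lambda>z. \<phi> (_ \<diamondop> z)"], simp_all)
  finally show "\<phi> (PiR x \<diamondop> PiL y) = \<phi> (PiL y \<diamondop> PiR x)" .
qed

text \<open>Counit absorption replaces \<open>eps (1_1 y) x_1 1_2\<close> by
  \<open>eps (x_1 y) x_2\<close>; the remaining \<open>x_2 S(x_3)\<close> is again a value of
  \<open>PiL\<close>, and weak multiplicativity joins the two counits.\<close>

lemma PiL_mul:
  assumes \<phi>: "lin \<phi>"
  shows "\<phi> (PiL (x \<diamondop> y)) = sw x (\<lambda>a b. \<phi> (a \<diamondop> PiL y \<diamondop> S b))"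
proof -
  note [simp] = lin_rules lin_comp[OF \<phi>] \<phi>
  have "sw x (\<lambda>a b. \<phi> (a \<diamondop> PiL y \<diamondop> S b)) = sw x (\<lambda>a b. sw one (\<lambda>p q. eps (p \<diamondop> y) * \<phi> (a \<diamondop> q \<diamondop> S b)))"
    by (subst lin_PiL(2)[of "\<lambda>z. \<phi> (_ \<diamondop> z \<diamondop> _)"]) simp_all
  also have "\<dots> = sw x (\<lambda>a b. sw a (\<lambda>p q. eps (p \<diamondop> y) * \<phi> (q \<diamondop> S b)))"
    by (subst counit_absorb3[of "\<lambda>z. \<phi> (z \<diamondop> _)"]) simp_all
  also have "\<dots> = sw x (\<lambda>a b. sw b (\<lambda>p q. eps (a \<diamondop> y) * \<phi> (p \<diamondop> S q)))"
    by (rule sw_assoc)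
  also have "\<dots> = sw x (\<lambda>a b. sw one (\<lambda>p q. eps (p \<diamondop> b) * eps (a \<diamondop> y) * \<phi> q))"
    by (simp add: sw_mult_left S_right) (simp add: sw_mult_left[symmetric] mult_ac)
  also have "\<dots> = sw one (\<lambda>p q. sw x (\<lambda>a b. eps (p \<diamondop> b) * eps (a \<diamondop> y)) * \<phi> q)"
    by (subst sw_swap) (simp only: sw_mult_right)
  also have "\<dots> = \<phi> (PiL (x \<diamondop> y))"
    by (simp add: lin_PiL(2) eps_mul3(1)[symmetric] mul_assoc)
  finally show ?thesis by simp
qed

lemma PiR_mul:
  assumes \<phi>: "lin \<phi>"
  shows "\<phi> (PiR (x \<diamondop> y)) = sw y (\<lambda>a b. \<phi> (S a \<diamondop> PiR x \<diamondop> b))"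
proof -
  note [simp] = lin_rules lin_comp[OF \<phi>] \<phi>
  have "sw y (\<lambda>a b. \<phi> (S a \<diamondop> PiR x \<diamondop> b)) = sw y (\<lambda>a b. sw one (\<lambda>p q. \<phi> (S a \<diamondop> (p \<diamondop> b)) * eps (x \<diamondop> q)))"
    by (subst lin_PiR(2)[of "\<lambda>z. \<phi> (_ \<diamondop> z \<diamondop> _)"]) (simp_all add: mul_assoc)
  also have "\<dots> = sw y (\<lambda>a b. sw b (\<lambda>p q. \<phi> (S a \<diamondop> p) * eps (x \<diamondop> q)))"
    by (subst counit_absorb2[of "\<lambda>z. \<phi> (_ \<diamondop> z)"]) simp_all
  also have "\<dots> = sw y (\<lambda>a b. sw a (\<lambda>p q. \<phi> (S p \<diamondop> q) * eps (x \<diamondop> b)))"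
    by (rule sw_assoc[symmetric])
  also have "\<dots> = sw y (\<lambda>a b. sw one (\<lambda>p q. \<phi> p * (eps (x \<diamondop> b) * eps (a \<diamondop> q))))"
    by (simp add: sw_mult_right S_left) (simp add: sw_mult_left[symmetric] mult_ac)
  also have "\<dots> = sw one (\<lambda>p q. \<phi> p * sw y (\<lambda>a b. eps (x \<diamondop> b) * eps (a \<diamondop> q)))"
    by (subst sw_swap) (simp only: sw_mult_left)
  also have "\<dots> = \<phi> (PiR (x \<diamondop> y))"
    by (simp add: lin_PiR(2) eps_mul3(1)[symmetric])
  finally show ?thesis by simp
qed

lemma S_PiL: "lin \<phi> \<Longrightarrow> sw x (\<lambda>a b. \<phi> (S a \<diamondop> PiL b)) = \<phi> (S x)"
  by (subst lin_PiL(1)[of "\<lambda>z. \<phi> (_ \<diamondop> z)"]) (simp_all add: S_S[symmetric] mul_assoc lin_rules lin_comp[of \<phi>])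

lemma S_PiR: "lin \<phi> \<Longrightarrow> sw x (\<lambda>a b. \<phi> (PiR a \<diamondop> S b)) = \<phi> (S x)"
  by (subst lin_PiR(1)[of "\<lambda>z. \<phi> (z \<diamondop> _)"])
    (simp_all add: S_S[symmetric] sw_assoc[of x "\<lambda>p q b. \<phi> (S p \<diamondop> q \<diamondop> S b)"] lin_rules lin_comp[of \<phi>])

text \<open>In a Hopf algebra this is uniqueness of convolution inverses. Here \<open>S\<close> is
  only a generalised inverse, satisfying \<open>S(x_1) PiL(x_2) = S x = PiR(x_1) S(x_2)\<close>;
  both forms are used, and the passage between them is the commutation of \<open>PiR\<close> with
  \<open>PiL\<close>.\<close>

lemma S_mul: "S (x \<diamondop> y) = S y \<diamondop> S x"
proof (rule cv_eqI)
  fix \<phi> :: "'i cv \<Rightarrow> complex" assume \<phi>: "lin \<phi>"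
  note [simp] = lin_rules lin_comp[OF \<phi>] \<phi>
  have "\<phi> (S (x \<diamondop> y)) = sw x (\<lambda>a b. sw y (\<lambda>a' b'. \<phi> (S (a \<diamondop> a') \<diamondop> PiL (b \<diamondop> b'))))"
    unfolding S_PiL[OF \<phi>, symmetric] by (subst sw_mul) simp_all
  also have "\<dots> = sw x (\<lambda>a b. sw y (\<lambda>a' b'. sw b (\<lambda>b1 b2. \<phi> (S (a \<diamondop> a') \<diamondop> (b1 \<diamondop> PiL b' \<diamondop> S b2)))))"
    by (subst PiL_mul[of "\<lambda>z. \<phi> (_ \<diamondop> z)"]) simp_all
  also have "\<dots> = sw x (\<lambda>a b. sw b (\<lambda>b1 b2. sw y (\<lambda>a' b'. \<phi> (S (a \<diamondop> a') \<diamondop> (b1 \<diamondop> PiL b' \<diamondop> S b2)))))"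
    by (subst sw_swap) (rule refl)
  also have "\<dots> = sw x (\<lambda>a b. sw b (\<lambda>b1 b2. sw y (\<lambda>a' b'. sw b' (\<lambda>c1 c2. \<phi> (S (a \<diamondop> a') \<diamondop> (b1 \<diamondop> (c1 \<diamondop> S c2) \<diamondop> S b2))))))"
    by (subst lin_PiL(1)[of "\<lambda>z. \<phi> (_ \<diamondop> (_ \<diamondop> z \<diamondop> _))"]) simp_all
  \<comment> \<open>Regrouping the legs exposes \<open>S (x_1 y_1) (x_2 y_2)\<close>, which is
    \<open>PiR\<close> of a product and expands by \<open>PiR_mul\<close>.\<close>
  also have "\<dots> = sw x (\<lambda>b b2. sw b (\<lambda>a b1. sw y (\<lambda>b' c2. sw b' (\<lambda>a' c1. \<phi> (S (a \<diamondop> a') \<diamondop> (b1 \<diamondop> (c1 \<diamondop> S c2) \<diamondop> S b2))))))"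
    by (simp only: sw_assoc)
  also have "\<dots> = sw x (\<lambda>b b2. sw y (\<lambda>b' c2. sw (b \<diamondop> b') (\<lambda>p q. \<phi> (S p \<diamondop> q \<diamondop> (S c2 \<diamondop> S b2)))))"
    by (subst sw_swap, subst sw_mul) (simp_all add: mul_assoc)
  also have "\<dots> = sw x (\<lambda>b b2. sw y (\<lambda>b' c2. \<phi> (PiR (b \<diamondop> b') \<diamondop> (S c2 \<diamondop> S b2))))"
    by (subst lin_PiR(1)[of "\<lambda>z. \<phi> (z \<diamondop> _)"]) simp_all
  also have "\<dots> = sw x (\<lambda>b b2. sw y (\<lambda>b' c2. sw b' (\<lambda>c1 c1'. \<phi> (S c1 \<diamondop> PiR b \<diamondop> c1' \<diamondop> (S c2 \<diamondop> S b2)))))"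
    by (subst PiR_mul[of "\<lambda>z. \<phi> (z \<diamondop> _)"]) simp_all
  also have "\<dots> = sw x (\<lambda>b b2. sw y (\<lambda>c1 d. sw d (\<lambda>c1' c2. \<phi> (S c1 \<diamondop> PiR b \<diamondop> c1' \<diamondop> (S c2 \<diamondop> S b2)))))"
    by (simp only: sw_assoc)
  also have "\<dots> = sw x (\<lambda>b b2. sw y (\<lambda>c1 d. \<phi> (S c1 \<diamondop> PiR b \<diamondop> PiL d \<diamondop> S b2)))"
    by (subst lin_PiL(1)[of "\<lambda>z. \<phi> (_ \<diamondop> _ \<diamondop> z \<diamondop> _)"]) (simp_all add: mul_assoc)
  also have "\<dots> = sw x (\<lambda>b b2. sw y (\<lambda>c1 d. \<phi> (S c1 \<diamondop> PiL d \<diamondop> (PiR b \<diamondop> S b2))))"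
    by (simp add: mul_assoc) (simp add: mul_assoc[symmetric] PiR_PiL_commute)
  also have "\<dots> = \<phi> (S y \<diamondop> S x)"
    by (subst S_PiL[of "\<lambda>z. \<phi> (z \<diamondop> _)"], simp, subst S_PiR[of "\<lambda>z. \<phi> (_ \<diamondop> z)"], simp_all)
  finally show "\<phi> (S (x \<diamondop> y)) = \<phi> (S y \<diamondop> S x)" .
qed

lemma PiL_one: "PiL one = one"
proof (rule cv_eqI)
  fix \<phi> :: "'i cv \<Rightarrow> complex" assume \<phi>: "lin \<phi>"
  show "\<phi> (PiL one) = \<phi> one"
    by (simp add: lin_PiL(2)[OF \<phi>] sw_counit1[OF \<phi>])
qed

text \<open>The weak unit axiom rewrites \<open>1_1 S(1_2) (x) 1_3\<close> as
  \<open>1_1 S(1'_1 1_2) (x) 1'_2\<close>, and antimultiplicativity splits off the factor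
  \<open>PiL 1 = 1\<close>.\<close>

lemma PiL_one_S:
  assumes F: "\<And>b. lin (\<lambda>a. F a b)" "\<And>a. lin (F a)"
  shows "sw one (\<lambda>a b. F (PiL a) b) = sw one (\<lambda>a b. F (S a) b)"
proof -
  note [simp] = lin_rules lin_comp[OF F(1)] lin_comp[OF F(2)] F
  have "sw one (\<lambda>a b. F (PiL a) b) = sw one (\<lambda>a b. sw a (\<lambda>p q. F (p \<diamondop> S q) b))"
    by (simp add: lin_PiL(1)[OF F(1)])
  also have "\<dots> = sw one (\<lambda>a b. sw b (\<lambda>p q. F (a \<diamondop> S p) q))"
    by (rule sw_assoc)
  also have "\<dots> = sw one (\<lambda>a b. sw one (\<lambda>a' b'. F (a \<diamondop> S (a' \<diamondop> b)) b'))"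
    by (rule sw_one3a(1)) simp
  also have "\<dots> = sw one (\<lambda>a' b'. sw one (\<lambda>a b. F (a \<diamondop> S b \<diamondop> S a') b'))"
    by (subst sw_swap) (simp add: S_mul mul_assoc)
  also have "\<dots> = sw one (\<lambda>a' b'. F (PiL one \<diamondop> S a') b')"
    by (subst lin_PiL(1)[of "\<lambda>z. F (z \<diamondop> _) _"]) simp_all
  finally show ?thesis by (simp add: PiL_one)
qed

text \<open>A third form of \<open>PiL\<close>, with the antipode applied to a leg of Delta(1); from
  it the inverse antipode of \<open>PiL x\<close> can be read off as
  \<open>1_1 eps (1_2 x)\<close>.\<close>

lemma PiL_alt:
  assumes \<phi>: "lin \<phi>"
  shows "\<phi> (PiL x) = sw one (\<lambda>a b. \<phi> (S a) * eps (b \<diamondop> x))"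
proof -
  note [simp] = lin_rules lin_comp[OF \<phi>] \<phi>
  have "sw one (\<lambda>a b. \<phi> (S a) * eps (b \<diamondop> x)) = sw one (\<lambda>a b. \<phi> (PiL a) * eps (b \<diamondop> x))"
    by (rule PiL_one_S[symmetric]) simp_all
  also have "\<dots> = sw one (\<lambda>a b. sw one (\<lambda>p q. eps (p \<diamondop> a) * eps (b \<diamondop> x) * \<phi> q))"
    by (simp add: lin_PiL(2)) (simp add: sw_mult_left[symmetric] mult_ac)
  also have "\<dots> = sw one (\<lambda>p q. eps (p \<diamondop> one \<diamondop> x) * \<phi> q)"
    unfolding eps_mul3(2) by (subst sw_swap) (simp only: sw_mult_right)
  also have "\<dots> = \<phi> (PiL x)"
    by (simp add: lin_PiL(2))
  finally show ?thesis by simp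
qed

end

section \<open>Pivotal elements and trace functionals\<close>

definition trc :: "('i::finite cv \<Rightarrow> 'i cv) \<Rightarrow> complex" where
  "trc T = (\<Sum>i\<in>UNIV. T (bas i) i)"

lemma trc_commute:
  fixes P Q :: "'i::finite cv \<Rightarrow> 'i cv"
  assumes "linv P" "linv Q"
  shows "trc (\<lambda>y. P (Q y)) = trc (\<lambda>y. Q (P y))"
proof -
  have P: "P x i = (\<Sum>j\<in>UNIV. x j * P (bas j) i)" and Q: "Q x i = (\<Sum>j\<in>UNIV. x j * Q (bas j) i)" for x i
    by (rule lin_expand[OF lin_coord[OF assms(1)]], rule lin_expand[OF lin_coord[OF assms(2)]])
  have "trc (\<lambda>y. P (Q y)) = (\<Sum>i\<in>UNIV. \<Sum>j\<in>UNIV. Q (bas i) j * P (bas j) i)"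
    unfolding trc_def by (subst P) simp
  also have "\<dots> = (\<Sum>i\<in>UNIV. \<Sum>j\<in>UNIV. P (bas i) j * Q (bas j) i)"
    by (subst sum.swap) (simp add: mult.commute)
  also have "\<dots> = trc (\<lambda>y. Q (P y))"
    unfolding trc_def by (subst (2) Q) simp
  finally show ?thesis .
qed

text \<open>Here \<open>k'\<close> is the inverse of the pivotal element, and
  \<open>sw_k_left\<close>, \<open>sw_k_right\<close> are the two group-like identities for Delta(k)
  paired with a bilinear form.\<close>

locale wha_pivotal = wha m u c e s D1 e2
  for m :: "'i::finite \<Rightarrow> 'i \<Rightarrow> 'i \<Rightarrow> complex" and u c e s D1 e2 +
  fixes k k' :: "'i cv"
  assumes k_k': "k \<diamondop> k' = one" and k'_k: "k' \<diamondop> k = one"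
    and S2: "S (S f) = k \<diamondop> f \<diamondop> k'"
    and sw_k_left: "\<lbrakk>\<And>b. lin (\<lambda>a. F a b); \<And>a. lin (F a)\<rbrakk> \<Longrightarrow> sw k F = sw one (\<lambda>a b. F (k \<diamondop> a) (k \<diamondop> b))"
    and sw_k_right: "\<lbrakk>\<And>b. lin (\<lambda>a. F a b); \<And>a. lin (F a)\<rbrakk> \<Longrightarrow> sw k F = sw one (\<lambda>a b. F (a \<diamondop> k) (b \<diamondop> k))"
begin

lemma k_cancel [simp]: "k \<diamondop> (k' \<diamondop> x) = x" "k' \<diamondop> (k \<diamondop> x) = x" "x \<diamondop> k \<diamondop> k' = x" "x \<diamondop> k' \<diamondop> k = x"
  by (simp_all add: mul_assoc[symmetric] k_k' k'_k) (simp_all add: mul_assoc k_k' k'_k)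

text \<open>The counit on the first leg of \<open>Delta(k) = Delta(1) (k (x) k)\<close> gives
  \<open>k = PiL k k\<close>, and \<open>k\<close> can be cancelled.\<close>

lemma PiL_k: "PiL k = one"
proof -
  have "k = PiL k \<diamondop> k"
  proof (rule cv_eqI)
    fix \<phi> :: "'i cv \<Rightarrow> complex" assume \<phi>: "lin \<phi>"
    note [simp] = lin_rules lin_comp[OF \<phi>] \<phi>
    have "\<phi> k = sw k (\<lambda>a b. eps a * \<phi> b)" by (simp add: sw_counit1)
    also have "\<dots> = sw one (\<lambda>a b. eps (a \<diamondop> k) * \<phi> (b \<diamondop> k))" by (rule sw_k_right) simp_all
    also have "\<dots> = \<phi> (PiL k \<diamondop> k)" by (subst lin_PiL(2)[of "\<lambda>z. \<phi> (z \<diamondop> k)"]) simp_all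
    finally show "\<phi> k = \<phi> (PiL k \<diamondop> k)" .
  qed
  then have "k \<diamondop> k' = PiL k \<diamondop> k \<diamondop> k'" by (rule arg_cong)
  then show ?thesis by (simp add: k_k')
qed

text \<open>The other group-like identity \<open>Delta(k) = (k (x) k) Delta(1)\<close> evaluates the
  same \<open>PiL k\<close> as \<open>k 1_1 S(1_2) S(k)\<close>.\<close>

lemma k_Sk: "k \<diamondop> S k = one"
proof -
  have "PiL k = k \<diamondop> S k"
  proof (rule cv_eqI)
    fix \<phi> :: "'i cv \<Rightarrow> complex" assume \<phi>: "lin \<phi>"
    note [simp] = lin_rules lin_comp[OF \<phi>] \<phi>
    have "\<phi> (PiL k) = sw k (\<lambda>a b. \<phi> (a \<diamondop> S b))" by (rule lin_PiL(1)[OF \<phi>])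
    also have "\<dots> = sw one (\<lambda>a b. \<phi> (k \<diamondop> a \<diamondop> S (k \<diamondop> b)))" by (rule sw_k_left) simp_all
    also have "\<dots> = sw one (\<lambda>a b. \<phi> (k \<diamondop> (a \<diamondop> S b) \<diamondop> S k))" by (simp add: S_mul mul_assoc)
    also have "\<dots> = \<phi> (k \<diamondop> PiL one \<diamondop> S k)" by (subst lin_PiL(1)[of "\<lambda>z. \<phi> (_ \<diamondop> z \<diamondop> _)"]) simp_all
    finally show "\<phi> (PiL k) = \<phi> (k \<diamondop> S k)" by (simp add: PiL_one)
  qed
  then show ?thesis by (simp add: PiL_k)
qed

lemma S_k: "S k = k'"
proof -
  have "k' = k' \<diamondop> (k \<diamondop> S k)" by (simp only: k_Sk mul_one)
  then show ?thesis by simp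
qed

lemma S_k': "S k' = k"
  using S2[of k] by (simp add: S_k)

text \<open>The inverse of the antipode: the square of \<open>S\<close> is conjugation by
  \<open>k\<close>, so \<open>S\<close> has to be followed by conjugation with
  \<open>k'\<close>.\<close>

definition Si :: "'i cv \<Rightarrow> 'i cv" where "Si f = k' \<diamondop> S f \<diamondop> k"

lemma linv_Si [lin_rules]: "linv g \<Longrightarrow> linv (\<lambda>x. Si (g x))"
  unfolding Si_def by (simp add: lin_rules)

lemma Si_S: "Si (S f) = f"
  by (simp add: Si_def S2 mul_assoc k'_k)

lemma Si_mul: "Si (x \<diamondop> y) = Si y \<diamondop> Si x"
  by (simp add: Si_def S_mul mul_assoc)

lemma Si_k': "Si k' = k"
  by (simp add: Si_def S_k' mul_assoc)

lemma Si_Si: "Si (Si a) = k' \<diamondop> a \<diamondop> k"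
  by (simp add: Si_def S_mul S2 S_k S_k' mul_assoc)

lemma k_Si: "k \<diamondop> Si a = S a \<diamondop> k"
  by (simp add: Si_def mul_assoc)

text \<open>Analogue of \<open>S_left_three\<close> for the inverse antipode, with the legs in
  opposite order. Since \<open>q Si(p) = Si (p S(q))\<close>, the first two legs of \<open>y\<close>
  combine to \<open>Si\<close> of a value of \<open>PiL\<close>, which \<open>PiL_alt\<close>
  evaluates.\<close>

lemma Si_three:
  assumes F: "\<And>b. lin (\<lambda>a. F a b)" "\<And>a. lin (F a)"
  shows "sw y (\<lambda>a b. sw a (\<lambda>p q. F (q \<diamondop> Si p) b)) = sw one (\<lambda>a b. F a (b \<diamondop> y))"
proof -
  note [simp] = lin_rules lin_comp[OF F(1)] lin_comp[OF F(2)] F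
  have "sw a (\<lambda>p q. F (q \<diamondop> Si p) b) = sw one (\<lambda>p q. F p b * eps (q \<diamondop> a))" for a b
  proof -
    have "sw a (\<lambda>p q. F (q \<diamondop> Si p) b) = sw a (\<lambda>p q. F (Si (p \<diamondop> S q)) b)"
      by (simp add: Si_mul Si_S)
    also have "\<dots> = F (Si (PiL a)) b"
      by (rule lin_PiL(1)[symmetric, of "\<lambda>z. F (Si z) b"]) simp
    also have "\<dots> = sw one (\<lambda>p q. F p b * eps (q \<diamondop> a))"
      by (subst PiL_alt[of "\<lambda>z. F (Si z) b"]) (simp_all add: Si_S)
    finally show ?thesis .
  qed
  then show ?thesis by (simp only: one_left_mul[of F, OF F])
qed

lemma sw_k':
  assumes F: "\<And>b. lin (\<lambda>a. F a b)" "\<And>a. lin (F a)"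
  shows "sw k' F = sw one (\<lambda>a b. F (a \<diamondop> k') (b \<diamondop> k'))"
proof -
  note [simp] = lin_rules lin_comp[OF F(1)] lin_comp[OF F(2)] F
  have "sw one (\<lambda>a b. F (a \<diamondop> k') (b \<diamondop> k')) = sw (k' \<diamondop> k) (\<lambda>a b. F (a \<diamondop> k') (b \<diamondop> k'))"
    by (simp add: k'_k)
  also have "\<dots> = sw k' (\<lambda>a b. sw k (\<lambda>c d. F (a \<diamondop> c \<diamondop> k') (b \<diamondop> d \<diamondop> k')))"
    by (rule sw_mul) simp_all
  also have "\<dots> = sw k' (\<lambda>a b. sw one (\<lambda>c d. F (a \<diamondop> (c \<diamondop> k) \<diamondop> k') (b \<diamondop> (d \<diamondop> k) \<diamondop> k')))"
    by (subst sw_k_right) simp_all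
  also have "\<dots> = sw k' (\<lambda>a b. sw one (\<lambda>c d. F (a \<diamondop> c) (b \<diamondop> d)))"
    by (simp add: mul_assoc k_k')
  also have "\<dots> = sw (k' \<diamondop> one) F"
    by (rule sw_mul[symmetric]) simp_all
  finally show ?thesis by simp
qed

lemma sw_PiR:
  assumes F: "\<And>b. lin (\<lambda>a. F a b)" "\<And>a. lin (F a)"
  shows "sw (PiR f) F = sw one (\<lambda>a b. F a (b \<diamondop> PiR f))"
proof -
  note [simp] = lin_rules lin_comp[OF F(1)] lin_comp[OF F(2)] F
  have "sw (PiR f) F = sw one (\<lambda>a b. sw a (\<lambda>p q. F p q * eps (f \<diamondop> b)))"
    by (subst lin_PiR(2)[of "\<lambda>x. sw x F"]) (simp_all add: sw_mult_right)
  also have "\<dots> = sw one (\<lambda>a b. sw b (\<lambda>p q. F a p * eps (f \<diamondop> q)))"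
    by (rule sw_assoc)
  also have "\<dots> = sw one (\<lambda>a b. sw one (\<lambda>a' b'. F a (b \<diamondop> a') * eps (f \<diamondop> b')))"
    by (rule sw_one3a(2)) simp
  also have "\<dots> = sw one (\<lambda>a b. F a (b \<diamondop> PiR f))"
    by (subst lin_PiR(2)[of "\<lambda>z. F _ (_ \<diamondop> z)"]) simp_all
  finally show ?thesis .
qed

text \<open>Values of \<open>PiR\<close> have coproduct \<open>1_1 (x) 1_2 PiR f\<close>, so the
  right factor \<open>k' PiR f\<close> reaches the first leg only as \<open>k'\<close>. This is why
  \<open>lam\<close> can carry an arbitrary \<open>PiR h\<close>.\<close>

lemma sw_mul_k'_PiR:
  assumes F: "\<And>b. lin (\<lambda>a. F a b)" "\<And>a. lin (F a)"
  shows "sw (y \<diamondop> (k' \<diamondop> PiR f)) F = sw y (\<lambda>a b. F (a \<diamondop> k') (b \<diamondop> (k' \<diamondop> PiR f)))"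
proof -
  note [simp] = lin_rules lin_comp[OF F(1)] lin_comp[OF F(2)] F
  have "sw (y \<diamondop> (k' \<diamondop> PiR f)) F = sw (y \<diamondop> k' \<diamondop> PiR f) F" by (simp add: mul_assoc)
  also have "\<dots> = sw (y \<diamondop> k') (\<lambda>a b. sw (PiR f) (\<lambda>c d. F (a \<diamondop> c) (b \<diamondop> d)))"
    by (rule sw_mul) simp_all
  also have "\<dots> = sw (y \<diamondop> k') (\<lambda>a b. sw one (\<lambda>c d. F (a \<diamondop> c) (b \<diamondop> d \<diamondop> PiR f)))"
    by (subst sw_PiR) (simp_all add: mul_assoc)
  also have "\<dots> = sw (y \<diamondop> k' \<diamondop> one) (\<lambda>a b. F a (b \<diamondop> PiR f))"
    by (rule sw_mul[symmetric]) simp_all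
  also have "\<dots> = sw y (\<lambda>a b. sw k' (\<lambda>c d. F (a \<diamondop> c) (b \<diamondop> d \<diamondop> PiR f)))"
    by (simp only: mul_one, rule sw_mul) simp_all
  also have "\<dots> = sw y (\<lambda>a b. sw one (\<lambda>c d. F (a \<diamondop> c \<diamondop> k') (b \<diamondop> d \<diamondop> k' \<diamondop> PiR f)))"
    by (subst sw_k') (simp_all add: mul_assoc)
  also have "\<dots> = sw (y \<diamondop> one) (\<lambda>a b. F (a \<diamondop> k') (b \<diamondop> k' \<diamondop> PiR f))"
    by (rule sw_mul[symmetric]) simp_all
  finally show ?thesis by (simp add: mul_assoc)
qed

text \<open>Inserting Delta(1) and applying \<open>Si_three\<close> turns
  \<open>f_1 (x) f_2 y\<close> into \<open>f_1 y_2 Si(y_1) (x) f_2 y_3\<close>. Now \<open>f\<close>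
  and \<open>y\<close> share a coproduct, and a trace over \<open>y\<close> can be rotated.\<close>

lemma split_three:
  assumes X: "lin X" and \<phi>: "lin \<phi>"
  shows "sw f (\<lambda>a b. X a * \<phi> (b \<diamondop> y)) = sw y (\<lambda>c d. sw (f \<diamondop> d) (\<lambda>a b. X (a \<diamondop> Si c) * \<phi> b))"
proof -
  note [simp] = lin_rules lin_comp[OF \<phi>] \<phi> lin_comp[OF X] X
  have "sw f (\<lambda>a b. X a * \<phi> (b \<diamondop> y)) = sw (f \<diamondop> one) (\<lambda>a b. X a * \<phi> (b \<diamondop> y))" by simp
  also have "\<dots> = sw f (\<lambda>a b. sw one (\<lambda>p q. X (a \<diamondop> p) * \<phi> (b \<diamondop> (q \<diamondop> y))))"
    by (subst sw_mul) (simp_all add: mul_assoc)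
  also have "\<dots> = sw f (\<lambda>a b. sw y (\<lambda>c d. sw c (\<lambda>p q. X (a \<diamondop> (q \<diamondop> Si p)) * \<phi> (b \<diamondop> d))))"
    by (subst Si_three[of "\<lambda>u v. X (_ \<diamondop> u) * \<phi> (_ \<diamondop> v)"]) simp_all
  also have "\<dots> = sw y (\<lambda>c d. sw c (\<lambda>p q. sw f (\<lambda>a b. X (a \<diamondop> (q \<diamondop> Si p)) * \<phi> (b \<diamondop> d))))"
    by (subst sw_swap, subst (2) sw_swap) (rule refl)
  also have "\<dots> = sw y (\<lambda>c d. sw d (\<lambda>p q. sw f (\<lambda>a b. X (a \<diamondop> (p \<diamondop> Si c)) * \<phi> (b \<diamondop> q))))"
    by (rule sw_assoc)
  also have "\<dots> = sw y (\<lambda>c d. sw (f \<diamondop> d) (\<lambda>a b. X (a \<diamondop> Si c) * \<phi> b))"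
    by (subst sw_swap, subst sw_mul) (simp_all add: mul_assoc)
  finally show ?thesis .
qed

text \<open>Expanding \<open>Y\<close> into products of coordinates makes every summand the trace of
  a composite of two linear maps, to which cyclicity applies.\<close>

lemma trace_cyclic_sw:
  assumes Y: "\<And>c. lin (\<lambda>a. Y a c)" "\<And>a. lin (Y a)"
  shows "(\<Sum>i\<in>UNIV. sw (bas i) (\<lambda>c d. sw (f \<diamondop> d) (\<lambda>a b. Y a c * (b \<diamondop> q) i))) =
    (\<Sum>i\<in>UNIV. sw (bas i) (\<lambda>a b. sw (b \<diamondop> q) (\<lambda>c d. Y a c * (f \<diamondop> d) i)))"
proof -
  note [simp] = lin_rules lin_comp[OF Y(1)] lin_comp[OF Y(2)] Y
  \<comment> \<open>\<open>P t\<close> contracts the first leg of Delta with the coordinate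
    functional \<open>t\<close>.\<close>
  define P where "P t y = (\<lambda>j. sw y (\<lambda>c d. c t * d j))" for t and y :: "'i cv"
  have linP: "linv (P t)" for t
    by (rule linvI) (simp add: P_def)
  note [simp] = linv_comp[OF linP]
  have \<phi>P: "\<phi> (P t y) = sw y (\<lambda>c d. c t * \<phi> d)" if "lin \<phi>" for \<phi> t y
    unfolding P_def by (simp add: lin_sw_out[OF that, of y "\<lambda>c d j. c t * d j"] lin_scale_vec[OF that])
  have Yst: "Y a c = (\<Sum>r\<in>UNIV. \<Sum>t\<in>UNIV. Y (bas r) (bas t) * (a r * c t))" for a c
  proof -
    have "Y a c = (\<Sum>r\<in>UNIV. a r * Y (bas r) c)" by (rule lin_expand[OF Y(1)])
    also have "\<dots> = (\<Sum>r\<in>UNIV. a r * (\<Sum>t\<in>UNIV. c t * Y (bas r) (bas t)))"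
      by (rule sum.cong[OF refl], rule arg_cong[where f = "times _"], rule lin_expand[OF Y(2)])
    finally show ?thesis by (simp add: sum_distrib_left mult_ac)
  qed
  have l: "sw y (\<lambda>c d. sw (f \<diamondop> d) (\<lambda>a b. a r * c t * (b \<diamondop> q) i)) = (P r (f \<diamondop> P t y) \<diamondop> q) i" for y i r t
    by (subst \<phi>P[of "\<lambda>z. (P r (f \<diamondop> z) \<diamondop> q) i"], simp, subst \<phi>P[of "\<lambda>z. (z \<diamondop> q) i"], simp)
      (simp add: sw_mult_left[symmetric] mult_ac)
  have r: "sw y (\<lambda>a b. sw (b \<diamondop> q) (\<lambda>c d. a r * c t * (f \<diamondop> d) i)) = (f \<diamondop> P t (P r y \<diamondop> q)) i" for y i r t
    by (subst \<phi>P[of "\<lambda>z. (f \<diamondop> P t (z \<diamondop> q)) i"], simp, subst \<phi>P[of "\<lambda>z. (f \<diamondop> z) i"], simp)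
      (simp add: sw_mult_left[symmetric] mult_ac)
  have tr: "(\<Sum>i\<in>UNIV. (P r (f \<diamondop> P t (bas i)) \<diamondop> q) i) = (\<Sum>i\<in>UNIV. (f \<diamondop> P t (P r (bas i) \<diamondop> q)) i)" for r t
    using trc_commute[of "\<lambda>z. P r z \<diamondop> q" "\<lambda>y. f \<diamondop> P t y"] by (simp add: trc_def)
  have "(\<Sum>i\<in>UNIV. sw (bas i) (\<lambda>c d. sw (f \<diamondop> d) (\<lambda>a b. Y a c * (b \<diamondop> q) i))) =
    (\<Sum>i\<in>UNIV. \<Sum>r\<in>UNIV. \<Sum>t\<in>UNIV. Y (bas r) (bas t) *
      sw (bas i) (\<lambda>c d. sw (f \<diamondop> d) (\<lambda>a b. a r * c t * (b \<diamondop> q) i)))"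
    by (subst Yst) (simp only: sum_distrib_right sw_sum mult.assoc[of "Y _ _"] sw_mult_left)
  also have "\<dots> = (\<Sum>r\<in>UNIV. \<Sum>t\<in>UNIV. Y (bas r) (bas t) * (\<Sum>i\<in>UNIV. (P r (f \<diamondop> P t (bas i)) \<diamondop> q) i))"
    unfolding l by (subst sum.swap, rule sum.cong[OF refl], subst sum.swap) (simp add: sum_distrib_left)
  also have "\<dots> = (\<Sum>i\<in>UNIV. \<Sum>r\<in>UNIV. \<Sum>t\<in>UNIV. Y (bas r) (bas t) *
      sw (bas i) (\<lambda>a b. sw (b \<diamondop> q) (\<lambda>c d. a r * c t * (f \<diamondop> d) i)))"
    unfolding tr r by (rule sym, subst sum.swap, rule sum.cong[OF refl], subst sum.swap) (simp add: sum_distrib_left)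
  also have "\<dots> = (\<Sum>i\<in>UNIV. sw (bas i) (\<lambda>a b. sw (b \<diamondop> q) (\<lambda>c d. Y a c * (f \<diamondop> d) i)))"
    by (rule sym, subst Yst) (simp only: sum_distrib_right sw_sum mult.assoc[of "Y _ _"] sw_mult_left)
  finally show ?thesis .
qed

definition lam :: "'i cv \<Rightarrow> 'i cv \<Rightarrow> complex" where
  "lam h f = trc (\<lambda>y. f \<diamondop> y \<diamondop> (k' \<diamondop> PiR h))"

lemma lin_lam0: "lin (lam h)"
  unfolding lam_def trc_def by (intro lin_sum) (simp add: lin_rules)

lemmas lin_lam [lin_rules] = lin_comp[OF lin_lam0]

text \<open>The right factor commutes with left multiplications, so cyclicity of the trace exchanges
  \<open>f\<close> and \<open>g\<close>.\<close>

lemma lam_commute: "lam h (f \<diamondop> g) = lam h (g \<diamondop> f)"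
  using trc_commute[of "\<lambda>y. f \<diamondop> y" "\<lambda>y. g \<diamondop> y \<diamondop> (k' \<diamondop> PiR h)"]
  by (simp add: lam_def mul_assoc lin_rules)

text \<open>After \<open>split_three\<close> and a rotation of the trace, the coproduct of
  \<open>y k' PiR h\<close> leaves \<open>k'\<close> on the leg under \<open>Si\<close>. Since
  \<open>Si k' = k\<close>, this creates the \<open>k\<close> of the formula, and
  \<open>Si_three\<close> cancels the extra legs of the summation variable.\<close>

lemma lam_left_integral:
  assumes X: "lin X"
  shows "sw f (\<lambda>a b. X a * lam h b) = sw one (\<lambda>a b. X (k \<diamondop> Si a) * lam h (f \<diamondop> b))"
proof -
  note [simp] = lin_rules lin_comp[OF X] X
  let ?q = "k' \<diamondop> PiR h"
  have "sw f (\<lambda>a b. X a * lam h b) = (\<Sum>i\<in>UNIV. sw f (\<lambda>a b. X a * (b \<diamondop> bas i \<diamondop> ?q) i))"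
    by (simp only: lam_def trc_def sum_distrib_left sw_sum)
  also have "\<dots> = (\<Sum>i\<in>UNIV. sw (bas i) (\<lambda>c d. sw (f \<diamondop> d) (\<lambda>a b. X (a \<diamondop> Si c) * (b \<diamondop> ?q) i)))"
    by (rule sum.cong[OF refl], rule split_three[OF X]) simp
  also have "\<dots> = (\<Sum>i\<in>UNIV. sw (bas i) (\<lambda>a b. sw (b \<diamondop> ?q) (\<lambda>c d. X (a \<diamondop> Si c) * (f \<diamondop> d) i)))"
    by (rule trace_cyclic_sw) simp_all
  also have "\<dots> = (\<Sum>i\<in>UNIV. sw one (\<lambda>a b. X (k \<diamondop> Si a) * (f \<diamondop> (b \<diamondop> bas i \<diamondop> ?q)) i))"
  proof (rule sum.cong[OF refl])
    fix i
    \<comment> \<open>Both sides are \<open>a k Si(c)\<close>, because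
      \<open>Si (Si a) = k' a k\<close>.\<close>
    have "a \<diamondop> Si (c \<diamondop> k') = k \<diamondop> Si (c \<diamondop> Si a)" for a c
      by (simp add: Si_mul Si_k' Si_Si mul_assoc)
    then have "sw (bas i) (\<lambda>a b. sw (b \<diamondop> ?q) (\<lambda>c d. X (a \<diamondop> Si c) * (f \<diamondop> d) i)) =
      sw (bas i) (\<lambda>a b. sw b (\<lambda>c d. X (k \<diamondop> Si (c \<diamondop> Si a)) * (f \<diamondop> (d \<diamondop> ?q)) i))"
      by (subst sw_mul_k'_PiR) simp_all
    also have "\<dots> = sw (bas i) (\<lambda>b d. sw b (\<lambda>a c. X (k \<diamondop> Si (c \<diamondop> Si a)) * (f \<diamondop> (d \<diamondop> ?q)) i))"
      by (rule sw_assoc[symmetric])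
    also have "\<dots> = sw one (\<lambda>a b. X (k \<diamondop> Si a) * (f \<diamondop> (b \<diamondop> bas i \<diamondop> ?q)) i)"
      by (rule Si_three) simp_all
    finally show "sw (bas i) (\<lambda>a b. sw (b \<diamondop> ?q) (\<lambda>c d. X (a \<diamondop> Si c) * (f \<diamondop> d) i)) = \<dots>" .
  qed
  also have "\<dots> = sw one (\<lambda>a b. X (k \<diamondop> Si a) * lam h (f \<diamondop> b))"
    by (simp only: lam_def trc_def sum_distrib_left sw_sum mul_assoc)
  finally show ?thesis .
qed

text \<open>By \<open>1_1 (x) f 1_2 = S(f_1) f_2 (x) f_3\<close> the first leg of \<open>g\<close>
  is completed to that of \<open>f_2 g\<close>, where \<open>lam_left_integral\<close> applies.
  Traciality and \<open>k Si(a) = S(a) k\<close> then let \<open>f\<close> absorb the remaining copy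
  of Delta(1).\<close>

theorem lam_integral:
  assumes X: "lin X"
  shows "sw g (\<lambda>a b. X a * lam h (f \<diamondop> b)) = sw f (\<lambda>a b. X (S a \<diamondop> k) * lam h (b \<diamondop> g))"
proof -
  note [simp] = lin_rules lin_comp[OF X] X
  have cyc: "lam h (r \<diamondop> g \<diamondop> b) = lam h (b \<diamondop> r \<diamondop> g)" for r b
    using lam_commute[of h "r \<diamondop> g" b] by (simp only: mul_assoc)
  have "sw g (\<lambda>a b. X a * lam h (f \<diamondop> b)) = sw (one \<diamondop> g) (\<lambda>a b. X a * lam h (f \<diamondop> b))" by simp
  also have "\<dots> = sw one (\<lambda>p q. sw g (\<lambda>a b. X (p \<diamondop> a) * lam h (f \<diamondop> q \<diamondop> b)))"
    by (subst sw_mul) (simp_all add: mul_assoc)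
  also have "\<dots> = sw f (\<lambda>c d. sw c (\<lambda>p q. sw g (\<lambda>a b. X (S p \<diamondop> q \<diamondop> a) * lam h (d \<diamondop> b))))"
    by (rule S_left_three[symmetric]) simp_all
  also have "\<dots> = sw f (\<lambda>p r. sw r (\<lambda>q d. sw g (\<lambda>a b. X (S p \<diamondop> q \<diamondop> a) * lam h (d \<diamondop> b))))"
    by (rule sw_assoc)
  also have "\<dots> = sw f (\<lambda>p r. sw (r \<diamondop> g) (\<lambda>a b. X (S p \<diamondop> a) * lam h b))"
    by (subst sw_mul) (simp_all add: mul_assoc)
  also have "\<dots> = sw f (\<lambda>p r. sw one (\<lambda>a b. X (S p \<diamondop> (k \<diamondop> Si a)) * lam h (r \<diamondop> g \<diamondop> b)))"
    by (subst lam_left_integral) simp_all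
  also have "\<dots> = sw f (\<lambda>p r. sw one (\<lambda>a b. X (S (a \<diamondop> p) \<diamondop> k) * lam h (b \<diamondop> r \<diamondop> g)))"
    by (simp only: k_Si S_mul cyc) (simp only: mul_assoc)
  also have "\<dots> = sw (one \<diamondop> f) (\<lambda>p r. X (S p \<diamondop> k) * lam h (r \<diamondop> g))"
    by (subst sw_swap, subst sw_mul) simp_all
  finally show ?thesis by simp
qed

end

section \<open>Matrix coefficients and vacuum sectors\<close>

lemma orthogonal_scalars:
  fixes x :: "'a::finite \<Rightarrow> complex"
  assumes "\<And>e e'. x e * x e' = (if e = e' then x e else 0)" "(\<Sum>e\<in>UNIV. x e) = 1"
  shows "\<exists>!e. x e = 1" "x e = 1 \<Longrightarrow> x e' = (if e' = e then 1 else 0)"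
proof -
  have idem: "x e = 0 \<or> x e = 1" for e
    using assms(1)[of e e] by simp
  have uniq: "x e' = (if e' = e then 1 else 0)" if "x e = 1" for e e'
    using assms(1)[of e e'] that by auto
  have "\<exists>e. x e \<noteq> 0"
    using assms(2) by (metis sum.neutral zero_neq_one)
  then have "\<exists>e. x e = 1" using idem by blast
  then show "\<exists>!e. x e = 1" using uniq by (metis zero_neq_one)
  show "x e = 1 \<Longrightarrow> x e' = (if e' = e then 1 else 0)" by (rule uniq)
qed

text \<open>Split semisimplicity in coordinates: \<open>p a i j\<close> are the matrix entries of
  the irreducible representation \<open>a\<close>, and \<open>E a i j\<close> are matching matrix
  units. \<open>p_mul\<close> and \<open>p_E\<close> leave the outer indices of \<open>p\<close>
  unrestricted, so entries out of range must be zero.\<close>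

locale wha_split = wha_pivotal m u c ee s D1 e2 k k'
  for m :: "'i::finite \<Rightarrow> 'i \<Rightarrow> 'i \<Rightarrow> complex" and u c ee s D1 e2 k k' +
  fixes n :: "'a::finite \<Rightarrow> nat" and p :: "'a \<Rightarrow> nat \<Rightarrow> nat \<Rightarrow> 'i cv \<Rightarrow> complex"
    and E :: "'a \<Rightarrow> nat \<Rightarrow> nat \<Rightarrow> 'i cv"
  assumes lin_p0: "lin (p a i j)"
    and p_mul: "p a i j (f \<diamondop> g) = (\<Sum>l<n a. p a i l f * p a l j g)"
    and p_one: "i < n a \<Longrightarrow> j < n a \<Longrightarrow> p a i j one = (if i = j then 1 else 0)"
    and p_E: "i < n a \<Longrightarrow> j < n a \<Longrightarrow> p b i' j' (E a i j) = (if a = b \<and> i = i' \<and> j = j' then 1 else 0)"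
    and p_ext: "(\<And>a i j. i < n a \<Longrightarrow> j < n a \<Longrightarrow> p a i j f = p a i j g) \<Longrightarrow> f = g"
    and n_pos: "n a > 0"
begin

lemmas lin_p [lin_rules] = lin_comp[OF lin_p0]

lemma expand_E: "f = (\<lambda>x. \<Sum>a\<in>UNIV. \<Sum>i<n a. \<Sum>j<n a. p a i j f * E a i j x)"
proof (rule p_ext)
  fix b k l assume kl: "k < n b" "l < n b"
  have "p b k l (\<lambda>x. \<Sum>a\<in>UNIV. \<Sum>i<n a. \<Sum>j<n a. p a i j f * E a i j x) =
    (\<Sum>a\<in>UNIV. \<Sum>i<n a. \<Sum>j<n a. p a i j f * p b k l (E a i j))"
    by (simp add: lin_sum_vec[OF lin_p0] lin_scale_vec[OF lin_p0])
  also have "\<dots> = (\<Sum>a\<in>UNIV. \<Sum>i<n a. \<Sum>j<n a. if a = b \<and> i = k \<and> j = l then p a i j f else 0)"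
    by (intro sum.cong refl) (simp add: p_E)
  also have "\<dots> = (\<Sum>a\<in>UNIV. if a = b then p b k l f else 0)"
  proof (rule sum.cong[OF refl])
    fix a
    show "(\<Sum>i<n a. \<Sum>j<n a. if a = b \<and> i = k \<and> j = l then p a i j f else 0) = (if a = b then p b k l f else 0)"
    proof (cases "a = b")
      case True
      have "(\<Sum>i<n b. \<Sum>j<n b. if i = k \<and> j = l then p b i j f else 0) =
        (\<Sum>i<n b. if i = k then p b k l f else 0)"
        using kl by (intro sum.cong refl) (auto simp: sum.delta)
      then show ?thesis unfolding True using kl by (simp add: sum.delta)
    qed simp
  qed
  finally show "p b k l f = p b k l (\<lambda>x. \<Sum>a\<in>UNIV. \<Sum>i<n a. \<Sum>j<n a. p a i j f * E a i j x)" by simp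
qed

lemma lin_expand_E:
  assumes "lin \<phi>"
  shows "\<phi> f = (\<Sum>a\<in>UNIV. \<Sum>i<n a. \<Sum>j<n a. p a i j f * \<phi> (E a i j))"
  using arg_cong[OF expand_E[of f], of \<phi>] by (simp add: lin_sum_vec[OF assms] lin_scale_vec[OF assms])

lemma p_mul_E:
  assumes "r < n a" "l < n a" "j < n b"
  shows "p b i j (f \<diamondop> E a r l) = (if a = b \<and> j = l then p b i r f else 0)"
  using assms by (auto simp: p_mul p_E if_distrib[of "\<lambda>t. _ * t"] sum.delta cong: if_cong conj_cong)

lemma p_E_mul:
  assumes "r < n a" "l < n a" "i < n b"
  shows "p b i j (E a r l \<diamondop> f) = (if a = b \<and> i = r then p b l j f else 0)"
  using assms by (auto simp: p_mul p_E if_distrib[of "\<lambda>t. t * _"] sum.delta cong: if_cong conj_cong)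

definition chi :: "'a \<Rightarrow> 'i cv \<Rightarrow> complex" where "chi a f = (\<Sum>i<n a. p a i i f)"

lemma lin_chi0: "lin (chi a)"
  unfolding chi_def by (intro lin_sum lin_p0)

lemmas lin_chi [lin_rules] = lin_comp[OF lin_chi0]

lemma chi_commute: "chi a (f \<diamondop> g) = chi a (g \<diamondop> f)"
  unfolding chi_def p_mul by (subst sum.swap) (simp add: mult.commute)

lemma chi_E: "i < n a \<Longrightarrow> j < n a \<Longrightarrow> chi b (E a i j) = (if a = b \<and> i = j then 1 else 0)"
  by (cases "a = b"; cases "i = j") (auto simp: chi_def p_E sum.delta' intro!: sum.neutral)

lemma trc_expand:
  assumes "linv T"
  shows "trc T = (\<Sum>a\<in>UNIV. \<Sum>i<n a. \<Sum>j<n a. p a i j (T (E a i j)))"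
proof -
  have T: "T x i' = (\<Sum>j\<in>UNIV. x j * T (bas j) i')" for x i'
    by (rule lin_expand[OF lin_coord[OF assms]])
  have "(\<Sum>a\<in>UNIV. \<Sum>i<n a. \<Sum>j<n a. p a i j (T (E a i j))) =
    (\<Sum>a\<in>UNIV. \<Sum>i<n a. \<Sum>j<n a. \<Sum>t\<in>UNIV. T (E a i j) t * p a i j (bas t))"
    by (intro sum.cong refl lin_expand[OF lin_p0])
  also have "\<dots> = (\<Sum>t\<in>UNIV. \<Sum>a\<in>UNIV. \<Sum>i<n a. \<Sum>j<n a. p a i j (bas t) * T (E a i j) t)"
    by (rule sym, subst sum.swap, rule sum.cong[OF refl], subst sum.swap, rule sum.cong[OF refl],
        subst sum.swap, simp add: mult.commute)
  also have "\<dots> = (\<Sum>t\<in>UNIV. T (bas t) t)"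
    by (intro sum.cong refl lin_expand_E[symmetric] lin_coord[OF assms])
  finally show ?thesis by (simp add: trc_def)
qed

text \<open>On the matrix block \<open>a\<close> the map \<open>y -> f y q\<close> is the tensor
  product of a left and a right action, so its trace is the product of the two characters.\<close>

lemma lam_chi: "lam h f = (\<Sum>a\<in>UNIV. chi a (k' \<diamondop> PiR h) * chi a f)"
proof -
  let ?q = "k' \<diamondop> PiR h"
  have "lam h f = (\<Sum>a\<in>UNIV. \<Sum>i<n a. \<Sum>j<n a. p a i j (f \<diamondop> E a i j \<diamondop> ?q))"
    unfolding lam_def by (rule trc_expand) (simp add: lin_rules)
  also have "\<dots> = (\<Sum>a\<in>UNIV. \<Sum>i<n a. \<Sum>j<n a. p a i i f * p a j j ?q)"
  proof (intro sum.cong refl)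
    fix a i j assume ij: "i \<in> {..<n a}" "j \<in> {..<n a}"
    have "p a i j (f \<diamondop> E a i j \<diamondop> ?q) = (\<Sum>l<n a. p a i l (f \<diamondop> E a i j) * p a l j ?q)"
      by (rule p_mul)
    also have "\<dots> = (\<Sum>l<n a. if l = j then p a i i f * p a j j ?q else 0)"
      using ij by (intro sum.cong refl) (auto simp: p_mul_E)
    finally show "p a i j (f \<diamondop> E a i j \<diamondop> ?q) = p a i i f * p a j j ?q"
      using ij by (simp add: sum.delta)
  qed
  also have "\<dots> = (\<Sum>a\<in>UNIV. chi a f * chi a ?q)"
    by (simp add: chi_def sum_product)
  finally show ?thesis by (simp add: mult.commute)
qed

section \<open>Block idempotents and the decomposition of the counit\<close>

definition z :: "'a \<Rightarrow> 'i cv" where "z a = (\<lambda>x. \<Sum>i<n a. E a i i x)"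

lemma p_z: "p b i j (z a) = (\<Sum>l<n a. p b i j (E a l l))"
  unfolding z_def by (rule lin_sum_vec[OF lin_p0])

lemma p_z': "i < n b \<Longrightarrow> j < n b \<Longrightarrow> p b i j (z a) = (if a = b \<and> i = j then 1 else 0)"
  unfolding p_z by (auto simp: p_E sum.delta cong: conj_cong)

lemma p_mul_z: "i < n b \<Longrightarrow> j < n b \<Longrightarrow> p b i j (f \<diamondop> z a) = (if a = b then p b i j f else 0)"
  by (auto simp: p_mul p_z' if_distrib[of "\<lambda>t. _ * t"] sum.delta cong: if_cong conj_cong)

lemma p_z_mul: "i < n b \<Longrightarrow> j < n b \<Longrightarrow> p b i j (z a \<diamondop> f) = (if a = b then p b i j f else 0)"
  by (auto simp: p_mul p_z' if_distrib[of "\<lambda>t. t * _"] sum.delta' cong: if_cong conj_cong)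

lemma z_central: "z a \<diamondop> f = f \<diamondop> z a"
  by (rule p_ext) (simp add: p_mul_z p_z_mul)

lemma z_idem: "z a \<diamondop> z a = z a"
  by (rule p_ext) (simp add: p_mul_z p_z')

lemma z_orth: "a \<noteq> b \<Longrightarrow> z a \<diamondop> z b = (\<lambda>i. 0)"
  by (rule p_ext) (auto simp: p_mul_z p_z' lin_zero_vec[OF lin_p0])

lemma sum_z: "(\<lambda>x. \<Sum>a\<in>UNIV. z a x) = one"
  by (rule p_ext) (simp add: lin_sum_vec[OF lin_p0] p_z' p_one sum.delta cong: conj_cong)

definition beta :: "'a \<Rightarrow> 'i cv \<Rightarrow> complex" where "beta a f = eps (z a \<diamondop> f)"

lemma lin_beta0: "lin (beta a)"
  unfolding beta_def by (simp add: lin_rules)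

lemmas lin_beta [lin_rules] = lin_comp[OF lin_beta0]

lemma eps_mul_z: "eps (f \<diamondop> (z a \<diamondop> g)) = beta a (f \<diamondop> g)"
  by (simp only: beta_def mul_assoc[symmetric] z_central[of a f])

lemma eps_z_mul: "eps (z a \<diamondop> f) = beta a f"
  by (simp add: beta_def)

lemma beta_z: "beta a (z a \<diamondop> f) = beta a f"
  by (simp add: beta_def mul_assoc[symmetric] z_idem)

lemma eps_beta: "eps f = (\<Sum>a\<in>UNIV. beta a f)"
proof -
  have "eps f = eps ((\<lambda>x. \<Sum>a\<in>UNIV. z a x) \<diamondop> f)" by (simp add: sum_z)
  also have "\<dots> = (\<Sum>a\<in>UNIV. eps (z a \<diamondop> f))"
    by (rule lin_sum_vec[of "\<lambda>x. eps (x \<diamondop> f)"]) (simp add: lin_rules)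
  finally show ?thesis by (simp add: beta_def)
qed

text \<open>Weak multiplicativity with \<open>z e\<close> and \<open>z e'\<close> inserted at the
  two ends: the central idempotents meet in the product and annihilate each other unless they
  agree.\<close>

lemma beta_mul3:
  "sw y (\<lambda>a b. beta e (x \<diamondop> b) * beta e' (a \<diamondop> w)) = (if e = e' then beta e (x \<diamondop> y \<diamondop> w) else 0)"
  "sw y (\<lambda>a b. beta e (x \<diamondop> a) * beta e' (b \<diamondop> w)) = (if e = e' then beta e (x \<diamondop> y \<diamondop> w) else 0)"
proof -
  have "eps (z e \<diamondop> x \<diamondop> y \<diamondop> (z e' \<diamondop> w)) = (if e = e' then beta e (x \<diamondop> y \<diamondop> w) else 0)"
  proof -
    have "eps (z e \<diamondop> x \<diamondop> y \<diamondop> (z e' \<diamondop> w)) = eps (z e' \<diamondop> z e \<diamondop> (x \<diamondop> y \<diamondop> w))"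
      unfolding eps_mul_z beta_def by (simp only: mul_assoc)
    also have "\<dots> = (if e = e' then beta e (x \<diamondop> y \<diamondop> w) else 0)"
      using lin_zero_vec[of "\<lambda>f. eps (f \<diamondop> (x \<diamondop> y \<diamondop> w))"] by (simp add: z_idem z_orth beta_def lin_rules)
    finally show ?thesis .
  qed
  note * = this[symmetric]
  show "sw y (\<lambda>a b. beta e (x \<diamondop> b) * beta e' (a \<diamondop> w)) = (if e = e' then beta e (x \<diamondop> y \<diamondop> w) else 0)"
    unfolding * eps_mul3(1)[of "z e \<diamondop> x" y "z e' \<diamondop> w"] by (simp add: eps_mul_z mul_assoc eps_z_mul)
  show "sw y (\<lambda>a b. beta e (x \<diamondop> a) * beta e' (b \<diamondop> w)) = (if e = e' then beta e (x \<diamondop> y \<diamondop> w) else 0)"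
    unfolding * eps_mul3(2)[of "z e \<diamondop> x" y "z e' \<diamondop> w"] by (simp add: eps_mul_z mul_assoc eps_z_mul)
qed

lemma beta_absorb1: "lin \<phi> \<Longrightarrow> sw f (\<lambda>a b. \<phi> a * beta e (b \<diamondop> y)) = sw one (\<lambda>a b. \<phi> (f \<diamondop> a) * beta e (b \<diamondop> y))"
  using counit_absorb1[of \<phi> f "z e \<diamondop> y"] by (simp add: eps_mul_z)

lemma beta_absorb2: "lin \<phi> \<Longrightarrow> sw f (\<lambda>a b. \<phi> a * beta e (y \<diamondop> b)) = sw one (\<lambda>a b. \<phi> (a \<diamondop> f) * beta e (y \<diamondop> b))"
  using counit_absorb2[of \<phi> f "z e \<diamondop> y"] by (simp add: mul_assoc eps_z_mul)

lemma beta_absorb3: "lin \<phi> \<Longrightarrow> sw f (\<lambda>a b. beta e (a \<diamondop> y) * \<phi> b) = sw one (\<lambda>a b. beta e (a \<diamondop> y) * \<phi> (f \<diamondop> b))"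
  using counit_absorb3[of \<phi> f "z e \<diamondop> y"] by (simp add: eps_mul_z)

lemma beta_absorb4: "lin \<phi> \<Longrightarrow> sw f (\<lambda>a b. beta e (y \<diamondop> a) * \<phi> b) = sw one (\<lambda>a b. beta e (y \<diamondop> a) * \<phi> (b \<diamondop> f))"
  using counit_absorb4[of \<phi> f "z e \<diamondop> y"] by (simp add: mul_assoc eps_z_mul)

text \<open>The central idempotents that cut out the irreducible classes with a given left,
  respectively right, vacuum.\<close>

definition xe :: "'a \<Rightarrow> 'i cv" where "xe e = (\<lambda>j. sw one (\<lambda>a b. beta e a * b j))"

definition ye :: "'a \<Rightarrow> 'i cv" where "ye e = (\<lambda>j. sw one (\<lambda>a b. beta e b * a j))"

lemma lin_xe:
  assumes "lin \<phi>" shows "\<phi> (xe e) = sw one (\<lambda>a b. beta e a * \<phi> b)"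
  unfolding xe_def by (simp add: lin_sw_out[OF assms, of one "\<lambda>a b j. beta e a * b j"] lin_scale_vec[OF assms])

lemma lin_ye:
  assumes "lin \<phi>" shows "\<phi> (ye e) = sw one (\<lambda>a b. \<phi> a * beta e b)"
  unfolding ye_def
  by (simp add: lin_sw_out[OF assms, of one "\<lambda>a b j. beta e b * a j"] lin_scale_vec[OF assms]) (simp add: mult.commute)

lemma sw_xe:
  assumes \<phi>: "lin \<phi>"
  shows "sw f (\<lambda>a b. beta e a * \<phi> b) = \<phi> (f \<diamondop> xe e)" "sw f (\<lambda>a b. beta e a * \<phi> b) = \<phi> (xe e \<diamondop> f)"
  using beta_absorb3[OF \<phi>, of f e one] beta_absorb4[OF \<phi>, of f e one]
  by (simp_all add: lin_xe[of "\<lambda>z. \<phi> (f \<diamondop> z)"] lin_xe[of "\<lambda>z. \<phi> (z \<diamondop> f)"] lin_rules lin_comp[OF \<phi>])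

lemma sw_ye:
  assumes \<phi>: "lin \<phi>"
  shows "sw f (\<lambda>a b. \<phi> a * beta e b) = \<phi> (f \<diamondop> ye e)" "sw f (\<lambda>a b. \<phi> a * beta e b) = \<phi> (ye e \<diamondop> f)"
  using beta_absorb1[OF \<phi>, of f e one] beta_absorb2[OF \<phi>, of f e one]
  by (simp_all add: lin_ye[of "\<lambda>z. \<phi> (f \<diamondop> z)"] lin_ye[of "\<lambda>z. \<phi> (z \<diamondop> f)"] lin_rules lin_comp[OF \<phi>])

text \<open>The same Sweedler sum of \<open>beta e f_1\<close> times \<open>f_2\<close> is evaluated
  by \<open>sw_xe\<close> once from each side.\<close>

lemma xe_central: "xe e \<diamondop> f = f \<diamondop> xe e"
  by (rule cv_eqI) (metis sw_xe)

lemma ye_central: "ye e \<diamondop> f = f \<diamondop> ye e"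
  by (rule cv_eqI) (metis sw_ye)

lemma xe_mul: "xe e \<diamondop> xe e' = (if e = e' then xe e else (\<lambda>i. 0))"
proof (rule cv_eqI)
  fix \<phi> :: "'i cv \<Rightarrow> complex" assume \<phi>: "lin \<phi>"
  note [simp] = lin_rules lin_comp[OF \<phi>] \<phi>
  have "\<phi> (xe e \<diamondop> xe e') = sw (xe e) (\<lambda>a b. beta e' a * \<phi> b)" by (rule sw_xe(1)[OF \<phi>, symmetric])
  also have "\<dots> = sw one (\<lambda>a b. sw b (\<lambda>c d. beta e a * (beta e' c * \<phi> d)))"
    by (subst lin_xe[of "\<lambda>f. sw f _"]) (simp_all add: sw_mult_left)
  also have "\<dots> = sw one (\<lambda>a d. sw a (\<lambda>b c. beta e (one \<diamondop> b) * beta e' (c \<diamondop> one)) * \<phi> d)"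
    by (subst sw_assoc[symmetric]) (simp add: sw_mult_right[symmetric] mult.assoc)
  also have "\<dots> = \<phi> (if e = e' then xe e else (\<lambda>i. 0))"
    unfolding beta_mul3(2) using lin_zero_vec[OF \<phi>] by (simp add: lin_xe sw_mult_left[of _ 0, simplified])
  finally show "\<phi> (xe e \<diamondop> xe e') = \<phi> (if e = e' then xe e else (\<lambda>i. 0))" .
qed

lemma ye_mul: "ye e \<diamondop> ye e' = (if e = e' then ye e else (\<lambda>i. 0))"
proof (rule cv_eqI)
  fix \<phi> :: "'i cv \<Rightarrow> complex" assume \<phi>: "lin \<phi>"
  note [simp] = lin_rules lin_comp[OF \<phi>] \<phi>
  have "\<phi> (ye e \<diamondop> ye e') = sw (ye e) (\<lambda>a b. \<phi> a * beta e' b)" by (rule sw_ye(1)[OF \<phi>, symmetric])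
  also have "\<dots> = sw one (\<lambda>a b. sw a (\<lambda>c d. \<phi> c * beta e' d * beta e b))"
    by (subst lin_ye[of "\<lambda>f. sw f _"]) (simp_all add: sw_mult_right)
  also have "\<dots> = sw one (\<lambda>c b. \<phi> c * sw b (\<lambda>d b. beta e' (one \<diamondop> d) * beta e (b \<diamondop> one)))"
    by (subst sw_assoc) (simp add: sw_mult_left[symmetric] mult.assoc)
  also have "\<dots> = \<phi> (if e = e' then ye e else (\<lambda>i. 0))"
    unfolding beta_mul3(2) using lin_zero_vec[OF \<phi>] by (simp add: lin_ye sw_mult_left[of _ 0, simplified])
  finally show "\<phi> (ye e \<diamondop> ye e') = \<phi> (if e = e' then ye e else (\<lambda>i. 0))" .
qed

lemma sum_xe: "(\<lambda>x. \<Sum>e\<in>UNIV. xe e x) = one"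
proof (rule cv_eqI)
  fix \<phi> :: "'i cv \<Rightarrow> complex" assume \<phi>: "lin \<phi>"
  show "\<phi> (\<lambda>x. \<Sum>e\<in>UNIV. xe e x) = \<phi> one"
    by (simp add: lin_sum_vec[OF \<phi>] lin_xe[OF \<phi>] sw_sum[symmetric] sum_distrib_right[symmetric]
        eps_beta[symmetric] sw_counit1[OF \<phi>])
qed

lemma sum_ye: "(\<lambda>x. \<Sum>e\<in>UNIV. ye e x) = one"
proof (rule cv_eqI)
  fix \<phi> :: "'i cv \<Rightarrow> complex" assume \<phi>: "lin \<phi>"
  show "\<phi> (\<lambda>x. \<Sum>e\<in>UNIV. ye e x) = \<phi> one"
    by (simp add: lin_sum_vec[OF \<phi>] lin_ye[OF \<phi>] sw_sum[symmetric] sum_distrib_left[symmetric]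
        eps_beta[symmetric] sw_counit2[OF \<phi>])
qed

text \<open>Commutation with the matrix units kills the off-diagonal entries and equates the
  diagonal ones.\<close>

lemma central_scalar:
  assumes "\<And>g. f \<diamondop> g = g \<diamondop> f" "i < n a" "j < n a"
  shows "p a i j f = (if i = j then p a 0 0 f else 0)"
proof -
  have *: "(if j' = l then p a i' k f else 0) = (if i' = k then p a l j' f else 0)"
    if "i' < n a" "j' < n a" "k < n a" "l < n a" for i' j' k l
    using arg_cong[OF assms(1)[of "E a k l"], of "p a i' j'"] that by (simp add: p_mul_E p_E_mul)
  show ?thesis
    using *[of i j j j] *[of i 0 i 0] assms(2,3) n_pos[of a] by (auto split: if_splits)
qed

text \<open>On an irreducible block orthogonal central idempotents act by scalars 0 or 1; as they
  sum to the unit, exactly one of them acts by 1.\<close>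

lemma central_family:
  fixes w :: "'a \<Rightarrow> 'i cv"
  assumes "\<And>e f. w e \<diamondop> f = f \<diamondop> w e" "\<And>e e'. w e \<diamondop> w e' = (if e = e' then w e else (\<lambda>i. 0))"
    "(\<lambda>x. \<Sum>e\<in>UNIV. w e x) = one"
  shows "\<exists>!e. p a 0 0 (w e) = 1"
    "p a 0 0 (w e) = 1 \<Longrightarrow> i < n a \<Longrightarrow> j < n a \<Longrightarrow> p a i j (f \<diamondop> w e') = (if e' = e then p a i j f else 0)"
proof -
  let ?x = "\<lambda>e. p a 0 0 (w e)"
  have sc: "p a i j (w e) = (if i = j then ?x e else 0)" if "i < n a" "j < n a" for i j e
    using central_scalar[OF assms(1) that] .
  have pf: "p a i j (f \<diamondop> w e) = p a i j f * ?x e" if "i < n a" "j < n a" for i j e f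
  proof -
    have "p a i j (f \<diamondop> w e) = (\<Sum>l<n a. if l = j then p a i l f * ?x e else 0)"
      unfolding p_mul using that by (intro sum.cong refl) (subst sc, auto)
    then show ?thesis using that by simp
  qed
  have 1: "?x e * ?x e' = (if e = e' then ?x e else 0)" for e e'
    using pf[of 0 0 "w e" e'] n_pos[of a] by (simp add: assms(2) lin_zero_vec[OF lin_p0] split: if_splits)
  have 2: "(\<Sum>e\<in>UNIV. ?x e) = 1"
    using arg_cong[OF assms(3), of "p a 0 0"] n_pos[of a] by (simp add: lin_sum_vec[OF lin_p0] p_one)
  show "\<exists>!e. ?x e = 1"
    using orthogonal_scalars(1)[of ?x, OF 1 2] .
  show "p a i j (f \<diamondop> w e') = (if e' = e then p a i j f else 0)" if "?x e = 1" "i < n a" "j < n a"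
    using orthogonal_scalars(2)[of ?x, OF 1 2 that(1), of e'] that by (simp add: pf)
qed

text \<open>Label of the idempotent that acts as 1 on block \<open>a\<close>. Its agreement with the
  label defined by fusion multiplicities is \<open>lidx_ll\<close>; \<open>ridx_rr\<close> does the
  same for \<open>rr\<close>.\<close>

definition ll :: "'a \<Rightarrow> 'a" where "ll a = (THE e. p a 0 0 (xe e) = 1)"

definition rr :: "'a \<Rightarrow> 'a" where "rr a = (THE e. p a 0 0 (ye e) = 1)"

lemma p_mul_xe: "i < n a \<Longrightarrow> j < n a \<Longrightarrow> p a i j (f \<diamondop> xe e) = (if e = ll a then p a i j f else 0)"
  using central_family(2)[of xe, OF xe_central xe_mul sum_xe, of a "ll a" i j f e]
    theI'[OF central_family(1)[of xe, OF xe_central xe_mul sum_xe, of a]]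
  unfolding ll_def[symmetric] by simp

lemma p_mul_ye: "i < n a \<Longrightarrow> j < n a \<Longrightarrow> p a i j (f \<diamondop> ye e) = (if e = rr a then p a i j f else 0)"
  using central_family(2)[of ye, OF ye_central ye_mul sum_ye, of a "rr a" i j f e]
    theI'[OF central_family(1)[of ye, OF ye_central ye_mul sum_ye, of a]]
  unfolding rr_def[symmetric] by simp

lemma chi_mul_xe: "chi a (f \<diamondop> xe e) = (if e = ll a then chi a f else 0)"
  unfolding chi_def by (auto simp: p_mul_xe)

lemma beta_ll_nonzero: "\<exists>f. beta (ll a) f \<noteq> 0"
proof (rule ccontr)
  assume "\<not> ?thesis"
  then have "p a 0 0 (one \<diamondop> xe (ll a)) = 0"
    by (simp add: lin_xe[OF lin_p0] sw_mult_left[of _ 0, simplified])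
  then show False using n_pos[of a] p_mul_xe[of 0 a 0 one "ll a"] by (simp add: p_one)
qed

lemma beta_rr_nonzero: "\<exists>f. beta (rr a) f \<noteq> 0"
proof (rule ccontr)
  assume "\<not> ?thesis"
  then have "p a 0 0 (one \<diamondop> ye (rr a)) = 0"
    by (simp add: lin_ye[OF lin_p0] sw_mult_left[of _ 0, simplified])
  then show False using n_pos[of a] p_mul_ye[of 0 a 0 one "rr a"] by (simp add: p_one)
qed

text \<open>Weak multiplicativity reproduces \<open>beta e\<close>: a second factor
  \<open>beta e\<close> can be split off \<open>beta e (1_1 w)\<close>, and on the other leg it acts
  as the idempotent \<open>xe e\<close>.\<close>

lemma xe_insert:
  assumes \<phi>: "lin \<phi>"
  shows "sw one (\<lambda>a b. beta e (a \<diamondop> w) * \<phi> b) = sw one (\<lambda>a b. beta e (a \<diamondop> w) * \<phi> (b \<diamondop> xe e))"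
proof -
  have "sw one (\<lambda>a b. beta e (a \<diamondop> w) * \<phi> (b \<diamondop> xe e)) = sw one (\<lambda>a b. sw b (\<lambda>c d. beta e (a \<diamondop> w) * (beta e c * \<phi> d)))"
    by (simp add: sw_xe(1)[OF \<phi>, symmetric] sw_mult_left)
  also have "\<dots> = sw one (\<lambda>a d. sw a (\<lambda>b c. beta e (one \<diamondop> c) * beta e (b \<diamondop> w)) * \<phi> d)"
    by (subst sw_assoc[symmetric]) (simp add: sw_mult_left[symmetric] mult_ac)
  finally show ?thesis unfolding beta_mul3(1) by simp
qed

lemma ye_insert:
  assumes \<phi>: "lin \<phi>"
  shows "sw one (\<lambda>a b. \<phi> a * beta e (b \<diamondop> w)) = sw one (\<lambda>a b. \<phi> (a \<diamondop> ye e) * beta e (b \<diamondop> w))"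
proof -
  have "sw one (\<lambda>a b. \<phi> (a \<diamondop> ye e) * beta e (b \<diamondop> w)) = sw one (\<lambda>a b. sw a (\<lambda>c d. \<phi> c * beta e d * beta e (b \<diamondop> w)))"
    by (simp add: sw_ye(1)[OF \<phi>, symmetric] sw_mult_right)
  also have "\<dots> = sw one (\<lambda>c b. \<phi> c * sw b (\<lambda>d b. beta e (one \<diamondop> d) * beta e (b \<diamondop> w)))"
    by (subst sw_assoc) (simp add: sw_mult_left[symmetric] mult_ac)
  finally show ?thesis unfolding beta_mul3(2) by simp
qed

text \<open>A nonzero \<open>beta e\<close> is nonzero on some matrix unit \<open>E e r t\<close>;
  sandwiching \<open>f\<close> between \<open>E e r i\<close> and \<open>E e j t\<close> recovers an
  entry of \<open>f\<close> up to that value. Statements about \<open>beta e\<close> thus extend to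
  the whole block.\<close>

lemma p_beta:
  assumes "\<exists>f. beta e f \<noteq> 0"
  obtains r t x where "r < n e" "t < n e" "x \<noteq> 0"
    "\<And>i j f. i < n e \<Longrightarrow> j < n e \<Longrightarrow> x * p e i j f = beta e (E e r i \<diamondop> f \<diamondop> E e j t)"
proof -
  have bE: "beta e (E a i j) = 0" if "a \<noteq> e" "i < n a" "j < n a" for a i j
  proof -
    have "z e \<diamondop> E a i j = (\<lambda>x. 0)"
      by (rule p_ext) (use that in \<open>auto simp: p_z_mul p_E lin_zero_vec[OF lin_p0]\<close>)
    then show ?thesis using lin_zero_vec[OF lin_eps0] by (simp add: beta_def)
  qed
  obtain f where "beta e f \<noteq> 0" using assms by blast
  moreover have "beta e f = (\<Sum>a\<in>UNIV. \<Sum>i<n a. \<Sum>j<n a. p a i j f * beta e (E a i j))"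
    by (rule lin_expand_E[OF lin_beta0])
  moreover have "\<dots> = 0" if "\<And>r t. r < n e \<Longrightarrow> t < n e \<Longrightarrow> beta e (E e r t) = 0"
  proof (intro sum.neutral ballI)
    fix a i j assume "i \<in> {..<n a}" "j \<in> {..<n a}"
    then show "p a i j f * beta e (E a i j) = 0" using that bE by (cases "a = e") auto
  qed
  ultimately obtain r t where rt: "r < n e" "t < n e" "beta e (E e r t) \<noteq> 0" by metis
  have "beta e (E e r t) * p e i j f = beta e (E e r i \<diamondop> f \<diamondop> E e j t)" if ij: "i < n e" "j < n e" for i j f
  proof -
    have "E e r i \<diamondop> f \<diamondop> E e j t = (\<lambda>x. p e i j f * E e r t x)"
    proof (rule p_ext)
      fix a i' j' assume i'j': "i' < n a" "j' < n a"
      show "p a i' j' (E e r i \<diamondop> f \<diamondop> E e j t) = p a i' j' (\<lambda>x. p e i j f * E e r t x)"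
        using ij i'j' rt by (auto simp: p_mul_E p_E_mul p_E lin_scale_vec[OF lin_p0])
    qed
    then show ?thesis by (simp add: lin_scale_vec[OF lin_beta0])
  qed
  then show thesis using that rt by blast
qed

text \<open>By \<open>p_beta\<close> the entry on the first leg becomes a value of
  \<open>beta e\<close>. This forces \<open>xe e\<close> onto the second leg, where it acts as zero
  for the wrong vacuum. Hence Delta(1) acts as zero on \<open>W_e (x) W_a\<close>.\<close>

lemma unit_fusion_left_zero:
  assumes "e \<noteq> ll a" "\<exists>f. beta e f \<noteq> 0" "i < n e" "j < n e" "i' < n a" "j' < n a"
  shows "sw one (\<lambda>x y. p e i j x * p a i' j' y) = 0"
proof -
  note [simp] = lin_rules
  obtain r t x where x: "r < n e" "t < n e" "x \<noteq> 0"
    "\<And>i j f. i < n e \<Longrightarrow> j < n e \<Longrightarrow> x * p e i j f = beta e (E e r i \<diamondop> f \<diamondop> E e j t)"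
    using p_beta[OF assms(2)] by metis
  let ?\<phi> = "p a i' j'"
  have "sw one (\<lambda>c d. beta e (X \<diamondop> c \<diamondop> w) * ?\<phi> d) = 0" for X w
  proof -
    have "sw one (\<lambda>c d. beta e (X \<diamondop> c \<diamondop> w) * ?\<phi> d) =
      sw one (\<lambda>c d. sw c (\<lambda>f g. beta e (X \<diamondop> g) * beta e (f \<diamondop> w) * ?\<phi> d))"
      by (simp add: sw_mult_right beta_mul3(1))
    also have "\<dots> = sw one (\<lambda>f b. beta e (f \<diamondop> w) * sw b (\<lambda>g d. beta e (X \<diamondop> g) * ?\<phi> d))"
      by (subst sw_assoc) (simp add: sw_mult_left[symmetric] mult_ac)
    also have "\<dots> = sw one (\<lambda>f b. beta e (f \<diamondop> w) * sw one (\<lambda>g d. beta e (X \<diamondop> g) * ?\<phi> (d \<diamondop> b)))"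
      by (subst beta_absorb4[OF lin_p0]) simp
    also have "\<dots> = sw one (\<lambda>f b. beta e (f \<diamondop> w) * sw one (\<lambda>g d. beta e (X \<diamondop> g) * ?\<phi> (d \<diamondop> (b \<diamondop> xe e))))"
      by (rule xe_insert) simp
    also have "\<dots> = 0"
      using assms by (simp add: mul_assoc[symmetric] p_mul_xe sw_mult_left[of _ 0, simplified])
    finally show ?thesis .
  qed
  then have "sw one (\<lambda>c d. x * p e i j c * ?\<phi> d) = 0"
    using assms by (simp add: x(4))
  then show ?thesis using x(3) by (simp add: mult.assoc sw_mult_left)
qed

lemma unit_fusion_right_zero:
  assumes "e \<noteq> rr a" "\<exists>f. beta e f \<noteq> 0" "i < n e" "j < n e" "i' < n a" "j' < n a"
  shows "sw one (\<lambda>x y. p a i' j' x * p e i j y) = 0"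
proof -
  note [simp] = lin_rules
  obtain r t x where x: "r < n e" "t < n e" "x \<noteq> 0"
    "\<And>i j f. i < n e \<Longrightarrow> j < n e \<Longrightarrow> x * p e i j f = beta e (E e r i \<diamondop> f \<diamondop> E e j t)"
    using p_beta[OF assms(2)] by metis
  let ?\<phi> = "p a i' j'"
  have "sw one (\<lambda>d c. ?\<phi> d * beta e (X \<diamondop> c \<diamondop> w)) = 0" for X w
  proof -
    have "sw one (\<lambda>d c. ?\<phi> d * beta e (X \<diamondop> c \<diamondop> w)) =
      sw one (\<lambda>d c. sw c (\<lambda>f g. ?\<phi> d * (beta e (X \<diamondop> g) * beta e (f \<diamondop> w))))"
      by (simp add: sw_mult_left beta_mul3(1))
    also have "\<dots> = sw one (\<lambda>b g. beta e (X \<diamondop> g) * sw b (\<lambda>d f. ?\<phi> d * beta e (f \<diamondop> w)))"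
      by (subst sw_assoc[symmetric]) (simp add: sw_mult_left[symmetric] mult_ac)
    also have "\<dots> = sw one (\<lambda>b g. beta e (X \<diamondop> g) * sw one (\<lambda>d f. ?\<phi> (b \<diamondop> d) * beta e (f \<diamondop> w)))"
      by (subst beta_absorb1[OF lin_p0]) simp
    also have "\<dots> = sw one (\<lambda>b g. beta e (X \<diamondop> g) * sw one (\<lambda>d f. ?\<phi> (b \<diamondop> (d \<diamondop> ye e)) * beta e (f \<diamondop> w)))"
      by (subst ye_insert[of "\<lambda>z. ?\<phi> (_ \<diamondop> z)"]) simp_all
    also have "\<dots> = 0"
      using assms by (simp add: mul_assoc[symmetric] p_mul_ye sw_mult_left[of _ 0, simplified])
    finally show ?thesis .
  qed
  then have "sw one (\<lambda>d c. ?\<phi> d * (x * p e i j c)) = 0"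
    using assms by (simp add: x(4))
  then show ?thesis using x(3) by (simp add: mult.left_commute sw_mult_left)
qed

end

section \<open>Fusion rules and positivity\<close>

text \<open>\<open>del a\<close> stands for \<open>d\<^sub>a / \<xi>\<^sub>a\<close>, so \<open>del a * del (bar a)\<close> is \<open>d\<^sub>a\<^sup>2\<close>.\<close>

locale wha_fusion = wha_split m u cc ee s D1 e2 k k' n p E
  for m :: "'i::finite \<Rightarrow> 'i \<Rightarrow> 'i \<Rightarrow> complex" and u cc ee s D1 e2 k k'
    and n :: "'a::finite \<Rightarrow> nat" and p E +
  fixes bar :: "'a \<Rightarrow> 'a" and del :: "'a \<Rightarrow> complex" and N :: "'a \<Rightarrow> 'a \<Rightarrow> 'a \<Rightarrow> nat"
    and ue ve :: "'a \<Rightarrow> nat \<Rightarrow> complex"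
  assumes sw_S: "\<lbrakk>\<And>b. lin (\<lambda>a. F a b); \<And>a. lin (F a)\<rbrakk> \<Longrightarrow> sw (S f) F = sw f (\<lambda>a b. F (S b) (S a))"
    and chi_S: "chi a (S f) = chi (bar a) f"
    and bar_bar: "bar (bar a) = a"
    and p_S_z: "b \<noteq> bar a \<Longrightarrow> i < n a \<Longrightarrow> j < n a \<Longrightarrow> p a i j (S (z b)) = 0"
    and chi_chi: "sw f (\<lambda>x y. chi a x * chi b y) = (\<Sum>c\<in>UNIV. of_nat (N a b c) * chi c f)"
    and beta_rank1: "\<exists>f. beta e f \<noteq> 0 \<Longrightarrow> beta e f = (\<Sum>i<n e. \<Sum>j<n e. ue e i * p e i j f * ve e j)"
    and chi_k'_PiR: "chi a (k' \<diamondop> PiR f) = del a * beta (rr a) f"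
    and chi_k_PiL: "chi a (k \<diamondop> PiL f) = del (bar a) * beta (rr (bar a)) f"
    and del_nonzero: "del a \<noteq> 0"
begin

text \<open>By \<open>chi_k_PiL\<close> the functional \<open>f -> chi a (k PiL f)\<close> is a
  nonzero multiple of the counit part at \<open>rr (bar a)\<close>. By \<open>xe_insert\<close>,
  \<open>PiL\<close> carries that vacuum block under the idempotent \<open>xe\<close> of the same
  label, and \<open>chi a\<close> only sees the one for \<open>ll a\<close>.\<close>

lemma rr_bar: "rr (bar a) = ll a"
proof (rule ccontr)
  note [simp] = lin_rules
  let ?e = "rr (bar a)"
  assume ne: "?e \<noteq> ll a"
  obtain f where f: "beta ?e f \<noteq> 0" using beta_rr_nonzero by blast
  have "chi a (k \<diamondop> PiL (z ?e \<diamondop> f)) = sw one (\<lambda>x y. beta ?e (x \<diamondop> f) * chi a (k \<diamondop> y))"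
    by (subst lin_PiL(2)[of "\<lambda>z. chi a (k \<diamondop> z)"]) (simp_all add: eps_mul_z)
  also have "\<dots> = sw one (\<lambda>x y. beta ?e (x \<diamondop> f) * chi a (k \<diamondop> (y \<diamondop> xe ?e)))"
    by (rule xe_insert) simp
  also have "\<dots> = 0"
    using ne by (simp add: mul_assoc[symmetric] chi_mul_xe sw_mult_left[of _ 0, simplified])
  finally show False using f del_nonzero by (simp add: chi_k_PiL beta_z)
qed

lemma ll_bar: "ll (bar a) = rr a"
  using rr_bar[of "bar a"] by (simp add: bar_bar)

lemma lam_del: "lam h f = (\<Sum>a\<in>UNIV. del a * beta (rr a) h * chi a f)"
  by (simp add: lam_chi chi_k'_PiR)

lemma beta_z_other: "e \<noteq> e' \<Longrightarrow> beta e (z e' \<diamondop> f) = 0"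
  using lin_zero_vec[of "\<lambda>x. eps (x \<diamondop> f)"] by (simp add: beta_def mul_assoc[symmetric] z_orth lin_rules)

text \<open>\<open>beta e\<close> depends only on the block \<open>e\<close>, so a witness in each
  block can be rescaled independently.\<close>

lemma exists_beta_values: "\<exists>h. \<forall>a. beta (rr a) h = w (rr a)"
proof -
  \<comment> \<open>Where \<open>beta e\<close> is zero the choice is arbitrary; such labels are
    never of the form \<open>rr a\<close>.\<close>
  define g where "g e = (SOME f. beta e f \<noteq> 0)" for e
  have g: "beta (rr a) (g (rr a)) \<noteq> 0" for a
    unfolding g_def by (rule someI_ex[OF beta_rr_nonzero])
  let ?h = "\<lambda>x. \<Sum>e\<in>UNIV. (w e / beta e (g e)) * (z e \<diamondop> g e) x"
  have "beta (rr a) ?h = w (rr a)" for a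
  proof -
    have "beta (rr a) ?h = (\<Sum>e\<in>UNIV. (w e / beta e (g e)) * beta (rr a) (z e \<diamondop> g e))"
      by (rule lin_sum_scale_vec[OF lin_beta0])
    also have "\<dots> = (\<Sum>e\<in>UNIV. if e = rr a then w e else 0)"
      using g[of a] by (intro sum.cong refl) (auto simp: beta_z beta_z_other)
    finally show ?thesis by simp
  qed
  then show ?thesis by blast
qed

text \<open>Pulling through with \<open>f = 1\<close> moves \<open>chi a\<close> onto
  \<open>k S(1_1)\<close>. There \<open>S(1_1)\<close> may be replaced by \<open>PiL(1_1)\<close>,
  whose character is \<open>del (bar a)\<close> times a value of \<open>beta\<close>, and the
  remaining sum over Delta(1) is the idempotent \<open>xe (ll a)\<close>.\<close>

lemma chi_lam:
  "sw g (\<lambda>x y. chi a x * lam h y) =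
    del (bar a) * (\<Sum>b\<in>UNIV. del b * beta (rr b) h * (if ll b = ll a then chi b g else 0))"
proof -
  note [simp] = lin_rules
  have "sw g (\<lambda>x y. chi a x * lam h y) = sw one (\<lambda>x y. chi a (k \<diamondop> S x) * lam h (y \<diamondop> g))"
    using lam_integral[OF lin_chi0, of g a h one] by (simp add: chi_commute[of a "S _"])
  also have "\<dots> = sw one (\<lambda>x y. chi a (k \<diamondop> PiL x) * lam h (y \<diamondop> g))"
    by (rule PiL_one_S[symmetric]) simp_all
  also have "\<dots> = del (bar a) * sw one (\<lambda>x y. beta (ll a) x * lam h (y \<diamondop> g))"
    by (simp add: chi_k_PiL rr_bar mult.assoc sw_mult_left)
  also have "\<dots> = del (bar a) * lam h (xe (ll a) \<diamondop> g)"
    by (subst lin_xe[of "\<lambda>z. lam h (z \<diamondop> g)"]) simp_all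
  also have "\<dots> = del (bar a) * (\<Sum>b\<in>UNIV. del b * beta (rr b) h * (if ll b = ll a then chi b g else 0))"
    by (simp add: lam_del xe_central chi_mul_xe eq_commute[of "ll a"])
  finally show ?thesis .
qed

lemma chi_coeff: "(\<Sum>a\<in>UNIV. x a * chi a (E b 0 0)) = x b"
  using n_pos[of b] by (simp add: chi_E sum_delta_mult)

text \<open>For an \<open>h\<close> with all values \<open>beta (rr a) h\<close> equal to 1,
  \<open>lam h\<close> is the sum of the \<open>del a\<close> times \<open>chi a\<close>.
  Coefficients of characters in \<open>chi_lam\<close> and in the fusion rule are compared on matrix
  units.\<close>

lemma fusion_del: "(\<Sum>a\<in>UNIV. of_nat (N c a b) * del a) = (if ll b = ll c then del (bar c) * del b else 0)"
proof -
  obtain h where h: "beta (rr a) h = 1" for a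
    using exists_beta_values[of "\<lambda>_. 1"] by blast
  have "sw g (\<lambda>x y. chi c x * lam h y) = (\<Sum>b\<in>UNIV. (\<Sum>a\<in>UNIV. of_nat (N c a b) * del a) * chi b g)" for g
  proof -
    have "sw g (\<lambda>x y. chi c x * lam h y) = (\<Sum>a\<in>UNIV. del a * sw g (\<lambda>x y. chi c x * chi a y))"
      by (simp add: lam_del h sum_distrib_left mult.left_commute[of "chi _ _"] sw_sum sw_mult_left)
    also have "\<dots> = (\<Sum>a\<in>UNIV. \<Sum>b\<in>UNIV. of_nat (N c a b) * del a * chi b g)"
      by (simp add: chi_chi sum_distrib_left) (simp add: mult_ac)
    also have "\<dots> = (\<Sum>b\<in>UNIV. (\<Sum>a\<in>UNIV. of_nat (N c a b) * del a) * chi b g)"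
      by (subst sum.swap) (simp add: sum_distrib_right)
    finally show ?thesis .
  qed
  moreover have "sw g (\<lambda>x y. chi c x * lam h y) = (\<Sum>b\<in>UNIV. (if ll b = ll c then del (bar c) * del b else 0) * chi b g)" for g
    unfolding chi_lam h sum_distrib_left by (intro sum.cong refl) simp
  ultimately have "(\<Sum>b\<in>UNIV. (\<Sum>a\<in>UNIV. of_nat (N c a b) * del a) * chi b (E b' 0 0)) =
    (\<Sum>b\<in>UNIV. (if ll b = ll c then del (bar c) * del b else 0) * chi b (E b' 0 0))" for b'
    by metis
  then show ?thesis unfolding chi_coeff .
qed

lemma bar_eq_iff: "bar a = b \<longleftrightarrow> a = bar b"
  using bar_bar by metis

lemma sum_bar: "(\<Sum>a\<in>UNIV. f (bar a)) = (\<Sum>a\<in>UNIV. f a)"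
  by (rule sum.reindex_bij_witness[where i = bar and j = bar]) (auto simp: bar_bar)

text \<open>The antipode reverses coproducts and carries \<open>chi a\<close> to
  \<open>chi (bar a)\<close>; the fusion rule on \<open>S f\<close> is read in both ways.\<close>

lemma N_reflect: "N a b d = N (bar b) (bar a) (bar d)"
proof -
  note [simp] = lin_rules
  have "sw (S f) (\<lambda>x y. chi a x * chi b y) = sw f (\<lambda>x y. chi (bar b) x * chi (bar a) y)" for f
    by (subst sw_S) (simp_all add: chi_S mult.commute)
  then have "(\<Sum>c\<in>UNIV. of_nat (N a b c) * chi (bar c) f) = (\<Sum>c\<in>UNIV. of_nat (N (bar b) (bar a) c) * chi c f)" for f
    by (simp add: chi_chi chi_S)
  moreover have "(\<Sum>c\<in>UNIV. of_nat (N a b c) * chi (bar c) f) = (\<Sum>c\<in>UNIV. of_nat (N a b (bar c)) * chi c f)" for f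
    using sum_bar[of "\<lambda>c. of_nat (N a b (bar c)) * chi c f"] by (simp add: bar_bar)
  ultimately have "(\<Sum>c\<in>UNIV. of_nat (N a b (bar c)) * chi c (E (bar d) 0 0)) =
      (\<Sum>c\<in>UNIV. of_nat (N (bar b) (bar a) c) * chi c (E (bar d) 0 0))"
    by metis
  then show ?thesis unfolding chi_coeff by (simp add: bar_bar)
qed

section \<open>An integral of the dual and Frobenius reciprocity\<close>

definition Es :: "'a set" where "Es = {e. \<exists>f. beta e f \<noteq> 0}"

text \<open>Under the vacuum functional \<open>f\<close> and \<open>PiL f\<close> act alike, which
  is what allows the vacuum vectors to carry an integral.\<close>

lemma beta_mul_PiL: "beta e (x \<diamondop> PiL f) = beta e (x \<diamondop> f)"
proof -
  note [simp] = lin_rules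
  have "beta e (x \<diamondop> PiL f) = sw one (\<lambda>a b. eps (a \<diamondop> f) * beta e (x \<diamondop> b))"
    by (rule lin_PiL(2)) simp
  also have "\<dots> = eps (z e \<diamondop> x \<diamondop> one \<diamondop> f)"
    unfolding eps_mul3(1)[of "z e \<diamondop> x" one f] by (simp add: beta_def mul_assoc mult.commute)
  finally show ?thesis by (simp add: beta_def mul_assoc)
qed

text \<open>On a vacuum block \<open>t\<close> is the rank-one projection onto the vacuum vector
  \<open>ve e\<close> along a coordinate functional normalised on it; on all other blocks it is
  zero. Since \<open>f\<close> and \<open>PiL f\<close> agree on the vacuum vector, \<open>t\<close>
  is a left integral, and \<open>t\<close> fixing that vector gives
  \<open>PiL t = 1\<close>.\<close>

lemma exists_integral:
  obtains t where "\<And>a. chi a t = (if a \<in> Es then 1 else 0)" "PiL t = one" "\<And>f. f \<diamondop> t = PiL f \<diamondop> t"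
proof -
  note [simp] = lin_rules
  have uv: "\<exists>i<n e. ue e i \<noteq> 0" "\<exists>i<n e. ve e i \<noteq> 0" if e: "e \<in> Es" for e
  proof -
    obtain f where f: "beta e f \<noteq> 0" using e by (auto simp: Es_def)
    show "\<exists>i<n e. ue e i \<noteq> 0"
    proof (rule ccontr)
      assume "\<not> ?thesis"
      then have "beta e f = 0" using beta_rank1[of e f] f by (auto intro!: sum.neutral)
      then show False using f by simp
    qed
    show "\<exists>i<n e. ve e i \<noteq> 0"
    proof (rule ccontr)
      assume "\<not> ?thesis"
      then have "beta e f = 0" using beta_rank1[of e f] f by (auto intro!: sum.neutral)
      then show False using f by simp
    qed
  qed
  \<comment> \<open>A coordinate in which the vacuum vector does not vanish; the sum defining
    \<open>t\<close> runs only over labels where one exists.\<close>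
  define i0 where "i0 e = (SOME i. i < n e \<and> ve e i \<noteq> 0)" for e
  have i0: "i0 e < n e" "ve e (i0 e) \<noteq> 0" if "e \<in> Es" for e
    using someI_ex[of "\<lambda>i. i < n e \<and> ve e i \<noteq> 0"] uv(2)[OF that] unfolding i0_def by blast+
  define t where "t = (\<lambda>x. \<Sum>e\<in>Es. \<Sum>i<n e. (ve e i / ve e (i0 e)) * E e i (i0 e) x)"
  have pt: "p a i j t = (if a \<in> Es \<and> j = i0 a then ve a i / ve a (i0 a) else 0)" if "i < n a" "j < n a" for a i j
  proof -
    have "p a i j t = (\<Sum>e\<in>Es. \<Sum>i'<n e. (ve e i' / ve e (i0 e)) * p a i j (E e i' (i0 e)))"
      unfolding t_def by (simp only: lin_sum_vec[OF lin_p0] lin_scale_vec[OF lin_p0])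
    also have "\<dots> = (\<Sum>e\<in>Es. if e = a then (if j = i0 a then ve a i / ve a (i0 a) else 0) else 0)"
    proof (rule sum.cong[OF refl])
      fix e assume e: "e \<in> Es"
      have "(\<Sum>i'<n e. (ve e i' / ve e (i0 e)) * p a i j (E e i' (i0 e))) =
        (\<Sum>i'<n e. if i' = i then (if e = a \<and> j = i0 e then ve e i / ve e (i0 e) else 0) else 0)"
        using i0(1)[OF e] by (intro sum.cong refl) (auto simp: p_E)
      then show "(\<Sum>i'<n e. (ve e i' / ve e (i0 e)) * p a i j (E e i' (i0 e))) =
        (if e = a then (if j = i0 a then ve a i / ve a (i0 a) else 0) else 0)"
        using that by auto
    qed
    finally show ?thesis by (simp add: sum.delta)
  qed
  have pft: "p a i j (f \<diamondop> t) = (if a \<in> Es \<and> j = i0 a then (\<Sum>l<n a. p a i l f * ve a l) / ve a (i0 a) else 0)"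
    if "i < n a" "j < n a" for a i j f
    using that by (auto simp: p_mul pt sum_divide_distrib)
  have chit: "chi a t = (if a \<in> Es then 1 else 0)" for a
  proof (cases "a \<in> Es")
    case True
    have "chi a t = (\<Sum>i<n a. if i = i0 a then 1 else 0)"
      unfolding chi_def using True i0[OF True] by (intro sum.cong refl) (auto simp: pt)
    then show ?thesis using True i0[OF True] by simp
  next
    case False then show ?thesis unfolding chi_def by (auto simp: pt)
  qed
  have betat: "beta e (x \<diamondop> t) = beta e x" for e x
  proof (cases "e \<in> Es")
    case True
    then have ex: "\<exists>f. beta e f \<noteq> 0" by (simp add: Es_def)
    have "beta e (x \<diamondop> t) = (\<Sum>i<n e. \<Sum>j<n e. if j = i0 e then ue e i * (\<Sum>l<n e. p e i l x * ve e l) else 0)"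
      unfolding beta_rank1[OF ex, of "x \<diamondop> t"] using True i0[OF True]
      by (intro sum.cong refl) (auto simp: pft)
    also have "\<dots> = beta e x"
      unfolding beta_rank1[OF ex, of x] using i0[OF True]
      by (simp add: sum_distrib_left mult.assoc)
    finally show ?thesis .
  next
    case False then show ?thesis by (simp add: Es_def)
  qed
  have PiLt: "PiL t = one"
  proof (rule cv_eqI)
    fix \<phi> :: "'i cv \<Rightarrow> complex" assume \<phi>: "lin \<phi>"
    have "eps (a \<diamondop> t) = eps a" for a by (simp add: eps_beta betat)
    then show "\<phi> (PiL t) = \<phi> one" by (simp add: lin_PiL(2)[OF \<phi>] sw_counit1[OF \<phi>])
  qed
  have ft: "f \<diamondop> t = PiL f \<diamondop> t" for f
  proof (rule p_ext)
    fix a i j assume ij: "i < n a" "j < n a"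
    have "(\<Sum>l<n a. p a i l f * ve a l) = (\<Sum>l<n a. p a i l (PiL f) * ve a l)" if a: "a \<in> Es"
    proof -
      have ex: "\<exists>f. beta a f \<noteq> 0" using a by (simp add: Es_def)
      obtain r where r: "r < n a" "ue a r \<noteq> 0" using uv(1)[OF a] by blast
      \<comment> \<open>Left multiplication by \<open>E a r i\<close> isolates row \<open>i\<close>
        of \<open>g\<close> applied to the vacuum vector, up to the nonzero factor
        \<open>ue a r\<close>.\<close>
      have "beta a (E a r i \<diamondop> g) = ue a r * (\<Sum>l<n a. p a i l g * ve a l)" for g
      proof -
        have "beta a (E a r i \<diamondop> g) = (\<Sum>i'<n a. if i' = r then \<Sum>l<n a. ue a r * p a i l g * ve a l else 0)"
          unfolding beta_rank1[OF ex, of "E a r i \<diamondop> g"] using ij r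
          by (intro sum.cong refl) (auto simp: p_E_mul)
        then show ?thesis using r by (simp add: sum_distrib_left mult.assoc)
      qed
      then show ?thesis using beta_mul_PiL[of a "E a r i" f] r by simp
    qed
    then show "p a i j (f \<diamondop> t) = p a i j (PiL f \<diamondop> t)" using ij by (simp add: pft)
  qed
  show thesis using that chit PiLt ft by blast
qed

lemma sw_PiL:
  assumes F: "\<And>b. lin (\<lambda>a. F a b)" "\<And>a. lin (F a)"
  shows "sw (PiL f) F = sw one (\<lambda>a b. F (PiL f \<diamondop> a) b)"
proof -
  note [simp] = lin_rules lin_comp[OF F(1)] lin_comp[OF F(2)] F
  have "sw (PiL f) F = sw one (\<lambda>a b. sw b (\<lambda>x y. eps (a \<diamondop> f) * F x y))"
    by (subst lin_PiL(2)[of "\<lambda>x. sw x F"]) (simp_all add: sw_mult_left)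
  also have "\<dots> = sw one (\<lambda>a b. sw one (\<lambda>a' b'. eps (a \<diamondop> f) * F (b \<diamondop> a') b'))"
    by (rule sw_one3a(2)) simp
  also have "\<dots> = sw one (\<lambda>a' b'. sw one (\<lambda>a b. eps (a \<diamondop> f) * F (b \<diamondop> a') b'))"
    by (rule sw_swap)
  also have "\<dots> = sw one (\<lambda>a b. F (PiL f \<diamondop> a) b)"
    by (subst lin_PiL(2)[of "\<lambda>z. F (z \<diamondop> _) _"]) simp_all
  finally show ?thesis .
qed

text \<open>Inserting Delta(1) and expanding it along \<open>f\<close> as
  \<open>S(f_1) f_2 (x) f_3\<close> puts \<open>f_2 t\<close> under a coproduct. There
  \<open>f_2\<close> acts as \<open>PiL f_2\<close>, and
  \<open>S(f_1) PiL(f_2) = S f\<close>.\<close>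

lemma integral_move:
  assumes t: "\<And>f. f \<diamondop> t = PiL f \<diamondop> t" and X: "lin X" and Y: "lin Y"
  shows "sw t (\<lambda>a b. X a * Y (f \<diamondop> b)) = sw t (\<lambda>a b. X (S f \<diamondop> a) * Y b)"
proof -
  note [simp] = lin_rules lin_comp[OF X] X lin_comp[OF Y] Y
  have t': "sw (r \<diamondop> t) G = sw t (\<lambda>a b. G (PiL r \<diamondop> a) b)"
    if G: "\<And>b. lin (\<lambda>a. G a b)" "\<And>a. lin (G a)" for r G
  proof -
    note [simp] = lin_comp[OF G(1)] lin_comp[OF G(2)] G
    have "sw (r \<diamondop> t) G = sw (PiL r \<diamondop> t) G" by (simp only: t[of r])
    also have "\<dots> = sw (PiL r) (\<lambda>a b. sw t (\<lambda>a' b'. G (a \<diamondop> a') (b \<diamondop> b')))"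
      by (rule sw_mul) simp_all
    also have "\<dots> = sw one (\<lambda>a b. sw t (\<lambda>a' b'. G (PiL r \<diamondop> (a \<diamondop> a')) (b \<diamondop> b')))"
      by (subst sw_PiL) (simp_all add: mul_assoc)
    also have "\<dots> = sw (one \<diamondop> t) (\<lambda>a b. G (PiL r \<diamondop> a) b)"
      by (rule sw_mul[symmetric]) simp_all
    finally show ?thesis by simp
  qed
  have "sw t (\<lambda>a b. X a * Y (f \<diamondop> b)) = sw (one \<diamondop> t) (\<lambda>a b. X a * Y (f \<diamondop> b))" by simp
  also have "\<dots> = sw one (\<lambda>x y. sw t (\<lambda>a b. X (x \<diamondop> a) * Y (f \<diamondop> y \<diamondop> b)))"
    by (subst sw_mul) (simp_all add: mul_assoc)
  also have "\<dots> = sw f (\<lambda>v w. sw v (\<lambda>x y. sw t (\<lambda>a b. X (S x \<diamondop> y \<diamondop> a) * Y (w \<diamondop> b))))"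
    by (rule S_left_three[symmetric]) simp_all
  also have "\<dots> = sw f (\<lambda>x r. sw r (\<lambda>y w. sw t (\<lambda>a b. X (S x \<diamondop> y \<diamondop> a) * Y (w \<diamondop> b))))"
    by (rule sw_assoc)
  also have "\<dots> = sw f (\<lambda>x r. sw (r \<diamondop> t) (\<lambda>a b. X (S x \<diamondop> a) * Y b))"
    by (subst sw_mul) (simp_all add: mul_assoc)
  also have "\<dots> = sw f (\<lambda>x r. sw t (\<lambda>a b. X (S x \<diamondop> PiL r \<diamondop> a) * Y b))"
    by (subst t') (simp_all add: mul_assoc)
  also have "\<dots> = sw t (\<lambda>a b. sw f (\<lambda>x r. X (S x \<diamondop> PiL r \<diamondop> a)) * Y b)"
    by (subst sw_swap) (simp only: sw_mult_right)
  also have "\<dots> = sw t (\<lambda>a b. X (S f \<diamondop> a) * Y b)"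
    by (subst S_PiL[of "\<lambda>z. X (z \<diamondop> _)"]) simp_all
  finally show ?thesis .
qed

lemma S_Si: "S (Si f) = f"
  by (simp add: Si_def S_mul S2 S_k S_k' mul_assoc k'_k)

lemma chi_z: "chi b (z b \<diamondop> f) = chi b f"
  unfolding chi_def by (simp add: p_z_mul)

text \<open>Orthogonality of characters under \<open>t\<close>. For \<open>b\<close> other than
  \<open>bar a\<close>, the idempotent \<open>z b\<close> is moved across and \<open>S (z b)\<close>
  vanishes on block \<open>a\<close>. For \<open>b = bar a\<close>, moving matrix units across
  reduces the value to the trace of one matrix, which is an entry of
  \<open>PiL t = 1\<close>.\<close>

lemma chi_chi_integral:
  assumes chit: "\<And>a. chi a t = (if a \<in> Es then 1 else 0)" and PiLt: "PiL t = one" and t: "\<And>f. f \<diamondop> t = PiL f \<diamondop> t"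
  shows "sw t (\<lambda>x y. chi a x * chi b y) = (if b = bar a then 1 else 0)"
proof (cases "b = bar a")
  case False
  note [simp] = lin_rules
  have z0: "chi a (S (z b) \<diamondop> x) = 0" for x
    unfolding chi_def using False by (auto simp: p_mul p_S_z intro!: sum.neutral)
  have "sw t (\<lambda>x y. chi a x * chi b y) = sw t (\<lambda>x y. chi a x * chi b (z b \<diamondop> y))"
    by (simp add: chi_z)
  also have "\<dots> = sw t (\<lambda>x y. chi a (S (z b) \<diamondop> x) * chi b y)"
    by (rule integral_move[OF t]) (simp_all add: lin_chi0)
  finally show ?thesis using False by (simp add: z0 sw_mult_left[of _ 0, simplified])
next
  case True
  note [simp] = lin_rules
  define X where "X i j i' j' = sw t (\<lambda>x y. p a i j x * p a i' j' (S y))" for i j i' j'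
  have move: "sw t (\<lambda>x y. p a i j x * p a i' j' (S y \<diamondop> g)) = sw t (\<lambda>x y. p a i j (g \<diamondop> x) * p a i' j' (S y))" for g i j i' j'
    using integral_move[OF t lin_p0, of "\<lambda>y. p a i' j' (S y)" a i j "Si g"] by (simp add: S_mul S_Si)
  \<comment> \<open>With \<open>g\<close> a matrix unit: \<open>X i j i' j'\<close> vanishes unless
    \<open>i = j'\<close>, and then does not depend on that common index.\<close>
  have rel: "(if j' = l then X i j i' r else 0) = (if i = r then X l j i' j' else 0)"
    if "i < n a" "j' < n a" "r < n a" "l < n a" for i j i' j' r l
    using move[of i j i' j' "E a r l"] that
    by (cases "j' = l"; cases "i = r") (simp_all add: p_mul_E p_E_mul X_def sw_mult_left[of _ 0, simplified])
  have diag: "X i i j j = (if i = j then X i i i i else 0)" if "i < n a" "j < n a" for i j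
    using rel[of i 0 j 0 i j] that n_pos[of a] by auto
  have "sw t (\<lambda>x y. chi a x * chi b y) = (\<Sum>i<n a. \<Sum>j<n a. X i i j j)"
  proof -
    have "sw t (\<lambda>x y. chi a x * chi b y) = sw t (\<lambda>x y. chi a x * chi a (S y))"
      by (simp add: True chi_S)
    also have "\<dots> = sw t (\<lambda>x y. \<Sum>i<n a. \<Sum>j<n a. p a i i x * p a j j (S y))"
      by (simp add: chi_def sum_product)
    finally show ?thesis by (simp add: sw_sum X_def)
  qed
  also have "\<dots> = (\<Sum>i<n a. \<Sum>j<n a. if j = i then X i i i i else 0)"
    by (intro sum.cong refl) (subst diag, auto)
  also have "\<dots> = (\<Sum>i<n a. X i i i i)" by simp
  \<comment> \<open>The outer indices are moved to 0, so that the sum becomes the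
    \<open>(0, 0)\<close> entry of \<open>t_1 S(t_2)\<close>.\<close>
  also have "\<dots> = (\<Sum>i<n a. X 0 i i 0)"
    using rel[of 0 _ _ 0] n_pos[of a] rel by (intro sum.cong refl) (metis lessThan_iff)
  also have "\<dots> = p a 0 0 (PiL t)"
    by (simp add: lin_PiL(1)[OF lin_p0] p_mul sw_sum X_def)
  finally show ?thesis using True n_pos[of a] by (simp add: PiLt p_one)
qed

text \<open>Both sides evaluate \<open>chi (bar b)\<close>, \<open>chi c\<close>,
  \<open>chi a\<close> on the three legs of \<open>t\<close>, grouped in the two ways permitted by
  coassociativity; orthogonality under \<open>t\<close> extracts one multiplicity from each
  grouping.\<close>

lemma N_cyclic: "N c a b = N (bar b) c (bar a)"
proof -
  obtain t where t: "\<And>a. chi a t = (if a \<in> Es then 1 else 0)" "PiL t = one" "\<And>f. f \<diamondop> t = PiL f \<diamondop> t"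
    using exists_integral by blast
  note tt = chi_chi_integral[OF t]
  have "of_nat (N c a b) = (\<Sum>d\<in>UNIV. of_nat (N c a d) * (if d = b then 1 else 0 :: complex))"
    by (simp add: sum_delta_mult)
  also have "\<dots> = (\<Sum>d\<in>UNIV. of_nat (N c a d) * sw t (\<lambda>x r. chi (bar b) x * chi d r))"
    by (simp add: tt bar_bar)
  also have "\<dots> = sw t (\<lambda>x r. chi (bar b) x * (\<Sum>d\<in>UNIV. of_nat (N c a d) * chi d r))"
    by (simp add: sum_distrib_left mult.left_commute[of "chi _ _"] sw_sum sw_mult_left)
  also have "\<dots> = sw t (\<lambda>x r. sw r (\<lambda>y w. chi (bar b) x * chi c y * chi a w))"
    by (simp only: chi_chi[symmetric] sw_mult_left mult.assoc)
  also have "\<dots> = sw t (\<lambda>r w. sw r (\<lambda>x y. chi (bar b) x * chi c y * chi a w))"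
    by (rule sw_assoc[symmetric])
  also have "\<dots> = sw t (\<lambda>r w. (\<Sum>d\<in>UNIV. of_nat (N (bar b) c d) * chi d r) * chi a w)"
    by (simp only: chi_chi[symmetric] sw_mult_right)
  also have "\<dots> = (\<Sum>d\<in>UNIV. of_nat (N (bar b) c d) * sw t (\<lambda>x r. chi d x * chi a r))"
    by (simp add: sum_distrib_right mult.assoc sw_sum sw_mult_left)
  also have "\<dots> = (\<Sum>d\<in>UNIV. of_nat (N (bar b) c d) * (if d = bar a then 1 else 0 :: complex))"
    by (simp add: tt bar_eq_iff eq_commute[of a])
  also have "\<dots> = of_nat (N (bar b) c (bar a))"
    by (simp add: sum_delta_mult)
  finally show ?thesis by simp
qed

lemma N_reciprocity: "N c a b = N (bar c) b a"
  using N_cyclic[of c a b] N_reflect[of "bar b" c "bar a"] by (simp add: bar_bar)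

lemma fusion_del': "(\<Sum>b\<in>UNIV. of_nat (N c a b) * del b) = (if ll a = rr c then del c * del a else 0)"
  unfolding N_reciprocity[of c a] using fusion_del[of "bar c" a] by (simp add: ll_bar bar_bar)

section \<open>Positivity of the squared dimensions\<close>

definition DD :: "'a \<Rightarrow> complex" where "DD e = (\<Sum>a\<in>{a. ll a = e}. del a * del (bar a))"

text \<open>Hermitian counterpart of \<open>DD\<close>, positive by construction; positivity of
  \<open>DD\<close> is obtained by comparison with it.\<close>

definition nn :: "'a \<Rightarrow> real" where "nn e = (\<Sum>a\<in>{a. ll a = e}. (cmod (del a))\<^sup>2)"

lemma nn_pos: "nn (ll a) > 0" "nn (rr a) > 0"
proof -
  have "nn (ll a) > 0" for a
    unfolding nn_def by (rule sum_pos2[where i = a]) (auto simp: del_nonzero)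
  from this[of a] this[of "bar a"] show "nn (ll a) > 0" "nn (rr a) > 0" by (simp_all add: ll_bar)
qed

lemma sum_if_ll: "(\<Sum>a\<in>UNIV. if ll a = e then f a else 0) = (\<Sum>a\<in>{a. ll a = e}. f a)"
  by (simp add: sum.If_cases)

text \<open>Evaluates \<open>\<Sum>\<^sub>x\<^sub>y N\<^sub>a\<^sub>x\<^sup>y cnj (del x) del y\<close> by summing over \<open>y\<close> first, respectively over \<open>x\<close> first.\<close>

lemma del_bar: "del a * of_real (nn (rr a)) = cnj (del (bar a)) * of_real (nn (ll a))"
proof -
  have norm: "cnj w * w = of_real ((cmod w)\<^sup>2)" for w :: complex
    by (simp only: complex_norm_square mult.commute)
  have "(\<Sum>x\<in>UNIV. \<Sum>y\<in>UNIV. of_nat (N a x y) * cnj (del x) * del y) =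
    (\<Sum>x\<in>UNIV. cnj (del x) * (\<Sum>y\<in>UNIV. of_nat (N a x y) * del y))"
    by (simp add: sum_distrib_left mult_ac)
  also have "\<dots> = (\<Sum>x\<in>UNIV. if ll x = rr a then del a * (cnj (del x) * del x) else 0)"
    unfolding fusion_del' by (intro sum.cong refl) (simp add: mult_ac)
  also have "\<dots> = del a * of_real (nn (rr a))"
    unfolding sum_if_ll nn_def norm by (simp add: sum_distrib_left)
  finally have 1: "(\<Sum>x\<in>UNIV. \<Sum>y\<in>UNIV. of_nat (N a x y) * cnj (del x) * del y) = del a * of_real (nn (rr a))" .
  have "(\<Sum>x\<in>UNIV. \<Sum>y\<in>UNIV. of_nat (N a x y) * cnj (del x) * del y) =
    (\<Sum>y\<in>UNIV. cnj (\<Sum>x\<in>UNIV. of_nat (N a x y) * del x) * del y)"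
    by (subst sum.swap) (simp add: sum_distrib_right)
  also have "\<dots> = (\<Sum>y\<in>UNIV. if ll y = ll a then cnj (del (bar a)) * (cnj (del y) * del y) else 0)"
    unfolding fusion_del by (intro sum.cong refl) (simp add: mult_ac)
  also have "\<dots> = cnj (del (bar a)) * of_real (nn (ll a))"
    unfolding sum_if_ll nn_def norm by (simp add: sum_distrib_left)
  finally show ?thesis using 1 by simp
qed

text \<open>Eliminating \<open>del (bar a)\<close> by \<open>del_bar\<close> shows
  \<open>d_a^2\<close> to be a positive real, although \<open>del a\<close> itself is
  complex.\<close>

lemma del_del_bar: "del a * del (bar a) = of_real ((cmod (del a))\<^sup>2 * nn (rr a) / nn (ll a))"
proof -
  have "cnj (del (bar a)) = del a * of_real (nn (rr a)) / of_real (nn (ll a))"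
    using del_bar[of a] nn_pos(1)[of a] by (simp add: field_simps)
  then have "del (bar a) = cnj (del a * of_real (nn (rr a)) / of_real (nn (ll a)))"
    by (metis complex_cnj_cnj)
  then have "del a * del (bar a) = (del a * cnj (del a)) * of_real (nn (rr a)) / of_real (nn (ll a))"
    by simp
  also have "del a * cnj (del a) = of_real ((cmod (del a))\<^sup>2)"
    by (simp only: complex_norm_square)
  finally show ?thesis by simp
qed

lemma DD_nonzero: "DD (ll a) \<noteq> 0"
proof -
  have eq: "DD (ll a) = of_real (\<Sum>x\<in>{x. ll x = ll a}. (cmod (del x))\<^sup>2 * nn (rr x) / nn (ll x))"
    by (simp add: DD_def del_del_bar)
  have "(\<Sum>x\<in>{x. ll x = ll a}. (cmod (del x))\<^sup>2 * nn (rr x) / nn (ll x)) > 0"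
    by (rule sum_pos2[where i = a])
      (use nn_pos del_nonzero in \<open>auto intro!: divide_pos_pos mult_pos_pos simp: less_imp_le\<close>)
  then show ?thesis unfolding eq of_real_eq_0_iff by linarith
qed

text \<open>The double count of \<open>del_bar\<close> again, now with the bilinear weight
  \<open>del x * del (bar y)\<close>: both orders of summation give the nonzero factor
  \<open>del (bar a)\<close> times a value of \<open>DD\<close>.\<close>

lemma DD_eq: "DD (ll a) = DD (rr a)"
proof -
  \<comment> \<open>\<open>N_reflect\<close> brings the inner sum over \<open>y\<close> into the
    form summed by \<open>fusion_del'\<close>.\<close>
  have "(\<Sum>x\<in>UNIV. \<Sum>y\<in>UNIV. of_nat (N a x y) * del x * del (bar y)) =
    (\<Sum>x\<in>UNIV. del x * (\<Sum>y\<in>UNIV. of_nat (N (bar x) (bar a) (bar y)) * del (bar y)))"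
    by (simp add: sum_distrib_left mult_ac N_reflect[of a])
  also have "\<dots> = (\<Sum>x\<in>UNIV. del x * (\<Sum>y\<in>UNIV. of_nat (N (bar x) (bar a) y) * del y))"
    by (simp add: sum_bar[of "\<lambda>y. of_nat (N (bar _) (bar a) y) * del y"])
  also have "\<dots> = (\<Sum>x\<in>UNIV. if ll x = rr a then del (bar a) * (del x * del (bar x)) else 0)"
    unfolding fusion_del' ll_bar rr_bar by (intro sum.cong refl) auto
  also have "\<dots> = del (bar a) * DD (rr a)"
    unfolding sum_if_ll DD_def by (simp add: sum_distrib_left)
  finally have 1: "(\<Sum>x\<in>UNIV. \<Sum>y\<in>UNIV. of_nat (N a x y) * del x * del (bar y)) = del (bar a) * DD (rr a)" .
  have "(\<Sum>x\<in>UNIV. \<Sum>y\<in>UNIV. of_nat (N a x y) * del x * del (bar y)) =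
    (\<Sum>y\<in>UNIV. (\<Sum>x\<in>UNIV. of_nat (N a x y) * del x) * del (bar y))"
    by (subst sum.swap) (simp add: sum_distrib_right)
  also have "\<dots> = (\<Sum>y\<in>UNIV. if ll y = ll a then del (bar a) * (del y * del (bar y)) else 0)"
    unfolding fusion_del by (intro sum.cong refl) auto
  also have "\<dots> = del (bar a) * DD (ll a)"
    unfolding sum_if_ll DD_def by (simp add: sum_distrib_left)
  finally show ?thesis using 1 del_nonzero[of "bar a"] by simp
qed

section \<open>The functional of Omega\<close>

definition Om :: "'i cv \<Rightarrow> complex" where "Om f = (\<Sum>a\<in>UNIV. del a / DD (ll a) * chi a f)"

text \<open>\<open>lam h\<close> weights \<open>chi a\<close> by a value attached to
  \<open>rr a\<close>, whereas \<open>Om\<close> divides by one attached to \<open>ll a\<close>;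
  \<open>DD_eq\<close> reconciles the two.\<close>

lemma Om_lam: "\<exists>h. Om = lam h \<and> (\<forall>a. beta (rr a) h = 1 / DD (rr a))"
proof -
  obtain h where "beta (rr a) h = 1 / DD (rr a)" for a
    using exists_beta_values[of "\<lambda>e. 1 / DD e"] by blast
  then show ?thesis by (intro exI[of _ h]) (simp add: fun_eq_iff Om_def lam_del DD_eq)
qed

text \<open>One factor is expanded in characters and the other is taken as \<open>lam h\<close>. By
  \<open>chi_lam\<close> the coefficient of \<open>chi b\<close> collects
  \<open>del a * del (bar a)\<close> over all \<open>a\<close> with \<open>ll a = ll b\<close>; this
  is \<open>DD (ll b)\<close>, which cancels one normalisation.\<close>

lemma Om_idem: "sw f (\<lambda>x y. Om x * Om y) = Om f"
proof -
  obtain h where h: "Om = lam h" "\<And>a. beta (rr a) h = 1 / DD (rr a)" using Om_lam by blast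
  have "sw f (\<lambda>x y. Om x * Om y) = sw f (\<lambda>x y. (\<Sum>a\<in>UNIV. del a / DD (ll a) * chi a x) * lam h y)"
    by (simp only: Om_def[symmetric] h(1)[symmetric])
  also have "\<dots> = (\<Sum>a\<in>UNIV. del a / DD (ll a) * sw f (\<lambda>x y. chi a x * lam h y))"
    by (simp only: sum_distrib_right mult.assoc sw_sum sw_mult_left)
  also have "\<dots> = (\<Sum>a\<in>UNIV. \<Sum>b\<in>UNIV. if ll a = ll b then (del a * del (bar a) / DD (ll b)) * (del b / DD (ll b) * chi b f) else 0)"
    unfolding chi_lam h(2) sum_distrib_left by (intro sum.cong refl) (simp add: DD_eq[symmetric])
  also have "\<dots> = (\<Sum>b\<in>UNIV. \<Sum>a\<in>UNIV. if ll a = ll b then (del a * del (bar a) / DD (ll b)) * (del b / DD (ll b) * chi b f) else 0)"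
    by (rule sum.swap)
  also have "\<dots> = (\<Sum>b\<in>UNIV. (DD (ll b) / DD (ll b)) * (del b / DD (ll b) * chi b f))"
    unfolding sum_if_ll DD_def by (simp only: sum_distrib_right sum_divide_distrib)
  also have "\<dots> = Om f" by (simp add: DD_nonzero Om_def)
  finally show ?thesis .
qed

lemma Om_commute: "Om (f \<diamondop> g) = Om (g \<diamondop> f)"
  by (simp add: Om_def chi_commute)

lemma Om_integral:
  assumes "lin X"
  shows "sw g (\<lambda>a b. X a * Om (f \<diamondop> b)) = sw f (\<lambda>a b. X (S a \<diamondop> k) * Om (b \<diamondop> g))"
  using Om_lam lam_integral[OF assms] by metis

text \<open>On every matrix block the form is a nonzero multiple of the trace form.\<close>

lemma Om_nondegenerate:
  assumes y: "lin y"
  shows "\<exists>f. \<forall>g. Om (f \<diamondop> g) = y g"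
proof -
  define co where "co a = del a / DD (ll a)" for a
  have co: "co a \<noteq> 0" for a by (simp add: co_def del_nonzero DD_nonzero)
  \<comment> \<open>The trace dual of \<open>y\<close>: matrix units are transposed and the weight
    of each block is divided out.\<close>
  define f where "f = (\<lambda>x. \<Sum>a\<in>UNIV. \<Sum>i<n a. \<Sum>j<n a. (y (E a i j) / co a) * E a j i x)"
  have pf: "p b r l f = y (E b l r) / co b" if "r < n b" "l < n b" for b r l
  proof -
    have "p b r l f = (\<Sum>a\<in>UNIV. \<Sum>i<n a. \<Sum>j<n a. (y (E a i j) / co a) * p b r l (E a j i))"
      unfolding f_def by (simp only: lin_sum_vec[OF lin_p0] lin_scale_vec[OF lin_p0])
    also have "\<dots> = (\<Sum>a\<in>UNIV. if a = b then y (E b l r) / co b else 0)"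
    proof (rule sum.cong[OF refl])
      fix a
      show "(\<Sum>i<n a. \<Sum>j<n a. (y (E a i j) / co a) * p b r l (E a j i)) = (if a = b then y (E b l r) / co b else 0)"
      proof (cases "a = b")
        case True
        have "(\<Sum>i<n b. \<Sum>j<n b. (y (E b i j) / co b) * p b r l (E b j i)) =
          (\<Sum>i<n b. \<Sum>j<n b. if j = r then (if i = l then y (E b l r) / co b else 0) else 0)"
          by (intro sum.cong refl) (auto simp: p_E)
        then show ?thesis unfolding True using that by simp
      next
        case False then show ?thesis by (auto simp: p_E intro!: sum.neutral)
      qed
    qed
    finally show ?thesis by simp
  qed
  have OmE: "Om (f \<diamondop> E b r l) = y (E b r l)" if "r < n b" "l < n b" for b r l
  proof -
    have "chi a (f \<diamondop> E b r l) = (if a = b then y (E b r l) / co b else 0)" for a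
    proof (cases "a = b")
      case True
      have "chi b (f \<diamondop> E b r l) = (\<Sum>i<n b. if i = l then p b l r f else 0)"
        unfolding chi_def using that by (intro sum.cong refl) (simp add: p_mul_E)
      then show ?thesis using True that by (simp add: pf)
    next
      case False then show ?thesis using that unfolding chi_def by (auto simp: p_mul_E intro!: sum.neutral)
    qed
    then show ?thesis using co[of b]
      by (simp add: Om_def co_def[symmetric] if_distrib[of "\<lambda>t. _ * t"] cong: if_cong)
  qed
  have linO: "lin (\<lambda>g. Om (f \<diamondop> g))"
    unfolding Om_def by (intro lin_sum lin_mult_left) (simp add: lin_rules)
  have "Om (f \<diamondop> g) = y g" for g
    unfolding lin_expand_E[OF y, of g] lin_expand_E[OF linO, of g]
    by (intro sum.cong refl) (simp add: OmE)
  then show ?thesis by blast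
qed

end

section \<open>Matrix units from irreducible representations\<close>

text \<open>Induction in the manner of Gram-Schmidt. Independence provides a vector on which the new
  functional differs from its interpolation by the old ones; corrected and scaled it is the new dual
  vector, and the old dual vectors are then corrected by it.\<close>

lemma dual_vectors:
  fixes \<phi> :: "'s \<Rightarrow> 'i cv \<Rightarrow> complex"
  assumes "finite A" "\<And>s. s \<in> A \<Longrightarrow> lin (\<phi> s)"
    "\<And>x. (\<And>f. (\<Sum>s\<in>A. x s * \<phi> s f) = 0) \<Longrightarrow> (\<forall>s\<in>A. x s = 0)"
  shows "\<exists>g. \<forall>s\<in>A. \<forall>t\<in>A. \<phi> s (g t) = (if s = t then 1 else 0)"
  using assms
proof (induction A rule: finite_induct)
  case empty
  then show ?case by simp
next
  case (insert a A)
  have step: "\<forall>s\<in>A. x s = 0" if "\<And>f. (\<Sum>s\<in>A. x s * \<phi> s f) = 0" for x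
  proof -
    have "\<forall>s\<in>insert a A. (x(a := 0)) s = 0"
    proof (rule insert.prems(2))
      fix f
      have "(\<Sum>s\<in>A. (x(a := 0)) s * \<phi> s f) = (\<Sum>s\<in>A. x s * \<phi> s f)"
        using insert.hyps by (intro sum.cong) auto
      then show "(\<Sum>s\<in>insert a A. (x(a := 0)) s * \<phi> s f) = 0"
        using that[of f] insert.hyps by simp
    qed
    then show ?thesis using insert.hyps by (metis fun_upd_apply insertCI)
  qed
  have "\<exists>g. \<forall>s\<in>A. \<forall>t\<in>A. \<phi> s (g t) = (if s = t then 1 else 0)"
  proof (rule insert.IH)
    show "lin (\<phi> s)" if "s \<in> A" for s
      by (rule insert.prems(1)) (use that in simp)
    show "\<forall>s\<in>A. x s = 0" if "\<And>f. (\<Sum>s\<in>A. x s * \<phi> s f) = 0" for x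
      by (rule step[OF that])
  qed
  then obtain g where g0: "\<forall>s\<in>A. \<forall>t\<in>A. \<phi> s (g t) = (if s = t then 1 else 0)"
    by (elim exE)
  have g: "\<phi> s (g t) = (if s = t then 1 else 0)" if "s \<in> A" "t \<in> A" for s t
    using g0 that by simp
  have l: "lin (\<phi> s)" if "s \<in> insert a A" for s by (rule insert.prems(1)[OF that])
  have "\<exists>f. \<phi> a f - (\<Sum>t\<in>A. \<phi> a (g t) * \<phi> t f) \<noteq> 0"
  proof (rule ccontr)
    assume no: "\<not> ?thesis"
    have e: "\<phi> a f = (\<Sum>t\<in>A. \<phi> a (g t) * \<phi> t f)" for f
    proof (rule ccontr)
      assume "\<phi> a f \<noteq> (\<Sum>t\<in>A. \<phi> a (g t) * \<phi> t f)"
      then have "\<phi> a f - (\<Sum>t\<in>A. \<phi> a (g t) * \<phi> t f) \<noteq> 0" by simp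
      then have "\<exists>f. \<phi> a f - (\<Sum>t\<in>A. \<phi> a (g t) * \<phi> t f) \<noteq> 0" by (rule exI[of _ f])
      then show False by (rule notE[OF no])
    qed
    \<comment> \<open>The relation that would contradict independence: coefficient 1 at
      \<open>a\<close> and minus the interpolation coefficients on \<open>A\<close>.\<close>
    have "\<forall>s\<in>insert a A. (\<lambda>s. if s = a then 1 else - \<phi> a (g s)) s = 0"
    proof (rule insert.prems(2))
      fix f
      have "(\<Sum>s\<in>A. (if s = a then 1 else - \<phi> a (g s)) * \<phi> s f) = - (\<Sum>t\<in>A. \<phi> a (g t) * \<phi> t f)"
        unfolding sum_negf[symmetric] using insert.hyps by (intro sum.cong) auto
      then show "(\<Sum>s\<in>insert a A. (\<lambda>s. if s = a then 1 else - \<phi> a (g s)) s * \<phi> s f) = 0"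
        using insert.hyps e[of f] by simp
    qed
    then show False by simp
  qed
  then obtain f where f: "\<phi> a f - (\<Sum>t\<in>A. \<phi> a (g t) * \<phi> t f) \<noteq> 0" (is "?y \<noteq> 0") by (elim exE)
  define h where "h = (\<lambda>i. (1 / ?y) * (f i - (\<Sum>t\<in>A. \<phi> t f * g t i)))"
  have h: "\<phi> s h = (1 / ?y) * (\<phi> s f - (\<Sum>t\<in>A. \<phi> t f * \<phi> s (g t)))" if "s \<in> insert a A" for s
    unfolding h_def
    by (simp only: lin_scale_vec[OF l[OF that]] lin_diff_vec[OF l[OF that]] lin_sum_vec[OF l[OF that]])
  have hA: "\<phi> s h = 0" if "s \<in> A" for s
  proof -
    have "(\<Sum>t\<in>A. \<phi> t f * \<phi> s (g t)) = (\<Sum>t\<in>A. if t = s then \<phi> t f else 0)"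
      using that by (intro sum.cong refl) (auto simp: g)
    then show ?thesis using that insert.hyps by (simp add: h)
  qed
  have ha: "\<phi> a h = 1" using f by (simp add: h mult.commute)
  define g' where "g' t = (if t = a then h else (\<lambda>i. g t i - \<phi> a (g t) * h i))" for t
  have "\<phi> s (g' t) = (if s = t then 1 else 0)" if "s \<in> insert a A" "t \<in> insert a A" for s t
  proof (cases "t = a")
    case True
    then show ?thesis using that hA ha by (auto simp: g'_def)
  next
    case False
    have "\<phi> s (g' t) = \<phi> s (g t) - \<phi> a (g t) * \<phi> s h"
      using False by (simp add: g'_def lin_diff_vec[OF l[OF that(1)]] lin_scale_vec[OF l[OF that(1)]])
    then show ?thesis using that False hA ha g by auto
  qed
  then show ?case by (intro exI[of _ g'] ballI)
qed

section \<open>Schur's lemma for matrix representations\<close>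

lemma mtrace_commute:
  assumes "A \<in> carrier_mat n m" "B \<in> carrier_mat m n"
  shows "mtrace (A * B) = mtrace (B * A)"
proof -
  have "mtrace (A * B) = (\<Sum>i<n. \<Sum>j<m. A $$ (i, j) * B $$ (j, i))"
    unfolding mtrace_def using assms by (auto simp: scalar_prod_def atLeast0LessThan intro!: sum.cong)
  also have "\<dots> = (\<Sum>j<m. \<Sum>i<n. B $$ (j, i) * A $$ (i, j))"
    by (subst sum.swap) (simp add: mult.commute)
  also have "\<dots> = mtrace (B * A)"
    unfolding mtrace_def using assms by (auto simp: scalar_prod_def atLeast0LessThan intro!: sum.cong)
  finally show ?thesis .
qed

lemma mult_mat_unit_vec:
  assumes "A \<in> carrier_mat n m" "j < m"
  shows "A *\<^sub>v unit_vec m j = (col A j :: complex vec)"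
  using assms by (intro eq_vecI) (auto simp: scalar_prod_right_unit)

lemma zero_mat_mult_vec: "v \<in> carrier_vec m \<Longrightarrow> 0\<^sub>m n m *\<^sub>v v = (0\<^sub>v n :: complex vec)"
  by (intro eq_vecI) auto

lemma smult_one_mat_mult_vec: "v \<in> carrier_vec n \<Longrightarrow> (x \<cdot>\<^sub>m 1\<^sub>m n) *\<^sub>v v = (x \<cdot>\<^sub>v v :: complex vec)"
  by (intro eq_vecI) (auto simp: row_smult[symmetric] scalar_prod_left_unit smult_scalar_prod_distrib[of _ n])

lemma mult_mat_zero_vec: "A \<in> carrier_mat n m \<Longrightarrow> A *\<^sub>v 0\<^sub>v m = (0\<^sub>v n :: complex vec)"
  by (intro eq_vecI) auto

lemma minus_vec_zeroD:
  assumes "v - w = 0\<^sub>v n" "v \<in> carrier_vec n" "w \<in> carrier_vec n"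
  shows "v = (w :: complex vec)"
proof (rule eq_vecI)
  fix i assume "i < dim_vec w"
  then show "v $ i = w $ i" using arg_cong[OF assms(1), of "\<lambda>x. x $ i"] assms(2,3) by simp
qed (use assms in auto)

lemma minus_mat_zeroD:
  assumes "A - B = 0\<^sub>m n m" "A \<in> carrier_mat n m" "B \<in> carrier_mat n m"
  shows "A = (B :: complex mat)"
proof (rule eq_matI)
  fix i j assume "i < dim_row B" "j < dim_col B"
  then show "A $$ (i, j) = B $$ (i, j)" using arg_cong[OF assms(1), of "\<lambda>x. x $$ (i, j)"] assms(2,3) by simp
qed (use assms in auto)

lemma mat_eqI_vec:
  fixes A B :: "complex mat"
  assumes "A \<in> carrier_mat n m" "B \<in> carrier_mat n m" "\<And>v. v \<in> carrier_vec m \<Longrightarrow> A *\<^sub>v v = B *\<^sub>v v"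
  shows "A = B"
proof (rule mat_col_eqI)
  fix j assume "j < dim_col B"
  then have j: "j < m" using assms by simp
  then show "col A j = col B j"
    using assms(3)[of "unit_vec m j"] mult_mat_unit_vec[OF assms(1) j] mult_mat_unit_vec[OF assms(2) j] by simp
qed (use assms in auto)

lemma drepD:
  assumes "drep H n \<rho>"
  shows "\<rho> f \<in> carrier_mat n n" "\<rho> (dmul H f g) = \<rho> f * \<rho> g" "\<rho> (dunit H) = 1\<^sub>m n"
    "\<rho> (\<lambda>i. a * f i + g i) = a \<cdot>\<^sub>m \<rho> f + \<rho> g"
  using assms by (auto simp: drep_def)

text \<open>The kernel of an intertwiner is invariant, and a nonzero intertwiner does not kill the
  whole space.\<close>

lemma intertwiner_injective:
  assumes \<rho>: "dirrep H n \<rho>" and \<sigma>: "drep H m \<sigma>" and \<Phi>: "\<Phi> \<in> carrier_mat m n" "\<Phi> \<noteq> 0\<^sub>m m n"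
    and i: "\<And>f. \<Phi> * \<rho> f = \<sigma> f * \<Phi>" and v: "v \<in> carrier_vec n" "\<Phi> *\<^sub>v v = 0\<^sub>v m"
  shows "v = 0\<^sub>v n"
proof -
  have d: "drep H n \<rho>" using \<rho> by (simp add: dirrep_def)
  let ?K = "{v \<in> carrier_vec n. \<Phi> *\<^sub>v v = 0\<^sub>v m}"
  have "inv_subspace n \<rho> ?K"
    unfolding inv_subspace_def
  proof (intro conjI ballI allI)
    show "0\<^sub>v n \<in> ?K" using \<Phi> by (auto simp: mult_mat_zero_vec)
    fix x y c assume xy: "x \<in> ?K" "y \<in> ?K"
    have "\<Phi> *\<^sub>v (c \<cdot>\<^sub>v x + y) = c \<cdot>\<^sub>v (\<Phi> *\<^sub>v x) + \<Phi> *\<^sub>v y"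
      using xy \<Phi> by (simp add: mult_add_distrib_mat_vec[of _ m n] mult_mat_vec[of _ m n])
    then show "c \<cdot>\<^sub>v x + y \<in> ?K" using xy by auto
  next
    fix f x assume x: "x \<in> ?K"
    have "\<Phi> *\<^sub>v (\<rho> f *\<^sub>v x) = \<sigma> f *\<^sub>v (\<Phi> *\<^sub>v x)"
      using x \<Phi> drepD(1)[OF d, of f] drepD(1)[OF \<sigma>, of f] i[of f]
      by (metis (no_types, lifting) assoc_mult_mat_vec mem_Collect_eq)
    also have "\<dots> = 0\<^sub>v m" using x drepD(1)[OF \<sigma>, of f] by (auto simp: mult_mat_zero_vec)
    finally show "\<rho> f *\<^sub>v x \<in> ?K" using x drepD(1)[OF d, of f] by auto
  qed auto
  then have "?K = {0\<^sub>v n} \<or> ?K = carrier_vec n" using \<rho> by (simp add: dirrep_def)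
  moreover have "?K \<noteq> carrier_vec n"
  proof
    assume K: "?K = carrier_vec n"
    have "\<Phi> = 0\<^sub>m m n"
      by (rule mat_eqI_vec[OF \<Phi>(1)]) (use K in \<open>auto simp: zero_mat_mult_vec\<close>)
    then show False using \<Phi> by simp
  qed
  ultimately show ?thesis using v by blast
qed

text \<open>The range is invariant too, so the map is onto; a right inverse is assembled from
  preimages of the unit vectors and is two-sided by injectivity.\<close>

lemma schur_equiv:
  assumes \<rho>: "dirrep H n \<rho>" and \<sigma>: "dirrep H m \<sigma>" and \<Phi>: "\<Phi> \<in> carrier_mat m n" "\<Phi> \<noteq> 0\<^sub>m m n"
    and i: "\<And>f. \<Phi> * \<rho> f = \<sigma> f * \<Phi>"
  shows "rep_equiv m \<sigma> n \<rho>"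
proof -
  have d: "drep H n \<rho>" "drep H m \<sigma>" using \<rho> \<sigma> by (simp_all add: dirrep_def)
  let ?R = "{\<Phi> *\<^sub>v v | v. v \<in> carrier_vec n}"
  have "inv_subspace m \<sigma> ?R"
    unfolding inv_subspace_def
  proof (intro conjI ballI allI)
    show "?R \<subseteq> carrier_vec m" using \<Phi> by auto
    have "\<Phi> *\<^sub>v 0\<^sub>v n = 0\<^sub>v m" using \<Phi> by (simp add: mult_mat_zero_vec)
    then show "0\<^sub>v m \<in> ?R" by (metis (mono_tags, lifting) mem_Collect_eq zero_carrier_vec)
    fix x y c assume "x \<in> ?R" "y \<in> ?R"
    then obtain v w where vw: "x = \<Phi> *\<^sub>v v" "y = \<Phi> *\<^sub>v w" "v \<in> carrier_vec n" "w \<in> carrier_vec n" by auto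
    have "c \<cdot>\<^sub>v x + y = \<Phi> *\<^sub>v (c \<cdot>\<^sub>v v + w)"
      using vw \<Phi> by (simp add: mult_add_distrib_mat_vec[of _ m n] mult_mat_vec[of _ m n])
    then show "c \<cdot>\<^sub>v x + y \<in> ?R" using vw by (auto intro!: exI[of _ "c \<cdot>\<^sub>v v + w"])
  next
    fix f x assume "x \<in> ?R"
    then obtain v where v: "x = \<Phi> *\<^sub>v v" "v \<in> carrier_vec n" by auto
    have "\<sigma> f *\<^sub>v x = \<Phi> *\<^sub>v (\<rho> f *\<^sub>v v)"
      using assoc_mult_mat_vec[OF \<Phi>(1) drepD(1)[OF d(1)] v(2), of f]
        assoc_mult_mat_vec[OF drepD(1)[OF d(2)] \<Phi>(1) v(2), of f] i[of f] v(1) by simp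
    then show "\<sigma> f *\<^sub>v x \<in> ?R" using v drepD(1)[OF d(1), of f] by (auto intro!: exI[of _ "\<rho> f *\<^sub>v v"])
  qed
  then have "?R = {0\<^sub>v m} \<or> ?R = carrier_vec m" using \<sigma> by (simp add: dirrep_def)
  moreover have "?R \<noteq> {0\<^sub>v m}"
  proof
    assume R: "?R = {0\<^sub>v m}"
    have "\<Phi> = 0\<^sub>m m n"
    proof (rule mat_eqI_vec[OF \<Phi>(1)])
      fix v :: "complex vec" assume "v \<in> carrier_vec n"
      then have "\<Phi> *\<^sub>v v \<in> ?R" by blast
      then show "\<Phi> *\<^sub>v v = 0\<^sub>m m n *\<^sub>v v" using R \<open>v \<in> _\<close> by (auto simp: zero_mat_mult_vec)
    qed simp
    then show False using \<Phi> by simp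
  qed
  ultimately have surj: "?R = carrier_vec m" by blast
  have "\<exists>w. w \<in> carrier_vec n \<and> \<Phi> *\<^sub>v w = unit_vec m j" for j
  proof -
    have "unit_vec m j \<in> ?R" unfolding surj by simp
    then show ?thesis by auto
  qed
  then obtain w where w: "\<And>j. w j \<in> carrier_vec n" "\<And>j. \<Phi> *\<^sub>v w j = unit_vec m j" by metis
  define Q where "Q = mat n m (\<lambda>(i, j). w j $ i)"
  have Q: "Q \<in> carrier_mat n m" by (simp add: Q_def)
  have colQ: "col Q j = w j" if "j < m" for j
    using that w(1)[of j] by (intro eq_vecI) (auto simp: Q_def)
  have PQ: "\<Phi> * Q = 1\<^sub>m m"
  proof (rule mat_col_eqI)
    fix j assume "j < dim_col (1\<^sub>m m :: complex mat)"
    then have j: "j < m" by simp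
    show "col (\<Phi> * Q) j = col (1\<^sub>m m) j"
      unfolding col_mult2[OF \<Phi>(1) Q j] colQ[OF j] w(2) using j by simp
  qed (use Q \<Phi> in auto)
  have QP: "Q * \<Phi> = 1\<^sub>m n"
  proof (rule mat_eqI_vec)
    fix v :: "complex vec" assume v: "v \<in> carrier_vec n"
    have "\<Phi> *\<^sub>v ((Q * \<Phi>) *\<^sub>v v - v) = 0\<^sub>v m"
    proof -
      have "\<Phi> *\<^sub>v ((Q * \<Phi>) *\<^sub>v v - v) = \<Phi> *\<^sub>v ((Q * \<Phi>) *\<^sub>v v) - \<Phi> *\<^sub>v v"
        using v Q \<Phi> by (intro mult_minus_distrib_mat_vec) auto
      also have "\<Phi> *\<^sub>v ((Q * \<Phi>) *\<^sub>v v) = (\<Phi> * Q) *\<^sub>v (\<Phi> *\<^sub>v v)"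
        using v Q \<Phi> by (simp add: assoc_mult_mat_vec[of _ n m _ n] assoc_mult_mat_vec[of _ m n _ m])
      also have "\<dots> = \<Phi> *\<^sub>v v" using v \<Phi> PQ by simp
      finally show ?thesis using v \<Phi> by simp
    qed
    moreover have "(Q * \<Phi>) *\<^sub>v v - v \<in> carrier_vec n" using v Q \<Phi> by auto
    ultimately have "(Q * \<Phi>) *\<^sub>v v - v = 0\<^sub>v n"
      using intertwiner_injective[OF \<rho> d(2) \<Phi> i] by blast
    moreover have "(Q * \<Phi>) *\<^sub>v v \<in> carrier_vec n" using v Q \<Phi> by auto
    ultimately have "(Q * \<Phi>) *\<^sub>v v = v" using v by (rule minus_vec_zeroD)
    then show "(Q * \<Phi>) *\<^sub>v v = 1\<^sub>m n *\<^sub>v v" using v by simp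
  qed (use Q \<Phi> in auto)
  \<comment> \<open>Equality of the dimensions is read off from the traces of the two
    products.\<close>
  have "m = n"
  proof -
    have "mtrace (\<Phi> * Q) = mtrace (Q * \<Phi>)" by (rule mtrace_commute[OF \<Phi>(1) Q])
    then have "(of_nat m :: complex) = of_nat n" by (simp add: PQ QP mtrace_def)
    then show ?thesis by simp
  qed
  moreover have "invertible_mat \<Phi>"
    unfolding invertible_mat_def inverts_mat_def
    using \<Phi> Q PQ QP \<open>m = n\<close> by (intro conjI exI[of _ Q]) auto
  ultimately show ?thesis
    unfolding rep_equiv_def using \<Phi> i by (intro conjI exI[of _ \<Phi>]) auto
qed

text \<open>Over the complex numbers there is an eigenvalue \<open>x\<close>; the difference with
  \<open>x\<close> times the identity is an intertwiner with nonzero kernel, hence zero.\<close>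

lemma schur_scalar:
  assumes \<rho>: "dirrep H n \<rho>" and \<Phi>: "\<Phi> \<in> carrier_mat n n" and i: "\<And>f. \<Phi> * \<rho> f = \<rho> f * \<Phi>"
  shows "\<exists>x. \<Phi> = x \<cdot>\<^sub>m 1\<^sub>m n"
proof -
  have d: "drep H n \<rho>" and n: "n > 0" using \<rho> by (simp_all add: dirrep_def)
  obtain x v where v: "v \<in> carrier_vec n" "v \<noteq> 0\<^sub>v n" "\<Phi> *\<^sub>v v = x \<cdot>\<^sub>v v"
    using spectrum_non_empty[OF \<Phi> n] \<Phi> by (auto simp: spectrum_def eigenvalue_def eigenvector_def)
  let ?A = "\<Phi> - x \<cdot>\<^sub>m 1\<^sub>m n"
  have A: "?A \<in> carrier_mat n n" using \<Phi> by auto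
  have "?A * \<rho> f = \<rho> f * ?A" for f
    using \<Phi> drepD(1)[OF d, of f] i[of f]
    by (simp add: minus_mult_distrib_mat[of _ n n _ _ n] mult_minus_distrib_mat[of _ n n _ n]
        mult_smult_distrib[of _ n n _ n] mult_smult_assoc_mat[of _ n n _ n])
  moreover have "?A *\<^sub>v v = 0\<^sub>v n"
    using \<Phi> v by (simp add: minus_mult_distrib_mat_vec[of _ n n] smult_one_mat_mult_vec)
  ultimately have "?A = 0\<^sub>m n n"
    using intertwiner_injective[OF \<rho> d A] v by blast
  then have "\<Phi> = x \<cdot>\<^sub>m 1\<^sub>m n"
    by (rule minus_mat_zeroD) (use \<Phi> in auto)
  then show ?thesis by blast
qed

text \<open>A relation among matrix coefficients attaches a vector of \<open>W_b\<close> to every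
  representation \<open>b\<close> and row \<open>i\<close>, and relations form a left module. Inside
  a minimal support, one component determines the others through intertwiners; Schur's lemma makes
  these zero or scalar, and evaluation at the unit then gives 1 where a relation must give
  0.\<close>

lemma coefficients_independent:
  fixes \<psi> :: "'a::finite \<Rightarrow> 'i::finite cv \<Rightarrow> complex mat"
  assumes irr: "irr_family H n \<psi>"
    and x0: "\<And>a i. x0 (a, i) \<in> carrier_vec (n a)"
      "\<And>f. (\<Sum>a\<in>UNIV. \<Sum>i<n a. (\<psi> a f *\<^sub>v x0 (a, i)) $ i) = 0"
    and ai: "i < n a"
  shows "x0 (a, i) = 0\<^sub>v (n a)"
proof (rule ccontr)
  assume nz: "x0 (a, i) \<noteq> 0\<^sub>v (n a)"
  have irrep: "dirrep H (n a) (\<psi> a)" for a using irr by (simp add: irr_family_def)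
  then have d: "drep H (n a) (\<psi> a)" for a by (simp add: dirrep_def)
  note car = drepD(1)[OF d]
  define K where "K f x = (\<Sum>a\<in>UNIV. \<Sum>i<n a. (\<psi> a f *\<^sub>v x (a, i)) $ i)" for f x
  define J where "J = {x. (\<forall>a i. x (a, i) \<in> carrier_vec (n a)) \<and> (\<forall>f. K f x = 0)}"
  define T where "T = (SIGMA a:(UNIV :: 'a set). {..<n a})"
  define supp where "supp x = {t \<in> T. x t \<noteq> 0\<^sub>v (n (fst t))}" for x :: "'a \<times> nat \<Rightarrow> complex vec"
  have finT: "finite T" by (auto simp: T_def)
  have fins: "finite (supp x)" for x using finT by (simp add: supp_def)
  have "x0 \<in> J \<and> supp x0 \<noteq> {}"
    using x0 nz ai by (auto simp: J_def K_def supp_def T_def)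
  then have "\<exists>x. (x \<in> J \<and> supp x \<noteq> {}) \<and> (\<forall>y. y \<in> J \<and> supp y \<noteq> {} \<longrightarrow> card (supp x) \<le> card (supp y))"
    using ex_has_least_nat[of "\<lambda>y. y \<in> J \<and> supp y \<noteq> {}" x0 "\<lambda>y. card (supp y)"] by simp
  then obtain x where x: "x \<in> J" "supp x \<noteq> {}"
    and xmin: "\<And>y. y \<in> J \<Longrightarrow> supp y \<noteq> {} \<Longrightarrow> card (supp x) \<le> card (supp y)"
    by blast
  obtain a0 i0 where t0: "(a0, i0) \<in> supp x" using x(2) by auto
  then have i0: "i0 < n a0" by (auto simp: supp_def T_def)
  define J0 where "J0 = {y \<in> J. supp y \<subseteq> supp x}"
  have J0car: "y (b, i) \<in> carrier_vec (n b)" if "y \<in> J0" for y b i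
    using that by (simp add: J0_def J_def)
  have K0: "K f y = 0" if "y \<in> J0" for f y
    using that by (simp add: J0_def J_def)
  have vanish: "y (b, i) = 0\<^sub>v (n b)" if "y \<in> J0" "i < n b" "(b, i) \<notin> supp x" for y b i
  proof (rule ccontr)
    assume "y (b, i) \<noteq> 0\<^sub>v (n b)"
    then have "(b, i) \<in> supp y" using that(2) by (simp add: supp_def T_def)
    then show False using that by (auto simp: J0_def)
  qed
  have J0I: "y \<in> J0" if "\<And>b i. y (b, i) \<in> carrier_vec (n b)" "\<And>f. K f y = 0"
    "\<And>b i. i < n b \<Longrightarrow> (b, i) \<notin> supp x \<Longrightarrow> y (b, i) = 0\<^sub>v (n b)" for y
  proof -
    have "supp y \<subseteq> supp x"
    proof
      fix t assume t: "t \<in> supp y"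
      obtain b i where bi: "t = (b, i)" by (cases t)
      then have "i < n b" "y (b, i) \<noteq> 0\<^sub>v (n b)" using t by (simp_all add: supp_def T_def)
      then show "t \<in> supp x" using that(3)[of i b] bi by metis
    qed
    then show ?thesis using that(1,2) by (simp add: J0_def J_def)
  qed
  have lincomb: "(\<lambda>t. c \<cdot>\<^sub>v y t + y' t) \<in> J0" if y: "y \<in> J0" "y' \<in> J0" for c y y'
  proof (rule J0I)
    fix b i show "c \<cdot>\<^sub>v y (b, i) + y' (b, i) \<in> carrier_vec (n b)" using J0car y by auto
  next
    fix f
    have "(\<psi> b f *\<^sub>v (c \<cdot>\<^sub>v y (b, i) + y' (b, i))) $ i = c * (\<psi> b f *\<^sub>v y (b, i)) $ i + (\<psi> b f *\<^sub>v y' (b, i)) $ i"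
      if "i < n b" for b i
      using that car[of b f] J0car[OF y(1), of b i] J0car[OF y(2), of b i]
      by (simp add: mult_add_distrib_mat_vec[of _ "n b" "n b"] mult_mat_vec[of _ "n b" "n b"])
    then have "K f (\<lambda>t. c \<cdot>\<^sub>v y t + y' t) = c * K f y + K f y'"
      unfolding K_def by (simp add: sum.distrib sum_distrib_left)
    then show "K f (\<lambda>t. c \<cdot>\<^sub>v y t + y' t) = 0" using K0 y by simp
  next
    fix b i assume "i < n b" "(b, i) \<notin> supp x"
    then have "y (b, i) = 0\<^sub>v (n b)" "y' (b, i) = 0\<^sub>v (n b)" using vanish[OF y(1)] vanish[OF y(2)] by blast+
    then show "c \<cdot>\<^sub>v y (b, i) + y' (b, i) = 0\<^sub>v (n b)" by (intro eq_vecI) auto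
  qed
  have act: "(\<lambda>t. \<psi> (fst t) g *\<^sub>v y t) \<in> J0" if y: "y \<in> J0" for g y
  proof (rule J0I)
    fix b i show "\<psi> (fst (b, i)) g *\<^sub>v y (b, i) \<in> carrier_vec (n b)"
      using J0car[OF y, of b i] car[of b g] by auto
  next
    fix f
    have "\<psi> b f *\<^sub>v (\<psi> b g *\<^sub>v y (b, i)) = \<psi> b (dmul H f g) *\<^sub>v y (b, i)" for b i
      unfolding drepD(2)[OF d] by (rule assoc_mult_mat_vec[OF car car J0car[OF y], symmetric])
    then have "K f (\<lambda>t. \<psi> (fst t) g *\<^sub>v y t) = K (dmul H f g) y" by (simp add: K_def)
    then show "K f (\<lambda>t. \<psi> (fst t) g *\<^sub>v y t) = 0" using K0[OF y] by simp
  next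
    fix b i assume "i < n b" "(b, i) \<notin> supp x"
    then have "y (b, i) = 0\<^sub>v (n b)" by (rule vanish[OF y])
    then show "\<psi> (fst (b, i)) g *\<^sub>v y (b, i) = 0\<^sub>v (n b)"
      using mult_mat_zero_vec[OF car] by simp
  qed
  have xJ0: "x \<in> J0" using x by (simp add: J0_def)
  \<comment> \<open>A zero at \<open>(a0, i0)\<close> makes the support strictly smaller, so
    minimality leaves only the zero relation.\<close>
  have key: "y (b, i) = 0\<^sub>v (n b)" if y: "y \<in> J0" "y (a0, i0) = 0\<^sub>v (n a0)" and i: "i < n b" for y b i
  proof -
    have "(a0, i0) \<notin> supp y" "supp y \<subseteq> supp x" using y by (simp_all add: supp_def J0_def)
    then have "supp y \<subset> supp x" using t0 by blast
    then have "card (supp y) < card (supp x)" by (rule psubset_card_mono[OF fins])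
    then have "supp y = {}" using xmin[of y] y by (auto simp: J0_def)
    then show ?thesis using i by (auto simp: supp_def T_def)
  qed
  let ?U = "(\<lambda>y. y (a0, i0)) ` J0"
  have "inv_subspace (n a0) (\<psi> a0) ?U"
    unfolding inv_subspace_def
  proof (intro conjI ballI allI)
    show "?U \<subseteq> carrier_vec (n a0)" using J0car by auto
    have "(\<lambda>t. 0\<^sub>v (n (fst t))) \<in> J0"
    proof (rule J0I)
      fix f
      have "(\<psi> a f *\<^sub>v 0\<^sub>v (n a)) $ i = 0" if "i < n a" for a i
        using mult_mat_zero_vec[OF car] that by simp
      then show "K f (\<lambda>t. 0\<^sub>v (n (fst t))) = 0" unfolding K_def by simp
    qed auto
    then show "0\<^sub>v (n a0) \<in> ?U" by (rule rev_image_eqI) simp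
    fix v w c assume "v \<in> ?U" "w \<in> ?U"
    then obtain y y' where y: "y \<in> J0" "y' \<in> J0" "v = y (a0, i0)" "w = y' (a0, i0)" by auto
    show "c \<cdot>\<^sub>v v + w \<in> ?U" by (rule rev_image_eqI[OF lincomb[OF y(1,2), of c]]) (simp add: y)
  next
    fix f v assume "v \<in> ?U"
    then obtain y where y: "y \<in> J0" "v = y (a0, i0)" by auto
    show "\<psi> a0 f *\<^sub>v v \<in> ?U" by (rule rev_image_eqI[OF act[OF y(1), of f]]) (simp add: y)
  qed
  then have "?U = {0\<^sub>v (n a0)} \<or> ?U = carrier_vec (n a0)" using irrep[of a0] by (simp add: dirrep_def)
  moreover have "x (a0, i0) \<in> ?U" "x (a0, i0) \<noteq> 0\<^sub>v (n a0)" using xJ0 t0 by (auto simp: supp_def)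
  ultimately have U: "?U = carrier_vec (n a0)" by blast
  have "\<exists>y\<in>J0. y (a0, i0) = unit_vec (n a0) j" for j
  proof -
    have "unit_vec (n a0) j \<in> ?U" unfolding U by simp
    then show ?thesis by auto
  qed
  then obtain Y where Y: "\<And>j. Y j \<in> J0" "\<And>j. Y j (a0, i0) = unit_vec (n a0) j" by metis
  define \<Phi> where "\<Phi> t = mat (n (fst t)) (n a0) (\<lambda>(r, j). Y j t $ r)" for t
  have \<Phi>car: "\<Phi> (b, i) \<in> carrier_mat (n b) (n a0)" for b i by (simp add: \<Phi>_def)
  have col\<Phi>: "col (\<Phi> (b, i)) j = Y j (b, i)" if "j < n a0" for b i j
    using that J0car[OF Y(1)[of j], of b i] by (intro eq_vecI) (auto simp: \<Phi>_def)
  have L: "(\<lambda>t. \<Phi> t *\<^sub>v v) \<in> J0" if v: "v \<in> carrier_vec (n a0)" for v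
  proof (rule J0I)
    fix b i show "\<Phi> (b, i) *\<^sub>v v \<in> carrier_vec (n b)" by (rule mult_mat_vec_carrier[OF \<Phi>car v])
  next
    fix f
    have "(\<psi> b f *\<^sub>v (\<Phi> (b, i) *\<^sub>v v)) $ i = (\<Sum>j<n a0. (\<psi> b f *\<^sub>v Y j (b, i)) $ i * v $ j)" if i: "i < n b" for b i
    proof -
      have "\<psi> b f *\<^sub>v (\<Phi> (b, i) *\<^sub>v v) = (\<psi> b f * \<Phi> (b, i)) *\<^sub>v v"
        by (rule assoc_mult_mat_vec[OF car \<Phi>car v, symmetric])
      then have "(\<psi> b f *\<^sub>v (\<Phi> (b, i) *\<^sub>v v)) $ i = row (\<psi> b f * \<Phi> (b, i)) i \<bullet> v"
        using i car[of b f] by simp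
      also have "\<dots> = (\<Sum>j<n a0. col (\<psi> b f * \<Phi> (b, i)) j $ i * v $ j)"
        using i v car[of b f] \<Phi>car[of b i] by (simp add: scalar_prod_def atLeast0LessThan)
      also have "\<dots> = (\<Sum>j<n a0. (\<psi> b f *\<^sub>v Y j (b, i)) $ i * v $ j)"
        by (intro sum.cong refl) (simp add: col_mult2[OF car \<Phi>car] col\<Phi> del: col_mult)
      finally show ?thesis .
    qed
    then have "K f (\<lambda>t. \<Phi> t *\<^sub>v v) = (\<Sum>b\<in>UNIV. \<Sum>i<n b. \<Sum>j<n a0. (\<psi> b f *\<^sub>v Y j (b, i)) $ i * v $ j)"
      unfolding K_def by (intro sum.cong refl) simp
    also have "\<dots> = (\<Sum>j<n a0. \<Sum>b\<in>UNIV. \<Sum>i<n b. (\<psi> b f *\<^sub>v Y j (b, i)) $ i * v $ j)"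
      by (rule sym, subst sum.swap, rule sum.cong[OF refl], rule sum.swap)
    also have "\<dots> = (\<Sum>j<n a0. K f (Y j) * v $ j)" unfolding K_def by (simp add: sum_distrib_right)
    finally show "K f (\<lambda>t. \<Phi> t *\<^sub>v v) = 0" using K0 Y(1) by simp
  next
    fix b i assume bi: "i < n b" "(b, i) \<notin> supp x"
    have "\<Phi> (b, i) = 0\<^sub>m (n b) (n a0)"
      by (rule eq_matI) (use vanish[OF Y(1) bi] in \<open>auto simp: \<Phi>_def\<close>)
    then show "\<Phi> (b, i) *\<^sub>v v = 0\<^sub>v (n b)" using zero_mat_mult_vec[OF v] by simp
  qed
  have \<Phi>0: "\<Phi> (a0, i0) = 1\<^sub>m (n a0)"
    by (rule eq_matI) (auto simp: \<Phi>_def Y(2))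
  \<comment> \<open>The relation generated by \<open>\<Phi>\<close> from the component of
    \<open>y\<close> agrees with \<open>y\<close> at \<open>(a0, i0)\<close>, and by
    \<open>key\<close> everywhere in range.\<close>
  have y\<Phi>: "y (b, i) = \<Phi> (b, i) *\<^sub>v y (a0, i0)" if y: "y \<in> J0" and i: "i < n b" for y b i
  proof -
    let ?v = "y (a0, i0)"
    have v: "?v \<in> carrier_vec (n a0)" by (rule J0car[OF y])
    have "(-1) \<cdot>\<^sub>v (\<Phi> (b, i) *\<^sub>v ?v) + y (b, i) = 0\<^sub>v (n b)"
    proof (rule key[OF lincomb[OF L[OF v] y, of "-1"] _ i])
      show "- 1 \<cdot>\<^sub>v (\<Phi> (a0, i0) *\<^sub>v y (a0, i0)) + y (a0, i0) = 0\<^sub>v (n a0)"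
        using v by (intro eq_vecI) (auto simp: \<Phi>0)
    qed
    moreover have "(-1) \<cdot>\<^sub>v (\<Phi> (b, i) *\<^sub>v ?v) + y (b, i) = y (b, i) - \<Phi> (b, i) *\<^sub>v ?v"
      using v \<Phi>car[of b i] J0car[OF y, of b i] by (intro eq_vecI) auto
    ultimately have "y (b, i) - \<Phi> (b, i) *\<^sub>v ?v = 0\<^sub>v (n b)" by simp
    then show ?thesis
      by (rule minus_vec_zeroD[OF _ J0car[OF y] mult_mat_vec_carrier[OF \<Phi>car v]])
  qed
  have inter: "\<Phi> (b, i) * \<psi> a0 g = \<psi> b g * \<Phi> (b, i)" if i: "i < n b" for b i g
  proof (rule mat_eqI_vec)
    fix v :: "complex vec" assume v: "v \<in> carrier_vec (n a0)"
    have "\<psi> b g *\<^sub>v (\<Phi> (b, i) *\<^sub>v v) = \<Phi> (b, i) *\<^sub>v (\<psi> a0 g *\<^sub>v v)"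
      using y\<Phi>[OF act[OF L[OF v], of g] i] v by (simp add: \<Phi>0)
    then show "(\<Phi> (b, i) * \<psi> a0 g) *\<^sub>v v = (\<psi> b g * \<Phi> (b, i)) *\<^sub>v v"
      using assoc_mult_mat_vec[OF \<Phi>car car v] assoc_mult_mat_vec[OF car \<Phi>car v] by simp
  qed (use car[of a0 g] car[of b g] \<Phi>car[of b i] in auto)
  have scal: "b = a0 \<and> (\<exists>s. \<Phi> (b, i) = s \<cdot>\<^sub>m 1\<^sub>m (n a0))" if t: "(b, i) \<in> supp x" for b i
  proof -
    have i: "i < n b" using t by (auto simp: supp_def T_def)
    have "\<Phi> (b, i) \<noteq> 0\<^sub>m (n b) (n a0)"
      using y\<Phi>[OF xJ0 i] t zero_mat_mult_vec[OF J0car[OF xJ0]] by (auto simp: supp_def)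
    then have "rep_equiv (n b) (\<psi> b) (n a0) (\<psi> a0)"
      using schur_equiv[OF irrep irrep \<Phi>car _ inter[OF i]] by blast
    then have b: "b = a0" using irr by (auto simp: irr_family_def)
    then show ?thesis using schur_scalar[OF irrep \<Phi>car[of a0 i]] inter i by blast
  qed
  \<comment> \<open>Within \<open>a0\<close> every component of \<open>Y i0\<close> is a multiple of
    the unit vector \<open>i0\<close>, so in row \<open>i\<close> it contributes only for
    \<open>i = i0\<close>.\<close>
  have val: "(\<psi> b (dunit H) *\<^sub>v Y i0 (b, i)) $ i = (if b = a0 \<and> i = i0 then 1 else 0)" if i: "i < n b" for b i
  proof -
    have 1: "\<psi> b (dunit H) *\<^sub>v Y i0 (b, i) = Y i0 (b, i)"
      using J0car[OF Y(1)[of i0], of b i] by (simp add: drepD(3)[OF d])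
    show ?thesis
    proof (cases "(b, i) \<in> supp x")
      case False
      then show ?thesis using vanish[OF Y(1) i] t0 i unfolding 1 by auto
    next
      case True
      then obtain s where b: "b = a0" and s: "\<Phi> (a0, i) = s \<cdot>\<^sub>m 1\<^sub>m (n a0)" using scal by blast
      have "Y i0 (a0, i) = s \<cdot>\<^sub>v unit_vec (n a0) i0"
        using y\<Phi>[OF Y(1)[of i0], of i a0] i by (simp add: b s Y(2) smult_one_mat_mult_vec)
      then show ?thesis
        unfolding 1 using i i0 Y(2)[of i0] by (cases "i = i0") (simp_all add: b)
    qed
  qed
  have "K (dunit H) (Y i0) = (\<Sum>b\<in>UNIV. \<Sum>i<n b. if b = a0 \<and> i = i0 then 1 else 0)"
    unfolding K_def by (intro sum.cong refl) (simp add: val)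
  also have "\<dots> = (\<Sum>b\<in>UNIV. if b = a0 then 1 else 0)"
    using i0 by (intro sum.cong refl) auto
  finally show False using K0[OF Y(1)] by simp
qed

lemma lin_rep_entry:
  assumes "drep H n \<rho>" "i < n" "j < n"
  shows "lin (\<lambda>f. \<rho> f $$ (i, j))"
  unfolding lin_def using drepD(1,4)[OF assms(1)] assms(2,3)
  by (metis (no_types, lifting) carrier_matD(1) carrier_matD(2) index_add_mat(1) index_smult_mat(1) index_smult_mat(2) index_smult_mat(3))

text \<open>Independent coefficients admit a biorthogonal system of algebra elements, and these are
  the matrix units.\<close>

lemma exists_matrix_units:
  fixes \<psi> :: "'a::finite \<Rightarrow> 'i::finite cv \<Rightarrow> complex mat"
  assumes irr: "irr_family H n \<psi>"
  shows "\<exists>E. \<forall>a i j b r l. i < n a \<longrightarrow> j < n a \<longrightarrow> r < n b \<longrightarrow> l < n b \<longrightarrow>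
    \<psi> b (E a i j) $$ (r, l) = (if a = b \<and> i = r \<and> j = l then 1 else 0)"
proof -
  have d: "drep H (n a) (\<psi> a)" for a using irr by (simp add: irr_family_def dirrep_def)
  define A where "A = (SIGMA a:(UNIV :: 'a set). {..<n a} \<times> {..<n a})"
  define \<phi> where "\<phi> = (\<lambda>(a, i, j) f. \<psi> a f $$ (i, j))"
  have "\<exists>g. \<forall>s\<in>A. \<forall>t\<in>A. \<phi> s (g t) = (if s = t then 1 else 0)"
  proof (rule dual_vectors)
    show "finite A" by (auto simp: A_def)
    show "lin (\<phi> s)" if "s \<in> A" for s
      using that lin_rep_entry[OF d] by (auto simp: A_def \<phi>_def)
    fix x assume x: "\<And>f. (\<Sum>s\<in>A. x s * \<phi> s f) = 0"
    define x0 where "x0 = (\<lambda>(a, i). vec (n a) (\<lambda>j. x (a, i, j)))"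
    have x00: "x0 (a, i) = 0\<^sub>v (n a)" if "i < n a" for a i
    proof (rule coefficients_independent[OF irr _ _ that])
      show "x0 (a, i) \<in> carrier_vec (n a)" for a i by (simp add: x0_def)
      fix f
      have "(\<psi> a f *\<^sub>v x0 (a, i)) $ i = (\<Sum>j<n a. x (a, i, j) * \<psi> a f $$ (i, j))" if "i < n a" for a i
        using drepD(1)[OF d, of a f] that
        by (simp add: x0_def scalar_prod_def atLeast0LessThan mult.commute)
      then have "(\<Sum>a\<in>UNIV. \<Sum>i<n a. (\<psi> a f *\<^sub>v x0 (a, i)) $ i) =
        (\<Sum>a\<in>UNIV. \<Sum>i<n a. \<Sum>j<n a. x (a, i, j) * \<psi> a f $$ (i, j))"
        by (intro sum.cong refl) simp
      also have "\<dots> = (\<Sum>s\<in>A. x s * \<phi> s f)"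
        unfolding A_def \<phi>_def by (simp add: sum.Sigma sum.cartesian_product case_prod_beta)
      finally show "(\<Sum>a\<in>UNIV. \<Sum>i<n a. (\<psi> a f *\<^sub>v x0 (a, i)) $ i) = 0" using x by simp
    qed
    have "x (a, i, j) = 0" if "i < n a" "j < n a" for a i j
      using arg_cong[OF x00[OF that(1)], of "\<lambda>v. v $ j"] that by (simp add: x0_def)
    then show "\<forall>s\<in>A. x s = 0" by (auto simp: A_def)
  qed
  then obtain g where g: "\<forall>s\<in>A. \<forall>t\<in>A. \<phi> s (g t) = (if s = t then 1 else 0)" by (elim exE)
  show ?thesis
  proof (rule exI[of _ "\<lambda>a i j. g (a, i, j)"], intro allI impI)
    fix a b :: 'a and i j r l assume "i < n a" "j < n a" "r < n b" "l < n b"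
    then have "(b, r, l) \<in> A" "(a, i, j) \<in> A" by (simp_all add: A_def)
    then have "\<phi> (b, r, l) (g (a, i, j)) = (if (b, r, l) = (a, i, j) then 1 else 0)" using g by blast
    then show "\<psi> b (g (a, i, j)) $$ (r, l) = (if a = b \<and> i = r \<and> j = l then 1 else 0)"
      unfolding \<phi>_def by auto
  qed
qed

section \<open>Irreducible representations of a semisimple algebra separate its elements\<close>

lemma linv_dmul: "linv (dmul H f)" "linv (\<lambda>f. dmul H f g)"
  by (rule linvI, simp add: lin_def dmul_def algebra_simps sum.distrib sum_distrib_left)+

lemma sum_fun_apply: "(sum f A) x = (\<Sum>a\<in>A. f a x)" for f :: "'s \<Rightarrow> 'i \<Rightarrow> complex"
  by (induction A rule: infinite_finite_induct) auto

text \<open>Supplies bases and dimensions of subspaces, needed to choose a left ideal of least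
  dimension and to represent it by matrices.\<close>

lemma fin_dim_cv:
  "finite_dimensional_vector_space (\<lambda>(c::complex) (f::'i::finite cv) i. c * f i) (range bas)"
proof -
  interpret vs: vector_space "\<lambda>(c::complex) (f::'i cv) i. c * f i"
    by unfold_locales (auto simp: fun_eq_iff algebra_simps)
  have inj: "inj (bas :: 'i \<Rightarrow> 'i cv)"
    by (rule injI) (metis bas_def zero_neq_one)
  show ?thesis
  proof unfold_locales
    show "finite (range bas :: 'i cv set)" by simp
    show "vs.independent (range bas)"
    proof (rule vs.independent_if_scalars_zero)
      fix w :: "'i cv \<Rightarrow> complex" and x :: "'i cv" assume w: "(\<Sum>v\<in>range bas. (\<lambda>i. w v * v i)) = 0" and "x \<in> range bas"
      then obtain j where j: "x = bas j" by blast
      have bas: "(\<Sum>i\<in>UNIV. w' i * bas i j) = w' j" for w' :: "'i \<Rightarrow> complex"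
        by (simp add: bas_def sum_delta_mult)
      have "0 = (\<Sum>v\<in>range bas. (\<lambda>i. w v * v i)) j" using w by simp
      also have "\<dots> = (\<Sum>i\<in>UNIV. w (bas i) * bas i j)"
        unfolding sum_fun_apply by (simp add: sum.reindex[OF inj])
      also have "\<dots> = w (bas j)" by (rule bas)
      finally show "w x = 0" using j by simp
    qed simp
    show "vs.span (range bas) = UNIV"
    proof (intro equalityI subset_UNIV subsetI)
      fix f :: "'i cv"
      have "f = (\<Sum>i\<in>UNIV. (\<lambda>j. f i * bas i j))"
        by (rule ext) (simp add: sum_fun_apply bas_def sum_delta_mult)
      also have "\<dots> \<in> vs.span (range bas)"
        by (intro vs.span_sum vs.span_scale vs.span_base rangeI)
      finally show "f \<in> vs.span (range bas)" .
    qed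
  qed
qed

text \<open>A nonzero common kernel contains a nonzero left ideal \<open>M\<close> of least
  dimension. Semisimplicity splits the unit as \<open>y + z\<close> along \<open>M\<close>, so
  \<open>y\<close> is a right unit of \<open>M\<close>. Left multiplication makes \<open>M\<close>
  an irreducible representation, hence equivalent to some \<open>\<psi> a\<close>; but
  \<open>y\<close> lies in the kernel and acts as zero, so \<open>y = y y = 0\<close> and
  \<open>M\<close> vanishes.\<close>

lemma irreps_separate:
  fixes \<psi> :: "'a \<Rightarrow> 'i::finite cv \<Rightarrow> complex mat"
  assumes irr: "irr_family H n \<psi>" and ss: "dsemisimple H"
    and assoc: "\<And>f g h. dmul H (dmul H f g) h = dmul H f (dmul H g h)"
    and unit: "\<And>f. dmul H (dunit H) f = f" "\<And>f. dmul H f (dunit H) = f"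
    and f0: "\<And>a. \<psi> a f0 = 0\<^sub>m (n a) (n a)"
  shows "f0 = (\<lambda>i. 0)"
proof (rule ccontr)
  assume nz: "f0 \<noteq> (\<lambda>i. 0)"
  interpret vs: finite_dimensional_vector_space "\<lambda>(c::complex) (f::'i cv) i. c * f i" "range bas"
    by (rule fin_dim_cv)
  have d: "drep H (n a) (\<psi> a)" for a using irr by (simp add: irr_family_def dirrep_def)
  have zero: "0 = (\<lambda>i::'i. 0::complex)" by (simp add: fun_eq_iff)
  have sub: "vs.subspace L" if "csubspace L" for L
  proof -
    have 0: "(\<lambda>i. 0) \<in> L" and lc: "\<And>a b c. a \<in> L \<Longrightarrow> b \<in> L \<Longrightarrow> (\<lambda>i. c * a i + b i) \<in> L"
      using that by (auto simp: csubspace_def)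
    show ?thesis
    proof (rule vs.subspaceI)
      show "0 \<in> L" using 0 by (simp add: zero)
      show "x + y \<in> L" if "x \<in> L" "y \<in> L" for x y
        using lc[OF that, of 1] by (simp add: plus_fun_def)
      show "(\<lambda>i. c * x i) \<in> L" if "x \<in> L" for c x
        using lc[OF that 0, of c] by simp
    qed
  qed
  let ?I = "{f. \<forall>a. \<psi> a f = 0\<^sub>m (n a) (n a)}"
  have 0: "\<psi> a (\<lambda>i. 0) = 0\<^sub>m (n a) (n a)" for a
  proof -
    have "\<psi> a (\<lambda>i. (-1) * f0 i + f0 i) = (-1) \<cdot>\<^sub>m \<psi> a f0 + \<psi> a f0" by (rule drepD(4)[OF d])
    then show ?thesis by (simp add: f0)
  qed
  have Iideal: "dleft_ideal H ?I"
    unfolding dleft_ideal_def csubspace_def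
  proof (intro conjI ballI allI impI)
    show "(\<lambda>_. 0) \<in> ?I" using 0 by simp
    show "(\<lambda>i. c * a i + b i) \<in> ?I" if "a \<in> ?I" "b \<in> ?I" for a b c
      using that drepD(4)[OF d] by auto
    show "dmul H f x \<in> ?I" if "x \<in> ?I" for f x
      using that drepD(2)[OF d] drepD(1)[OF d, of _ f] by (auto intro!: right_mult_zero_mat)
  qed
  define P where "P L \<longleftrightarrow> dleft_ideal H L \<and> L \<subseteq> ?I \<and> L \<noteq> {\<lambda>i. 0}" for L
  have "P ?I" using Iideal nz f0 by (auto simp: P_def)
  then obtain M where M: "P M" and Mmin: "\<And>L. P L \<Longrightarrow> vs.dim M \<le> vs.dim L"
    using ex_has_least_nat[of P ?I vs.dim] by blast
  have Mid: "dleft_ideal H M" and MI: "M \<subseteq> ?I" and Mnz: "M \<noteq> {\<lambda>i. 0}" using M by (auto simp: P_def)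
  have Msub: "vs.subspace M" using Mid sub by (simp add: dleft_ideal_def)
  have Mmul: "dmul H f x \<in> M" if "x \<in> M" for f x using Mid that by (simp add: dleft_ideal_def)
  have min: "L = M" if "dleft_ideal H L" "L \<subseteq> M" "L \<noteq> {\<lambda>i. 0}" for L
  proof (rule vs.subspace_dim_equal[OF _ Msub that(2)])
    show "vs.subspace L" using that sub by (simp add: dleft_ideal_def)
    show "vs.dim M \<le> vs.dim L" using that MI by (intro Mmin) (auto simp: P_def)
  qed
  obtain M' y z where M': "dleft_ideal H M'" "M \<inter> M' = {\<lambda>_. 0}" and yz: "y \<in> M" "z \<in> M'" "dunit H = (\<lambda>i. y i + z i)"
    using ss Mid unfolding dsemisimple_def by meson
  \<comment> \<open>The difference of \<open>x\<close> and \<open>x y\<close> is \<open>x z\<close>,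
    which lies both in \<open>M\<close> and in its complement.\<close>
  have idem: "x = dmul H x y" if x: "x \<in> M" for x
  proof -
    have "x = dmul H x (\<lambda>i. y i + z i)" using unit(2)[of x] by (simp only: yz(3))
    also have "\<dots> = (\<lambda>i. dmul H x y i + dmul H x z i)"
      using linvD[OF linv_dmul(1)[of H x], of 1 y z] by simp
    finally have eq: "x = (\<lambda>i. dmul H x y i + dmul H x z i)" .
    have xz: "dmul H x z \<in> M'" using M'(1) yz(2) by (simp add: dleft_ideal_def)
    have "(\<lambda>i. (-1) * dmul H x y i + x i) \<in> M"
      using Mid Mmul[OF yz(1)] x unfolding dleft_ideal_def csubspace_def by blast
    moreover have "(\<lambda>i. (-1) * dmul H x y i + x i) = dmul H x z"
      using fun_cong[OF eq] by (simp add: fun_eq_iff algebra_simps)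
    ultimately have "dmul H x z = (\<lambda>_. 0)" using xz M'(2) by auto
    then show ?thesis using eq by simp
  qed
  obtain Bs where Bs: "Bs \<subseteq> M" "vs.independent Bs" "M \<subseteq> vs.span Bs" "card Bs = vs.dim M"
    using vs.basis_exists[of M] by blast
  have span: "vs.span Bs = M" using Bs Msub vs.span_minimal by blast
  have finB: "finite Bs" by (rule vs.finiteI_independent[OF Bs(2)])
  define r where "r = card Bs"
  obtain h where h: "bij_betw h {..<r} Bs"
    using ex_bij_betw_nat_finite[OF finB] by (auto simp: r_def atLeast0LessThan)
  have hM: "h j \<in> M" if "j < r" for j using h that Bs(1) by (auto simp: bij_betw_def)
  define co where "co v i = vs.representation Bs v (h i)" for v i
  have co_lin: "co (\<lambda>k. a * v k + w k) i = a * co v i + co w i" if "v \<in> M" "w \<in> M" for a v w i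
    using vs.representation_add[OF Bs(2), of w "\<lambda>k. a * v k"] vs.representation_scale[OF Bs(2), of v a] that
      vs.subspace_scale[OF Msub that(1), of a]
    by (simp add: co_def span plus_fun_def)
  have co_expand: "v = (\<lambda>k. \<Sum>i<r. co v i * h i k)" if "v \<in> M" for v
  proof -
    have "(\<Sum>b\<in>Bs. (\<lambda>i. vs.representation Bs v b * b i)) = v"
      using vs.sum_representation_eq[OF Bs(2) _ finB subset_refl] that by (simp add: span)
    moreover have "(\<Sum>b\<in>Bs. (\<lambda>i. vs.representation Bs v b * b i)) k = (\<Sum>i<r. co v i * h i k)" for k
      unfolding sum_fun_apply sum.reindex_bij_betw[OF h, symmetric] co_def ..
    ultimately show ?thesis by auto
  qed
  have co_h: "co (h j) i = (if i = j then 1 else 0)" if "i < r" "j < r" for i j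
    using vs.representation_basis[OF Bs(2), of "h j"] h that
    by (auto simp: co_def bij_betw_def inj_on_def)
  have comb: "(\<lambda>k. \<Sum>i\<in>A. w i * h i k) \<in> M" if "A \<subseteq> {..<r}" for w A
  proof -
    have "(\<Sum>i\<in>A. (\<lambda>k. w i * h i k)) \<in> M"
      by (intro vs.subspace_sum[OF Msub] vs.subspace_scale[OF Msub] hM) (use that in auto)
    moreover have "(\<Sum>i\<in>A. (\<lambda>k. w i * h i k)) = (\<lambda>k. \<Sum>i\<in>A. w i * h i k)" by (rule ext) (rule sum_fun_apply)
    ultimately show ?thesis by simp
  qed
  have co_comb: "co (\<lambda>k. \<Sum>l<r. w l * h l k) i = w i" if i: "i < r" for w i
  proof -
    have "A \<subseteq> {..<r} \<Longrightarrow> co (\<lambda>k. \<Sum>l\<in>A. w l * h l k) i = (\<Sum>l\<in>A. w l * co (h l) i)" if "finite A" for A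
      using that
    proof (induction A rule: finite_induct)
      case empty
      show ?case using vs.representation_zero[of Bs] by (simp add: co_def zero)
    next
      case (insert a A)
      then show ?case using co_lin[OF hM comb[of A w], of a "w a" i] by simp
    qed
    from this[of "{..<r}"] show ?thesis using i by (simp add: co_h sum.delta if_distrib[of "\<lambda>t. _ * t"] cong: if_cong)
  qed
  have co_mul: "dmul H f (\<lambda>k. \<Sum>l<r. w l * h l k) = (\<lambda>k. \<Sum>l<r. w l * dmul H f (h l) k)" for f w
    by (rule ext) (rule lin_sum_scale_vec[OF lin_coord[OF linv_dmul(1)]])
  have co_mul': "co (dmul H f v) i = (\<Sum>l<r. co (dmul H f (h l)) i * co v l)" if v: "v \<in> M" and i: "i < r" for f v i
  proof -
    have "dmul H f v = (\<lambda>k. \<Sum>l<r. co v l * dmul H f (h l) k)"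
      using co_mul[of f "co v"] co_expand[OF v] by simp
    also have "\<dots> = (\<lambda>k. \<Sum>l<r. co v l * (\<Sum>j<r. co (dmul H f (h l)) j * h j k))"
      using co_expand[OF Mmul[OF hM]] by (intro ext sum.cong refl) (metis lessThan_iff)
    also have "\<dots> = (\<lambda>k. \<Sum>j<r. (\<Sum>l<r. co (dmul H f (h l)) j * co v l) * h j k)"
      by (rule ext) (simp add: sum_distrib_left sum_distrib_right mult_ac, rule sum.swap)
    finally show ?thesis using co_comb[OF i] by simp
  qed
  \<comment> \<open>Left multiplication on \<open>M\<close>, written in the basis
    \<open>h\<close>.\<close>
  define \<rho> where "\<rho> f = mat r r (\<lambda>(i, j). co (dmul H f (h j)) i)" for f
  have \<rho>v: "(\<rho> f *\<^sub>v w) $ i = co (dmul H f (\<lambda>k. \<Sum>l<r. w $ l * h l k)) i" if "w \<in> carrier_vec r" "i < r" for f w i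
  proof -
    have "co (dmul H f (\<lambda>k. \<Sum>l<r. w $ l * h l k)) i = (\<Sum>l<r. co (dmul H f (h l)) i * w $ l)"
      using co_mul'[OF comb[of "{..<r}" "\<lambda>l. w $ l"] that(2)] by (simp add: co_comb)
    then show ?thesis using that by (simp add: \<rho>_def scalar_prod_def atLeast0LessThan)
  qed
  have rep: "drep H r \<rho>"
    unfolding drep_def
  proof (intro conjI allI)
    show "\<rho> f \<in> carrier_mat r r" for f by (simp add: \<rho>_def)
    show "\<rho> (\<lambda>i. a * f i + g i) = a \<cdot>\<^sub>m \<rho> f + \<rho> g" for a f g
    proof (rule eq_matI)
      fix i j assume "i < dim_row (a \<cdot>\<^sub>m \<rho> f + \<rho> g)" "j < dim_col (a \<cdot>\<^sub>m \<rho> f + \<rho> g)"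
      then have ij: "i < r" "j < r" by (simp_all add: \<rho>_def)
      show "\<rho> (\<lambda>i. a * f i + g i) $$ (i, j) = (a \<cdot>\<^sub>m \<rho> f + \<rho> g) $$ (i, j)"
        using ij co_lin[OF Mmul[OF hM] Mmul[OF hM], of j j a f g i] linvD[OF linv_dmul(2)[of H "h j"], of a f g]
        by (simp add: \<rho>_def)
    qed (simp_all add: \<rho>_def)
    show "\<rho> (dmul H f g) = \<rho> f * \<rho> g" for f g
    proof (rule eq_matI)
      fix i j assume "i < dim_row (\<rho> f * \<rho> g)" "j < dim_col (\<rho> f * \<rho> g)"
      then have ij: "i < r" "j < r" by (simp_all add: \<rho>_def)
      then show "\<rho> (dmul H f g) $$ (i, j) = (\<rho> f * \<rho> g) $$ (i, j)"
        using co_mul'[OF Mmul[OF hM[OF ij(2)]] ij(1), of f g]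
        by (simp add: \<rho>_def assoc scalar_prod_def atLeast0LessThan)
    qed (simp_all add: \<rho>_def)
    show "\<rho> (dunit H) = 1\<^sub>m r"
      by (rule eq_matI) (simp_all add: \<rho>_def unit co_h)
  qed
  have rpos: "r > 0"
  proof (rule ccontr)
    assume "\<not> r > 0"
    then have "vs.dim M = 0" using Bs(4) by (simp add: r_def)
    then have "M \<subseteq> {0}" by (simp only: vs.dim_eq_0)
    moreover have "(\<lambda>i. 0) \<in> M" using Mid by (simp add: dleft_ideal_def csubspace_def)
    ultimately show False using Mnz by (auto simp: zero)
  qed
  have "dirrep H r \<rho>"
    unfolding dirrep_def
  proof (intro conjI allI impI rep rpos)
    fix V assume V: "inv_subspace r \<rho> V"
    have Vc: "V \<subseteq> carrier_vec r" and V0: "0\<^sub>v r \<in> V"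
      and Vl: "\<And>x y c. x \<in> V \<Longrightarrow> y \<in> V \<Longrightarrow> c \<cdot>\<^sub>v x + y \<in> V" and Va: "\<And>f x. x \<in> V \<Longrightarrow> \<rho> f *\<^sub>v x \<in> V"
      using V by (auto simp: inv_subspace_def)
    define la where "la w = (\<lambda>k. \<Sum>l<r. w $ l * h l k)" for w
    have laM: "la w \<in> M" for w using comb[of "{..<r}"] by (simp add: la_def)
    have co_la: "co (la w) i = w $ i" if "i < r" for w i using co_comb[OF that] by (simp add: la_def)
    have la_inj: "w = w'" if "la w = la w'" "w \<in> carrier_vec r" "w' \<in> carrier_vec r" for w w'
    proof (rule eq_vecI)
      fix i assume "i < dim_vec w'"
      then have i: "i < r" using that by simp
      show "w $ i = w' $ i" using co_la[OF i, of w] co_la[OF i, of w'] that(1) by simp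
    qed (use that in auto)
    have lacomb: "la (c \<cdot>\<^sub>v x + y) = (\<lambda>k. c * la x k + la y k)" if "x \<in> carrier_vec r" "y \<in> carrier_vec r" for c x y
    proof (rule ext)
      fix k
      have "la (c \<cdot>\<^sub>v x + y) k = (\<Sum>l<r. c * (x $ l * h l k) + y $ l * h l k)"
        unfolding la_def using that by (intro sum.cong refl) (simp add: algebra_simps)
      then show "la (c \<cdot>\<^sub>v x + y) k = c * la x k + la y k"
        by (simp add: la_def sum.distrib sum_distrib_left)
    qed
    have laact: "la (\<rho> f *\<^sub>v w) = dmul H f (la w)" if "w \<in> carrier_vec r" for f w
    proof -
      have "la (\<rho> f *\<^sub>v w) = (\<lambda>k. \<Sum>l<r. co (dmul H f (la w)) l * h l k)"
        unfolding la_def[of "\<rho> f *\<^sub>v w"] using \<rho>v[OF that] by (intro ext sum.cong refl) (simp add: la_def)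
      also have "\<dots> = dmul H f (la w)" using co_expand[OF Mmul[OF laM]] by simp
      finally show ?thesis .
    qed
    \<comment> \<open>\<open>la\<close> carries an invariant subspace of coordinate vectors to a
      left ideal inside \<open>M\<close>, so minimality of \<open>M\<close> yields
      irreducibility.\<close>
    have ideal: "dleft_ideal H (la ` V)"
      unfolding dleft_ideal_def csubspace_def
    proof (intro conjI ballI allI impI)
      have "la (0\<^sub>v r) = (\<lambda>_. 0)" by (simp add: la_def)
      then show "(\<lambda>_. 0) \<in> la ` V" using V0 by (metis imageI)
      fix a b c assume "a \<in> la ` V" "b \<in> la ` V"
      then obtain x y where xy: "x \<in> V" "y \<in> V" "a = la x" "b = la y" by auto
      have "x \<in> carrier_vec r" "y \<in> carrier_vec r" using xy(1,2) Vc by blast+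
      then have "(\<lambda>i. c * a i + b i) = la (c \<cdot>\<^sub>v x + y)" unfolding xy(3,4) by (rule lacomb[symmetric])
      then show "(\<lambda>i. c * a i + b i) \<in> la ` V" using Vl[OF xy(1,2)] by auto
    next
      fix f a assume "a \<in> la ` V"
      then obtain x where x: "x \<in> V" "a = la x" by auto
      have "x \<in> carrier_vec r" using x(1) Vc by blast
      then have "dmul H f a = la (\<rho> f *\<^sub>v x)" unfolding x(2) by (rule laact[symmetric])
      then show "dmul H f a \<in> la ` V" using Va[OF x(1)] by auto
    qed
    show "V = {0\<^sub>v r} \<or> V = carrier_vec r"
    proof (cases "la ` V = {\<lambda>i. 0}")
      case True
      have "x = 0\<^sub>v r" if "x \<in> V" for x
      proof (rule la_inj)
        have "la (0\<^sub>v r) = (\<lambda>_. 0)" by (simp add: la_def)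
        then show "la x = la (0\<^sub>v r)" using True that by auto
      qed (use that Vc in auto)
      then have "V = {0\<^sub>v r}" using V0 by blast
      then show ?thesis ..
    next
      case False
      then have "la ` V = M" using min[OF ideal] laM by blast
      have "carrier_vec r \<subseteq> V"
      proof
        fix w :: "complex vec" assume w: "w \<in> carrier_vec r"
        have "la w \<in> la ` V" using laM \<open>la ` V = M\<close> by simp
        then obtain v where "v \<in> V" "la w = la v" by auto
        then show "w \<in> V" using la_inj[of w v] w Vc by auto
      qed
      then show ?thesis using Vc by blast
    qed
  qed
  then obtain a where "rep_equiv r \<rho> (n a) (\<psi> a)" using irr unfolding irr_family_def by meson
  then obtain Q where ra: "r = n a" and Q: "Q \<in> carrier_mat r r" "invertible_mat Q" "\<And>f. \<rho> f * Q = Q * \<psi> a f"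
    by (auto simp: rep_equiv_def)
  obtain Q' where Q': "Q * Q' = 1\<^sub>m r" "Q' \<in> carrier_mat r r"
  proof -
    obtain Q' where 1: "Q * Q' = 1\<^sub>m (dim_row Q)" "Q' * Q = 1\<^sub>m (dim_row Q')"
      using Q(2) unfolding invertible_mat_def inverts_mat_def by auto
    have "dim_row Q' = r" using arg_cong[OF 1(2), of dim_col] Q(1) by simp
    moreover have "dim_col Q' = r" using arg_cong[OF 1(1), of dim_col] Q(1) by simp
    ultimately show thesis using that[of Q'] 1 Q(1) by auto
  qed
  have \<rho>y: "\<rho> y = 0\<^sub>m r r"
  proof -
    have "\<psi> a y = 0\<^sub>m r r" using yz(1) MI ra by auto
    then have "\<rho> y * Q = 0\<^sub>m r r" using Q(1,3) by simp
    then have "\<rho> y * (Q * Q') = 0\<^sub>m r r * Q'"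
      using Q(1) Q'(2) drepD(1)[OF rep, of y] by (simp add: assoc_mult_mat[of _ r r _ r _ r, symmetric])
    then show ?thesis using Q' drepD(1)[OF rep, of y] by simp
  qed
  have "co (dmul H y y) i = 0" if i: "i < r" for i
  proof -
    have "co (dmul H y (h l)) i = 0" if "l < r" for l
      using arg_cong[OF \<rho>y, of "\<lambda>A. A $$ (i, l)"] i that by (simp add: \<rho>_def)
    then show ?thesis using co_mul'[OF yz(1) i, of y] by simp
  qed
  then have "dmul H y y = (\<lambda>i. 0)" using co_expand[OF Mmul[OF yz(1)], of y] by simp
  then have y0: "y = (\<lambda>i. 0)" using idem[OF yz(1)] by simp
  have "M \<subseteq> {\<lambda>i. 0}"
  proof
    fix x assume "x \<in> M"
    then have "x = dmul H x (\<lambda>i. 0)" using idem y0 by simp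
    also have "\<dots> = (\<lambda>i. 0)" by (simp add: dmul_def)
    finally show "x \<in> {\<lambda>i. 0}" by simp
  qed
  moreover have "(\<lambda>i. 0) \<in> M" using Mid by (simp add: dleft_ideal_def csubspace_def)
  ultimately show False using Mnz by blast
qed

section \<open>From structure constants to the abstract setting\<close>

lemma sum_UNIV_prod: "(\<Sum>p\<in>UNIV. f p) = (\<Sum>a\<in>UNIV. \<Sum>b\<in>UNIV. f (a, b))"
  for f :: "'i::finite \<times> 'j::finite \<Rightarrow> complex"
  unfolding UNIV_Times_UNIV[symmetric] by (simp add: sum.cartesian_product)

lemma sum5_permute:
  "(\<Sum>a\<in>UNIV. \<Sum>b\<in>UNIV. \<Sum>d\<in>UNIV. \<Sum>a'\<in>UNIV. \<Sum>d'\<in>UNIV. f a b d a' d') =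
   (\<Sum>a'\<in>UNIV. \<Sum>b\<in>UNIV. \<Sum>d'\<in>UNIV. \<Sum>a\<in>UNIV. \<Sum>d\<in>UNIV. f a b d a' d')"
  for f :: "'i::finite \<Rightarrow> 'i \<Rightarrow> 'i \<Rightarrow> 'i \<Rightarrow> 'i \<Rightarrow> complex"
proof -
  have "(\<Sum>a\<in>UNIV. \<Sum>b\<in>UNIV. \<Sum>d\<in>UNIV. \<Sum>a'\<in>UNIV. \<Sum>d'\<in>UNIV. f a b d a' d') =
    (\<Sum>(a, b, d, a', d')\<in>UNIV. f a b d a' d')"
    by (simp add: sum_UNIV_prod)
  also have "\<dots> = (\<Sum>(a', b, d', a, d)\<in>UNIV. f a b d a' d')"
    by (rule sum.reindex_bij_witness[where i = "\<lambda>(a', b, d', a, d). (a, b, d, a', d')"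
          and j = "\<lambda>(a, b, d, a', d'). (a', b, d', a, d)"]) auto
  also have "\<dots> = (\<Sum>a'\<in>UNIV. \<Sum>b\<in>UNIV. \<Sum>d'\<in>UNIV. \<Sum>a\<in>UNIV. \<Sum>d\<in>UNIV. f a b d a' d')"
    by (simp add: sum_UNIV_prod)
  finally show ?thesis .
qed

text \<open>Transposition exchanges multiplication with coproduct and unit with counit. Accordingly
  \<open>D1\<close> and \<open>e2\<close> trade places, and the weak unit axioms become the weak
  counit axioms.\<close>

lemma (in wha) dual: "wha (\<lambda>i j k. c k i j) e (\<lambda>i j k. m j k i) u (\<lambda>i j. s j i) e2 D1"
proof
  show "e2 = (\<lambda>j k. \<Sum>r\<in>UNIV. e r * m j k r)" by (rule e2_def)
  show "D1 = (\<lambda>i j. \<Sum>r\<in>UNIV. u r * c r i j)" by (rule D1_def)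
  fix i j k l
  show "(\<Sum>r\<in>UNIV. c r i j * c l r k) = (\<Sum>r\<in>UNIV. c r j k * c l i r)"
    using c_assoc[of l k i j] by (simp add: mult.commute)
  show "(\<Sum>r\<in>UNIV. e r * c k r j) = (if j = k then 1 else 0)" by (rule c_counit(1))
  show "(\<Sum>r\<in>UNIV. e r * c k j r) = (if j = k then 1 else 0)" by (rule c_counit(2))
  show "(\<Sum>r\<in>UNIV. m r k l * m i j r) = (\<Sum>r\<in>UNIV. m i r l * m j k r)"
    using m_assoc[of i j k l] by (simp add: mult.commute)
  show "(\<Sum>r\<in>UNIV. u r * m r j k) = (if j = k then 1 else 0)" by (rule m_unit(1))
  show "(\<Sum>r\<in>UNIV. u r * m j r k) = (if j = k then 1 else 0)" by (rule m_unit(2))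
  show "(\<Sum>r\<in>UNIV. c r i j * m k l r) =
    (\<Sum>a\<in>UNIV. \<Sum>b\<in>UNIV. \<Sum>p\<in>UNIV. \<Sum>q\<in>UNIV. m a b i * m p q j * c k a p * c l b q)"
  proof -
    have "(\<Sum>r\<in>UNIV. c r i j * m k l r) =
      (\<Sum>a\<in>UNIV. \<Sum>b\<in>UNIV. \<Sum>p\<in>UNIV. \<Sum>q\<in>UNIV. c k a b * c l p q * m a p i * m b q j)"
      using m_c[of k l i j] by (simp add: mult.commute)
    also have "\<dots> = (\<Sum>a\<in>UNIV. \<Sum>b\<in>UNIV. \<Sum>p\<in>UNIV. \<Sum>q\<in>UNIV. m a b i * m p q j * c k a p * c l b q)"
      by (rule sum.cong[OF refl], subst sum.swap) (simp add: mult_ac)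
    finally show ?thesis .
  qed
  show "(\<Sum>r\<in>UNIV. e2 r l * m j k r) = (\<Sum>p\<in>UNIV. \<Sum>q\<in>UNIV. e2 j p * e2 q l * c k q p)" by (rule e2_e2(1))
  show "(\<Sum>r\<in>UNIV. e2 r l * m j k r) = (\<Sum>p\<in>UNIV. \<Sum>q\<in>UNIV. e2 j p * e2 q l * c k p q)" by (rule e2_e2(2))
  show "(\<Sum>r\<in>UNIV. D1 r l * c r j k) = (\<Sum>p\<in>UNIV. \<Sum>q\<in>UNIV. D1 j p * D1 q l * m q p k)" by (rule D1_D1(1))
  show "(\<Sum>r\<in>UNIV. D1 r l * c r j k) = (\<Sum>p\<in>UNIV. \<Sum>q\<in>UNIV. D1 j p * D1 q l * m p q k)" by (rule D1_D1(2))
  show "(\<Sum>a\<in>UNIV. \<Sum>b\<in>UNIV. \<Sum>r\<in>UNIV. m a b i * s r a * c k r b) = (\<Sum>p\<in>UNIV. e2 k p * D1 i p)"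
  proof -
    have "(\<Sum>a\<in>UNIV. \<Sum>b\<in>UNIV. \<Sum>r\<in>UNIV. m a b i * s r a * c k r b) =
      (\<Sum>r\<in>UNIV. \<Sum>b\<in>UNIV. \<Sum>a\<in>UNIV. c k r b * s r a * m a b i)"
      by (subst sum.swap, subst (2) sum.swap, subst sum.swap) (simp add: mult_ac)
    then show ?thesis using s_left[of k i] by (simp add: mult.commute)
  qed
  show "(\<Sum>a\<in>UNIV. \<Sum>b\<in>UNIV. \<Sum>r\<in>UNIV. m a b i * s r b * c k a r) = (\<Sum>p\<in>UNIV. e2 p k * D1 p i)"
  proof -
    have "(\<Sum>a\<in>UNIV. \<Sum>b\<in>UNIV. \<Sum>r\<in>UNIV. m a b i * s r b * c k a r) =
      (\<Sum>a\<in>UNIV. \<Sum>r\<in>UNIV. \<Sum>b\<in>UNIV. c k a r * s r b * m a b i)"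
      by (rule sum.cong[OF refl], subst sum.swap) (simp add: mult_ac)
    then show ?thesis using s_right[of k i] by (simp add: mult.commute)
  qed
  show "(\<Sum>a\<in>UNIV. \<Sum>b\<in>UNIV. \<Sum>d\<in>UNIV. \<Sum>a'\<in>UNIV. \<Sum>d'\<in>UNIV.
      (\<Sum>r\<in>UNIV. m a r i * m b d r) * s a' a * s d' d * (\<Sum>r\<in>UNIV. c r a' b * c k r d')) = s k i"
  proof -
    have cc: "(\<Sum>r\<in>UNIV. c r a' b * c k r d') = (\<Sum>r\<in>UNIV. c k a' r * c r b d')" for a' b d'
      using c_assoc[of k d' a' b] by (simp add: mult.commute)
    have mm: "(\<Sum>r\<in>UNIV. m a r i * m b d r) = (\<Sum>r\<in>UNIV. m a b r * m r d i)" for a b d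
      using m_assoc[of a b d i] by (simp add: mult.commute)
    show ?thesis
      unfolding cc mm s_s[of k i, symmetric]
      by (subst sum5_permute) (simp add: mult_ac)
  qed
qed

lemma mulA_bas: "mulA H (bas i) (bas j) = smul H i j"
  "mulA H (bas i) y = (\<lambda>k. \<Sum>j\<in>UNIV. y j * smul H i j k)"
  "mulA H x (bas j) = (\<lambda>k. \<Sum>i\<in>UNIV. x i * smul H i j k)"
proof -
  show 1: "mulA H (bas i) y = (\<lambda>k. \<Sum>j\<in>UNIV. y j * smul H i j k)" for y
    by (rule ext) (simp add: mulA_def bas_def sum_delta_mult mult.assoc sum_distrib_left[symmetric])
  show "mulA H x (bas j) = (\<lambda>k. \<Sum>i\<in>UNIV. x i * smul H i j k)"
    by (rule ext) (simp add: mulA_def bas_def mult.assoc sum_distrib_left[symmetric] sum_delta_mult)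
  show "mulA H (bas i) (bas j) = smul H i j"
    unfolding 1 by (simp add: bas_def sum_delta_mult)
qed

lemma DeltaA_bas: "DeltaA H (bas i) (j, k) = scomul H i j k"
  by (simp add: DeltaA_def bas_def sum_delta_mult)

lemma SA_bas: "SA H (bas i) = santi H i"
  by (rule ext) (simp add: SA_def bas_def sum_delta_mult)

lemma epsA_bas: "epsA H (bas i) = scounit H i"
  by (simp add: epsA_def bas_def sum_delta_mult)

lemma Delta2A_apply: "Delta2A H x ((i, j), k) = (\<Sum>r\<in>UNIV. DeltaA H x (r, k) * scomul H r i j)"
proof -
  have "Delta2A H x ((i, j), k) = (\<Sum>r\<in>UNIV. \<Sum>q\<in>UNIV. (DeltaA H x (r, q) * scomul H r i j) * (if k = q then 1 else 0))"
    by (simp add: Delta2A_def tmap_def sum_UNIV_prod DeltaA_bas) (simp add: bas_def)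
  then show ?thesis by (simp only: sum_delta_mult)
qed

text \<open>Every axiom is evaluated on basis vectors. The laborious ones are the weak unit axioms,
  where the factors 1 on the outer legs must be contracted against a multiplication before the
  tensors reduce to \<open>D1\<close>.\<close>

lemma wha_of_weak_hopf:
  fixes H :: "'i::finite wstr"
  assumes "weak_hopf H"
  shows "wha (smul H) (sunit H) (scomul H) (scounit H) (santi H)
    (\<lambda>j k. \<Sum>r\<in>UNIV. sunit H r * scomul H r j k) (\<lambda>i j. \<Sum>r\<in>UNIV. scounit H r * smul H i j r)"
proof -
  define D1 where "D1 = (\<lambda>j k. \<Sum>r\<in>UNIV. sunit H r * scomul H r j k)"
  define e2 where "e2 = (\<lambda>i j. \<Sum>r\<in>UNIV. scounit H r * smul H i j r)"
  have D1: "DeltaA H (oneA H) (j, k) = D1 j k" for j k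
    by (simp add: DeltaA_def oneA_def D1_def)
  have eps2: "epsA H (mulA H (bas i) (bas j)) = e2 i j" for i j
    by (simp add: mulA_bas(1) epsA_def e2_def mult.commute)
  have eps3: "epsA H (mulA H (mulA H (bas j) (bas k)) (bas l)) = (\<Sum>r\<in>UNIV. e2 r l * smul H j k r)" for j k l
  proof -
    have "epsA H (mulA H (mulA H (bas j) (bas k)) (bas l)) = (\<Sum>t\<in>UNIV. \<Sum>r\<in>UNIV. smul H j k r * smul H r l t * scounit H t)"
      by (simp only: mulA_bas(1)[of H j k]) (simp add: mulA_bas(3) epsA_def sum_distrib_right)
    also have "\<dots> = (\<Sum>r\<in>UNIV. \<Sum>t\<in>UNIV. smul H j k r * smul H r l t * scounit H t)" by (rule sum.swap)
    also have "\<dots> = (\<Sum>r\<in>UNIV. e2 r l * smul H j k r)" by (simp add: e2_def sum_distrib_right) (simp only: mult_ac)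
    finally show ?thesis .
  qed
  have assoc: "mulA H (mulA H x y) z = mulA H x (mulA H y z)"
    and unit: "mulA H (oneA H) x = x" "mulA H x (oneA H) = x"
    and coassoc: "Delta2A H x = (\<lambda>((a, b), c). tmap id (DeltaA H) (DeltaA H x) (a, (b, c)))"
    and counit: "(\<lambda>j. \<Sum>i\<in>UNIV. epsA H (bas i) * DeltaA H x (i, j)) = x"
      "(\<lambda>i. \<Sum>j\<in>UNIV. DeltaA H x (i, j) * epsA H (bas j)) = x"
    and Dmul: "DeltaA H (mulA H x y) = mul2A H (DeltaA H x) (DeltaA H y)"
    and D2a: "Delta2A H (oneA H) = mul3A H (\<lambda>((a, b), c). oneA H a * DeltaA H (oneA H) (b, c)) (\<lambda>((a, b), c). DeltaA H (oneA H) (a, b) * oneA H c)"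
    and D2b: "Delta2A H (oneA H) = mul3A H (\<lambda>((a, b), c). DeltaA H (oneA H) (a, b) * oneA H c) (\<lambda>((a, b), c). oneA H a * DeltaA H (oneA H) (b, c))"
    and epsa: "epsA H (mulA H (mulA H x y) z) =
        (\<Sum>p\<in>UNIV. DeltaA H y p * epsA H (mulA H x (bas (fst p))) * epsA H (mulA H (bas (snd p)) z))"
    and epsb: "epsA H (mulA H (mulA H x y) z) =
        (\<Sum>p\<in>UNIV. DeltaA H y p * epsA H (mulA H x (bas (snd p))) * epsA H (mulA H (bas (fst p)) z))"
    and S1: "(\<lambda>k. \<Sum>p\<in>UNIV. DeltaA H x p * mulA H (SA H (bas (fst p))) (bas (snd p)) k) =
          (\<lambda>k. \<Sum>p\<in>UNIV. DeltaA H (oneA H) p * epsA H (mulA H x (bas (snd p))) * bas (fst p) k)"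
    and S2: "(\<lambda>k. \<Sum>p\<in>UNIV. DeltaA H x p * mulA H (bas (fst p)) (SA H (bas (snd p))) k) =
          (\<lambda>k. \<Sum>p\<in>UNIV. DeltaA H (oneA H) p * epsA H (mulA H (bas (fst p)) x) * bas (snd p) k)"
    and S3: "(\<lambda>k. \<Sum>p\<in>UNIV. Delta2A H x p *
            mulA H (mulA H (SA H (bas (fst (fst p)))) (bas (snd (fst p)))) (SA H (bas (snd p))) k) = SA H x"
    for x y z
    using assms unfolding weak_hopf_def Let_def by blast+
  have one1: "(\<Sum>r\<in>UNIV. sunit H r * smul H r j k) = (if j = k then 1 else 0)" for j k
    using fun_cong[OF unit(1)[of "bas j"], of k] by (simp add: mulA_bas(3) oneA_def) (auto simp: bas_def)
  have one2: "(\<Sum>r\<in>UNIV. sunit H r * smul H j r k) = (if j = k then 1 else 0)" for j k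
    using fun_cong[OF unit(2)[of "bas j"], of k] by (simp add: mulA_bas(2) oneA_def) (auto simp: bas_def)
  have "wha (smul H) (sunit H) (scomul H) (scounit H) (santi H) D1 e2"
  proof
    show "D1 = (\<lambda>j k. \<Sum>r\<in>UNIV. sunit H r * scomul H r j k)" by (rule D1_def)
    show "e2 = (\<lambda>i j. \<Sum>r\<in>UNIV. scounit H r * smul H i j r)" by (rule e2_def)
    fix i j k l
    show "(\<Sum>r\<in>UNIV. smul H i j r * smul H r k l) = (\<Sum>r\<in>UNIV. smul H j k r * smul H i r l)"
      using fun_cong[OF assoc[of "bas i" "bas j" "bas k"], of l]
      by (simp add: mulA_bas(1)) (simp add: mulA_bas(2,3))
    show "(\<Sum>r\<in>UNIV. sunit H r * smul H r j k) = (if j = k then 1 else 0)" by (rule one1)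
    show "(\<Sum>r\<in>UNIV. sunit H r * smul H j r k) = (if j = k then 1 else 0)" by (rule one2)
    have coass: "(\<Sum>r\<in>UNIV. scomul H l r k * scomul H r i j) = (\<Sum>r\<in>UNIV. scomul H l i r * scomul H r j k)" for i j k l
    proof -
      have "tmap id (DeltaA H) (DeltaA H (bas l)) (i, (j, k)) = (\<Sum>q\<in>UNIV. \<Sum>r\<in>UNIV. (scomul H l q r * scomul H r j k) * (if i = q then 1 else 0))"
        by (simp add: tmap_def sum_UNIV_prod DeltaA_bas) (simp add: bas_def mult_ac)
      also have "\<dots> = (\<Sum>r\<in>UNIV. scomul H l i r * scomul H r j k)"
        by (subst sum.swap) (simp only: sum_delta_mult)
      finally show ?thesis
        using fun_cong[OF coassoc[of "bas l"], of "((i, j), k)"] by (simp add: Delta2A_apply DeltaA_bas)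
    qed
    then show "(\<Sum>r\<in>UNIV. scomul H l r k * scomul H r i j) = (\<Sum>r\<in>UNIV. scomul H l i r * scomul H r j k)" .
    show "(\<Sum>r\<in>UNIV. scounit H r * scomul H k r j) = (if j = k then 1 else 0)"
      using fun_cong[OF counit(1)[of "bas k"], of j] by (simp add: epsA_bas DeltaA_bas) (simp add: bas_def)
    show "(\<Sum>r\<in>UNIV. scounit H r * scomul H k j r) = (if j = k then 1 else 0)"
      using fun_cong[OF counit(2)[of "bas k"], of j] by (simp add: epsA_bas DeltaA_bas mult.commute) (simp add: bas_def)
    show "(\<Sum>r\<in>UNIV. smul H i j r * scomul H r k l) =
      (\<Sum>a\<in>UNIV. \<Sum>b\<in>UNIV. \<Sum>p\<in>UNIV. \<Sum>q\<in>UNIV. scomul H i a b * scomul H j p q * smul H a p k * smul H b q l)"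
      using fun_cong[OF Dmul[of "bas i" "bas j"], of "(k, l)"]
      by (simp add: mulA_bas(1) mul2A_def sum_UNIV_prod DeltaA_bas) (simp add: DeltaA_def)
    have D2: "Delta2A H (oneA H) ((j, k), l) = (\<Sum>r\<in>UNIV. D1 r l * scomul H r j k)"
      by (simp add: Delta2A_apply D1)
    have mul3: "mul3A H (\<lambda>((a, b), c). oneA H a * DeltaA H (oneA H) (b, c)) (\<lambda>((a, b), c). DeltaA H (oneA H) (a, b) * oneA H c) ((j, k), l)
      = (\<Sum>p\<in>UNIV. \<Sum>q\<in>UNIV. D1 j p * D1 q l * smul H q p k)"
    proof -
      let ?R = "\<lambda>b c a' b'. D1 b c * D1 a' b' * smul H b b' k"
      have "mul3A H (\<lambda>((a, b), c). oneA H a * DeltaA H (oneA H) (b, c)) (\<lambda>((a, b), c). DeltaA H (oneA H) (a, b) * oneA H c) ((j, k), l)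
        = (\<Sum>a\<in>UNIV. \<Sum>b\<in>UNIV. \<Sum>c\<in>UNIV. \<Sum>a'\<in>UNIV. \<Sum>b'\<in>UNIV. \<Sum>c'\<in>UNIV.
            (sunit H a * smul H a a' j) * ((sunit H c' * smul H c c' l) * ?R b c a' b'))"
        by (simp add: mul3A_def sum_UNIV_prod D1[unfolded oneA_def] oneA_def) (intro sum.cong refl, simp only: mult_ac)
      also have "\<dots> = (\<Sum>b\<in>UNIV. \<Sum>c\<in>UNIV. \<Sum>a'\<in>UNIV. \<Sum>b'\<in>UNIV. \<Sum>c'\<in>UNIV. \<Sum>a\<in>UNIV.
            (sunit H a * smul H a a' j) * ((sunit H c' * smul H c c' l) * ?R b c a' b'))"
        by (rule sum_rotate6)
      also have "\<dots> = (\<Sum>b\<in>UNIV. \<Sum>c\<in>UNIV. \<Sum>a'\<in>UNIV. \<Sum>b'\<in>UNIV.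
            (if a' = j then 1 else 0) * ((if c = l then 1 else 0) * ?R b c a' b'))"
        by (simp only: sum_distrib_right[symmetric] sum_distrib_left[symmetric] one1 one2)
      also have "\<dots> = (\<Sum>b\<in>UNIV. \<Sum>b'\<in>UNIV. ?R b l j b')"
        by (simp only: sum_distrib_left[symmetric] sum_delta_mult)
      also have "\<dots> = (\<Sum>p\<in>UNIV. \<Sum>q\<in>UNIV. D1 j p * D1 q l * smul H q p k)"
        by (subst sum.swap) (simp add: mult_ac)
      finally show ?thesis .
    qed
    have mul3': "mul3A H (\<lambda>((a, b), c). DeltaA H (oneA H) (a, b) * oneA H c) (\<lambda>((a, b), c). oneA H a * DeltaA H (oneA H) (b, c)) ((j, k), l)
      = (\<Sum>p\<in>UNIV. \<Sum>q\<in>UNIV. D1 j p * D1 q l * smul H p q k)"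
    proof -
      let ?R = "\<lambda>b' c' a b. D1 a b * D1 b' c' * smul H b b' k"
      have "mul3A H (\<lambda>((a, b), c). DeltaA H (oneA H) (a, b) * oneA H c) (\<lambda>((a, b), c). oneA H a * DeltaA H (oneA H) (b, c)) ((j, k), l)
        = (\<Sum>a'\<in>UNIV. \<Sum>b'\<in>UNIV. \<Sum>c'\<in>UNIV. \<Sum>a\<in>UNIV. \<Sum>b\<in>UNIV. \<Sum>c\<in>UNIV.
            (sunit H a' * smul H a a' j) * ((sunit H c * smul H c c' l) * ?R b' c' a b))"
        unfolding mul3A_def prod.case
        by (subst sum.swap) (simp add: sum_UNIV_prod D1[unfolded oneA_def] oneA_def, intro sum.cong refl, simp only: mult_ac)
      also have "\<dots> = (\<Sum>b'\<in>UNIV. \<Sum>c'\<in>UNIV. \<Sum>a\<in>UNIV. \<Sum>b\<in>UNIV. \<Sum>c\<in>UNIV. \<Sum>a'\<in>UNIV.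
            (sunit H a' * smul H a a' j) * ((sunit H c * smul H c c' l) * ?R b' c' a b))"
        by (rule sum_rotate6)
      also have "\<dots> = (\<Sum>b'\<in>UNIV. \<Sum>c'\<in>UNIV. \<Sum>a\<in>UNIV. \<Sum>b\<in>UNIV.
            (if a = j then 1 else 0) * ((if c' = l then 1 else 0) * ?R b' c' a b))"
        by (simp only: sum_distrib_right[symmetric] sum_distrib_left[symmetric] one1 one2)
      also have "\<dots> = (\<Sum>b'\<in>UNIV. \<Sum>b\<in>UNIV. ?R b' l j b)"
        by (simp only: sum_distrib_left[symmetric] sum_delta_mult)
      also have "\<dots> = (\<Sum>p\<in>UNIV. \<Sum>q\<in>UNIV. D1 j p * D1 q l * smul H p q k)"
        by (rule sum.swap)
      finally show ?thesis .
    qed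
    show "(\<Sum>r\<in>UNIV. D1 r l * scomul H r j k) = (\<Sum>p\<in>UNIV. \<Sum>q\<in>UNIV. D1 j p * D1 q l * smul H q p k)"
      using D2 D2a mul3 by simp
    show "(\<Sum>r\<in>UNIV. D1 r l * scomul H r j k) = (\<Sum>p\<in>UNIV. \<Sum>q\<in>UNIV. D1 j p * D1 q l * smul H p q k)"
      using D2 D2b mul3' by simp
    show "(\<Sum>r\<in>UNIV. e2 r l * smul H j k r) = (\<Sum>p\<in>UNIV. \<Sum>q\<in>UNIV. e2 j p * e2 q l * scomul H k q p)"
      using epsb[of "bas j" "bas k" "bas l"] unfolding eps3
      by (simp add: sum_UNIV_prod DeltaA_bas eps2) (subst sum.swap, simp add: mult_ac)
    show "(\<Sum>r\<in>UNIV. e2 r l * smul H j k r) = (\<Sum>p\<in>UNIV. \<Sum>q\<in>UNIV. e2 j p * e2 q l * scomul H k p q)"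
      using epsa[of "bas j" "bas k" "bas l"] unfolding eps3
      by (simp add: sum_UNIV_prod DeltaA_bas eps2 mult_ac)
    show "(\<Sum>a\<in>UNIV. \<Sum>b\<in>UNIV. \<Sum>r\<in>UNIV. scomul H i a b * santi H a r * smul H r b k) = (\<Sum>p\<in>UNIV. D1 k p * e2 i p)"
    proof -
      have "(\<Sum>a\<in>UNIV. \<Sum>b\<in>UNIV. \<Sum>r\<in>UNIV. scomul H i a b * santi H a r * smul H r b k) =
        (\<Sum>a\<in>UNIV. \<Sum>b\<in>UNIV. D1 a b * e2 i b * bas a k)"
        using fun_cong[OF S1[of "bas i"], of k]
        by (simp add: sum_UNIV_prod DeltaA_bas SA_bas D1 eps2) (simp add: mulA_bas(3) sum_distrib_left mult.assoc)
      also have "\<dots> = (\<Sum>b\<in>UNIV. \<Sum>a\<in>UNIV. (D1 a b * e2 i b) * (if k = a then 1 else 0))"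
        by (subst sum.swap) (simp add: bas_def)
      finally show ?thesis by (simp only: sum_delta_mult)
    qed
    show "(\<Sum>a\<in>UNIV. \<Sum>b\<in>UNIV. \<Sum>r\<in>UNIV. scomul H i a b * santi H b r * smul H a r k) = (\<Sum>p\<in>UNIV. D1 p k * e2 p i)"
    proof -
      have "(\<Sum>a\<in>UNIV. \<Sum>b\<in>UNIV. \<Sum>r\<in>UNIV. scomul H i a b * santi H b r * smul H a r k) =
        (\<Sum>a\<in>UNIV. \<Sum>b\<in>UNIV. D1 a b * e2 a i * bas b k)"
        using fun_cong[OF S2[of "bas i"], of k]
        by (simp add: sum_UNIV_prod DeltaA_bas SA_bas D1 eps2) (simp add: mulA_bas(2) sum_distrib_left mult.assoc)
      also have "\<dots> = (\<Sum>a\<in>UNIV. \<Sum>b\<in>UNIV. (D1 a b * e2 a i) * (if k = b then 1 else 0))"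
        by (simp add: bas_def)
      finally show ?thesis by (simp only: sum_delta_mult)
    qed
    show "(\<Sum>a\<in>UNIV. \<Sum>b\<in>UNIV. \<Sum>d\<in>UNIV. \<Sum>a'\<in>UNIV. \<Sum>d'\<in>UNIV.
        (\<Sum>r\<in>UNIV. scomul H i a r * scomul H r b d) * santi H a a' * santi H d d' * (\<Sum>r\<in>UNIV. smul H a' b r * smul H r d' k)) = santi H i k"
    proof -
      have mm: "mulA H (mulA H (santi H a) (bas b)) (santi H d) k =
        (\<Sum>a'\<in>UNIV. \<Sum>d'\<in>UNIV. santi H a a' * santi H d d' * (\<Sum>r\<in>UNIV. smul H a' b r * smul H r d' k))" for a b d
      proof -
        have "mulA H (mulA H (santi H a) (bas b)) (santi H d) k =
          (\<Sum>r\<in>UNIV. \<Sum>d'\<in>UNIV. \<Sum>a'\<in>UNIV. santi H a a' * santi H d d' * (smul H a' b r * smul H r d' k))"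
          by (simp only: mulA_bas(3)) (simp add: mulA_def sum_distrib_right, simp only: mult_ac)
        also have "\<dots> = (\<Sum>d'\<in>UNIV. \<Sum>a'\<in>UNIV. \<Sum>r\<in>UNIV. santi H a a' * santi H d d' * (smul H a' b r * smul H r d' k))"
          by (subst sum.swap) (rule sum.cong[OF refl], rule sum.swap)
        also have "\<dots> = (\<Sum>a'\<in>UNIV. \<Sum>d'\<in>UNIV. \<Sum>r\<in>UNIV. santi H a a' * santi H d d' * (smul H a' b r * smul H r d' k))"
          by (rule sum.swap)
        finally show ?thesis by (simp only: sum_distrib_left)
      qed
      have c3: "(\<Sum>r\<in>UNIV. scomul H i r d * scomul H r a b) = (\<Sum>r\<in>UNIV. scomul H i a r * scomul H r b d)" for a b d
        by (rule coass)
      have "santi H i k = (\<Sum>p\<in>UNIV. Delta2A H (bas i) p *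
            mulA H (mulA H (SA H (bas (fst (fst p)))) (bas (snd (fst p)))) (SA H (bas (snd p))) k)"
        using fun_cong[OF S3[of "bas i"], of k] by (simp add: SA_bas)
      also have "\<dots> = (\<Sum>a\<in>UNIV. \<Sum>b\<in>UNIV. \<Sum>d\<in>UNIV. (\<Sum>r\<in>UNIV. scomul H i a r * scomul H r b d) *
            mulA H (mulA H (santi H a) (bas b)) (santi H d) k)"
        by (simp add: sum_UNIV_prod Delta2A_apply DeltaA_bas SA_bas c3)
      finally show ?thesis
        unfolding mm by (simp add: sum_distrib_left mult.assoc)
    qed
  qed
  then show ?thesis unfolding D1_def e2_def .
qed

lemma minv_props:
  assumes A: "A \<in> carrier_mat n n" and inv: "invertible_mat A"
  shows "minv A \<in> carrier_mat n n" "A * minv A = 1\<^sub>m n" "minv A * A = 1\<^sub>m n"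
proof -
  obtain B where B: "A * B = 1\<^sub>m (dim_row A)" "B * A = 1\<^sub>m (dim_row B)"
    using inv unfolding invertible_mat_def inverts_mat_def by auto
  have "dim_col B = n" using arg_cong[OF B(1), of dim_col] A by simp
  moreover have "dim_row B = n" using arg_cong[OF B(2), of dim_col] A by simp
  ultimately have Bc: "B \<in> carrier_mat n n" by auto
  let ?P = "\<lambda>B. B \<in> carrier_mat (dim_col A) (dim_row A) \<and> A * B = 1\<^sub>m (dim_row A) \<and> B * A = 1\<^sub>m (dim_col A)"
  have PB: "?P B" using A B Bc by auto
  moreover have "C = B" if C: "?P C" for C
  proof -
    have "C = C * (A * B)" using C A Bc PB by auto
    also have "\<dots> = (C * A) * B" using C A Bc by (intro assoc_mult_mat[symmetric]) auto
    also have "\<dots> = B" using C A Bc by auto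
    finally show ?thesis .
  qed
  ultimately have "?P (minv A)" unfolding minv_def by (rule theI)
  then show "minv A \<in> carrier_mat n n" "A * minv A = 1\<^sub>m n" "minv A * A = 1\<^sub>m n" using A by auto
qed

lemma mtrace_transpose: "A \<in> carrier_mat n n \<Longrightarrow> mtrace (transpose_mat A) = mtrace A"
  by (auto simp: mtrace_def)

lemma mtrace_smult: "mtrace (x \<cdot>\<^sub>m A) = x * mtrace A" if "A \<in> carrier_mat n n"
  using that by (simp add: mtrace_def sum_distrib_left)

lemma mtrace_mult:
  assumes "A \<in> carrier_mat n m" "B \<in> carrier_mat m n"
  shows "mtrace (A * B) = (\<Sum>i<n. \<Sum>j<m. A $$ (i, j) * B $$ (j, i))"
  unfolding mtrace_def using assms by (auto simp: scalar_prod_def atLeast0LessThan intro!: sum.cong)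

lemma index_mult_sum:
  assumes "A \<in> carrier_mat n m" "B \<in> carrier_mat m r" "i < n" "j < r"
  shows "(A * B) $$ (i, j) = (\<Sum>k<m. A $$ (i, k) * B $$ (k, j) :: complex)"
  using assms by (simp add: scalar_prod_def atLeast0LessThan)

lemma mat_mult3_index:
  assumes "A \<in> carrier_mat n m" "B \<in> carrier_mat m r" "C \<in> carrier_mat r t" "i < n" "j < t"
  shows "(A * B * C) $$ (i, j) = (\<Sum>k<m. \<Sum>l<r. A $$ (i, k) * B $$ (k, l) * C $$ (l, j) :: complex)"
proof -
  have "(A * B * C) $$ (i, j) = (\<Sum>l<r. \<Sum>k<m. A $$ (i, k) * B $$ (k, l) * C $$ (l, j))"
    unfolding index_mult_sum[OF mult_carrier_mat[OF assms(1,2)] assms(3,4,5)] sum_distrib_right[symmetric]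
    using index_mult_sum[OF assms(1,2,4)] by (intro sum.cong refl) simp
  then show ?thesis by (subst sum.swap)
qed

lemma sum_div_mod:
  fixes f :: "nat \<Rightarrow> nat \<Rightarrow> complex"
  shows "(\<Sum>r<m * n. f (r div n) (r mod n)) = (\<Sum>i<m. \<Sum>j<n. f i j)"
proof -
  have "(\<Sum>i<m. \<Sum>j<n. f i j) = (\<Sum>(i, j)\<in>{..<m} \<times> {..<n}. f i j)"
    by (simp add: sum.cartesian_product)
  also have "\<dots> = (\<Sum>r<m * n. f (r div n) (r mod n))"
  proof (rule sum.reindex_bij_witness[where i = "\<lambda>r. (r div n, r mod n)" and j = "\<lambda>(i, j). i * n + j"])
    fix r assume "r \<in> {..<m * n}"
    then have r: "r < m * n" and n: "n > 0" by (auto intro: Nat.gr0I)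
    then show "(r div n, r mod n) \<in> {..<m} \<times> {..<n}"
      by (auto simp: less_mult_imp_div_less)
    show "(case (r div n, r mod n) of (i, j) \<Rightarrow> i * n + j) = r" by simp
  next
    fix x assume "x \<in> {..<m} \<times> {..<n}"
    then obtain i j where x: "x = (i, j)" "i < m" "j < n" by auto
    have "i * n + j < (i + 1) * n" using x by simp
    also have "\<dots> \<le> m * n" using x by (intro mult_right_mono) auto
    finally show "(case x of (i, j) \<Rightarrow> i * n + j) \<in> {..<m * n}" using x by simp
    show "f ((case x of (i, j) \<Rightarrow> i * n + j) div n) ((case x of (i, j) \<Rightarrow> i * n + j) mod n) = (case x of (i, j) \<Rightarrow> f i j)"
      using x by simp
    show "((case x of (i, j) \<Rightarrow> i * n + j) div n, (case x of (i, j) \<Rightarrow> i * n + j) mod n) = x"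
      using x by simp
  qed
  finally show ?thesis by simp
qed

section \<open>The dual algebra and its irreducible blocks\<close>

locale pivotal_fusion =
  fixes H :: "'i::finite wstr"
    and dimW :: "'a::finite \<Rightarrow> nat" and \<psi> :: "'a \<Rightarrow> 'i cv \<Rightarrow> complex mat"
    and N :: "'a \<Rightarrow> 'a \<Rightarrow> 'a \<Rightarrow> nat" and V W :: "'a \<Rightarrow> 'a \<Rightarrow> 'a \<Rightarrow> nat \<Rightarrow> complex mat"
    and b u v :: "'a \<Rightarrow> complex mat" and bar :: "'a \<Rightarrow> 'a" and Z :: "'a \<Rightarrow> complex mat"
    and w d \<xi> :: "'a \<Rightarrow> complex" and g k :: "'i cv"
  assumes wha: "weak_hopf H"
    and semisimple: "dsemisimple H"
    and irr: "irr_family H dimW \<psi>"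
    and fusion: "fusion_data H dimW \<psi> N V W"
    and vacuum: "vacuum_data H dimW \<psi> b u v"
    and conj: "conj_data H dimW \<psi> bar Z"
    and wdef: "w_data dimW N V W b u v bar Z w"
    and d_sq: "\<And>a. (d a)\<^sup>2 = w a * w (bar a)"
    and d_bar: "\<And>a. d a = d (bar a)"
    and g_def: "\<And>a. \<psi> a g = (d a / w (bar a)) \<cdot>\<^sub>m (transpose_mat (minv (Z a)) * Z (bar a))"
    and k_piv: "dpivotal_elem H k"
    and \<xi>_def: "\<And>a. \<psi> a k = \<xi> a \<cdot>\<^sub>m \<psi> a g"
begin

abbreviation "D1 \<equiv> \<lambda>j k. \<Sum>r\<in>UNIV. sunit H r * scomul H r j k"
abbreviation "e2 \<equiv> \<lambda>i j. \<Sum>r\<in>UNIV. scounit H r * smul H i j r"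
abbreviation "Bm \<equiv> \<lambda>i j k. scomul H k i j"
abbreviation "Bc \<equiv> \<lambda>i j k. smul H j k i"
abbreviation "Bs \<equiv> \<lambda>i j. santi H j i"

sublocale A: wha "smul H" "sunit H" "scomul H" "scounit H" "santi H" D1 e2
  by (rule wha_of_weak_hopf[OF wha])

sublocale B: wha Bm "scounit H" Bc "sunit H" Bs e2 D1
  by (rule A.dual)

lemma B_mul: "B.mul = dmul H"
  by (intro ext) (simp add: B.mul_def dmul_def sum_UNIV_prod)

lemma B_one: "B.one = dunit H"
  by (simp add: B.one_def dunit_def)

lemma B_S: "B.S = dS H"
  by (intro ext) (simp add: B.S_def dS_def mult.commute)

lemma B_eps: "B.eps f = ev f (oneA H)"
  by (simp add: B.eps_def ev_def oneA_def)

lemma B_sw: "B.sw f F = (\<Sum>i\<in>UNIV. \<Sum>j\<in>UNIV. dDelta H f (i, j) * F (bas i) (bas j))"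
  by (simp add: B.sw_def dDelta_def)

lemmas dmul_assoc = B.mul_assoc[unfolded B_mul]
lemmas dmul_one = B.one_mul[unfolded B_mul B_one] B.mul_one[unfolded B_mul B_one]

definition k' :: "'i cv" where "k' = dinv H k"

text \<open>Two-sided inverses are unique, so the definite description behind \<open>dinv\<close>
  denotes the inverse.\<close>

lemma k_inverse: "B.mul k k' = B.one" "B.mul k' k = B.one"
proof -
  obtain h where h: "dmul H k h = dunit H" "dmul H h k = dunit H"
    using k_piv by (auto simp: dpivotal_elem_def dgrouplike_def dinvertible_def)
  have uniq: "h' = h" if "dmul H k h' = dunit H \<and> dmul H h' k = dunit H" for h'
  proof -
    have "h' = dmul H h' (dmul H k h)" by (simp only: h dmul_one)
    also have "\<dots> = dmul H (dmul H h' k) h" by (rule dmul_assoc[symmetric])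
    also have "\<dots> = h" using that by (simp only: dmul_one)
    finally show ?thesis .
  qed
  have "\<exists>!h. dmul H k h = dunit H \<and> dmul H h k = dunit H"
    by (rule ex1I[of _ h]) (simp only: h simp_thms, rule uniq)
  then have "dmul H k k' = dunit H \<and> dmul H k' k = dunit H"
    unfolding k'_def dinv_def by (rule theI')
  then show "B.mul k k' = B.one" "B.mul k' k = B.one" by (simp_all add: B_mul B_one)
qed

text \<open>Converts group-likeness, stated as an equality of coordinate tensors, into the paired
  form required by \<open>wha_pivotal\<close>.\<close>

lemma dmul2_left:
  assumes F: "\<And>b. lin (\<lambda>a. F a b)" "\<And>a. lin (F a)"
  shows "(\<Sum>i\<in>UNIV. \<Sum>j\<in>UNIV. dmul2 H (tens x y) X (i, j) * F (bas i) (bas j)) =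
    (\<Sum>i\<in>UNIV. \<Sum>j\<in>UNIV. X (i, j) * F (B.mul x (bas i)) (B.mul y (bas j)))"
proof -
  have e: "dmul2 H (tens x y) X (i, j) = (\<Sum>q\<in>UNIV. \<Sum>q'\<in>UNIV. X (q, q') * (B.mul x (bas q) i * B.mul y (bas q') j))" for i j
  proof -
    have "dmul2 H (tens x y) X (i, j) = (\<Sum>q\<in>UNIV. \<Sum>p\<in>UNIV. tens x y p * X q * scomul H i (fst p) (fst q) * scomul H j (snd p) (snd q))"
      unfolding dmul2_def prod.case by (rule sum.swap)
    also have "\<dots> = (\<Sum>q\<in>UNIV. \<Sum>q'\<in>UNIV. X (q, q') * (\<Sum>p\<in>UNIV. \<Sum>p'\<in>UNIV. (x p * scomul H i p q) * (y p' * scomul H j p' q')))"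
      by (simp add: sum_UNIV_prod tens_def sum_distrib_left) (intro sum.cong refl, simp only: mult_ac)
    finally show ?thesis by (simp add: B.mul_bas' sum_product)
  qed
  have FF: "F x' y' = (\<Sum>i\<in>UNIV. \<Sum>j\<in>UNIV. (x' i * y' j) * F (bas i) (bas j))" for x' y'
    by (subst lin_expand[OF F(1)], subst lin_expand[OF F(2)]) (simp add: sum_distrib_left mult.assoc)
  have "(\<Sum>i\<in>UNIV. \<Sum>j\<in>UNIV. dmul2 H (tens x y) X (i, j) * F (bas i) (bas j)) =
    (\<Sum>i\<in>UNIV. \<Sum>j\<in>UNIV. \<Sum>q\<in>UNIV. \<Sum>q'\<in>UNIV. X (q, q') * ((B.mul x (bas q) i * B.mul y (bas q') j) * F (bas i) (bas j)))"
    unfolding e by (simp only: sum_distrib_right mult.assoc)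
  also have "\<dots> = (\<Sum>j\<in>UNIV. \<Sum>q\<in>UNIV. \<Sum>q'\<in>UNIV. \<Sum>i\<in>UNIV. X (q, q') * ((B.mul x (bas q) i * B.mul y (bas q') j) * F (bas i) (bas j)))"
    by (rule sum_rotate4)
  also have "\<dots> = (\<Sum>q\<in>UNIV. \<Sum>q'\<in>UNIV. \<Sum>i\<in>UNIV. \<Sum>j\<in>UNIV. X (q, q') * ((B.mul x (bas q) i * B.mul y (bas q') j) * F (bas i) (bas j)))"
    by (rule sum_rotate4)
  also have "\<dots> = (\<Sum>q\<in>UNIV. \<Sum>q'\<in>UNIV. X (q, q') * F (B.mul x (bas q)) (B.mul y (bas q')))"
    by (subst FF) (simp only: sum_distrib_left)
  finally show ?thesis .
qed

lemma dmul2_right: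
  assumes F: "\<And>b. lin (\<lambda>a. F a b)" "\<And>a. lin (F a)"
  shows "(\<Sum>i\<in>UNIV. \<Sum>j\<in>UNIV. dmul2 H X (tens x y) (i, j) * F (bas i) (bas j)) =
    (\<Sum>i\<in>UNIV. \<Sum>j\<in>UNIV. X (i, j) * F (B.mul (bas i) x) (B.mul (bas j) y))"
proof -
  have e: "dmul2 H X (tens x y) (i, j) = (\<Sum>q\<in>UNIV. \<Sum>q'\<in>UNIV. X (q, q') * (B.mul (bas q) x i * B.mul (bas q') y j))" for i j
  proof -
    have "dmul2 H X (tens x y) (i, j) = (\<Sum>q\<in>UNIV. \<Sum>q'\<in>UNIV. X (q, q') * (\<Sum>p\<in>UNIV. \<Sum>p'\<in>UNIV. (x p * scomul H i q p) * (y p' * scomul H j q' p')))"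
      unfolding dmul2_def by (simp add: sum_UNIV_prod tens_def sum_distrib_left) (intro sum.cong refl, simp only: mult_ac)
    then show ?thesis by (simp add: B.bas_mul sum_product)
  qed
  have FF: "F x' y' = (\<Sum>i\<in>UNIV. \<Sum>j\<in>UNIV. (x' i * y' j) * F (bas i) (bas j))" for x' y'
    by (subst lin_expand[OF F(1)], subst lin_expand[OF F(2)]) (simp add: sum_distrib_left mult.assoc)
  have "(\<Sum>i\<in>UNIV. \<Sum>j\<in>UNIV. dmul2 H X (tens x y) (i, j) * F (bas i) (bas j)) =
    (\<Sum>i\<in>UNIV. \<Sum>j\<in>UNIV. \<Sum>q\<in>UNIV. \<Sum>q'\<in>UNIV. X (q, q') * ((B.mul (bas q) x i * B.mul (bas q') y j) * F (bas i) (bas j)))"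
    unfolding e by (simp only: sum_distrib_right mult.assoc)
  also have "\<dots> = (\<Sum>j\<in>UNIV. \<Sum>q\<in>UNIV. \<Sum>q'\<in>UNIV. \<Sum>i\<in>UNIV. X (q, q') * ((B.mul (bas q) x i * B.mul (bas q') y j) * F (bas i) (bas j)))"
    by (rule sum_rotate4)
  also have "\<dots> = (\<Sum>q\<in>UNIV. \<Sum>q'\<in>UNIV. \<Sum>i\<in>UNIV. \<Sum>j\<in>UNIV. X (q, q') * ((B.mul (bas q) x i * B.mul (bas q') y j) * F (bas i) (bas j)))"
    by (rule sum_rotate4)
  also have "\<dots> = (\<Sum>q\<in>UNIV. \<Sum>q'\<in>UNIV. X (q, q') * F (B.mul (bas q) x) (B.mul (bas q') y))"
    by (subst FF) (simp only: sum_distrib_left)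
  finally show ?thesis .
qed

sublocale B: wha_pivotal Bm "scounit H" Bc "sunit H" Bs e2 D1 k k'
proof
  show "B.mul k k' = B.one" "B.mul k' k = B.one" by (rule k_inverse)+
  show "B.S (B.S f) = B.mul (B.mul k f) k'" for f
    using k_piv by (simp add: dpivotal_elem_def B_S B_mul k'_def)
  fix F :: "'i cv \<Rightarrow> 'i cv \<Rightarrow> complex" assume F: "\<And>b. lin (\<lambda>a. F a b)" "\<And>a. lin (F a)"
  have D: "dDelta H k = dmul2 H (tens k k) (dDelta H (dunit H))" "dDelta H k = dmul2 H (dDelta H (dunit H)) (tens k k)"
    using k_piv by (auto simp: dpivotal_elem_def dgrouplike_def)
  show "B.sw k F = B.sw B.one (\<lambda>a b. F (B.mul k a) (B.mul k b))"
    unfolding B_sw B_one by (subst D(1)) (rule dmul2_left[OF F])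
  show "B.sw k F = B.sw B.one (\<lambda>a b. F (B.mul a k) (B.mul b k))"
    unfolding B_sw B_one by (subst D(2)) (rule dmul2_right[OF F])
qed

text \<open>Entries outside the matrix are set to 0, so that the product rule and the values on
  matrix units hold for all indices.\<close>

definition p :: "'a \<Rightarrow> nat \<Rightarrow> nat \<Rightarrow> 'i cv \<Rightarrow> complex" where
  "p a i j f = (if i < dimW a \<and> j < dimW a then \<psi> a f $$ (i, j) else 0)"

definition E :: "'a \<Rightarrow> nat \<Rightarrow> nat \<Rightarrow> 'i cv" where
  "E = (SOME E. \<forall>a i j a' r l. i < dimW a \<longrightarrow> j < dimW a \<longrightarrow> r < dimW a' \<longrightarrow> l < dimW a' \<longrightarrow>
    \<psi> a' (E a i j) $$ (r, l) = (if a = a' \<and> i = r \<and> j = l then 1 else 0))"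

lemma \<psi>_E: "i < dimW a \<Longrightarrow> j < dimW a \<Longrightarrow> r < dimW a' \<Longrightarrow> l < dimW a' \<Longrightarrow>
    \<psi> a' (E a i j) $$ (r, l) = (if a = a' \<and> i = r \<and> j = l then 1 else 0)"
  using someI_ex[OF exists_matrix_units[OF irr]] unfolding E_def[symmetric] by simp

lemma rep: "drep H (dimW a) (\<psi> a)"
  using irr by (simp add: irr_family_def dirrep_def)

lemma \<psi>_carrier [simp]: "\<psi> a f \<in> carrier_mat (dimW a) (dimW a)"
  by (rule drepD(1)[OF rep])

lemma \<psi>_dim [simp]: "dim_row (\<psi> a f) = dimW a" "dim_col (\<psi> a f) = dimW a"
  using carrier_matD[OF \<psi>_carrier] by blast+

lemma \<psi>_mul: "\<psi> a (B.mul f h) = \<psi> a f * \<psi> a h"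
  unfolding B_mul by (rule drepD(2)[OF rep])

lemma \<psi>_one: "\<psi> a B.one = 1\<^sub>m (dimW a)"
  unfolding B_one by (rule drepD(3)[OF rep])

lemma \<psi>_lin: "\<psi> a (\<lambda>i. x * f i + h i) = x \<cdot>\<^sub>m \<psi> a f + \<psi> a h"
  by (rule drepD(4)[OF rep])

sublocale B: wha_split Bm "scounit H" Bc "sunit H" Bs e2 D1 k k' dimW p E
proof
  show "lin (p a i j)" for a i j
  proof (cases "i < dimW a \<and> j < dimW a")
    case True
    then have "p a i j = (\<lambda>f. \<psi> a f $$ (i, j))" by (auto simp: p_def)
    then show ?thesis using lin_rep_entry[OF rep] True by simp
  next
    case False
    then have "p a i j = (\<lambda>f. 0)" by (auto simp: p_def)
    then show ?thesis by (simp add: lin_def)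
  qed
  show "p a i j (B.mul f h) = (\<Sum>l<dimW a. p a i l f * p a l j h)" for a i j f h
    by (auto simp: p_def \<psi>_mul index_mult_sum[OF \<psi>_carrier \<psi>_carrier] simp del: index_mult_mat(1))
  show "p a i j B.one = (if i = j then 1 else 0)" if "i < dimW a" "j < dimW a" for a i j
    using that by (simp add: p_def \<psi>_one)
  show "p b' i' j' (E a i j) = (if a = b' \<and> i = i' \<and> j = j' then 1 else 0)" if "i < dimW a" "j < dimW a" for a i j b' i' j'
    using that by (auto simp: p_def \<psi>_E)
  show "dimW a > 0" for a using irr by (simp add: irr_family_def dirrep_def)
  show "f = h" if eq: "\<And>a i j. i < dimW a \<Longrightarrow> j < dimW a \<Longrightarrow> p a i j f = p a i j h" for f h
  proof -
    have "\<psi> a (\<lambda>i. (-1) * f i + h i) = 0\<^sub>m (dimW a) (dimW a)" for a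
      unfolding \<psi>_lin
    proof (rule eq_matI)
      fix i j assume "i < dim_row (0\<^sub>m (dimW a) (dimW a) :: complex mat)" "j < dim_col (0\<^sub>m (dimW a) (dimW a) :: complex mat)"
      then have ij: "i < dimW a" "j < dimW a" by simp_all
      then show "(- 1 \<cdot>\<^sub>m \<psi> a f + \<psi> a h) $$ (i, j) = 0\<^sub>m (dimW a) (dimW a) $$ (i, j)"
        using eq[OF ij] \<psi>_carrier[of a f] \<psi>_carrier[of a h] by (simp add: p_def)
    qed (use \<psi>_carrier in auto)
    then have "(\<lambda>i. (-1) * f i + h i) = (\<lambda>i. 0)"
      by (rule irreps_separate[OF irr semisimple dmul_assoc dmul_one])
    then show ?thesis by (auto simp: fun_eq_iff)
  qed
qed

lemma dim_pos: "dimW a > 0"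
  by (rule B.n_pos)

lemma \<psi>_p: "i < dimW a \<Longrightarrow> j < dimW a \<Longrightarrow> \<psi> a f $$ (i, j) = p a i j f"
  by (simp add: p_def)

lemma chi_mtrace: "B.chi a f = mtrace (\<psi> a f)"
  by (simp add: B.chi_def mtrace_def p_def)

text \<open>Invertibility of \<open>Z a\<close> includes that it is square.\<close>

lemma dim_bar: "dimW (bar a) = dimW a"
proof -
  have "Z a \<in> carrier_mat (dimW a) (dimW (bar a))" "invertible_mat (Z a)"
    using conj by (auto simp: conj_data_def)
  then show ?thesis by (auto simp: invertible_mat_def)
qed

lemma \<psi>_bar_carrier [simp]: "\<psi> (bar a) f \<in> carrier_mat (dimW a) (dimW a)"
  using \<psi>_carrier[of "bar a" f] by (simp only: dim_bar)

lemma Z_carrier [simp]: "Z a \<in> carrier_mat (dimW a) (dimW a)"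
  using conj by (auto simp: conj_data_def dim_bar)

lemma Z_bar_carrier [simp]: "Z (bar a) \<in> carrier_mat (dimW a) (dimW a)"
  using Z_carrier[of "bar a"] by (simp only: dim_bar)

abbreviation "Zi a \<equiv> minv (Z a)"

lemma Z_inverse: "Zi a \<in> carrier_mat (dimW a) (dimW a)" "Z a * Zi a = 1\<^sub>m (dimW a)" "Zi a * Z a = 1\<^sub>m (dimW a)"
  using minv_props[OF Z_carrier] conj by (auto simp: conj_data_def)

lemma Zi_carrier [simp]: "Zi a \<in> carrier_mat (dimW a) (dimW a)" "Zi (bar a) \<in> carrier_mat (dimW a) (dimW a)"
  using Z_inverse(1)[of a] Z_inverse(1)[of "bar a"] by (simp_all only: dim_bar)

lemma Z_bar_inverse: "Z (bar a) * Zi (bar a) = 1\<^sub>m (dimW a)" "Zi (bar a) * Z (bar a) = 1\<^sub>m (dimW a)"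
  using Z_inverse[of "bar a"] by (simp_all only: dim_bar)

lemma conj_eq: "transpose_mat (\<psi> a (B.S f)) = Z a * \<psi> (bar a) f * Zi a"
  using conj by (simp add: conj_data_def B_S)

lemma conj_left: "transpose_mat (\<psi> a (B.S f)) * Z a = Z a * \<psi> (bar a) f"
proof -
  let ?n = "dimW a"
  have "transpose_mat (\<psi> a (B.S f)) * Z a = (Z a * \<psi> (bar a) f) * (Zi a * Z a)"
    unfolding conj_eq by (rule assoc_mult_mat[of _ ?n ?n _ ?n _ ?n]) (simp_all add: mult_carrier_mat[of _ ?n ?n _ ?n])
  then show ?thesis by (simp add: Z_inverse right_mult_one_mat[of _ ?n ?n] mult_carrier_mat[of _ ?n ?n _ ?n])
qed

text \<open>\<open>R a\<close> is the matrix part of \<open>\<psi> a g\<close>, and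
  \<open>K a\<close> is its inverse; both \<open>g\<close> and \<open>k\<close> act through
  \<open>R a\<close> up to a scalar.\<close>

definition R :: "'a \<Rightarrow> complex mat" where "R a = transpose_mat (Zi a) * Z (bar a)"

definition K :: "'a \<Rightarrow> complex mat" where "K a = Zi (bar a) * transpose_mat (Z a)"

lemma R_K_carrier [simp]: "R a \<in> carrier_mat (dimW a) (dimW a)" "K a \<in> carrier_mat (dimW a) (dimW a)"
  by (simp_all add: R_def K_def mult_carrier_mat[of _ "dimW a" "dimW a" _ "dimW a"])

lemma R_K: "R a * K a = 1\<^sub>m (dimW a)" "K a * R a = 1\<^sub>m (dimW a)"
proof -
  let ?n = "dimW a"
  note as = assoc_mult_mat[of _ ?n ?n _ ?n _ ?n]
  note car = mult_carrier_mat[of _ ?n ?n _ ?n]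
  have t1: "transpose_mat (Zi a) * transpose_mat (Z a) = 1\<^sub>m ?n"
    by (subst transpose_mult[symmetric, of _ ?n ?n _ ?n]) (simp_all add: Z_inverse)
  have t2: "transpose_mat (Z a) * transpose_mat (Zi a) = 1\<^sub>m ?n"
    by (subst transpose_mult[symmetric, of _ ?n ?n _ ?n]) (simp_all add: Z_inverse)
  have "R a * K a = transpose_mat (Zi a) * ((Z (bar a) * Zi (bar a)) * transpose_mat (Z a))"
    unfolding R_def K_def by (simp add: as car)
  then show "R a * K a = 1\<^sub>m ?n" by (simp add: Z_bar_inverse t1 left_mult_one_mat[of _ ?n ?n] right_mult_one_mat[of _ ?n ?n])
  have "K a * R a = Zi (bar a) * ((transpose_mat (Z a) * transpose_mat (Zi a)) * Z (bar a))"
    unfolding R_def K_def by (simp add: as car)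
  then show "K a * R a = 1\<^sub>m ?n" by (simp add: Z_bar_inverse t2 left_mult_one_mat[of _ ?n ?n] right_mult_one_mat[of _ ?n ?n])
qed

text \<open>The square of the antipode is computed twice: conjugating twice gives
  \<open>bar (bar a)\<close> transported by \<open>R a\<close>, and pivotality gives
  \<open>a\<close> conjugated by \<open>k\<close>. The two representations are therefore equivalent,
  and distinct labels are inequivalent.\<close>

lemma bar_bar: "bar (bar a) = a"
proof (rule ccontr)
  assume ne: "bar (bar a) \<noteq> a"
  let ?n = "dimW a"
  note as = assoc_mult_mat[of _ ?n ?n _ ?n _ ?n]
  note car = mult_carrier_mat[of _ ?n ?n _ ?n]
  let ?b = "bar (bar a)"
  have dimbb: "dimW ?b = ?n" by (simp add: dim_bar)
  have bbcar [simp]: "\<psi> ?b f \<in> carrier_mat ?n ?n" for f using \<psi>_bar_carrier[of "bar a" f] by (simp only: dim_bar)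
  have S2: "\<psi> a (B.S (B.S f)) = R a * \<psi> ?b f * K a" for f
  proof -
    have "\<psi> a (B.S (B.S f)) = transpose_mat (transpose_mat (\<psi> a (B.S (B.S f))))" by simp
    also have "\<dots> = transpose_mat (Zi a) * (transpose_mat (\<psi> (bar a) (B.S f)) * transpose_mat (Z a))"
      unfolding conj_eq[of a] by (simp add: transpose_mult[of _ ?n ?n _ ?n] car)
    also have "\<dots> = R a * \<psi> ?b f * K a"
      unfolding conj_eq[of "bar a"] R_def K_def by (simp add: as car)
    finally show ?thesis .
  qed
  have k: "\<psi> a k * \<psi> a k' = 1\<^sub>m ?n" "\<psi> a k' * \<psi> a k = 1\<^sub>m ?n"
    using B.k_k' B.k'_k by (simp_all add: \<psi>_mul[symmetric] \<psi>_one)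
  define Q where "Q = \<psi> a k' * R a"
  have Q: "Q \<in> carrier_mat ?n ?n" by (simp add: Q_def car)
  have inter: "\<psi> a f * Q = Q * \<psi> ?b f" for f
  proof -
    have "\<psi> a k * \<psi> a f * \<psi> a k' = R a * \<psi> ?b f * K a"
      using S2[of f] by (simp add: B.S2 \<psi>_mul)
    then have "\<psi> a k' * (\<psi> a k * \<psi> a f * \<psi> a k') * R a = \<psi> a k' * (R a * \<psi> ?b f * K a) * R a" by simp
    moreover have "\<psi> a k' * (\<psi> a k * \<psi> a f * \<psi> a k') * R a = (\<psi> a k' * \<psi> a k) * (\<psi> a f * Q)"
      unfolding Q_def by (simp add: as car)
    moreover have "\<psi> a k' * (R a * \<psi> ?b f * K a) * R a = Q * \<psi> ?b f * (K a * R a)"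
      unfolding Q_def by (simp add: as car)
    ultimately show ?thesis using Q by (simp add: k R_K car left_mult_one_mat[of _ ?n ?n] right_mult_one_mat[of _ ?n ?n])
  qed
  have "invertible_mat Q"
    unfolding invertible_mat_def inverts_mat_def
  proof (intro conjI exI[of _ "K a * \<psi> a k"])
    have "Q * (K a * \<psi> a k) = \<psi> a k' * ((R a * K a) * \<psi> a k)" unfolding Q_def by (simp add: as car)
    then show "Q * (K a * \<psi> a k) = 1\<^sub>m (dim_row Q)" using Q by (simp add: R_K k left_mult_one_mat[of _ ?n ?n] right_mult_one_mat[of _ ?n ?n])
    have "K a * \<psi> a k * Q = K a * ((\<psi> a k * \<psi> a k') * R a)" unfolding Q_def by (simp add: as car)
    then show "K a * \<psi> a k * Q = 1\<^sub>m (dim_row (K a * \<psi> a k))" using Q by (simp add: R_K k carrier_matD(1)[OF R_K_carrier(2)] left_mult_one_mat[of _ ?n ?n] right_mult_one_mat[of _ ?n ?n])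
  qed (use Q in auto)
  then have "rep_equiv (dimW a) (\<psi> a) (dimW ?b) (\<psi> ?b)"
    unfolding rep_equiv_def using Q inter dimbb by auto
  then show False using irr ne by (auto simp: irr_family_def)
qed

section \<open>Fusion multiplicities and vacuum labels\<close>

lemma psi2_entry:
  assumes "r < dimW a * dimW c" "s < dimW a * dimW c"
  shows "psi2 dimW \<psi> a c (dDelta H f) $$ (r, s) =
    B.sw f (\<lambda>x y. p a (r div dimW c) (s div dimW c) x * p c (r mod dimW c) (s mod dimW c) y)"
proof -
  have "r div dimW c < dimW a" "s div dimW c < dimW a" "r mod dimW c < dimW c" "s mod dimW c < dimW c"
    using assms dim_pos[of c] by (simp_all add: less_mult_imp_div_less)
  then show ?thesis
    using assms by (simp add: psi2_def sum_UNIV_prod kron_def B_sw p_def mult.assoc)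
qed

lemma psi2_fusion:
  assumes "r < dimW a * dimW c" "s < dimW a * dimW c"
  shows "psi2 dimW \<psi> a c (dDelta H f) $$ (r, s) = (\<Sum>x\<in>UNIV. \<Sum>\<mu><N a c x. (V a c x \<mu> * \<psi> x f * W a c x \<mu>) $$ (r, s))"
  using fusion assms by (simp add: fusion_data_def)

lemma VW_carrier:
  "\<mu> < N a c x \<Longrightarrow> V a c x \<mu> \<in> carrier_mat (dimW a * dimW c) (dimW x)"
  "\<mu> < N a c x \<Longrightarrow> W a c x \<mu> \<in> carrier_mat (dimW x) (dimW a * dimW c)"
  using fusion by (simp_all add: fusion_data_def)

lemma WV:
  "\<mu> < N a c x \<Longrightarrow> \<nu> < N a c y \<Longrightarrow> W a c x \<mu> * V a c y \<nu> =
    (if x = y \<and> \<mu> = \<nu> then 1\<^sub>m (dimW x) else 0\<^sub>m (dimW x) (dimW y))"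
  using fusion unfolding fusion_data_def by blast

text \<open>Trace of the fusion decomposition: cyclicity brings \<open>W\<close> next to
  \<open>V\<close>, and every channel contributes one character.\<close>

lemma chi_chi: "B.sw f (\<lambda>x y. B.chi a x * B.chi c y) = (\<Sum>e\<in>UNIV. of_nat (N a c e) * B.chi e f)"
proof -
  let ?M = "dimW a * dimW c"
  have "B.sw f (\<lambda>x y. B.chi a x * B.chi c y) = (\<Sum>i<dimW a. \<Sum>j<dimW c. B.sw f (\<lambda>x y. p a i i x * p c j j y))"
    by (simp only: B.chi_def sum_product B.sw_sum)
  also have "\<dots> = (\<Sum>r<?M. B.sw f (\<lambda>x y. p a (r div dimW c) (r div dimW c) x * p c (r mod dimW c) (r mod dimW c) y))"
    by (rule sum_div_mod[symmetric])
  also have "\<dots> = (\<Sum>r<?M. \<Sum>e\<in>UNIV. \<Sum>\<mu><N a c e. (V a c e \<mu> * \<psi> e f * W a c e \<mu>) $$ (r, r))"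
    by (intro sum.cong refl) (simp add: psi2_entry[symmetric] psi2_fusion)
  also have "\<dots> = (\<Sum>e\<in>UNIV. \<Sum>\<mu><N a c e. \<Sum>r<?M. (V a c e \<mu> * \<psi> e f * W a c e \<mu>) $$ (r, r))"
    by (subst sum.swap, rule sum.cong[OF refl], rule sum.swap)
  also have "\<dots> = (\<Sum>e\<in>UNIV. \<Sum>\<mu><N a c e. B.chi e f)"
  proof (intro sum.cong refl)
    fix e \<mu> assume "\<mu> \<in> {..<N a c e}"
    then have \<mu>: "\<mu> < N a c e" by simp
    note [simp] = VW_carrier[OF \<mu>]
    have "(\<Sum>r<?M. (V a c e \<mu> * \<psi> e f * W a c e \<mu>) $$ (r, r)) = mtrace (V a c e \<mu> * (\<psi> e f * W a c e \<mu>))"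
      unfolding mtrace_def by (subst assoc_mult_mat[of _ ?M "dimW e" _ "dimW e" _ ?M, symmetric]) (simp_all add: carrier_matD[OF VW_carrier(1)[OF \<mu>]])
    also have "\<dots> = mtrace ((\<psi> e f * W a c e \<mu>) * V a c e \<mu>)"
      by (rule mtrace_commute[of _ ?M "dimW e"]) (simp_all add: mult_carrier_mat[of _ "dimW e" "dimW e" _ ?M])
    also have "(\<psi> e f * W a c e \<mu>) * V a c e \<mu> = \<psi> e f * (W a c e \<mu> * V a c e \<mu>)"
      by (rule assoc_mult_mat[of _ "dimW e" "dimW e" _ ?M _ "dimW e"]) simp_all
    also have "mtrace \<dots> = B.chi e f"
      unfolding WV[OF \<mu> \<mu>] by (simp add: chi_mtrace right_mult_one_mat[of _ "dimW e" "dimW e"])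
    finally show "(\<Sum>r<?M. (V a c e \<mu> * \<psi> e f * W a c e \<mu>) $$ (r, r)) = B.chi e f" .
  qed
  finally show ?thesis by simp
qed

lemma \<psi>_z: "\<psi> a (B.z e) = (if a = e then 1\<^sub>m (dimW a) else 0\<^sub>m (dimW a) (dimW a))"
  by (rule eq_matI) (auto simp: \<psi>_p B.p_z')

text \<open>\<open>z e\<close> acts as zero on every label other than \<open>e\<close>, so if
  \<open>e\<close> is not a constituent it kills the whole tensor product.\<close>

lemma sw_z_zero:
  assumes N: "N a c e = 0" and i: "i < dimW a" "r < dimW a" "j < dimW c" "l < dimW c"
  shows "B.sw (B.z e) (\<lambda>x y. p a i r x * p c j l y) = 0"
proof -
  let ?M = "dimW a * dimW c"
  have bound: "i * dimW c + j < ?M" if "i < dimW a" "j < dimW c" for i j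
  proof -
    have "i * dimW c + j < (i + 1) * dimW c" using that by simp
    also have "\<dots> \<le> ?M" using that by (intro mult_right_mono) auto
    finally show ?thesis .
  qed
  have "B.sw (B.z e) (\<lambda>x y. p a i r x * p c j l y) =
    psi2 dimW \<psi> a c (dDelta H (B.z e)) $$ (i * dimW c + j, r * dimW c + l)"
    using i by (subst psi2_entry) (simp_all add: bound)
  also have "\<dots> = 0"
    unfolding psi2_fusion[OF bound[OF i(1,3)] bound[OF i(2,4)]]
  proof (intro sum.neutral ballI)
    fix x \<mu> assume "\<mu> \<in> {..<N a c x}"
    then have \<mu>: "\<mu> < N a c x" by simp
    then have "x \<noteq> e" using N by auto
    then have "V a c x \<mu> * \<psi> x (B.z e) * W a c x \<mu> = 0\<^sub>m ?M ?M"
      using VW_carrier[OF \<mu>] by (simp add: \<psi>_z)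
    then show "(V a c x \<mu> * \<psi> x (B.z e) * W a c x \<mu>) $$ (i * dimW c + j, r * dimW c + l) = 0"
      using bound i by simp
  qed
  finally show ?thesis .
qed

lemma b_carrier [simp]: "b a \<in> carrier_mat (dimW a) (dimW a)"
  using vacuum by (simp add: vacuum_data_def)

text \<open>The idempotent \<open>z e\<close> selects the summand \<open>e\<close> in the vacuum
  decomposition of the counit.\<close>

lemma beta_trace: "B.beta e f = mtrace (b e * \<psi> e f)"
proof -
  have "B.beta e f = (\<Sum>a\<in>UNIV. mtrace (b a * \<psi> a (B.mul (B.z e) f)))"
    using vacuum by (simp add: B.beta_def B_eps vacuum_data_def)
  also have "\<dots> = (\<Sum>a\<in>UNIV. if a = e then mtrace (b e * \<psi> e f) else 0)"
  proof (intro sum.cong refl)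
    fix a
    show "mtrace (b a * \<psi> a (B.mul (B.z e) f)) = (if a = e then mtrace (b e * \<psi> e f) else 0)"
      by (simp add: \<psi>_mul \<psi>_z right_mult_zero_mat[of _ "dimW a" "dimW a"] left_mult_zero_mat[of _ "dimW a" "dimW a"]
          left_mult_one_mat[of _ "dimW e" "dimW e"]) (simp add: mtrace_def)
  qed
  finally show ?thesis by simp
qed

lemma vacE_iff: "e \<in> vacE dimW b \<longleftrightarrow> (\<exists>f. B.beta e f \<noteq> 0)"
proof
  assume "e \<in> vacE dimW b"
  then have "b e \<noteq> 0\<^sub>m (dimW e) (dimW e)" by (simp add: vacE_def)
  then obtain i j where ij: "i < dimW e" "j < dimW e" "b e $$ (i, j) \<noteq> 0"
    using b_carrier[of e] by (metis (no_types, lifting) carrier_matD eq_matI index_zero_mat)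
  have "B.beta e (E e j i) = (\<Sum>r<dimW e. \<Sum>l<dimW e. b e $$ (r, l) * \<psi> e (E e j i) $$ (l, r))"
    unfolding beta_trace by (rule mtrace_mult) simp_all
  also have "\<dots> = (\<Sum>r<dimW e. \<Sum>l<dimW e. if l = j then (if r = i then b e $$ (i, j) else 0) else 0)"
    using ij by (intro sum.cong refl) (auto simp: \<psi>_E)
  also have "\<dots> = b e $$ (i, j)" using ij by simp
  finally show "\<exists>f. B.beta e f \<noteq> 0" using ij(3) by metis
next
  assume ex: "\<exists>f. B.beta e f \<noteq> 0"
  show "e \<in> vacE dimW b"
  proof (rule ccontr)
    assume "e \<notin> vacE dimW b"
    then have b0: "b e = 0\<^sub>m (dimW e) (dimW e)" by (simp add: vacE_def)
    have "B.beta e f = 0" for f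
      unfolding beta_trace b0 by (simp add: left_mult_zero_mat[of _ "dimW e" "dimW e"]) (simp add: mtrace_def)
    then show False using ex by blast
  qed
qed

lemma uv:
  assumes "\<exists>f. B.beta e f \<noteq> 0"
  shows "v e \<in> carrier_mat (dimW e) 1" "u e \<in> carrier_mat 1 (dimW e)" "b e = v e * u e"
  using vacuum assms unfolding vacE_iff[symmetric] by (auto simp: vacuum_data_def vacE_def)

lemma beta_rank1:
  assumes e: "\<exists>f. B.beta e f \<noteq> 0"
  shows "B.beta e f = (\<Sum>i<dimW e. \<Sum>j<dimW e. u e $$ (0, i) * p e i j f * v e $$ (j, 0))"
proof -
  have "B.beta e f = (\<Sum>j<dimW e. \<Sum>i<dimW e. b e $$ (j, i) * \<psi> e f $$ (i, j))"
    unfolding beta_trace by (rule mtrace_mult) simp_all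
  also have "\<dots> = (\<Sum>j<dimW e. \<Sum>i<dimW e. u e $$ (0, i) * p e i j f * v e $$ (j, 0))"
  proof (intro sum.cong refl)
    fix i j assume "j \<in> {..<dimW e}" "i \<in> {..<dimW e}"
    then show "b e $$ (j, i) * \<psi> e f $$ (i, j) = u e $$ (0, i) * p e i j f * v e $$ (j, 0)"
      using uv[OF e] by (simp add: index_mult_sum[OF uv(1,2)[OF e]] \<psi>_p del: index_mult_mat(1))
  qed
  finally show ?thesis by (subst sum.swap)
qed

text \<open>For a wrong vacuum \<open>e\<close> the unit already acts as zero on
  \<open>W_e (x) W_a\<close>, so no constituent survives. For \<open>ll a\<close>, multiplicity zero
  would make \<open>z a\<close> act as zero on the tensor product, although \<open>xe (ll a)\<close>
  acts as 1 on block \<open>a\<close>.\<close>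

lemma lidx_ll: "lidx dimW b N a = B.ll a"
proof -
  have uniq: "e = B.ll a" if e: "e \<in> vacE dimW b" "N e a a \<noteq> 0" for e
  proof (rule ccontr)
    assume ne: "e \<noteq> B.ll a"
    have ex: "\<exists>f. B.beta e f \<noteq> 0" using e by (simp add: vacE_iff)
    note [simp] = lin_rules
    have "B.sw f (\<lambda>x y. B.chi e x * B.chi a y) = 0" for f
    proof -
      have "B.sw f (\<lambda>x y. B.chi e x * B.chi a y) = B.sw (B.mul B.one f) (\<lambda>x y. B.chi e x * B.chi a y)" by simp
      also have "\<dots> = B.sw B.one (\<lambda>x y. B.sw f (\<lambda>x' y'. B.chi e (B.mul x x') * B.chi a (B.mul y y')))"
        by (rule B.sw_mul) simp_all
      also have "\<dots> = B.sw f (\<lambda>x' y'. B.sw B.one (\<lambda>x y. B.chi e (B.mul x x') * B.chi a (B.mul y y')))"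
        by (rule B.sw_swap)
      also have "\<dots> = B.sw f (\<lambda>x' y'. \<Sum>i<dimW e. \<Sum>i'<dimW a. \<Sum>l<dimW e. \<Sum>l'<dimW a.
          (p e l i x' * p a l' i' y') * B.sw B.one (\<lambda>x y. p e i l x * p a i' l' y))"
        unfolding B.chi_def B.p_mul sum_product B.sw_sum B.sw_mult_left[symmetric]
        by (simp only: mult_ac)
      also have "\<dots> = B.sw f (\<lambda>x' y'. 0)"
        by (rule B.sw_cong, intro sum.neutral ballI) (simp add: B.unit_fusion_left_zero[OF ne ex])
      finally show ?thesis by (simp add: B.sw_def)
    qed
    then have "(\<Sum>x\<in>UNIV. of_nat (N e a x) * B.chi x (E a 0 0)) = (0 :: complex)"
      by (simp add: chi_chi)
    moreover have "(\<Sum>x\<in>UNIV. of_nat (N e a x) * B.chi x (E a 0 0)) = (of_nat (N e a a) :: complex)"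
      using dim_pos[of a] by (simp add: B.chi_E sum_delta_mult)
    ultimately show False using e(2) by simp
  qed
  have mem: "B.ll a \<in> vacE dimW b" by (simp add: vacE_iff B.beta_ll_nonzero)
  have N: "N (B.ll a) a a \<noteq> 0"
  proof
    assume N0: "N (B.ll a) a a = 0"
    let ?e = "B.ll a"
    have "B.sw (B.z a) (\<lambda>x y. B.beta ?e x * p a 0 0 y) = p a 0 0 (B.mul (B.z a) (B.xe ?e))"
      by (rule B.sw_xe(1)[OF B.lin_p0])
    also have "\<dots> = 1" using dim_pos[of a] by (simp add: B.p_mul_xe B.p_z')
    finally have 1: "B.sw (B.z a) (\<lambda>x y. B.beta ?e x * p a 0 0 y) = 1" .
    have "B.sw (B.z a) (\<lambda>x y. B.beta ?e x * p a 0 0 y) = B.sw (B.z a) (\<lambda>x y. \<Sum>i<dimW ?e. \<Sum>j<dimW ?e.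
        (u ?e $$ (0, i) * v ?e $$ (j, 0)) * (p ?e i j x * p a 0 0 y))"
      unfolding beta_rank1[OF B.beta_ll_nonzero] sum_distrib_right by (simp only: mult_ac)
    also have "\<dots> = 0"
      unfolding B.sw_sum B.sw_mult_left using dim_pos[of a] by (intro sum.neutral ballI) (simp add: sw_z_zero[OF N0])
    finally show False using 1 by simp
  qed
  show ?thesis unfolding lidx_def
  proof (rule the_equality)
    show "B.ll a \<in> vacE dimW b \<and> N (B.ll a) a a \<noteq> 0" by (rule conjI[OF mem N])
    show "e = B.ll a" if "e \<in> vacE dimW b \<and> N e a a \<noteq> 0" for e
      by (rule uniq[OF conjunct1[OF that] conjunct2[OF that]])
  qed
qed

lemma ridx_rr: "ridx dimW b N a = B.rr a"
proof -
  have uniq: "e = B.rr a" if e: "e \<in> vacE dimW b" "N a e a \<noteq> 0" for e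
  proof (rule ccontr)
    assume ne: "e \<noteq> B.rr a"
    have ex: "\<exists>f. B.beta e f \<noteq> 0" using e by (simp add: vacE_iff)
    note [simp] = lin_rules
    have "B.sw f (\<lambda>x y. B.chi a x * B.chi e y) = 0" for f
    proof -
      have "B.sw f (\<lambda>x y. B.chi a x * B.chi e y) = B.sw (B.mul B.one f) (\<lambda>x y. B.chi a x * B.chi e y)" by simp
      also have "\<dots> = B.sw B.one (\<lambda>x y. B.sw f (\<lambda>x' y'. B.chi a (B.mul x x') * B.chi e (B.mul y y')))"
        by (rule B.sw_mul) simp_all
      also have "\<dots> = B.sw f (\<lambda>x' y'. B.sw B.one (\<lambda>x y. B.chi a (B.mul x x') * B.chi e (B.mul y y')))"
        by (rule B.sw_swap)
      also have "\<dots> = B.sw f (\<lambda>x' y'. \<Sum>i<dimW a. \<Sum>i'<dimW e. \<Sum>l<dimW a. \<Sum>l'<dimW e.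
          (p a l i x' * p e l' i' y') * B.sw B.one (\<lambda>x y. p a i l x * p e i' l' y))"
        unfolding B.chi_def B.p_mul sum_product B.sw_sum B.sw_mult_left[symmetric]
        by (simp only: mult_ac)
      also have "\<dots> = B.sw f (\<lambda>x' y'. 0)"
        by (rule B.sw_cong, intro sum.neutral ballI) (simp add: B.unit_fusion_right_zero[OF ne ex])
      finally show ?thesis by (simp add: B.sw_def)
    qed
    then have "(\<Sum>x\<in>UNIV. of_nat (N a e x) * B.chi x (E a 0 0)) = (0 :: complex)"
      by (simp add: chi_chi)
    moreover have "(\<Sum>x\<in>UNIV. of_nat (N a e x) * B.chi x (E a 0 0)) = (of_nat (N a e a) :: complex)"
      using dim_pos[of a] by (simp add: B.chi_E sum_delta_mult)
    ultimately show False using e(2) by simp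
  qed
  have mem: "B.rr a \<in> vacE dimW b" by (simp add: vacE_iff B.beta_rr_nonzero)
  have N: "N a (B.rr a) a \<noteq> 0"
  proof
    assume N0: "N a (B.rr a) a = 0"
    let ?e = "B.rr a"
    have "B.sw (B.z a) (\<lambda>x y. p a 0 0 x * B.beta ?e y) = p a 0 0 (B.mul (B.z a) (B.ye ?e))"
      by (rule B.sw_ye(1)[OF B.lin_p0])
    also have "\<dots> = 1" using dim_pos[of a] by (simp add: B.p_mul_ye B.p_z')
    finally have 1: "B.sw (B.z a) (\<lambda>x y. p a 0 0 x * B.beta ?e y) = 1" .
    have "B.sw (B.z a) (\<lambda>x y. p a 0 0 x * B.beta ?e y) = B.sw (B.z a) (\<lambda>x y. \<Sum>i<dimW ?e. \<Sum>j<dimW ?e.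
        (u ?e $$ (0, i) * v ?e $$ (j, 0)) * (p a 0 0 x * p ?e i j y))"
      unfolding beta_rank1[OF B.beta_rr_nonzero] sum_distrib_left by (simp only: mult_ac)
    also have "\<dots> = 0"
      unfolding B.sw_sum B.sw_mult_left using dim_pos[of a] by (intro sum.neutral ballI) (simp add: sw_z_zero[OF N0])
    finally show False using 1 by simp
  qed
  show ?thesis unfolding ridx_def
  proof (rule the_equality)
    show "B.rr a \<in> vacE dimW b \<and> N a (B.rr a) a \<noteq> 0" by (rule conjI[OF mem N])
    show "e = B.rr a" if "e \<in> vacE dimW b \<and> N a e a \<noteq> 0" for e
      by (rule uniq[OF conjunct1[OF that] conjunct2[OF that]])
  qed
qed

end

lemma mtrace_sandwich:
  assumes [simp]: "X \<in> carrier_mat m m" "V \<in> carrier_mat m n" "v \<in> carrier_mat n q" "u \<in> carrier_mat q n" "W \<in> carrier_mat n m"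
  shows "mtrace (X * ((V * v) * (u * W))) = mtrace ((v * u) * (W * X * V))"
proof -
  define B where "B = v * u"
  have [simp]: "B \<in> carrier_mat n n" unfolding B_def by (rule mult_carrier_mat[of _ n q]) simp_all
  have uW: "u * W \<in> carrier_mat q m" and WX [simp]: "W * X \<in> carrier_mat n m" and BW [simp]: "B * W \<in> carrier_mat n m"
    by (auto intro: mult_carrier_mat[of _ q n] mult_carrier_mat[of _ n m] mult_carrier_mat[of _ n n])
  have BWX [simp]: "B * (W * X) \<in> carrier_mat n m" by (rule mult_carrier_mat[of _ n n]) simp_all
  have "(V * v) * (u * W) = V * (v * (u * W))" using uW by (intro assoc_mult_mat[of _ m n _ q _ m]) simp_all
  also have "v * (u * W) = B * W" unfolding B_def by (rule assoc_mult_mat[of _ n q _ n _ m, symmetric]) simp_all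
  finally have "mtrace (X * ((V * v) * (u * W))) = mtrace (X * (V * (B * W)))" by simp
  also have "\<dots> = mtrace (V * (B * W) * X)"
    by (rule mtrace_commute[of _ m m]) (auto intro: mult_carrier_mat[of _ m n])
  also have "V * (B * W) * X = V * (B * (W * X))"
    by (simp add: assoc_mult_mat[of V m n "B * W" m X m] assoc_mult_mat[of B n n W m X m])
  also have "mtrace \<dots> = mtrace (B * (W * X) * V)"
    by (rule mtrace_commute[of _ m n]) simp_all
  also have "B * (W * X) * V = B * (W * X * V)"
    by (rule assoc_mult_mat[of _ n n _ m _ n]) simp_all
  finally show ?thesis unfolding B_def .
qed

context pivotal_fusion begin

section \<open>The scalars w and the characters of the pivotal element\<close>

lemma p_S:
  assumes "i < dimW a" "j < dimW a"
  shows "p a i j (B.S f) = (\<Sum>r<dimW a. \<Sum>l<dimW a. Z a $$ (j, r) * p (bar a) r l f * Zi a $$ (l, i))"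
proof -
  have "p a i j (B.S f) = transpose_mat (\<psi> a (B.S f)) $$ (j, i)" using assms by (simp add: p_def)
  also have "\<dots> = (\<Sum>r<dimW a. \<Sum>l<dimW a. Z a $$ (j, r) * \<psi> (bar a) f $$ (r, l) * Zi a $$ (l, i))"
    unfolding conj_eq using assms by (intro mat_mult3_index[of _ "dimW a" "dimW a" _ "dimW a" _ "dimW a"]) simp_all
  finally show ?thesis by (simp add: p_def dim_bar)
qed

text \<open>Guarantees that the fusion tensors with index 0 in the definition of \<open>w\<close>
  exist. Otherwise \<open>z (rr c)\<close> would act as zero on the product of \<open>bar c\<close>
  and \<open>c\<close>, and \<open>PiR\<close> of it would vanish on \<open>c\<close>; in counit
  form this \<open>PiR\<close> acts as \<open>ye (rr c)\<close>, which is 1 there.\<close>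

lemma N_bar: "N (bar c) c (B.rr c) \<noteq> 0"
proof
  assume N0: "N (bar c) c (B.rr c) = 0"
  let ?r = "B.rr c"
  have "p c 0 0 (B.PiR (B.z ?r)) = B.sw (B.z ?r) (\<lambda>x y. p c 0 0 (B.mul (B.S x) y))"
    by (rule B.lin_PiR(1)[OF B.lin_p0])
  also have "\<dots> = B.sw (B.z ?r) (\<lambda>x y. \<Sum>j<dimW c. \<Sum>i<dimW c. \<Sum>l<dimW c.
      (Z c $$ (j, i) * Zi c $$ (l, 0)) * (p (bar c) i l x * p c j 0 y))"
    unfolding B.p_mul
    by (rule B.sw_cong, rule sum.cong[OF refl]) (simp add: p_S dim_pos sum_distrib_right, simp only: mult_ac)
  also have "\<dots> = 0"
    unfolding B.sw_sum B.sw_mult_left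
    by (intro sum.neutral ballI) (simp add: sw_z_zero[OF N0] dim_bar dim_pos)
  finally have "p c 0 0 (B.PiR (B.z ?r)) = 0" .
  moreover have "p c 0 0 (B.PiR (B.z ?r)) = 1"
  proof -
    have "p c 0 0 (B.PiR (B.z ?r)) = B.sw B.one (\<lambda>x y. p c 0 0 x * B.eps (B.mul (B.z ?r) y))"
      by (rule B.lin_PiR(2)[OF B.lin_p0])
    also have "\<dots> = p c 0 0 (B.mul B.one (B.ye ?r))"
      unfolding B.eps_z_mul by (rule B.sw_ye(1)[OF B.lin_p0])
    also have "\<dots> = 1" using dim_pos[of c] by (simp only: B.p_mul_ye if_True) (simp add: B.p_one)
    finally show ?thesis .
  qed
  ultimately show False by simp
qed

lemma psi2_carrier [simp]: "psi2 dimW \<psi> a c X \<in> carrier_mat (dimW a * dimW c) (dimW a * dimW c)"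
  by (simp add: psi2_def)

lemma W_psi2_V:
  assumes \<mu>: "\<mu> < N a c e"
  shows "W a c e \<mu> * psi2 dimW \<psi> a c (dDelta H f) * V a c e \<mu> = \<psi> e f"
proof (rule eq_matI)
  let ?M = "dimW a * dimW c"
  fix i j assume "i < dim_row (\<psi> e f)" "j < dim_col (\<psi> e f)"
  then have ij: "i < dimW e" "j < dimW e" by simp_all
  let ?W = "W a c e \<mu>" and ?V = "V a c e \<mu>"
  note c = VW_carrier[OF \<mu>]
  have "(?W * psi2 dimW \<psi> a c (dDelta H f) * ?V) $$ (i, j) =
    (\<Sum>r<?M. \<Sum>l<?M. ?W $$ (i, r) * psi2 dimW \<psi> a c (dDelta H f) $$ (r, l) * ?V $$ (l, j))"
    using ij by (intro mat_mult3_index[OF c(2) psi2_carrier c(1)])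
  also have "\<dots> = (\<Sum>r<?M. \<Sum>l<?M. \<Sum>x\<in>UNIV. \<Sum>\<nu><N a c x. ?W $$ (i, r) * (V a c x \<nu> * \<psi> x f * W a c x \<nu>) $$ (r, l) * ?V $$ (l, j))"
    by (intro sum.cong refl) (simp add: psi2_fusion sum_distrib_left sum_distrib_right)
  also have "\<dots> = (\<Sum>r<?M. \<Sum>x\<in>UNIV. \<Sum>\<nu><N a c x. \<Sum>l<?M. ?W $$ (i, r) * (V a c x \<nu> * \<psi> x f * W a c x \<nu>) $$ (r, l) * ?V $$ (l, j))"
    by (rule sum.cong[OF refl], subst sum.swap, rule sum.cong[OF refl], rule sum.swap)
  also have "\<dots> = (\<Sum>x\<in>UNIV. \<Sum>\<nu><N a c x. \<Sum>r<?M. \<Sum>l<?M. ?W $$ (i, r) * (V a c x \<nu> * \<psi> x f * W a c x \<nu>) $$ (r, l) * ?V $$ (l, j))"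
    by (subst sum.swap, rule sum.cong[OF refl], rule sum.swap)
  also have "\<dots> = (\<Sum>x\<in>UNIV. \<Sum>\<nu><N a c x. if x = e then (if \<nu> = \<mu> then \<psi> e f $$ (i, j) else 0) else 0)"
  proof (intro sum.cong refl)
    fix x \<nu> assume "\<nu> \<in> {..<N a c x}"
    then have \<nu>: "\<nu> < N a c x" by simp
    note c' = VW_carrier[OF \<nu>]
    let ?V' = "V a c x \<nu>" and ?W' = "W a c x \<nu>"
    have m: "?V' * \<psi> x f \<in> carrier_mat ?M (dimW x)" by (rule mult_carrier_mat[OF c'(1)]) simp
    have m2: "?V' * \<psi> x f * ?W' \<in> carrier_mat ?M ?M" by (rule mult_carrier_mat[OF m c'(2)])
    have m3: "\<psi> x f * ?W' \<in> carrier_mat (dimW x) ?M" by (rule mult_carrier_mat[OF _ c'(2)]) simp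
    have "?W * (?V' * \<psi> x f * ?W') * ?V = ?W * (?V' * (\<psi> x f * ?W')) * ?V"
      by (subst assoc_mult_mat[OF c'(1) _ c'(2)]) simp_all
    also have "\<dots> = (?W * ?V') * (\<psi> x f * ?W') * ?V"
      by (subst assoc_mult_mat[OF c(2) c'(1) m3]) simp
    also have "\<dots> = (?W * ?V') * (\<psi> x f * ?W' * ?V)"
      by (rule assoc_mult_mat[OF mult_carrier_mat[OF c(2) c'(1)] m3 c(1)])
    also have "\<psi> x f * ?W' * ?V = \<psi> x f * (?W' * ?V)"
      by (rule assoc_mult_mat[OF \<psi>_carrier c'(2) c(1)])
    also have "(?W * ?V') * (\<psi> x f * (?W' * ?V)) = (if x = e \<and> \<nu> = \<mu> then \<psi> e f else 0\<^sub>m (dimW e) (dimW e))"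
    proof (cases "x = e \<and> \<nu> = \<mu>")
      case True
      then show ?thesis by (simp add: WV[OF \<mu> \<mu>] left_mult_one_mat[of _ "dimW e" "dimW e"] right_mult_one_mat[of _ "dimW e" "dimW e"])
    next
      case False
      then have "?W * ?V' = 0\<^sub>m (dimW e) (dimW x)" by (subst WV[OF \<mu> \<nu>]) auto
      then show ?thesis using False
        by (simp only: if_False) (rule left_mult_zero_mat, rule mult_carrier_mat[OF \<psi>_carrier mult_carrier_mat[OF c'(2) c(1)]])
    qed
    finally have "(?W * (?V' * \<psi> x f * ?W') * ?V) $$ (i, j) = (if x = e then (if \<nu> = \<mu> then \<psi> e f $$ (i, j) else 0) else 0)"
      using ij by simp
    moreover have "(?W * (?V' * \<psi> x f * ?W') * ?V) $$ (i, j) = (\<Sum>r<?M. \<Sum>l<?M. ?W $$ (i, r) * (?V' * \<psi> x f * ?W') $$ (r, l) * ?V $$ (l, j))"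
      by (rule mat_mult3_index[OF c(2) m2 c(1) ij])
    ultimately show "(\<Sum>r<?M. \<Sum>l<?M. ?W $$ (i, r) * (?V' * \<psi> x f * ?W') $$ (r, l) * ?V $$ (l, j)) =
        (if x = e then (if \<nu> = \<mu> then \<psi> e f $$ (i, j) else 0) else 0)" by simp
  qed
  also have "\<dots> = (\<Sum>x\<in>UNIV. if x = e then (\<Sum>\<nu><N a c e. if \<nu> = \<mu> then \<psi> e f $$ (i, j) else 0) else 0)"
    by (intro sum.cong refl) simp
  also have "\<dots> = \<psi> e f $$ (i, j)" using \<mu> by simp
  finally show "(?W * psi2 dimW \<psi> a c (dDelta H f) * ?V) $$ (i, j) = \<psi> e f $$ (i, j)" .
qed (use VW_carrier[OF \<mu>] in auto)

lemma w_nonzero: "w c \<noteq> 0"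
  using wdef by (simp add: w_data_def Let_def)

text \<open>The defining equation of \<open>w\<close> is paired with the action of Delta(f). The
  rank-one side reduces through the vacuum channel to \<open>beta\<close>; the side with
  \<open>theta_col\<close> and \<open>zeta_row\<close> becomes a trace of matrices once the
  Kronecker indices are unfolded.\<close>

lemma w_trace:
  "B.sw f (\<lambda>x y. mtrace (Z c * \<psi> (bar c) x * transpose_mat (Zi (bar c)) * transpose_mat (\<psi> c y))) = w c * B.beta (B.rr c) f"
proof -
  let ?n = "dimW c" let ?M = "dimW (bar c) * dimW c" let ?r = "B.rr c"
  let ?X = "psi2 dimW \<psi> (bar c) c (dDelta H f)"
  let ?V = "V (bar c) c ?r 0" and ?W = "W (bar c) c ?r 0"
  let ?T = "theta_col dimW bar Z c * zeta_row dimW bar Z c"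
  have N0: "0 < N (bar c) c ?r" using N_bar by simp
  note VW = VW_carrier[OF N0] and uv = uv[OF B.beta_rr_nonzero[of c]]
  have T: "?T = w c \<cdot>\<^sub>m ((?V * v ?r) * (u ?r * ?W))"
    using wdef by (simp add: w_data_def Let_def ridx_rr)
  have VvuW: "(?V * v ?r) * (u ?r * ?W) \<in> carrier_mat ?M ?M"
    by (rule mult_carrier_mat[OF mult_carrier_mat[OF VW(1) uv(1)] mult_carrier_mat[OF uv(2) VW(2)]])
  have "mtrace (?X * ?T) = w c * mtrace (?X * ((?V * v ?r) * (u ?r * ?W)))"
    unfolding T by (subst mult_smult_distrib[OF psi2_carrier VvuW], rule mtrace_smult[OF mult_carrier_mat[OF psi2_carrier VvuW]])
  also have "mtrace (?X * ((?V * v ?r) * (u ?r * ?W))) = mtrace ((v ?r * u ?r) * (?W * ?X * ?V))"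
    by (rule mtrace_sandwich[OF psi2_carrier VW(1) uv(1,2) VW(2)])
  also have "\<dots> = B.beta ?r f"
    unfolding W_psi2_V[OF N0] uv(3)[symmetric] beta_trace ..
  finally have right: "mtrace (?X * ?T) = w c * B.beta ?r f" .
  have Tc: "?T \<in> carrier_mat ?M ?M" unfolding T using VvuW by simp
  have T_entry: "?T $$ (s, r) = Zi (bar c) $$ (s mod ?n, s div ?n) * Z c $$ (r mod ?n, r div ?n)" if "s < ?M" "r < ?M" for s r
    using that by (simp add: theta_col_def zeta_row_def scalar_prod_def)
  have "mtrace (?X * ?T) = (\<Sum>r<?M. \<Sum>s<?M. ?X $$ (r, s) * ?T $$ (s, r))"
    by (rule mtrace_mult[OF psi2_carrier Tc])
  also have "\<dots> = (\<Sum>r<dimW (bar c) * ?n. \<Sum>s<dimW (bar c) * ?n. B.sw f (\<lambda>x y. Z c $$ (r mod ?n, r div ?n) * Zi (bar c) $$ (s mod ?n, s div ?n) *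
      (p (bar c) (r div ?n) (s div ?n) x * p c (r mod ?n) (s mod ?n) y)))"
    unfolding B.sw_mult_left by (intro sum.cong refl) (simp add: psi2_entry T_entry del: index_mult_mat(1))
  also have "\<dots> = (\<Sum>r<dimW (bar c) * ?n. \<Sum>i'<dimW (bar c). \<Sum>j'<?n. B.sw f (\<lambda>x y. Z c $$ (r mod ?n, r div ?n) * Zi (bar c) $$ (j', i') *
      (p (bar c) (r div ?n) i' x * p c (r mod ?n) j' y)))"
    by (rule sum.cong[OF refl], rule sum_div_mod)
  also have "\<dots> = (\<Sum>i<dimW (bar c). \<Sum>j<?n. \<Sum>i'<dimW (bar c). \<Sum>j'<?n. B.sw f (\<lambda>x y. Z c $$ (j, i) * Zi (bar c) $$ (j', i') *
      (p (bar c) i i' x * p c j j' y)))"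
    by (rule sum_div_mod)
  also have "\<dots> = (\<Sum>j<?n. \<Sum>i<?n. \<Sum>j'<?n. \<Sum>i'<?n. B.sw f (\<lambda>x y. Z c $$ (j, i) * Zi (bar c) $$ (j', i') *
      (p (bar c) i i' x * p c j j' y)))"
    unfolding dim_bar by (subst sum.swap, rule sum.cong[OF refl], rule sum.cong[OF refl], rule sum.swap)
  also have "\<dots> = (\<Sum>j<?n. \<Sum>j'<?n. \<Sum>i<?n. \<Sum>i'<?n. B.sw f (\<lambda>x y. Z c $$ (j, i) * Zi (bar c) $$ (j', i') *
      (p (bar c) i i' x * p c j j' y)))"
    by (rule sum.cong[OF refl], rule sum.swap)
  also have "\<dots> = B.sw f (\<lambda>x y. \<Sum>j<?n. \<Sum>j'<?n. \<Sum>i<?n. \<Sum>i'<?n. Z c $$ (j, i) * Zi (bar c) $$ (j', i') *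
      (p (bar c) i i' x * p c j j' y))"
    by (simp only: B.sw_sum)
  also have "\<dots> = B.sw f (\<lambda>x y. mtrace (Z c * \<psi> (bar c) x * transpose_mat (Zi (bar c)) * transpose_mat (\<psi> c y)))"
  proof (rule B.sw_cong)
    fix x y
    have A: "Z c * \<psi> (bar c) x * transpose_mat (Zi (bar c)) \<in> carrier_mat ?n ?n"
      by (simp add: mult_carrier_mat[of _ ?n ?n _ ?n])
    have "mtrace (Z c * \<psi> (bar c) x * transpose_mat (Zi (bar c)) * transpose_mat (\<psi> c y)) =
      (\<Sum>j<?n. \<Sum>j'<?n. (Z c * \<psi> (bar c) x * transpose_mat (Zi (bar c))) $$ (j, j') * transpose_mat (\<psi> c y) $$ (j', j))"
      by (rule mtrace_mult[OF A]) simp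
    also have "\<dots> = (\<Sum>j<?n. \<Sum>j'<?n. (\<Sum>i<?n. \<Sum>i'<?n. Z c $$ (j, i) * \<psi> (bar c) x $$ (i, i') * transpose_mat (Zi (bar c)) $$ (i', j')) * \<psi> c y $$ (j, j'))"
      by (intro sum.cong refl arg_cong2[of _ _ _ _ "times"] mat_mult3_index[of _ ?n ?n _ ?n _ ?n]) simp_all
    also have "\<dots> = (\<Sum>j<?n. \<Sum>j'<?n. \<Sum>i<?n. \<Sum>i'<?n. Z c $$ (j, i) * Zi (bar c) $$ (j', i') * (p (bar c) i i' x * p c j j' y))"
      unfolding sum_distrib_right
      by (intro sum.cong refl) (simp add: p_def dim_bar carrier_matD[OF Zi_carrier(2)])
    finally show "(\<Sum>j<?n. \<Sum>j'<?n. \<Sum>i<?n. \<Sum>i'<?n. Z c $$ (j, i) * Zi (bar c) $$ (j', i') * (p (bar c) i i' x * p c j j' y)) =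
      mtrace (Z c * \<psi> (bar c) x * transpose_mat (Zi (bar c)) * transpose_mat (\<psi> c y))" by simp
  qed
  finally show ?thesis using right by simp
qed

lemma lin_mtrace:
  assumes "A \<in> carrier_mat (dimW a) (dimW a)"
  shows "lin (\<lambda>h. mtrace (A * \<psi> a h))"
proof -
  have "(\<lambda>h. mtrace (A * \<psi> a h)) = (\<lambda>h. \<Sum>i<dimW a. \<Sum>j<dimW a. A $$ (i, j) * p a j i h)"
    by (rule ext, subst mtrace_mult[OF assms \<psi>_carrier]) (intro sum.cong refl, simp add: p_def)
  then show ?thesis by (simp add: lin_rules)
qed

text \<open>The matrices in \<open>w_trace\<close> convert \<open>\<psi> (bar c)\<close> of the
  first leg into the transpose of \<open>\<psi> c\<close> of its antipode; transposing under the
  trace leaves \<open>K c\<close> times the action of \<open>S(f_1) f_2\<close>.\<close>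

lemma mtrace_K_PiR: "mtrace (K c * \<psi> c (B.PiR f)) = w c * B.beta (B.rr c) f"
proof -
  let ?n = "dimW c"
  note as = assoc_mult_mat[of _ ?n ?n _ ?n _ ?n] and car = mult_carrier_mat[of _ ?n ?n _ ?n]
  have "mtrace (K c * \<psi> c (B.PiR f)) = B.sw f (\<lambda>x y. mtrace (K c * \<psi> c (B.mul (B.S x) y)))"
    by (rule B.lin_PiR(1)[OF lin_mtrace]) simp
  also have "\<dots> = B.sw f (\<lambda>x y. mtrace (Z c * \<psi> (bar c) x * transpose_mat (Zi (bar c)) * transpose_mat (\<psi> c y)))"
  proof (rule B.sw_cong)
    fix x y
    let ?A = "Z c * \<psi> (bar c) x" let ?Y = "transpose_mat (Zi (bar c))" let ?P = "transpose_mat (\<psi> c y)"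
    have "transpose_mat (Z c) * \<psi> c (B.S x) = transpose_mat ?A"
      unfolding conj_left[symmetric] by (simp add: transpose_mult[of _ ?n ?n _ ?n])
    then have "transpose_mat (?P * (?A * ?Y)) = Zi (bar c) * (transpose_mat (Z c) * \<psi> c (B.S x)) * \<psi> c y"
      by (simp add: transpose_mult[of _ ?n ?n _ ?n] car)
    also have "\<dots> = K c * \<psi> c (B.mul (B.S x) y)"
      unfolding K_def \<psi>_mul by (simp add: as car)
    finally have "mtrace (K c * \<psi> c (B.mul (B.S x) y)) = mtrace (?P * (?A * ?Y))"
      by (metis mtrace_transpose car transpose_carrier_mat \<psi>_carrier Z_carrier \<psi>_bar_carrier Zi_carrier(2))
    also have "\<dots> = mtrace (?A * ?Y * ?P)"
      by (rule mtrace_commute[of _ ?n ?n]) (simp_all add: car)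
    finally show "mtrace (K c * \<psi> c (B.mul (B.S x) y)) = mtrace (?A * ?Y * ?P)" .
  qed
  finally show ?thesis unfolding w_trace .
qed

text \<open>This is \<open>w_trace\<close> at \<open>bar a\<close>, read back on \<open>a\<close> by
  \<open>bar_bar\<close>; the conjugation relation moves the transposed \<open>Zi a\<close> past the
  antipode of the second leg.\<close>

lemma mtrace_R_PiL: "mtrace (R a * \<psi> a (B.PiL f)) = w (bar a) * B.beta (B.rr (bar a)) f"
proof -
  let ?n = "dimW a"
  note as = assoc_mult_mat[of _ ?n ?n _ ?n _ ?n] and car = mult_carrier_mat[of _ ?n ?n _ ?n]
  have "mtrace (R a * \<psi> a (B.PiL f)) = B.sw f (\<lambda>x y. mtrace (R a * \<psi> a (B.mul x (B.S y))))"
    by (rule B.lin_PiL(1)[OF lin_mtrace]) simp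
  also have "\<dots> = B.sw f (\<lambda>x y. mtrace (Z (bar a) * \<psi> (bar (bar a)) x * transpose_mat (Zi (bar (bar a))) * transpose_mat (\<psi> (bar a) y)))"
  proof (rule B.sw_cong)
    fix x y
    let ?A = "Z (bar a) * \<psi> a x" let ?Y = "transpose_mat (Zi a)" let ?P = "transpose_mat (\<psi> (bar a) y)"
    have "Zi a * transpose_mat (\<psi> a (B.S y)) = Zi a * (Z a * \<psi> (bar a) y * Zi a)"
      unfolding conj_eq ..
    also have "\<dots> = (Zi a * Z a) * (\<psi> (bar a) y * Zi a)" by (simp add: as car)
    also have "\<dots> = \<psi> (bar a) y * Zi a" by (simp add: Z_inverse car left_mult_one_mat[of _ ?n ?n])
    finally have "transpose_mat (Zi a * transpose_mat (\<psi> a (B.S y))) = transpose_mat (\<psi> (bar a) y * Zi a)" by simp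
    then have SY: "\<psi> a (B.S y) * ?Y = ?Y * ?P"
      by (simp add: transpose_mult[of _ ?n ?n _ ?n])
    have "mtrace (R a * \<psi> a (B.mul x (B.S y))) = mtrace (?Y * (?A * \<psi> a (B.S y)))"
      unfolding R_def \<psi>_mul by (simp add: as car)
    also have "\<dots> = mtrace (?A * \<psi> a (B.S y) * ?Y)"
      by (rule mtrace_commute[of _ ?n ?n]) (simp_all add: car)
    also have "?A * \<psi> a (B.S y) * ?Y = ?A * (\<psi> a (B.S y) * ?Y)" by (rule as) (simp_all add: car)
    also have "\<dots> = ?A * ?Y * ?P" unfolding SY by (rule as[symmetric]) (simp_all add: car)
    finally show "mtrace (R a * \<psi> a (B.mul x (B.S y))) =
      mtrace (Z (bar a) * \<psi> (bar (bar a)) x * transpose_mat (Zi (bar (bar a))) * transpose_mat (\<psi> (bar a) y))"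
      unfolding bar_bar .
  qed
  finally show ?thesis unfolding w_trace .
qed

text \<open>The scalar relating \<open>\<psi> a k\<close> to \<open>R a\<close>: the factor
  \<open>\<xi> a\<close> together with the normalisation of \<open>g\<close>.\<close>

definition kap :: "'a \<Rightarrow> complex" where "kap a = \<xi> a * d a / w (bar a)"

lemma \<psi>_k: "\<psi> a k = kap a \<cdot>\<^sub>m R a"
  unfolding \<xi>_def g_def R_def[symmetric] kap_def by (rule eq_matI) simp_all

text \<open>The invertible element \<open>k\<close> cannot act as zero; the nonvanishing of
  \<open>\<xi> a\<close> and \<open>d a\<close> is a consequence.\<close>

lemma kap_nonzero: "kap a \<noteq> 0"
proof
  assume "kap a = 0"
  then have "\<psi> a k = 0\<^sub>m (dimW a) (dimW a)" unfolding \<psi>_k by (intro eq_matI) (simp_all add: carrier_matD[OF R_K_carrier(1)])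
  then have "\<psi> a (B.mul k k') = 0\<^sub>m (dimW a) (dimW a)" unfolding \<psi>_mul by (simp add: left_mult_zero_mat[of _ "dimW a" "dimW a"])
  then have "(1\<^sub>m (dimW a) :: complex mat) $$ (0, 0) = 0\<^sub>m (dimW a) (dimW a) $$ (0, 0)" by (simp add: B.k_k' \<psi>_one)
  then show False using dim_pos[of a] by simp
qed

lemma \<xi>_nonzero: "\<xi> a \<noteq> 0" and d_nonzero: "d a \<noteq> 0"
  using kap_nonzero[of a] by (auto simp: kap_def)

lemma \<psi>_k': "\<psi> a k' = (1 / kap a) \<cdot>\<^sub>m K a"
proof -
  let ?n = "dimW a"
  have "K a = K a * \<psi> a (B.mul k k')" by (simp add: B.k_k' \<psi>_one right_mult_one_mat[of _ ?n ?n])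
  also have "\<dots> = K a * (kap a \<cdot>\<^sub>m (R a * \<psi> a k'))"
    unfolding \<psi>_mul \<psi>_k by (subst mult_smult_assoc_mat[of _ ?n ?n _ ?n]) simp_all
  also have "\<dots> = kap a \<cdot>\<^sub>m (K a * (R a * \<psi> a k'))"
    by (rule mult_smult_distrib[of _ ?n ?n _ ?n]) (simp_all add: mult_carrier_mat[of _ ?n ?n _ ?n])
  also have "K a * (R a * \<psi> a k') = (K a * R a) * \<psi> a k'"
    by (rule assoc_mult_mat[of _ ?n ?n _ ?n _ ?n, symmetric]) simp_all
  also have "\<dots> = \<psi> a k'" by (simp add: R_K left_mult_one_mat[of _ ?n ?n])
  finally have "K a = kap a \<cdot>\<^sub>m \<psi> a k'" .
  then show ?thesis using kap_nonzero[of a] by (intro eq_matI) simp_all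
qed

text \<open>The identity \<open>S k = k'\<close> on block \<open>a\<close> is transported by
  conjugation to block \<open>bar a\<close>, where \<open>k\<close> acts as
  \<open>kap (bar a)\<close> times \<open>R (bar a)\<close>.\<close>

lemma kap_bar: "kap a * kap (bar a) = 1"
proof -
  let ?n = "dimW a"
  note as = assoc_mult_mat[of _ ?n ?n _ ?n _ ?n] and car = mult_carrier_mat[of _ ?n ?n _ ?n]
  let ?Y = "transpose_mat (Zi (bar a))"
  have Rb: "R (bar a) = ?Y * Z a" unfolding R_def bar_bar ..
  have YZ: "?Y * Z a \<in> carrier_mat ?n ?n" by (rule car) simp_all
  have "transpose_mat (\<psi> a k') = Z a * (kap (bar a) \<cdot>\<^sub>m (?Y * Z a)) * Zi a"
    unfolding B.S_k[symmetric] conj_eq \<psi>_k Rb ..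
  also have "\<dots> = kap (bar a) \<cdot>\<^sub>m (Z a * (?Y * Z a) * Zi a)"
    by (subst mult_smult_distrib[OF Z_carrier YZ], rule mult_smult_assoc_mat[OF car[OF Z_carrier YZ] Zi_carrier(1)])
  also have "Z a * (?Y * Z a) * Zi a = Z a * ?Y * (Z a * Zi a)" by (simp add: as car)
  also have "\<dots> = Z a * ?Y" by (simp add: Z_inverse car right_mult_one_mat[of _ ?n ?n])
  also have "\<dots> = transpose_mat (K a)" unfolding K_def by (simp add: transpose_mult[of _ ?n ?n _ ?n])
  finally have "transpose_mat (transpose_mat (\<psi> a k')) = transpose_mat (kap (bar a) \<cdot>\<^sub>m transpose_mat (K a))" by simp
  moreover have tr: "transpose_mat (kap (bar a) \<cdot>\<^sub>m transpose_mat (K a)) = kap (bar a) \<cdot>\<^sub>m K a"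
    by (rule eq_matI) simp_all
  ultimately have "(1 / kap a) \<cdot>\<^sub>m K a = kap (bar a) \<cdot>\<^sub>m K a"
    unfolding \<psi>_k' by simp
  then have "((1 / kap a) \<cdot>\<^sub>m K a) * R a = (kap (bar a) \<cdot>\<^sub>m K a) * R a" by simp
  then have "(1 / kap a) \<cdot>\<^sub>m (1\<^sub>m ?n :: complex mat) = kap (bar a) \<cdot>\<^sub>m 1\<^sub>m ?n"
    by (simp add: mult_smult_assoc_mat[of _ ?n ?n _ ?n] R_K)
  then have "((1 / kap a) \<cdot>\<^sub>m (1\<^sub>m ?n :: complex mat)) $$ (0, 0) = (kap (bar a) \<cdot>\<^sub>m 1\<^sub>m ?n) $$ (0, 0)" by simp
  then show ?thesis using dim_pos[of a] kap_nonzero[of a] by (simp add: field_simps)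
qed

text \<open>In the product of the two values of \<open>kap\<close> the square of \<open>d a\<close>
  cancels \<open>w a * w (bar a)\<close>. As a result the \<open>\<xi>\<close> factors drop out of
  \<open>del a * del (bar a)\<close>.\<close>

lemma \<xi>_bar: "\<xi> (bar a) = 1 / \<xi> a"
proof -
  have "kap a * kap (bar a) = \<xi> a * \<xi> (bar a) * ((d a)\<^sup>2 / (w a * w (bar a)))"
    unfolding kap_def bar_bar d_bar[of a, symmetric] by (simp add: power2_eq_square mult_ac)
  also have "\<dots> = \<xi> a * \<xi> (bar a)" unfolding d_sq using w_nonzero by simp
  finally show ?thesis using kap_bar[of a] \<xi>_nonzero[of a] by (simp add: field_simps)
qed

sublocale B: wha_fusion Bm "scounit H" Bc "sunit H" Bs e2 D1 k k' dimW p E bar "\<lambda>a. d a / \<xi> a" N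
  "\<lambda>e i. u e $$ (0, i)" "\<lambda>e j. v e $$ (j, 0)"
proof
  fix a b' :: 'a and f :: "'i cv"
  let ?n = "dimW a"
  show "B.sw f (\<lambda>x y. B.chi a x * B.chi b' y) = (\<Sum>c\<in>UNIV. of_nat (N a b' c) * B.chi c f)"
    by (rule chi_chi)
  show "bar (bar a) = a" by (rule bar_bar)
  show "d a / \<xi> a \<noteq> 0" using d_nonzero \<xi>_nonzero by simp
  show "\<exists>f. B.beta a f \<noteq> 0 \<Longrightarrow> B.beta a f = (\<Sum>i<?n. \<Sum>j<?n. u a $$ (0, i) * p a i j f * v a $$ (j, 0))"
    by (rule beta_rank1)
  show "p a i j (B.S (B.z b')) = 0" if "b' \<noteq> bar a" "i < ?n" "j < ?n" for i j
    unfolding p_S[OF that(2,3)] using that(1) by (intro sum.neutral ballI) (simp add: B.p_z' dim_bar)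
  show "B.chi a (B.S f) = B.chi (bar a) f"
  proof -
    have "B.chi a (B.S f) = mtrace (Z a * \<psi> (bar a) f * Zi a)"
      unfolding chi_mtrace conj_eq[symmetric] by (rule mtrace_transpose[symmetric, OF \<psi>_carrier])
    also have "\<dots> = mtrace (Zi a * (Z a * \<psi> (bar a) f))"
      by (rule mtrace_commute[of _ ?n ?n]) (simp_all add: mult_carrier_mat[of _ ?n ?n _ ?n])
    also have "Zi a * (Z a * \<psi> (bar a) f) = (Zi a * Z a) * \<psi> (bar a) f"
      by (rule assoc_mult_mat[of _ ?n ?n _ ?n _ ?n, symmetric]) simp_all
    also have "\<dots> = \<psi> (bar a) f" by (simp add: Z_inverse left_mult_one_mat[of _ ?n ?n])
    finally show ?thesis by (simp add: chi_mtrace)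
  qed
  \<comment> \<open>The scalar is \<open>w a / kap a\<close>, which \<open>d_sq\<close> turns into
    \<open>d a / \<xi> a\<close>; this is the origin of the coefficients of Omega.\<close>
  show "B.chi a (B.mul k' (B.PiR f)) = d a / \<xi> a * B.beta (B.rr a) f"
  proof -
    have "B.chi a (B.mul k' (B.PiR f)) = 1 / kap a * (w a * B.beta (B.rr a) f)"
      unfolding chi_mtrace \<psi>_mul \<psi>_k' mtrace_K_PiR[symmetric]
      by (subst mult_smult_assoc_mat[of _ ?n ?n _ ?n], simp_all only: R_K_carrier \<psi>_carrier)
        (rule mtrace_smult[of _ ?n], simp add: mult_carrier_mat[of _ ?n ?n _ ?n])
    also have "\<dots> = (w a * w (bar a)) / (\<xi> a * d a) * B.beta (B.rr a) f" by (simp add: kap_def)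
    also have "\<dots> = d a / \<xi> a * B.beta (B.rr a) f"
      unfolding d_sq[symmetric] using d_nonzero[of a] by (simp add: power2_eq_square)
    finally show ?thesis .
  qed
  \<comment> \<open>Here the scalar is \<open>kap a * w (bar a)\<close>, that is
    \<open>\<xi> a * d a\<close>, rewritten by the inverse relation between \<open>\<xi> a\<close>
    and \<open>\<xi> (bar a)\<close>.\<close>
  show "B.chi a (B.mul k (B.PiL f)) = d (bar a) / \<xi> (bar a) * B.beta (B.rr (bar a)) f"
  proof -
    have "B.chi a (B.mul k (B.PiL f)) = kap a * (w (bar a) * B.beta (B.rr (bar a)) f)"
      unfolding chi_mtrace \<psi>_mul \<psi>_k mtrace_R_PiL[symmetric]
      by (subst mult_smult_assoc_mat[of _ ?n ?n _ ?n], simp_all only: R_K_carrier \<psi>_carrier)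
        (rule mtrace_smult[of _ ?n], simp add: mult_carrier_mat[of _ ?n ?n _ ?n])
    also have "\<dots> = d (bar a) / \<xi> (bar a) * B.beta (B.rr (bar a)) f"
      unfolding \<xi>_bar d_bar[of a, symmetric] using w_nonzero[of "bar a"] by (simp add: kap_def)
    finally show ?thesis .
  qed
next
  fix F :: "'i cv \<Rightarrow> 'i cv \<Rightarrow> complex" and f :: "'i cv"
  assume F: "\<And>b. lin (\<lambda>a. F a b)" "\<And>a. lin (F a)"
  have FF: "F x y = (\<Sum>i\<in>UNIV. \<Sum>j\<in>UNIV. (x i * y j) * F (bas i) (bas j))" for x y
    by (subst lin_expand[OF F(1)], subst lin_expand[OF F(2)]) (simp add: sum_distrib_left mult.assoc)
  \<comment> \<open>That the dual antipode reverses coproducts is the transpose of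
    antimultiplicativity of the antipode in the algebra itself.\<close>
  have D: "dDelta H (B.S f) (i, j) = (\<Sum>a\<in>UNIV. \<Sum>b\<in>UNIV. santi H j a * santi H i b * dDelta H f (a, b))" for i j
  proof -
    have S: "(\<Sum>r\<in>UNIV. smul H i j r * santi H r l) = (\<Sum>a\<in>UNIV. \<Sum>b\<in>UNIV. santi H j a * santi H i b * smul H a b l)" for l
      using fun_cong[OF A.S_mul[of "bas i" "bas j"], of l]
      by (simp add: A.S_bas A.mul_bas) (simp add: A.S_def A.mul_def)
    have "dDelta H (B.S f) (i, j) = (\<Sum>r\<in>UNIV. \<Sum>l\<in>UNIV. f l * (smul H i j r * santi H r l))"
      unfolding B_S by (simp add: dDelta_def dS_def sum_distrib_right sum_distrib_left) (simp only: mult_ac)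
    also have "\<dots> = (\<Sum>l\<in>UNIV. f l * (\<Sum>r\<in>UNIV. smul H i j r * santi H r l))"
      unfolding sum_distrib_left by (rule sum.swap)
    also have "\<dots> = (\<Sum>l\<in>UNIV. \<Sum>a\<in>UNIV. \<Sum>b\<in>UNIV. santi H j a * santi H i b * (f l * smul H a b l))"
      unfolding S by (simp add: sum_distrib_left) (simp only: mult_ac)
    also have "\<dots> = (\<Sum>a\<in>UNIV. \<Sum>l\<in>UNIV. \<Sum>b\<in>UNIV. santi H j a * santi H i b * (f l * smul H a b l))"
      by (rule sum.swap)
    also have "\<dots> = (\<Sum>a\<in>UNIV. \<Sum>b\<in>UNIV. \<Sum>l\<in>UNIV. santi H j a * santi H i b * (f l * smul H a b l))"
      by (rule sum.cong[OF refl], rule sum.swap)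
    finally show ?thesis by (simp add: dDelta_def sum_distrib_left)
  qed
  have "B.sw (B.S f) F = (\<Sum>i\<in>UNIV. \<Sum>j\<in>UNIV. \<Sum>a\<in>UNIV. \<Sum>b\<in>UNIV. dDelta H f (a, b) * (santi H i b * santi H j a * F (bas i) (bas j)))"
    unfolding B_sw D by (simp add: sum_distrib_right) (simp only: mult_ac)
  also have "\<dots> = (\<Sum>j\<in>UNIV. \<Sum>a\<in>UNIV. \<Sum>b\<in>UNIV. \<Sum>i\<in>UNIV. dDelta H f (a, b) * (santi H i b * santi H j a * F (bas i) (bas j)))"
    by (rule sum_rotate4)
  also have "\<dots> = (\<Sum>a\<in>UNIV. \<Sum>b\<in>UNIV. \<Sum>i\<in>UNIV. \<Sum>j\<in>UNIV. dDelta H f (a, b) * (santi H i b * santi H j a * F (bas i) (bas j)))"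
    by (rule sum_rotate4)
  also have "\<dots> = B.sw f (\<lambda>a b. F (B.S b) (B.S a))"
    unfolding B_sw FF[of "B.S _"] B.S_bas by (simp only: sum_distrib_left)
  finally show "B.sw (B.S f) F = B.sw f (\<lambda>a b. F (B.S b) (B.S a))" .
qed

end

section \<open>The element Omega\<close>

lemma ev_bas: "ev (bas i) x = x i" "ev f (bas i) = f i"
  by (simp_all add: ev_def bas_def sum_delta_mult)

lemma lin_ev: "lin (\<lambda>f. ev f x)" "lin (ev f)"
  unfolding ev_def by (simp_all add: lin_rules)

lemma mul2A_tens:
  "mul2A H (tens y y') X (r, l) = (\<Sum>q\<in>UNIV. \<Sum>q'\<in>UNIV. X (q, q') * (mulA H y (bas q) r * mulA H y' (bas q') l))"
proof -
  have "mul2A H (tens y y') X (r, l) = (\<Sum>q\<in>UNIV. \<Sum>p\<in>UNIV. tens y y' p * X q * smul H (fst p) (fst q) r * smul H (snd p) (snd q) l)"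
    unfolding mul2A_def prod.case by (rule sum.swap)
  also have "\<dots> = (\<Sum>q\<in>UNIV. \<Sum>q'\<in>UNIV. X (q, q') * (\<Sum>p\<in>UNIV. \<Sum>p'\<in>UNIV. (y p * smul H p q r) * (y' p' * smul H p' q' l)))"
    by (simp add: sum_UNIV_prod tens_def sum_distrib_left) (intro sum.cong refl, simp only: mult_ac)
  finally show ?thesis by (simp add: mulA_bas(3) sum_product)
qed

context pivotal_fusion begin

lemma ev_mul: "ev (B.mul f h) x = (\<Sum>i\<in>UNIV. \<Sum>j\<in>UNIV. f i * h j * DeltaA H x (i, j))"
proof -
  have "ev (B.mul f h) x = (\<Sum>l\<in>UNIV. \<Sum>i\<in>UNIV. \<Sum>j\<in>UNIV. f i * h j * (x l * scomul H l i j))"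
    by (simp add: ev_def B.mul_def sum_distrib_right) (simp only: mult_ac)
  also have "\<dots> = (\<Sum>i\<in>UNIV. \<Sum>l\<in>UNIV. \<Sum>j\<in>UNIV. f i * h j * (x l * scomul H l i j))" by (rule sum.swap)
  also have "\<dots> = (\<Sum>i\<in>UNIV. \<Sum>j\<in>UNIV. \<Sum>l\<in>UNIV. f i * h j * (x l * scomul H l i j))"
    by (rule sum.cong[OF refl], rule sum.swap)
  finally show ?thesis by (simp add: DeltaA_def sum_distrib_left)
qed

lemma ev_mul_bas: "ev (B.mul (bas i) (bas j)) x = DeltaA H x (i, j)"
  by (simp add: B.mul_bas ev_def DeltaA_def mult.commute)

lemma ev_mul_bas_right: "ev (B.mul f (bas j)) x = (\<Sum>i\<in>UNIV. f i * DeltaA H x (i, j))"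
  unfolding B.mul_bas' ev_def DeltaA_def prod.case sum_distrib_right sum_distrib_left
  by (subst sum.swap) (simp only: mult_ac)

lemma ev_mul3:
  "ev (B.mul (B.mul f h) h') x = (\<Sum>a\<in>UNIV. \<Sum>b\<in>UNIV. \<Sum>c\<in>UNIV. Delta2A H x ((a, b), c) * (f a * h b * h' c))"
proof -
  have "ev (B.mul (B.mul f h) h') x = (\<Sum>r\<in>UNIV. \<Sum>c\<in>UNIV. \<Sum>a\<in>UNIV. \<Sum>b\<in>UNIV. (DeltaA H x (r, c) * scomul H r a b) * (f a * h b * h' c))"
    unfolding ev_mul by (simp add: B.mul_def sum_distrib_right) (simp only: mult_ac)
  also have "\<dots> = (\<Sum>c\<in>UNIV. \<Sum>a\<in>UNIV. \<Sum>b\<in>UNIV. \<Sum>r\<in>UNIV. (DeltaA H x (r, c) * scomul H r a b) * (f a * h b * h' c))"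
    by (rule sum_rotate4)
  also have "\<dots> = (\<Sum>c\<in>UNIV. \<Sum>a\<in>UNIV. \<Sum>b\<in>UNIV. Delta2A H x ((a, b), c) * (f a * h b * h' c))"
    unfolding Delta2A_apply sum_distrib_right ..
  also have "\<dots> = (\<Sum>a\<in>UNIV. \<Sum>c\<in>UNIV. \<Sum>b\<in>UNIV. Delta2A H x ((a, b), c) * (f a * h b * h' c))" by (rule sum.swap)
  also have "\<dots> = (\<Sum>a\<in>UNIV. \<Sum>b\<in>UNIV. \<Sum>c\<in>UNIV. Delta2A H x ((a, b), c) * (f a * h b * h' c))"
    by (rule sum.cong[OF refl], rule sum.swap)
  finally show ?thesis .
qed

text \<open>The factors \<open>\<xi> x\<close> and \<open>\<xi> (bar x)\<close> cancel, so that
  \<open>DD\<close> is the sum of the squares of \<open>d\<close>.\<close>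

lemma Om_eq:
  "B.Om f = (\<Sum>a\<in>UNIV. (1 / (\<Sum>x\<in>{x. lidx dimW b N x = lidx dimW b N a}. (d x)\<^sup>2)) * (d a / \<xi> a) * mtrace (\<psi> a f))"
proof -
  have del: "d x / \<xi> x * (d (bar x) / \<xi> (bar x)) = (d x)\<^sup>2" for x
    unfolding d_bar[of x, symmetric] \<xi>_bar using \<xi>_nonzero[of x] by (simp add: power2_eq_square)
  show ?thesis unfolding B.Om_def B.DD_def del lidx_ll chi_mtrace by (simp add: mult.commute)
qed

definition T :: "'i cv \<Rightarrow> 'i cv" where "T x = (\<lambda>i. ev (B.mul (B.S (bas i)) k) x)"

lemma ev_T: "ev f (T x) = ev (B.mul (B.S f) k) x"
proof -
  note [simp] = lin_rules
  have "lin (\<lambda>f. ev (B.mul (B.S f) k) x)" by (rule lin_comp[OF lin_ev(1)]) simp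
  from lin_expand[OF this, of f] show ?thesis by (simp add: ev_def T_def)
qed

lemma mulA_one_bas: "mulA H (oneA H) (bas q) = bas q"
  using wha by (simp add: weak_hopf_def)

text \<open>Paired with two basis functionals, \<open>S\<close> reverses their product. Inserting
  \<open>k k' = 1\<close> between the factors supplies a \<open>k\<close> for each occurrence of
  \<open>T\<close> and leaves \<open>k'\<close> on the middle leg.\<close>

lemma Delta_T:
  "DeltaA H (T x) = (\<lambda>(p, q). \<Sum>t\<in>UNIV. Delta2A H x t * ev (dinv H k) (bas (snd (fst t)))
                                        * T (bas (snd t)) p * T (bas (fst (fst t))) q)"
proof (rule ext, clarify)
  fix i j
  let ?f = "B.mul (B.S (bas j)) k" and ?h = "B.mul (B.S (bas i)) k"
  have "B.mul (B.S (B.mul (bas i) (bas j))) k = B.mul (B.S (bas j)) (B.mul (B.S (bas i)) k)"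
    by (simp only: B.S_mul B.mul_assoc)
  also have "\<dots> = B.mul (B.S (bas j)) (B.mul (B.mul k k') ?h)" by (simp add: B.k_k')
  also have "\<dots> = B.mul (B.mul ?f k') ?h" by (simp only: B.mul_assoc)
  finally have "DeltaA H (T x) (i, j) = ev (B.mul (B.mul ?f k') ?h) x"
    unfolding ev_mul_bas[symmetric] ev_T by simp
  then show "DeltaA H (T x) (i, j) = (\<Sum>t\<in>UNIV. Delta2A H x t * ev (dinv H k) (bas (snd (fst t))) * T (bas (snd t)) i * T (bas (fst (fst t))) j)"
    unfolding ev_mul3 k'_def[symmetric] T_def ev_bas sum_UNIV_prod fst_conv snd_conv by (simp only: mult_ac)
qed

context
  fixes \<Omega> :: "'i cv"
  assumes \<Omega>: "\<And>f. ev f \<Omega> = B.Om f"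
begin

lemma Delta_Omega: "DeltaA H \<Omega> (i, j) = B.Om (B.mul (bas i) (bas j))"
  unfolding ev_mul_bas[symmetric] \<Omega> ..

lemma cocommutative: "DeltaopA H \<Omega> = DeltaA H \<Omega>"
  by (rule ext) (auto simp: DeltaopA_def Delta_Omega intro: B.Om_commute)

text \<open>\<open>Om_nondegenerate\<close> represents every element as a contraction of the first
  leg; cocommutativity handles the second leg.\<close>

lemma nondegenerate_Omega: "nondegenerate H \<Omega>"
proof -
  have ex: "\<exists>f. (\<lambda>j. \<Sum>i\<in>UNIV. f i * DeltaA H \<Omega> (i, j)) = y" for y
  proof -
    obtain f where "\<forall>g. B.Om (B.mul f g) = ev g y" using B.Om_nondegenerate[OF lin_ev(1)] by blast
    then have "B.Om (B.mul f (bas j)) = y j" for j by (simp add: ev_bas)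
    then show ?thesis by (intro exI[of _ f]) (simp add: ev_mul_bas_right[symmetric] \<Omega>)
  qed
  have comm: "DeltaA H \<Omega> (i, j) = DeltaA H \<Omega> (j, i)" for i j
    unfolding Delta_Omega by (rule B.Om_commute)
  have eq: "(\<lambda>i. \<Sum>j\<in>UNIV. DeltaA H \<Omega> (i, j) * f j) = (\<lambda>j. \<Sum>i\<in>UNIV. f i * DeltaA H \<Omega> (i, j))" for f
    by (rule ext, rule sum.cong[OF refl], subst comm, rule mult.commute)
  have r: "range (\<lambda>f. (\<lambda>j. \<Sum>i\<in>UNIV. f i * DeltaA H \<Omega> (i, j))) = UNIV"
  proof (intro equalityI subset_UNIV subsetI)
    fix y :: "'i cv"
    obtain f where "(\<lambda>j. \<Sum>i\<in>UNIV. f i * DeltaA H \<Omega> (i, j)) = y" using ex by blast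
    then show "y \<in> range (\<lambda>f. (\<lambda>j. \<Sum>i\<in>UNIV. f i * DeltaA H \<Omega> (i, j)))" by (intro image_eqI[of _ _ f]) simp_all
  qed
  show ?thesis unfolding nondegenerate_def eq using r by simp
qed

text \<open>Coefficients of a product in the algebra are Sweedler sums of basis functionals in the
  dual, so this is \<open>Om_idem\<close> evaluated on \<open>bas l\<close>.\<close>

lemma Omega_idem: "mulA H \<Omega> \<Omega> = \<Omega>"
proof
  fix l
  have "mulA H \<Omega> \<Omega> l = B.sw (bas l) (\<lambda>x y. ev x \<Omega> * ev y \<Omega>)"
    unfolding B.sw_bas ev_bas mulA_def by (simp only: mult_ac)
  also have "\<dots> = \<Omega> l" unfolding \<Omega> B.Om_idem by (simp add: \<Omega>[symmetric] ev_bas)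
  finally show "mulA H \<Omega> \<Omega> l = \<Omega> l" .
qed

text \<open>The coefficient \<open>(r, l)\<close> of the two tensors is the pulling-through identity
  for the functionals \<open>bas r\<close> and \<open>bas l\<close>, with the free leg evaluated at
  \<open>x\<close>.\<close>

lemma Omega_pulling:
  "mul2A H (tens (oneA H) x) (DeltaA H \<Omega>) = mul2A H (tens (T x) (oneA H)) (DeltaA H \<Omega>)"
proof (rule ext, clarify)
  fix r l
  have "mul2A H (tens (oneA H) x) (DeltaA H \<Omega>) (r, l) = (\<Sum>q'\<in>UNIV. \<Sum>q\<in>UNIV. (DeltaA H \<Omega> (q, q') * mulA H x (bas q') l) * (if r = q then 1 else 0))"
    unfolding mul2A_tens mulA_one_bas by (subst sum.swap) (simp only: bas_def mult_ac)
  also have "\<dots> = (\<Sum>q'\<in>UNIV. \<Sum>a\<in>UNIV. smul H a q' l * (x a * DeltaA H \<Omega> (r, q')))"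
    unfolding sum_delta_mult by (simp add: mulA_bas(3) sum_distrib_left) (simp only: mult_ac)
  also have "\<dots> = B.sw (bas l) (\<lambda>a b. ev a x * B.Om (B.mul (bas r) b))"
    unfolding B.sw_bas ev_bas Delta_Omega by (rule sum.swap)
  also have "\<dots> = B.sw (bas r) (\<lambda>a b. ev (B.mul (B.S a) k) x * B.Om (B.mul b (bas l)))"
    by (rule B.Om_integral[OF lin_ev(1)])
  also have "\<dots> = (\<Sum>q\<in>UNIV. \<Sum>a\<in>UNIV. smul H a q r * (T x a * DeltaA H \<Omega> (q, l)))"
    unfolding B.sw_bas Delta_Omega T_def by (rule sum.swap)
  also have "\<dots> = (\<Sum>q\<in>UNIV. \<Sum>q'\<in>UNIV. (DeltaA H \<Omega> (q, q') * mulA H (T x) (bas q) r) * (if l = q' then 1 else 0))"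
    unfolding sum_delta_mult by (simp add: mulA_bas(3) sum_distrib_left) (simp only: mult_ac)
  also have "\<dots> = mul2A H (tens (T x) (oneA H)) (DeltaA H \<Omega>) (r, l)"
    unfolding mul2A_tens mulA_one_bas by (simp only: bas_def mult_ac)
  finally show "mul2A H (tens (oneA H) x) (DeltaA H \<Omega>) (r, l) = mul2A H (tens (T x) (oneA H)) (DeltaA H \<Omega>) (r, l)" .
qed

end

lemma clinear_T: "clinear T"
  unfolding clinear_def T_def by (simp add: linD[OF lin_ev(2)])

end

theorem theorem5p13:
  fixes H :: "'i::finite wstr"
    and dimW :: "'a::finite \<Rightarrow> nat" and \<psi> :: "'a \<Rightarrow> 'i cv \<Rightarrow> complex mat"
    and N :: "'a \<Rightarrow> 'a \<Rightarrow> 'a \<Rightarrow> nat" and V W :: "'a \<Rightarrow> 'a \<Rightarrow> 'a \<Rightarrow> nat \<Rightarrow> complex mat"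
    and b u v :: "'a \<Rightarrow> complex mat" and bar :: "'a \<Rightarrow> 'a" and Z :: "'a \<Rightarrow> complex mat"
    and w d \<xi> :: "'a \<Rightarrow> complex" and g k \<Omega> :: "'i cv"
  assumes wha: "weak_hopf H"
    and semisimple: "dsemisimple H"
    and pivotal: "dpivotal H"
    and irr: "irr_family H dimW \<psi>"
    and fusion: "fusion_data H dimW \<psi> N V W"
    and vacuum: "vacuum_data H dimW \<psi> b u v"
    and conj: "conj_data H dimW \<psi> bar Z"
    and wdef: "w_data dimW N V W b u v bar Z w"
    and d_sq: "\<And>a. (d a)\<^sup>2 = w a * w (bar a)"
    and d_bar: "\<And>a. d a = d (bar a)"
    and g_def: "\<And>a. \<psi> a g = (d a / w (bar a)) \<cdot>\<^sub>m (transpose_mat (minv (Z a)) * Z (bar a))"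
    and k_piv: "dpivotal_elem H k"
    and \<xi>_def: "\<And>a. \<psi> a k = \<xi> a \<cdot>\<^sub>m \<psi> a g"
    and \<Omega>_def: "\<And>f. ev f \<Omega> = (\<Sum>a\<in>UNIV.
          (1 / (\<Sum>x\<in>{x. lidx dimW b N x = lidx dimW b N a}. (d x)\<^sup>2)) * (d a / \<xi> a) * mtrace (\<psi> a f))"
  shows "nondegenerate H \<Omega> \<and>
         DeltaopA H \<Omega> = DeltaA H \<Omega> \<and>
         mulA H \<Omega> \<Omega> = \<Omega> \<and>
         (\<exists>T. clinear T \<and>
            (\<forall>x. mul2A H (tens (oneA H) x) (DeltaA H \<Omega>) = mul2A H (tens (T x) (oneA H)) (DeltaA H \<Omega>) \<and>
                 DeltaA H (T x) =
                   (\<lambda>(p, q). \<Sum>t\<in>UNIV. Delta2A H x t * ev (dinv H k) (bas (snd (fst t)))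
                                        * T (bas (snd t)) p * T (bas (fst (fst t))) q)))"
proof -
  interpret pivotal_fusion H dimW \<psi> N V W b u v bar Z w d \<xi> g k
    by (rule pivotal_fusion.intro[OF wha semisimple irr fusion vacuum conj wdef d_sq d_bar g_def k_piv \<xi>_def])
  have \<Omega>: "ev f \<Omega> = B.Om f" for f unfolding \<Omega>_def Om_eq ..
  show ?thesis
    using nondegenerate_Omega[OF \<Omega>] cocommutative[OF \<Omega>] Omega_idem[OF \<Omega>] clinear_T Omega_pulling[OF \<Omega>] Delta_T
    by blast
qed

end
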